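(* Let $\beta=-2K\zeta(\alpha)+\alpha\zeta(\alpha+2K)-\alpha\zeta(\alpha)$, suppose that $\Re\beta>0$, and let $t\in\mathbf C$ be such that $\Psi(x+2t;\alpha)$ is analytic for $x\in[0,2K]$. Let $\phi_{(t)}(x)=\Psi(x+2t;\alpha)$ and let $\Gamma_{\phi_{(t)}}$ be the Hankel integral operator on $L^2(0,\infty)$ with symbol $\phi_{(t)}$. Then, with $\lambda_n=(2\pi in+\beta)/(2K)$, $\xi_n=\frac1{2K}\int_0^{2K}e^{\lambda_nu}\phi_{(t)}(u)\,du$ $(n\in\mathbf Z)$ and the operators $A,B,C$ of the context, so that $\phi_{(t)}(x)=Ce^{-xA}B=\sum_{n\in\mathbf Z}\xi_ne^{-\lambda_nx}$ for $x>0$: (i) $\Gamma_{\phi_{(t)}}:L^2(0,\infty)\to L^2(0,\infty)$ is trace class. (ii) The operator $R_x=\int_x^\infty e^{-sA}BCe^{-sA}\,ds$ on $\ell^2(\mathbf Z)$ is trace class, and for $\mu$ in an open neighbourhood of zero the kernel $T_\mu(x,y)=-\mu Ce^{-xA}(I+\mu R_x)^{-1}e^{-yA}B$ gives a solution to $$T_\mu(x,y)+\mu\phi_{(t)}(x+y)+\mu\int_x^\infty T_\mu(x,z)\phi_{(t)}(z+y)\,dz=0\qquad(0<x\le y).$$ (iii) If $I-R_x$ is invertible for all $x>0$, then for $x>0$ the Hankel operator on $L^2(0,\infty)$ with kernel $\phi_{(t)}(u+v+2x)$, denoted $\Gamma_{\phi_{(t+x)}}$, satisfies $$\det(I-\Gamma_{\phi_{(t+x)}})=\exp\Bigl(-\int_x^\infty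 T_{-1}(u,u)\,du\Bigr).$$
   Context: Let $0<k<1$, $K=K(k)=\int_0^{\pi/2}\frac{du}{\sqrt{1-k^2\sin^2u}}$ and $K'=K(\sqrt{1-k^2})$. Let $\mathbf L=\{2Km+2iK'n:m,n\in\mathbf Z\}$, let $\sigma(z)=z\prod_{\omega\in\mathbf L\setminus\{0\}}(1-\frac z\omega)\exp(\frac z\omega+\frac12(\frac z\omega)^2)$, $\zeta=\sigma'/\sigma$, and for a spectral parameter $\alpha\in\mathbf C\setminus\mathbf L$ let $$\Psi(x;\alpha)=-\frac{\sigma(x-\alpha)}{\sigma(\alpha)\sigma(x)}e^{\zeta(\alpha)x},$$ a solution of Lamé's equation with $\ell=1$. The Hankel operator with symbol $\phi$ is $\Gamma_\phi h(x)=\int_0^\infty\phi(x+y)h(y)\,dy$. The operators are $B:\mathbf C\to\ell^1(\mathbf Z)$, $a\mapsto a(\xi_n)_n$; $e^{-sA}:\ell^2(\mathbf Z)\to\ell^2(\mathbf Z)$, $(\alpha_n)\mapsto(e^{-s\lambda_n}\alpha_n)$; $C:\ell^1(\mathbf Z)\subset\ell^2(\mathbf Z)\to\mathbf C$, $(\alpha_n)\mapsto\sum_n\alpha_n$. *)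

theory Defs
  imports "HOL-Complex_Analysis.Complex_Analysis"
begin

section \<open>Operators on complex \<open>L\<^sup>2\<close> spaces\<close>

text \<open>
  Elements of \<open>L\<^sup>2(M)\<close> are represented by functions, and operators by maps on functions; all
  identities between elements of \<open>L\<^sup>2(M)\<close> are understood almost everywhere. The sequence space
  \<open>\<ell>\<^sup>2(\<int>)\<close> is the case of the counting measure, where almost everywhere means everywhere.
\<close>

definition L2 :: "'a measure \<Rightarrow> ('a \<Rightarrow> complex) set" where
  "L2 M = {f \<in> borel_measurable M. integrable M (\<lambda>x. (cmod (f x))\<^sup>2)}"

definition L2_norm :: "'a measure \<Rightarrow> ('a \<Rightarrow> complex) \<Rightarrow> real" where
  "L2_norm M f = sqrt (LINT x|M. (cmod (f x))\<^sup>2)"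

definition L2_inner :: "'a measure \<Rightarrow> ('a \<Rightarrow> complex) \<Rightarrow> ('a \<Rightarrow> complex) \<Rightarrow> complex" where
  "L2_inner M f g = (LINT x|M. f x * cnj (g x))"

definition bounded_op :: "'a measure \<Rightarrow> (('a \<Rightarrow> complex) \<Rightarrow> ('a \<Rightarrow> complex)) \<Rightarrow> bool" where
  "bounded_op M T \<longleftrightarrow>
     (\<forall>f\<in>L2 M. T f \<in> L2 M) \<and>
     (\<forall>f\<in>L2 M. \<forall>g\<in>L2 M. \<forall>a b. AE x in M. T (\<lambda>x. a * f x + b * g x) x = a * T f x + b * T g x) \<and>
     (\<exists>c. \<forall>f\<in>L2 M. L2_norm M (T f) \<le> c * L2_norm M f)"

definition op_norm :: "'a measure \<Rightarrow> (('a \<Rightarrow> complex) \<Rightarrow> ('a \<Rightarrow> complex)) \<Rightarrow> real" where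
  "op_norm M T = Inf {c. 0 \<le> c \<and> (\<forall>f\<in>L2 M. L2_norm M (T f) \<le> c * L2_norm M f)}"

definition invertible_op :: "'a measure \<Rightarrow> (('a \<Rightarrow> complex) \<Rightarrow> ('a \<Rightarrow> complex)) \<Rightarrow> bool" where
  "invertible_op M T \<longleftrightarrow> bounded_op M T \<and>
     (\<exists>S. bounded_op M S \<and>
        (\<forall>f\<in>L2 M. (AE x in M. S (T f) x = f x) \<and> (AE x in M. T (S f) x = f x)))"

definition rank_at_most :: "'a measure \<Rightarrow> nat \<Rightarrow> (('a \<Rightarrow> complex) \<Rightarrow> ('a \<Rightarrow> complex)) \<Rightarrow> bool" where
  "rank_at_most M n F \<longleftrightarrow>
     (\<exists>h. (\<forall>i<n. h i \<in> L2 M) \<and>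
        (\<forall>f\<in>L2 M. \<exists>c. AE x in M. F f x = (\<Sum>i<n. c i * h i x)))"

text \<open>
  The singular numbers \<open>s\<^sub>n(T) = inf {\<parallel>T - F\<parallel> : rank F \<le> n}\<close>, \<open>n = 0, 1, 2, \<dots>\<close>, in the
  normalisation usual for Hankel operators (e.g. in Peller's book). An operator is of trace class
  when its singular numbers are summable.
\<close>

definition singular_number ::
    "'a measure \<Rightarrow> (('a \<Rightarrow> complex) \<Rightarrow> ('a \<Rightarrow> complex)) \<Rightarrow> nat \<Rightarrow> real" where
  "singular_number M T n =
     Inf {op_norm M (\<lambda>f x. T f x - F f x) |F. bounded_op M F \<and> rank_at_most M n F}"

definition trace_class :: "'a measure \<Rightarrow> (('a \<Rightarrow> complex) \<Rightarrow> ('a \<Rightarrow> complex)) \<Rightarrow> bool" where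
  "trace_class M T \<longleftrightarrow> bounded_op M T \<and> summable (singular_number M T)"

definition orthonormal_set :: "'a measure \<Rightarrow> ('a \<Rightarrow> complex) set \<Rightarrow> bool" where
  "orthonormal_set M E \<longleftrightarrow> E \<subseteq> L2 M \<and>
     (\<forall>e\<in>E. \<forall>f\<in>E. L2_inner M e f = (if e = f then 1 else 0))"

definition orthonormal_basis :: "'a measure \<Rightarrow> ('a \<Rightarrow> complex) set \<Rightarrow> bool" where
  "orthonormal_basis M E \<longleftrightarrow> orthonormal_set M E \<and>
     (\<forall>f\<in>L2 M. (\<forall>e\<in>E. L2_inner M f e = 0) \<longrightarrow> (AE x in M. f x = 0))"

text \<open>
  \<open>has_fredholm_det M S d\<close>: \<open>S - I\<close> is of trace class and \<open>det S = d\<close>. The determinant is the limit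
  of the determinants of the finite sections \<open>(\<langle>S e, f\<rangle>)\<close>, \<open>e, f \<in> F\<close>, over the finite subsets
  \<open>F\<close> of an orthonormal basis; the limit does not depend on the basis.
\<close>

definition has_fredholm_det ::
    "'a measure \<Rightarrow> (('a \<Rightarrow> complex) \<Rightarrow> ('a \<Rightarrow> complex)) \<Rightarrow> complex \<Rightarrow> bool" where
  "has_fredholm_det M S d \<longleftrightarrow>
     trace_class M (\<lambda>f x. S f x - f x) \<and>
     (\<forall>E. orthonormal_basis M E \<longrightarrow>
        ((\<lambda>F. \<Sum>p | p permutes F. of_int (sign p) * (\<Prod>e\<in>F. L2_inner M (S e) (p e)))
           \<longlongrightarrow> d) (finite_subsets_at_top E))"

lemma orthonormal_basis_exists: "\<exists>E. orthonormal_basis M E"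
proof -
  have "\<exists>E\<in>{E. orthonormal_set M E}. \<forall>X\<in>{E. orthonormal_set M E}. E \<subseteq> X \<longrightarrow> X = E"
  proof (rule subset_Zorn')
    fix \<C> assume chain: "subset.chain {E. orthonormal_set M E} \<C>"
    show "\<Union>\<C> \<in> {E. orthonormal_set M E}"
      unfolding orthonormal_set_def mem_Collect_eq
    proof (intro conjI ballI)
      show "\<Union>\<C> \<subseteq> L2 M"
        using chain by (auto simp: subset.chain_def orthonormal_set_def)
    next
      fix e f assume "e \<in> \<Union>\<C>" "f \<in> \<Union>\<C>"
      then obtain X Y where XY: "X \<in> \<C>" "Y \<in> \<C>" "e \<in> X" "f \<in> Y" by blast
      with chain have "X \<subseteq> Y \<or> Y \<subseteq> X" by (auto simp: subset.chain_def)
      with XY obtain Z where "Z \<in> \<C>" "e \<in> Z" "f \<in> Z" by blast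
      moreover from this chain have "orthonormal_set M Z" by (auto simp: subset.chain_def)
      ultimately show "L2_inner M e f = (if e = f then 1 else 0)"
        by (auto simp: orthonormal_set_def)
    qed
  qed
  then obtain E where E: "orthonormal_set M E"
    and max: "\<And>X. orthonormal_set M X \<Longrightarrow> E \<subseteq> X \<Longrightarrow> X = E" by blast
  have "AE x in M. f x = 0" if f: "f \<in> L2 M" and orth: "\<And>e. e \<in> E \<Longrightarrow> L2_inner M f e = 0" for f
  proof (rule ccontr)
    assume nz: "\<not> (AE x in M. f x = 0)"
    define I where "I = (LINT x|M. (cmod (f x))\<^sup>2)"
    have int: "integrable M (\<lambda>x. (cmod (f x))\<^sup>2)" and meas: "f \<in> borel_measurable M"
      using f by (auto simp: L2_def)
    have "I \<noteq> 0"
      using nz integral_nonneg_eq_0_iff_AE[OF int] by (auto simp: I_def)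
    moreover have "I \<ge> 0" by (simp add: I_def)
    ultimately have I: "I > 0" by simp
    define c where "c = complex_of_real (1 / sqrt I)"
    define g where "g = (\<lambda>x. c * f x)"
    have g: "g \<in> L2 M"
      using meas int by (auto simp: L2_def g_def norm_mult power_mult_distrib)
    have ge: "L2_inner M g e = 0" if "e \<in> E" for e
      using orth[OF that] by (simp add: L2_inner_def g_def mult.assoc)
    have eg: "L2_inner M e g = 0" if "e \<in> E" for e
    proof -
      have "L2_inner M e g = cnj (L2_inner M g e)"
        unfolding L2_inner_def by (subst Bochner_Integration.integral_cnj [symmetric]) (simp add: mult.commute)
      thus ?thesis using ge[OF that] by simp
    qed
    have "L2_inner M g g = (LINT x|M. c * cnj c * of_real ((cmod (f x))\<^sup>2))"
      unfolding L2_inner_def g_def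
      by (intro Bochner_Integration.integral_cong refl)
         (simp only: complex_norm_square complex_cnj_mult mult_ac)
    also have "\<dots> = c * cnj c * of_real I"
      by (simp only: I_def integral_mult_right_zero integral_complex_of_real)
    also have "\<dots> = of_real ((1 / sqrt I) * (1 / sqrt I) * I)"
      by (simp only: c_def complex_cnj_complex_of_real of_real_mult)
    also have "(1 / sqrt I) * (1 / sqrt I) * I = 1"
      using I by (simp add: field_simps)
    finally have gg: "L2_inner M g g = 1" by simp
    hence "g \<notin> E" using ge by force
    moreover have "orthonormal_set M (insert g E)"
      using E g ge eg gg \<open>g \<notin> E\<close> by (auto simp: orthonormal_set_def)
    ultimately show False using max[of "insert g E"] by blast
  qed
  with E show ?thesis unfolding orthonormal_basis_def by blast
qed

lemma has_fredholm_det_unique: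
  assumes "has_fredholm_det M S d" "has_fredholm_det M S d'"
  shows "d = d'"
proof -
  obtain E where "orthonormal_basis M E" using orthonormal_basis_exists by blast
  with assms show ?thesis
    unfolding has_fredholm_det_def by (blast intro: tendsto_unique[OF finite_subsets_at_top_neq_bot])
qed

abbreviation half_line :: "real measure" where
  "half_line \<equiv> restrict_space lborel {0<..}"

definition hankel_op :: "(real \<Rightarrow> complex) \<Rightarrow> (real \<Rightarrow> complex) \<Rightarrow> (real \<Rightarrow> complex)" where
  "hankel_op \<phi> h = (\<lambda>x. LINT y|half_line. \<phi> (x + y) * h y)"

section \<open>The solution of Lame's equation\<close>

definition elliptic_K :: "real \<Rightarrow> real" where
  "elliptic_K k = (LBINT u:{0..pi/2}. 1 / sqrt (1 - k\<^sup>2 * (sin u)\<^sup>2))"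

definition period_lattice :: "real \<Rightarrow> complex set" where
  "period_lattice k =
     {2 * of_real (elliptic_K k) * of_int m
        + 2 * \<i> * of_real (elliptic_K (sqrt (1 - k\<^sup>2))) * of_int n |m n. True}"

text \<open>
  The factor \<open>weierstrass_factor 2 w\<close> is \<open>(1 - w) exp (w + w\<^sup>2/2)\<close>, and the product over the
  lattice is taken unconditionally.
\<close>

definition wsigma :: "real \<Rightarrow> complex \<Rightarrow> complex" where
  "wsigma k z = z * Lim (finite_subsets_at_top (period_lattice k - {0}))
                        (\<lambda>F. \<Prod>\<omega>\<in>F. weierstrass_factor 2 (z / \<omega>))"

definition wzeta :: "real \<Rightarrow> complex \<Rightarrow> complex" where
  "wzeta k z = deriv (wsigma k) z / wsigma k z"

definition Psi :: "real \<Rightarrow> complex \<Rightarrow> complex \<Rightarrow> complex" where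
  "Psi k \<alpha> x = - (wsigma k (x - \<alpha>) / (wsigma k \<alpha> * wsigma k x)) * exp (wzeta k \<alpha> * x)"

definition lame_beta :: "real \<Rightarrow> complex \<Rightarrow> complex" where
  "lame_beta k \<alpha> = - 2 * of_real (elliptic_K k) * wzeta k \<alpha>
     + \<alpha> * wzeta k (\<alpha> + 2 * of_real (elliptic_K k)) - \<alpha> * wzeta k \<alpha>"

definition lame_symbol :: "real \<Rightarrow> complex \<Rightarrow> complex \<Rightarrow> real \<Rightarrow> complex" where
  "lame_symbol k \<alpha> t x = Psi k \<alpha> (of_real x + 2 * t)"

definition lame_lambda :: "real \<Rightarrow> complex \<Rightarrow> int \<Rightarrow> complex" where
  "lame_lambda k \<alpha> n = (2 * of_real pi * \<i> * of_int n + lame_beta k \<alpha>) / (2 * of_real (elliptic_K k))"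

definition lame_xi :: "real \<Rightarrow> complex \<Rightarrow> complex \<Rightarrow> int \<Rightarrow> complex" where
  "lame_xi k \<alpha> t n = 1 / (2 * of_real (elliptic_K k)) *
     (LBINT u:{0..2 * elliptic_K k}. exp (lame_lambda k \<alpha> n * of_real u) * lame_symbol k \<alpha> t u)"

section \<open>The linear system\<close>

abbreviation ell2 :: "(int \<Rightarrow> complex) set" where
  "ell2 \<equiv> L2 (count_space UNIV)"

definition ell1 :: "(int \<Rightarrow> complex) set" where
  "ell1 = {a. (\<lambda>n. cmod (a n)) summable_on UNIV}"

definition semigroup_op :: "(int \<Rightarrow> complex) \<Rightarrow> real \<Rightarrow> (int \<Rightarrow> complex) \<Rightarrow> (int \<Rightarrow> complex)" where
  "semigroup_op lam s a = (\<lambda>n. exp (- of_real s * lam n) * a n)"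

definition input_op :: "(int \<Rightarrow> complex) \<Rightarrow> complex \<Rightarrow> (int \<Rightarrow> complex)" where
  "input_op xi a = (\<lambda>n. a * xi n)"

text \<open>Meaningful on \<^term>\<open>ell1\<close> only.\<close>

definition output_op :: "(int \<Rightarrow> complex) \<Rightarrow> complex" where
  "output_op a = (\<Sum>\<^sub>\<infinity>n. a n)"

text \<open>
  The integrand \<open>e\<^sup>-\<^sup>s\<^sup>A B C e\<^sup>-\<^sup>s\<^sup>A\<close> of \<open>R\<^sub>x\<close> is defined on \<^term>\<open>ell1\<close> only, since all \<open>\<lambda>\<^sub>n\<close> have the same
  real part and so \<open>e\<^sup>-\<^sup>s\<^sup>A\<close> does not map \<open>\<ell>\<^sup>2\<close> into \<^term>\<open>ell1\<close>. The integral is therefore taken as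
  a weak one: \<open>R\<^sub>x\<close> is the operator on \<open>\<ell>\<^sup>2\<close> whose matrix in the standard basis is the integral of
  the matrix of the integrand.
\<close>

definition R_op ::
    "(int \<Rightarrow> complex) \<Rightarrow> (int \<Rightarrow> complex) \<Rightarrow> real \<Rightarrow> (int \<Rightarrow> complex) \<Rightarrow> (int \<Rightarrow> complex)" where
  "R_op lam xi x a = (\<lambda>j. \<Sum>\<^sub>\<infinity>m.
     (LBINT s:{x..}. semigroup_op lam s (input_op xi (output_op
         (semigroup_op lam s (\<lambda>i. if i = m then 1 else 0)))) j) * a m)"

definition resolvent_op ::
    "(int \<Rightarrow> complex) \<Rightarrow> (int \<Rightarrow> complex) \<Rightarrow> complex \<Rightarrow> real \<Rightarrow> (int \<Rightarrow> complex) \<Rightarrow> (int \<Rightarrow> complex)" where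
  "resolvent_op lam xi \<mu> x = inv_into ell2 (\<lambda>a n. a n + \<mu> * R_op lam xi x a n)"

definition T_kernel ::
    "(int \<Rightarrow> complex) \<Rightarrow> (int \<Rightarrow> complex) \<Rightarrow> complex \<Rightarrow> real \<Rightarrow> real \<Rightarrow> complex" where
  "T_kernel lam xi \<mu> x y = - \<mu> * output_op (semigroup_op lam x
     (resolvent_op lam xi \<mu> x (semigroup_op lam y (input_op xi 1))))"

end

theory Submission
  imports Defs "Jordan_Normal_Form.Determinant"
begin

text \<open>
  The quasi-periodicity \<open>\<sigma>(z + 2K) = C e\<^sup>c\<^sup>z \<sigma>(z)\<close>, which follows from the periodicity of \<open>\<zeta>''\<close>, shows
  that \<open>\<Psi>\<close> has the multiplier \<open>e\<^sup>-\<^sup>\<beta>\<close> under \<open>x \<mapsto> x + 2K\<close>. Hence \<open>e\<^bsup>\<beta>u/2K\<^esup> \<phi>(u)\<close> is periodic and analytic,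
  its Fourier coefficients \<open>\<xi>\<^sub>n\<close> decay rapidly, and \<open>\<phi>(x) = \<Sum>n. \<xi>\<^sub>n e\<^bsup>-\<lambda>\<^sub>n x\<^esup>\<close> turns \<open>\<Gamma>\<^sub>\<phi>\<close> and \<open>R\<^sub>x\<close> into rapidly
  convergent sums of operators of rank one, which gives the trace class properties. The integral
  equation follows by moving the integral inside a bounded functional on \<open>\<ell>\<^sup>1\<close>.

  For the determinant, the finite sections of \<open>I - \<Gamma>\<close> in any orthonormal basis are rewritten by
  Sylvester's identity and expanded in principal minors: they are sums over the finite sets
  \<open>S \<subset> \<int>\<close> of \<open>(-1)\<^bsup>|S|\<^esup> \<Prod>n\<in>S. \<xi>\<^sub>n e\<^bsup>-2x\<lambda>\<^sub>n\<^esup>\<close> times a Gram determinant, dominated uniformly by the expansion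
  of a convergent product \<open>\<Prod>n. 1 + w\<^sub>n\<close>. Parseval's identity identifies their limit \<open>D(x)\<close>.
  Differentiating the truncated determinants and comparing the adjugate with the resolvent yields
  \<open>D'(x) = T\<^sub>-\<^sub>1(x, x) D(x)\<close>, and \<open>D(x) \<rightarrow> 1\<close> as \<open>x \<rightarrow> \<infinity>\<close>.
\<close>

section \<open>\<open>L\<^sup>2\<close> spaces\<close>

text \<open>\<open>has_fredholm_det\<close> asks for convergence along the finite subsets of every
  orthonormal basis E, so two limits must be interchanged: N to infinity in the number of
  exponentials and F to E in the basis. A bound uniform in F permits this. By Bessel's inequality
  all Gram sums over F are at most 1/(2c), where c is the common real part of the \<lambda>_n, so a
  minor of order m is at most m! (2c)^-m; its indices being distinct integers, the factorial splits
  into factors 2(1 + |n|), one per index. This costs one power of |n| against \<xi>_n;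
  differentiation in x brings down sums of \<lambda>_n and costs a second one. Hence the weight (1 +
  |n|)^2 in \<open>exponential_system\<close>.

  The other obstacle is that C is unbounded on \<open>ell2\<close> and exp(-sA) does not smooth. Up
  to the factor \<xi>_j, the entries of R_x are exp(-x(\<lambda>_j + \<lambda>_m)) / (\<lambda>_j +
  \<lambda>_m), with modulus depending on j + m alone; the rows are square summable uniformly in j,
  and \<xi>_j sends the result into \<open>ell1\<close>. A solution of (I + \<mu> R_x) a = f with f
  in \<open>ell1\<close> therefore lies in \<open>ell1\<close> too, where C acts.\<close>

lemma L2_measurable: "f \<in> L2 M \<Longrightarrow> f \<in> borel_measurable M"
  by (simp add: L2_def)

lemma L2_integrable: "f \<in> L2 M \<Longrightarrow> integrable M (\<lambda>x. (cmod (f x))\<^sup>2)"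
  by (simp add: L2_def)

lemma L2_norm_nonneg [simp]: "L2_norm M f \<ge> 0"
  by (simp add: L2_norm_def)

lemma L2_norm_power2: "(L2_norm M f)\<^sup>2 = (LINT x|M. (cmod (f x))\<^sup>2)"
  by (simp add: L2_norm_def)

lemma L2_bound:
  assumes g: "integrable M g" and f: "f \<in> borel_measurable M" "AE x in M. (cmod (f x))\<^sup>2 \<le> g x"
  shows "f \<in> L2 M" "(L2_norm M f)\<^sup>2 \<le> (LINT x|M. g x)"
proof -
  have "AE x in M. norm ((cmod (f x))\<^sup>2) \<le> norm (g x)"
    using f(2) by eventually_elim auto
  hence i: "integrable M (\<lambda>x. (cmod (f x))\<^sup>2)"
    by (rule Bochner_Integration.integrable_bound[OF g, rotated]) (use f in measurable)
  thus "f \<in> L2 M" using f by (simp add: L2_def)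
  show "(L2_norm M f)\<^sup>2 \<le> (LINT x|M. g x)"
    unfolding L2_norm_power2 using i g f(2) by (rule integral_mono_AE)
qed

lemma L2_norm_cong_AE:
  assumes "f \<in> borel_measurable M" "g \<in> borel_measurable M" "AE x in M. f x = g x"
  shows "L2_norm M f = L2_norm M g"
  unfolding L2_norm_def
  by (intro arg_cong[of _ _ sqrt] integral_cong_AE) (use assms in auto)

lemma L2_add [intro]:
  assumes f: "f \<in> L2 M" and g: "g \<in> L2 M"
  shows "(\<lambda>x. f x + g x) \<in> L2 M"
proof (rule L2_bound(1))
  show "integrable M (\<lambda>x. 2 * (cmod (f x))\<^sup>2 + 2 * (cmod (g x))\<^sup>2)"
    using f g by (intro Bochner_Integration.integrable_add integrable_mult_right L2_integrable)
  show "(\<lambda>x. f x + g x) \<in> borel_measurable M" using f g L2_measurable by measurable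
  have "(cmod (f x + g x))\<^sup>2 \<le> 2 * (cmod (f x))\<^sup>2 + 2 * (cmod (g x))\<^sup>2" for x
  proof -
    have "(cmod (f x + g x))\<^sup>2 \<le> (cmod (f x) + cmod (g x))\<^sup>2"
      by (intro power_mono norm_triangle_ineq) auto
    also have "\<dots> \<le> 2 * (cmod (f x))\<^sup>2 + 2 * (cmod (g x))\<^sup>2"
      using zero_le_power2[of "cmod (f x) - cmod (g x)"] unfolding power2_diff power2_sum by linarith
    finally show ?thesis .
  qed
  thus "AE x in M. (cmod (f x + g x))\<^sup>2 \<le> 2 * (cmod (f x))\<^sup>2 + 2 * (cmod (g x))\<^sup>2" by simp
qed

lemma L2_scale [intro]: "f \<in> L2 M \<Longrightarrow> (\<lambda>x. c * f x) \<in> L2 M"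
  by (auto simp: L2_def norm_mult power_mult_distrib)

lemma L2_minus [intro]: "f \<in> L2 M \<Longrightarrow> (\<lambda>x. - f x) \<in> L2 M"
  using L2_scale[of f M "-1"] by simp

lemma L2_diff [intro]: "f \<in> L2 M \<Longrightarrow> g \<in> L2 M \<Longrightarrow> (\<lambda>x. f x - g x) \<in> L2 M"
  using L2_add[of f M "\<lambda>x. - g x"] L2_minus[of g M] by simp

lemma L2_zero [intro, simp]: "(\<lambda>x. 0) \<in> L2 M"
  by (simp add: L2_def)

lemma L2_cnj [intro]: "f \<in> L2 M \<Longrightarrow> (\<lambda>x. cnj (f x)) \<in> L2 M"
  by (auto simp: L2_def intro!: borel_measurable_continuous_on[of cnj] continuous_intros)

lemma L2_sum [intro]: "(\<And>i. i \<in> I \<Longrightarrow> f i \<in> L2 M) \<Longrightarrow> (\<lambda>x. \<Sum>i\<in>I. f i x) \<in> L2 M"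
  by (induction I rule: infinite_finite_induct) auto

lemma L2_mult_integrable:
  assumes f: "f \<in> L2 M" and g: "g \<in> L2 M"
  shows "integrable M (\<lambda>x. f x * g x)" "integrable M (\<lambda>x. cmod (f x) * cmod (g x))"
proof -
  have m: "f \<in> borel_measurable M" "g \<in> borel_measurable M" using f g L2_measurable by auto
  show *: "integrable M (\<lambda>x. f x * g x)"
  proof (rule Bochner_Integration.integrable_bound)
    show "integrable M (\<lambda>x. (cmod (f x))\<^sup>2 + (cmod (g x))\<^sup>2)"
      using f g by (intro Bochner_Integration.integrable_add L2_integrable)
    show "(\<lambda>x. f x * g x) \<in> borel_measurable M" using m by measurable
    have "cmod (f x * g x) \<le> (cmod (f x))\<^sup>2 + (cmod (g x))\<^sup>2" for x
    proof -
      have "0 \<le> (cmod (f x))\<^sup>2 + (cmod (g x))\<^sup>2" by simp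
      thus ?thesis
        using zero_le_power2[of "cmod (f x) - cmod (g x)"] unfolding power2_diff norm_mult by linarith
    qed
    thus "AE x in M. cmod (f x * g x) \<le> norm ((cmod (f x))\<^sup>2 + (cmod (g x))\<^sup>2)"
      by (simp add: order_trans[OF _ abs_ge_self])
  qed
  show "integrable M (\<lambda>x. cmod (f x) * cmod (g x))"
    using integrable_norm[OF *] by (simp add: norm_mult)
qed

text \<open>The integral of (|f| - s |g|)^2 is a quadratic in s that is never negative; its value at
  s = B / C gives B^2 <= A C.\<close>

lemma L2_Cauchy_Schwarz:
  assumes f: "f \<in> L2 M" and g: "g \<in> L2 M"
  shows "(LINT x|M. cmod (f x) * cmod (g x)) \<le> L2_norm M f * L2_norm M g"
proof -
  define A B C where "A = (LINT x|M. (cmod (f x))\<^sup>2)"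
    and "B = (LINT x|M. cmod (f x) * cmod (g x))" and "C = (LINT x|M. (cmod (g x))\<^sup>2)"
  have q: "0 \<le> A - 2 * s * B + s\<^sup>2 * C" for s
  proof -
    have "0 \<le> (LINT x|M. (cmod (f x) - s * cmod (g x))\<^sup>2)" by (rule Bochner_Integration.integral_nonneg) auto
    also have "\<dots> = (LINT x|M. ((cmod (f x))\<^sup>2 - (2 * s) * (cmod (f x) * cmod (g x))) + s\<^sup>2 * (cmod (g x))\<^sup>2)"
      by (intro Bochner_Integration.integral_cong) (auto simp: power2_eq_square algebra_simps)
    also have "\<dots> = A - 2 * s * B + s\<^sup>2 * C"
      unfolding A_def B_def C_def using L2_integrable[OF f] L2_integrable[OF g] L2_mult_integrable[OF f g]
      by (subst Bochner_Integration.integral_add Bochner_Integration.integral_diff; simp)+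
    finally show ?thesis .
  qed
  have "B\<^sup>2 \<le> A * C"
  proof (cases "C = 0")
    case True
    have "B = 0"
    proof (rule ccontr)
      assume "B \<noteq> 0"
      \<comment> \<open>With C = 0 the quadratic is affine in s, and at this point it equals
        -1.\<close>
      thus False using q[of "(A + 1) / (2 * B)"] True by simp
    qed
    thus ?thesis using True by simp
  next
    case False
    hence C: "C > 0" by (simp add: C_def order_less_le)
    have "0 \<le> A - 2 * (B / C) * B + (B / C)\<^sup>2 * C" by (rule q)
    also have "\<dots> = A - B\<^sup>2 / C" using C by (simp add: power2_eq_square field_simps)
    finally show ?thesis using C by (simp add: field_simps)
  qed
  hence "\<bar>B\<bar> \<le> sqrt (A * C)" by (rule real_le_rsqrt[of "\<bar>B\<bar>", simplified])
  thus ?thesis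
    unfolding L2_norm_def A_def[symmetric] B_def[symmetric] C_def[symmetric] by (simp add: real_sqrt_mult)
qed

lemma L2_mult_bound:
  assumes f: "f \<in> L2 M" and g: "g \<in> L2 M"
  shows "cmod (LINT x|M. f x * g x) \<le> L2_norm M f * L2_norm M g"
proof -
  have "cmod (LINT x|M. f x * g x) \<le> (LINT x|M. cmod (f x * g x))" by (rule integral_norm_bound)
  thus ?thesis using L2_Cauchy_Schwarz[OF f g] by (simp add: norm_mult)
qed

lemma L2_norm_cnj [simp]: "L2_norm M (\<lambda>x. cnj (f x)) = L2_norm M f"
  by (simp add: L2_norm_def)

lemma L2_inner_bound:
  assumes "f \<in> L2 M" "g \<in> L2 M"
  shows "cmod (L2_inner M f g) \<le> L2_norm M f * L2_norm M g"
  using L2_mult_bound[OF assms(1) L2_cnj[OF assms(2)]] by (simp add: L2_inner_def)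

lemma L2_norm_add_le:
  assumes f: "f \<in> L2 M" and g: "g \<in> L2 M"
  shows "L2_norm M (\<lambda>x. f x + g x) \<le> L2_norm M f + L2_norm M g"
proof (rule power2_le_imp_le)
  have i: "integrable M (\<lambda>x. (cmod (f x))\<^sup>2 + 2 * (cmod (f x) * cmod (g x)) + (cmod (g x))\<^sup>2)"
    using f g by (intro Bochner_Integration.integrable_add integrable_mult_right L2_integrable L2_mult_integrable)
  have "(L2_norm M (\<lambda>x. f x + g x))\<^sup>2 \<le> (LINT x|M. (cmod (f x))\<^sup>2 + 2 * (cmod (f x) * cmod (g x)) + (cmod (g x))\<^sup>2)"
  proof (rule L2_bound(2)[OF i])
    show "(\<lambda>x. f x + g x) \<in> borel_measurable M" using L2_add[OF f g] L2_measurable by auto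
    have "(cmod (f x + g x))\<^sup>2 \<le> (cmod (f x))\<^sup>2 + 2 * (cmod (f x) * cmod (g x)) + (cmod (g x))\<^sup>2" for x
      using power_mono[OF norm_triangle_ineq[of "f x" "g x"] norm_ge_zero, of 2] by (simp add: power2_sum)
    thus "AE x in M. (cmod (f x + g x))\<^sup>2 \<le> (cmod (f x))\<^sup>2 + 2 * (cmod (f x) * cmod (g x)) + (cmod (g x))\<^sup>2" by simp
  qed
  also have "\<dots> = (L2_norm M f)\<^sup>2 + 2 * (LINT x|M. cmod (f x) * cmod (g x)) + (L2_norm M g)\<^sup>2"
    unfolding L2_norm_power2 using L2_integrable[OF f] L2_integrable[OF g] L2_mult_integrable[OF f g]
    by (subst Bochner_Integration.integral_add; simp)+
  also have "\<dots> \<le> (L2_norm M f + L2_norm M g)\<^sup>2"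
    using L2_Cauchy_Schwarz[OF f g] by (simp add: power2_sum)
  finally show "(L2_norm M (\<lambda>x. f x + g x))\<^sup>2 \<le> (L2_norm M f + L2_norm M g)\<^sup>2" .
qed simp

lemma L2_norm_scale: "L2_norm M (\<lambda>x. c * f x) = cmod c * L2_norm M f"
  by (simp add: L2_norm_def norm_mult power_mult_distrib real_sqrt_mult)

lemma L2_norm_minus [simp]: "L2_norm M (\<lambda>x. - f x) = L2_norm M f"
  by (simp add: L2_norm_def)

lemma L2_norm_zero [simp]: "L2_norm M (\<lambda>x. 0) = 0"
  by (simp add: L2_norm_def)

lemma L2_norm_minus_commute: "L2_norm M (\<lambda>x. f x - g x) = L2_norm M (\<lambda>x. g x - f x)"
  by (simp add: L2_norm_def norm_minus_commute)

lemma L2_norm_diff_le: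
  assumes "f \<in> L2 M" "g \<in> L2 M"
  shows "L2_norm M (\<lambda>x. f x - g x) \<le> L2_norm M f + L2_norm M g"
  using L2_norm_add_le[OF assms(1) L2_minus[OF assms(2)]] by simp

lemma L2_norm_triangle:
  assumes "f \<in> L2 M" "g \<in> L2 M"
  shows "L2_norm M f \<le> L2_norm M (\<lambda>x. f x - g x) + L2_norm M g"
  using L2_norm_add_le[OF L2_diff[OF assms] assms(2)] by simp

lemma L2_norm_triangle3:
  assumes "f \<in> L2 M" "g \<in> L2 M" "h \<in> L2 M"
  shows "L2_norm M (\<lambda>x. f x - h x) \<le> L2_norm M (\<lambda>x. f x - g x) + L2_norm M (\<lambda>x. g x - h x)"
  using L2_norm_add_le[OF L2_diff[OF assms(1,2)] L2_diff[OF assms(2,3)]] by simp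

lemma L2_norm_eq_0_imp_AE:
  assumes "f \<in> L2 M" "L2_norm M f = 0"
  shows "AE x in M. f x = 0"
proof -
  have "(LINT x|M. (cmod (f x))\<^sup>2) = 0" using assms(2) L2_norm_power2[of M f] by simp
  thus ?thesis
    using integral_nonneg_eq_0_iff_AE[OF L2_integrable[OF assms(1)]] by simp
qed

text \<open>Riesz--Fischer, for sequences converging geometrically. The weights \<open>2 ^ n\<close> make a single
  integrable function dominate all tails.\<close>

lemma L2_complete:
  fixes f :: "nat \<Rightarrow> 'a \<Rightarrow> complex"
  assumes f: "\<And>n. f n \<in> L2 M"
    and step: "\<And>n. (L2_norm M (\<lambda>x. f (Suc n) x - f n x))\<^sup>2 \<le> (1 / 4) ^ n"
  obtains g where "g \<in> L2 M" "(\<lambda>n. L2_norm M (\<lambda>x. f n x - g x)) \<longlonglongrightarrow> 0"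
proof -
  define h where "h n x = f (Suc n) x - f n x" for n x
  have h: "h n \<in> L2 M" for n unfolding h_def by (intro L2_diff f)
  define H where "H x = (\<Sum>n. 2 ^ n * (cmod (h n x))\<^sup>2)" for x
  have hi: "integrable M (\<lambda>x. 2 ^ n * (cmod (h n x))\<^sup>2)" for n
    by (intro integrable_mult_right L2_integrable h)
  have hb: "(LINT x|M. 2 ^ n * (cmod (h n x))\<^sup>2) \<le> (1 / 2) ^ n" for n
  proof -
    have "(LINT x|M. 2 ^ n * (cmod (h n x))\<^sup>2) = 2 ^ n * (L2_norm M (h n))\<^sup>2"
      by (simp add: L2_norm_power2)
    also have "\<dots> \<le> 2 ^ n * (1 / 4) ^ n"
      using step[of n] by (intro mult_left_mono) (auto simp: h_def[abs_def])
    also have "\<dots> = (1 / 2) ^ n" by (simp add: power_mult_distrib[symmetric])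
    finally show ?thesis .
  qed
  have AEs: "AE x in M. summable (\<lambda>n. 2 ^ n * (cmod (h n x))\<^sup>2)"
  proof -
    have m: "(\<lambda>x. \<Sum>n. ennreal (2 ^ n * (cmod (h n x))\<^sup>2)) \<in> borel_measurable M"
      using h L2_measurable by measurable
    have "(\<integral>\<^sup>+x. (\<Sum>n. ennreal (2 ^ n * (cmod (h n x))\<^sup>2)) \<partial>M) = (\<Sum>n. \<integral>\<^sup>+x. ennreal (2 ^ n * (cmod (h n x))\<^sup>2) \<partial>M)"
      by (rule nn_integral_suminf) (use h L2_measurable in measurable)
    also have "\<dots> = (\<Sum>n. ennreal (LINT x|M. 2 ^ n * (cmod (h n x))\<^sup>2))"
      by (intro suminf_cong nn_integral_eq_integral hi) auto
    also have "\<dots> \<le> (\<Sum>n. ennreal ((1 / 2) ^ n))"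
      by (intro suminf_le ennreal_leI hb) auto
    also have "\<dots> = ennreal (\<Sum>n. (1 / 2) ^ n)"
      by (intro suminf_ennreal2) (auto intro: summable_geometric)
    also have "\<dots> < \<infinity>" by simp
    finally have "AE x in M. (\<Sum>n. ennreal (2 ^ n * (cmod (h n x))\<^sup>2)) \<noteq> \<infinity>"
      by (intro nn_integral_PInf_AE m) auto
    thus ?thesis by eventually_elim (rule summable_suminf_not_top, auto)
  qed
  have HI: "integrable M H"
    unfolding H_def
  proof (rule integrable_suminf)
    show "integrable M (\<lambda>x. 2 ^ n * (cmod (h n x))\<^sup>2)" for n by (rule hi)
    show "AE x in M. summable (\<lambda>n. norm (2 ^ n * (cmod (h n x))\<^sup>2))" using AEs by simp
    show "summable (\<lambda>n. LINT x|M. norm (2 ^ n * (cmod (h n x))\<^sup>2))"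
      by (rule summable_comparison_test'[of "\<lambda>n. (1 / 2) ^ n" 0]) (use hb in \<open>auto intro: summable_geometric\<close>)
  qed
  \<comment> \<open>From 2^n |h_n|^2 <= H follows |h_n| <= sqrt H * r^n with r^2 = 1/2, so the
    increments decay geometrically at almost every point.\<close>
  define r :: real where "r = 1 / sqrt 2"
  have r: "0 < r" "r < 1" "r\<^sup>2 = 1 / 2" by (auto simp: r_def power_divide)
  have rn: "(r ^ n)\<^sup>2 = (1 / 2) ^ n" for n
    using r(3) by (metis power_mult mult.commute)
  \<comment> \<open>Where the sequence diverges, \<open>lim\<close> has an arbitrary value. The
    function is measurable all the same, and the divergence is confined to a null set.\<close>
  define g where "g x = lim (\<lambda>n. f n x)" for x
  have gm: "g \<in> borel_measurable M"
    unfolding g_def using f L2_measurable by measurable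
  define C where "C = (1 / (1 - r))\<^sup>2"
  have tail: "AE x in M. (cmod (f n x - g x))\<^sup>2 \<le> (C * (1 / 2) ^ n) * H x" for n
    using AEs
  proof eventually_elim
    case (elim x)
    have Hx: "2 ^ n * (cmod (h n x))\<^sup>2 \<le> H x" for n
      unfolding H_def using sum_le_suminf[OF elim, of "{n}"] by simp
    have H0: "H x \<ge> 0" by (rule order_trans[OF _ Hx[of 0]]) simp
    have hx: "cmod (h n x) \<le> sqrt (H x) * r ^ n" for n
    proof -
      have "(cmod (h n x))\<^sup>2 \<le> H x * (1 / 2) ^ n" using Hx[of n] by (simp add: field_simps)
      also have "\<dots> = (sqrt (H x) * r ^ n)\<^sup>2"
        using H0 by (simp add: power_mult_distrib rn)
      finally show ?thesis by (rule power2_le_imp_le) (use r H0 in auto)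
    qed
    have sg: "summable (\<lambda>k. sqrt (H x) * r ^ k)" using r by (intro summable_mult summable_geometric) auto
    have sh: "summable (\<lambda>k. h k x)"
      by (rule summable_comparison_test'[OF sg, of 0]) (use hx in auto)
    have ft: "f n x = f 0 x + (\<Sum>k<n. h k x)" for n
      by (induction n) (auto simp: h_def)
    have "(\<lambda>n. f 0 x + (\<Sum>k<n. h k x)) \<longlonglongrightarrow> f 0 x + (\<Sum>k. h k x)"
      by (intro tendsto_intros summable_LIMSEQ sh)
    hence "(\<lambda>n. f n x) \<longlonglongrightarrow> f 0 x + (\<Sum>k. h k x)"
      by (simp only: ft[symmetric])
    hence gx: "g x = f 0 x + (\<Sum>k. h k x)"
      unfolding g_def by (rule limI)
    have "cmod (f n x - g x) = cmod (\<Sum>k. h (k + n) x)"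
      unfolding gx ft[of n] suminf_minus_initial_segment[OF sh] by (simp add: norm_minus_commute)
    also have "\<dots> \<le> (\<Sum>k. (sqrt (H x) * r ^ n) * r ^ k)"
    proof (rule norm_suminf_le)
      show "cmod (h (k + n) x) \<le> sqrt (H x) * r ^ n * r ^ k" for k
        using hx[of "k + n"] by (simp add: power_add mult_ac)
      show "summable (\<lambda>k. sqrt (H x) * r ^ n * r ^ k)" using r by (intro summable_mult summable_geometric) auto
    qed
    also have "\<dots> = sqrt (H x) * r ^ n * (1 / (1 - r))"
      using r by (subst suminf_mult) (auto simp: suminf_geometric intro: summable_geometric)
    finally have "(cmod (f n x - g x))\<^sup>2 \<le> (sqrt (H x) * r ^ n * (1 / (1 - r)))\<^sup>2"
      by (rule power_mono) auto
    also have "\<dots> = (C * (1 / 2) ^ n) * H x"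
      using H0 unfolding C_def power_mult_distrib rn by simp
    finally show ?case .
  qed
  have fg: "(\<lambda>x. f n x - g x) \<in> L2 M" "(L2_norm M (\<lambda>x. f n x - g x))\<^sup>2 \<le> (LINT x|M. (C * (1 / 2) ^ n) * H x)" for n
  proof -
    have m: "(\<lambda>x. f n x - g x) \<in> borel_measurable M" using gm f L2_measurable by measurable
    show "(\<lambda>x. f n x - g x) \<in> L2 M" "(L2_norm M (\<lambda>x. f n x - g x))\<^sup>2 \<le> (LINT x|M. (C * (1 / 2) ^ n) * H x)"
      using L2_bound[OF integrable_mult_right[OF HI] m tail] by auto
  qed
  have "g \<in> L2 M" using L2_diff[OF f[of 0] fg(1)[of 0]] by simp
  moreover have "(\<lambda>n. L2_norm M (\<lambda>x. f n x - g x)) \<longlonglongrightarrow> 0"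
  proof (rule tendsto_sandwich)
    show "\<forall>\<^sub>F n in sequentially. 0 \<le> L2_norm M (\<lambda>x. f n x - g x)" by simp
    have "L2_norm M (\<lambda>x. f n x - g x) \<le> sqrt ((C * (1 / 2) ^ n) * (LINT x|M. H x))" for n
      using fg(2)[of n] by (intro real_le_rsqrt) simp
    thus "\<forall>\<^sub>F n in sequentially. L2_norm M (\<lambda>x. f n x - g x) \<le> sqrt ((C * (1 / 2) ^ n) * (LINT x|M. H x))"
      by simp
    have "(\<lambda>n. sqrt ((C * (1 / 2) ^ n) * (LINT x|M. H x))) \<longlonglongrightarrow> sqrt ((C * 0) * (LINT x|M. H x))"
      by (intro tendsto_intros LIMSEQ_power_zero) auto
    thus "(\<lambda>n. sqrt ((C * (1 / 2) ^ n) * (LINT x|M. H x))) \<longlonglongrightarrow> 0" by simp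
  qed simp
  ultimately show ?thesis using that by blast
qed

section \<open>Orthonormal sets: Bessel's inequality, expansion and Parseval's identity\<close>

lemma L2_inner_diff_left:
  assumes "f \<in> L2 M" "g \<in> L2 M" "h \<in> L2 M"
  shows "L2_inner M (\<lambda>x. f x - g x) h = L2_inner M f h - L2_inner M g h"
  using L2_mult_integrable(1)[OF assms(1) L2_cnj[OF assms(3)]] L2_mult_integrable(1)[OF assms(2) L2_cnj[OF assms(3)]]
  by (simp add: L2_inner_def left_diff_distrib)

lemma L2_inner_scale_left: "L2_inner M (\<lambda>x. c * f x) h = c * L2_inner M f h"
  by (simp add: L2_inner_def mult.assoc)

lemma L2_inner_commute: "L2_inner M f g = cnj (L2_inner M g f)"
  unfolding L2_inner_def by (subst Bochner_Integration.integral_cnj [symmetric]) (simp add: mult.commute)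

lemma L2_inner_sum_left:
  assumes "\<And>i. i \<in> I \<Longrightarrow> f i \<in> L2 M" "h \<in> L2 M"
  shows "L2_inner M (\<lambda>x. \<Sum>i\<in>I. f i x) h = (\<Sum>i\<in>I. L2_inner M (f i) h)"
  using assms L2_mult_integrable(1)[OF _ L2_cnj]
  unfolding L2_inner_def sum_distrib_right by (intro Bochner_Integration.integral_sum) auto

lemma L2_inner_self:
  "L2_inner M f f = of_real ((L2_norm M f)\<^sup>2)"
proof -
  have "L2_inner M f f = (LINT x|M. of_real ((cmod (f x))\<^sup>2))"
    unfolding L2_inner_def by (intro Bochner_Integration.integral_cong refl) (simp only: complex_norm_square)
  thus ?thesis by (simp only: integral_complex_of_real L2_norm_power2)
qed

context
  fixes M :: "'a measure" and E :: "('a \<Rightarrow> complex) set"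
  assumes E: "orthonormal_set M E"
begin

lemma orthonormal_set_L2: "e \<in> E \<Longrightarrow> e \<in> L2 M"
  using E by (auto simp: orthonormal_set_def)

lemma L2_inner_orthonormal_sum:
  assumes F: "finite F" "F \<subseteq> E" and e: "e \<in> E"
  shows "L2_inner M (\<lambda>x. \<Sum>f\<in>F. c f * f x) e = (if e \<in> F then c e else 0)"
proof -
  have "L2_inner M (\<lambda>x. \<Sum>f\<in>F. c f * f x) e = (\<Sum>f\<in>F. L2_inner M (\<lambda>x. c f * f x) e)"
    using F e orthonormal_set_L2 by (intro L2_inner_sum_left L2_scale) auto
  also have "\<dots> = (\<Sum>f\<in>F. c f * (if f = e then 1 else 0))"
    using F e E by (intro sum.cong refl) (auto simp: L2_inner_scale_left orthonormal_set_def subset_iff)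
  finally show ?thesis using F(1) by (simp add: if_distrib cong: if_cong)
qed

lemma L2_norm_orthonormal_sum:
  assumes F: "finite F" "F \<subseteq> E"
  shows "(L2_norm M (\<lambda>x. \<Sum>f\<in>F. c f * f x))\<^sup>2 = (\<Sum>f\<in>F. (cmod (c f))\<^sup>2)"
proof -
  let ?s = "\<lambda>x. \<Sum>f\<in>F. c f * f x"
  have s: "?s \<in> L2 M" using F orthonormal_set_L2 by (intro L2_sum L2_scale) auto
  have "L2_inner M ?s ?s = (\<Sum>f\<in>F. L2_inner M (\<lambda>x. c f * f x) ?s)"
    using F s orthonormal_set_L2 by (intro L2_inner_sum_left L2_scale) auto
  also have "\<dots> = (\<Sum>f\<in>F. c f * cnj (L2_inner M ?s f))"
    by (intro sum.cong refl) (simp add: L2_inner_scale_left L2_inner_commute[of M _ ?s])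
  also have "\<dots> = (\<Sum>f\<in>F. of_real ((cmod (c f))\<^sup>2))"
    using F by (intro sum.cong refl) (simp only: L2_inner_orthonormal_sum[OF F] complex_norm_square subset_iff if_True)
  finally have "complex_of_real ((L2_norm M ?s)\<^sup>2) = of_real (\<Sum>f\<in>F. (cmod (c f))\<^sup>2)"
    by (simp only: L2_inner_self of_real_sum)
  thus ?thesis by (simp only: of_real_eq_iff)
qed

text \<open>Pythagoras. Nonnegativity of the left side is Bessel's inequality; the right side also
  shows that enlarging F can only improve the approximation, as the proof of Parseval's identity
  requires.\<close>

lemma L2_norm_diff_projection:
  assumes F: "finite F" "F \<subseteq> E" and g: "g \<in> L2 M"
  shows "(L2_norm M (\<lambda>x. g x - (\<Sum>f\<in>F. L2_inner M g f * f x)))\<^sup>2 =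
    (L2_norm M g)\<^sup>2 - (\<Sum>f\<in>F. (cmod (L2_inner M g f))\<^sup>2)"
proof -
  let ?s = "\<lambda>x. \<Sum>f\<in>F. L2_inner M g f * f x"
  have s: "?s \<in> L2 M" using F orthonormal_set_L2 by (intro L2_sum L2_scale) auto
  have sg: "L2_inner M ?s g = of_real (\<Sum>f\<in>F. (cmod (L2_inner M g f))\<^sup>2)"
  proof -
    have "L2_inner M ?s g = (\<Sum>f\<in>F. L2_inner M (\<lambda>x. L2_inner M g f * f x) g)"
      using F g orthonormal_set_L2 by (intro L2_inner_sum_left L2_scale) auto
    also have "\<dots> = (\<Sum>f\<in>F. of_real ((cmod (L2_inner M g f))\<^sup>2))"
      by (intro sum.cong refl) (simp only: L2_inner_scale_left complex_norm_square L2_inner_commute[of M _ g])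
    finally show ?thesis by simp
  qed
  have "L2_inner M (\<lambda>x. g x - ?s x) (\<lambda>x. g x - ?s x) =
      L2_inner M g g - cnj (L2_inner M ?s g) - L2_inner M ?s g + L2_inner M ?s ?s"
  proof -
    let ?d = "\<lambda>x. g x - ?s x"
    have "L2_inner M ?d ?d = cnj (L2_inner M ?d g) - cnj (L2_inner M ?d ?s)"
      unfolding L2_inner_diff_left[OF g s L2_diff[OF g s]] by (simp only: L2_inner_commute[symmetric])
    also have "L2_inner M ?d g = L2_inner M g g - L2_inner M ?s g"
      by (rule L2_inner_diff_left[OF g s g])
    also have "L2_inner M ?d ?s = L2_inner M g ?s - L2_inner M ?s ?s"
      by (rule L2_inner_diff_left[OF g s s])
    also have "L2_inner M g ?s = cnj (L2_inner M ?s g)" by (rule L2_inner_commute)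
    finally show ?thesis by (simp add: L2_inner_self)
  qed
  hence "complex_of_real ((L2_norm M (\<lambda>x. g x - ?s x))\<^sup>2) =
    of_real ((L2_norm M g)\<^sup>2 - (\<Sum>f\<in>F. (cmod (L2_inner M g f))\<^sup>2))"
    unfolding sg L2_inner_self L2_norm_orthonormal_sum[OF F] by simp
  thus ?thesis by (simp only: of_real_eq_iff)
qed

lemma L2_Bessel:
  assumes "finite F" "F \<subseteq> E" "g \<in> L2 M"
  shows "(\<Sum>f\<in>F. (cmod (L2_inner M g f))\<^sup>2) \<le> (L2_norm M g)\<^sup>2"
  using L2_norm_diff_projection[OF assms] zero_le_power2[of "L2_norm M (\<lambda>x. g x - (\<Sum>f\<in>F. L2_inner M g f * f x))"]
  by linarith

end

text \<open>The basis may be uncountable, so there is no sequence of partial sums to start from.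
  Bessel's inequality makes the squared coefficients summable; finite sets that capture this sum up
  to 4^-n, made increasing, give a sequence of projections that converges by
  \<open>L2_complete\<close>.\<close>

lemma orthonormal_basis_expansion:
  assumes E: "orthonormal_basis M E" and g: "g \<in> L2 M" and \<epsilon>: "\<epsilon> > 0"
  obtains F where "finite F" "F \<subseteq> E" "L2_norm M (\<lambda>x. g x - (\<Sum>f\<in>F. L2_inner M g f * f x)) < \<epsilon>"
proof -
  have On: "orthonormal_set M E" and compl: "\<And>f. f \<in> L2 M \<Longrightarrow> (\<And>e. e \<in> E \<Longrightarrow> L2_inner M f e = 0) \<Longrightarrow> AE x in M. f x = 0"
    using E by (auto simp: orthonormal_basis_def)
  note EL = orthonormal_set_L2[OF On]
  define w where "w e = (cmod (L2_inner M g e))\<^sup>2" for e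
  have sm: "w summable_on E"
  proof (rule nonneg_bdd_above_summable_on)
    show "bdd_above (sum w ` {F. F \<subseteq> E \<and> finite F})"
      using L2_Bessel[OF On _ _ g] by (auto simp: bdd_above_def w_def)
  qed (auto simp: w_def)
  \<comment> \<open>A convergent nonnegative family has less than 4^-n left on every finite set
    disjoint from a suitable F; 4^-n is the rate that \<open>L2_complete\<close> demands.\<close>
  have ex: "\<exists>F. finite F \<and> F \<subseteq> E \<and> (\<forall>G. finite G \<longrightarrow> G \<subseteq> E \<longrightarrow> G \<inter> F = {} \<longrightarrow> sum w G < (1 / 4) ^ n)" for n
  proof -
    have "(sum w \<longlongrightarrow> infsum w E) (finite_subsets_at_top E)" using has_sum_infsum[OF sm] by (simp add: has_sum_def)
    hence "\<forall>\<^sub>F F in finite_subsets_at_top E. dist (sum w F) (infsum w E) < (1 / 4) ^ n"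
      by (rule tendstoD) simp
    then obtain F where F: "finite F" "F \<subseteq> E"
      and d: "\<And>F'. finite F' \<Longrightarrow> F \<subseteq> F' \<Longrightarrow> F' \<subseteq> E \<Longrightarrow> dist (sum w F') (infsum w E) < (1 / 4) ^ n"
      unfolding eventually_finite_subsets_at_top by auto
    have "sum w G < (1 / 4) ^ n" if G: "finite G" "G \<subseteq> E" "G \<inter> F = {}" for G
    proof -
      have "sum w (F \<union> G) = sum w F + sum w G" using G F by (intro sum.union_disjoint) auto
      moreover have "sum w (F \<union> G) \<le> infsum w E"
        using sm G F by (intro finite_sum_le_infsum) (auto simp: w_def)
      moreover have "dist (sum w F) (infsum w E) < (1 / 4) ^ n" using F by (intro d) auto
      ultimately show ?thesis by (simp add: dist_real_def)
    qed
    thus ?thesis using F by blast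
  qed
  then obtain F0 where F0: "\<And>n. finite (F0 n)" "\<And>n. F0 n \<subseteq> E"
    and t0: "\<And>n G. finite G \<Longrightarrow> G \<subseteq> E \<Longrightarrow> G \<inter> F0 n = {} \<Longrightarrow> sum w G < (1 / 4) ^ n"
    by metis
  define F where "F n = (\<Union>k\<le>n. F0 k)" for n
  have F: "finite (F n)" "F n \<subseteq> E" "F n \<subseteq> F (Suc n)" "F0 n \<subseteq> F n" for n
    using F0 by (auto simp: F_def atMost_Suc)
  have t: "sum w G < (1 / 4) ^ n" if "finite G" "G \<subseteq> E" "G \<inter> F n = {}" for n G
    using that F(4)[of n] by (intro t0) auto
  define P where "P n x = (\<Sum>f\<in>F n. L2_inner M g f * f x)" for n x
  have P: "P n \<in> L2 M" for n
    unfolding P_def using F(2) EL by (intro L2_sum L2_scale) blast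
  have "(L2_norm M (\<lambda>x. P (Suc n) x - P n x))\<^sup>2 \<le> (1 / 4) ^ n" for n
  proof -
    have "P (Suc n) x - P n x = (\<Sum>f\<in>F (Suc n) - F n. L2_inner M g f * f x)" for x
      unfolding P_def using F by (simp add: sum_diff)
    hence "(L2_norm M (\<lambda>x. P (Suc n) x - P n x))\<^sup>2 = sum w (F (Suc n) - F n)"
      using L2_norm_orthonormal_sum[OF On, of "F (Suc n) - F n" "L2_inner M g"] F(1,2)[of "Suc n"]
      by (simp add: w_def le_infI1 Diff_subset_conv le_supI2)
    also have "\<dots> < (1 / 4) ^ n" using F by (intro t) auto
    finally show ?thesis by simp
  qed
  from L2_complete[OF P this] obtain q where q: "q \<in> L2 M" and lim: "(\<lambda>n. L2_norm M (\<lambda>x. P n x - q x)) \<longlonglongrightarrow> 0"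
    by blast
  \<comment> \<open>The limit q has the same coefficients as g, so g - q is orthogonal to the whole
    basis and vanishes almost everywhere by completeness.\<close>
  have "L2_inner M (\<lambda>x. g x - q x) e = 0" if e: "e \<in> E" for e
  proof -
    have "(\<lambda>n. L2_inner M (P n) e - L2_inner M q e) \<longlonglongrightarrow> 0"
    proof (rule Lim_null_comparison)
      show "\<forall>\<^sub>F n in sequentially. norm (L2_inner M (P n) e - L2_inner M q e) \<le> L2_norm M (\<lambda>x. P n x - q x) * L2_norm M e"
        using L2_inner_bound[OF L2_diff[OF P q] EL[OF e]] P q EL[OF e] by (simp add: L2_inner_diff_left)
      show "(\<lambda>n. L2_norm M (\<lambda>x. P n x - q x) * L2_norm M e) \<longlonglongrightarrow> 0"
        using tendsto_mult_right[OF lim, of "L2_norm M e"] by simp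
    qed
    hence l1: "(\<lambda>n. L2_inner M (P n) e) \<longlonglongrightarrow> L2_inner M q e" by (simp add: LIM_zero_iff)
    have l2: "(\<lambda>n. L2_inner M (P n) e) \<longlonglongrightarrow> L2_inner M g e"
    proof (cases "\<exists>n. e \<in> F n")
      case True
      then obtain n where n: "e \<in> F n" by blast
      have "\<forall>m\<ge>n. L2_inner M (P m) e = L2_inner M g e"
      proof (intro allI impI)
        fix m assume "m \<ge> n"
        hence "e \<in> F m" using n lift_Suc_mono_le[of F n m] F(3) by blast
        thus "L2_inner M (P m) e = L2_inner M g e"
          unfolding P_def using L2_inner_orthonormal_sum[OF On F(1,2) e] by simp
      qed
      thus ?thesis by (intro tendsto_eventually) (auto simp: eventually_at_top_linorder)
    next
      case False
      \<comment> \<open>A basis element outside all F n forms a finite set disjoint from each of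
        them, so its squared coefficient is below every 4^-n.\<close>
      have "w e \<le> 0"
      proof (rule LIMSEQ_le_const)
        show "(\<lambda>n. (1 / 4 :: real) ^ n) \<longlonglongrightarrow> 0" by (intro LIMSEQ_power_zero) auto
        have "w e \<le> (1 / 4) ^ n" for n using t[of "{e}" n] e False by auto
        thus "\<exists>N. \<forall>n\<ge>N. w e \<le> (1 / 4) ^ n" by blast
      qed
      hence "L2_inner M g e = 0" by (simp add: w_def)
      thus ?thesis
        unfolding P_def using L2_inner_orthonormal_sum[OF On F(1,2) e] False by simp
    qed
    show ?thesis
      using LIMSEQ_unique[OF l1 l2] g q EL[OF e] by (simp add: L2_inner_diff_left)
  qed
  hence ae: "AE x in M. g x - q x = 0" using g q by (intro compl L2_diff) auto
  from lim \<epsilon> obtain n where n: "L2_norm M (\<lambda>x. P n x - q x) < \<epsilon>"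
    by (metis (no_types, lifting) LIMSEQ_D L2_norm_nonneg abs_of_nonneg diff_zero order_refl real_norm_def)
  have "L2_norm M (\<lambda>x. g x - P n x) = L2_norm M (\<lambda>x. q x - P n x)"
    using L2_measurable[OF L2_diff[OF g P]] L2_measurable[OF L2_diff[OF q P]] ae
    by (intro L2_norm_cong_AE) auto
  hence "L2_norm M (\<lambda>x. g x - P n x) < \<epsilon>" using n by (simp add: L2_norm_minus_commute[of M q])
  thus ?thesis using that[of "F n"] F unfolding P_def by blast
qed

text \<open>Only f has to be approximated: by the Cauchy-Schwarz inequality the error of the sum is
  at most the error of f times the norm of g.\<close>

lemma orthonormal_basis_Parseval:
  assumes E: "orthonormal_basis M E" and f: "f \<in> L2 M" and g: "g \<in> L2 M"
  shows "((\<lambda>F. \<Sum>e\<in>F. L2_inner M f e * L2_inner M e g) \<longlongrightarrow> L2_inner M f g) (finite_subsets_at_top E)"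
proof (rule tendstoI)
  have On: "orthonormal_set M E" using E by (simp add: orthonormal_basis_def)
  note EL = orthonormal_set_L2[OF On]
  fix \<epsilon> :: real assume \<epsilon>: "\<epsilon> > 0"
  \<comment> \<open>The summand 1 keeps the quotient meaningful when g has norm 0.\<close>
  define \<delta> where "\<delta> = \<epsilon> / (L2_norm M g + 1)"
  have ng: "L2_norm M g + 1 > 0" using L2_norm_nonneg[of M g] by linarith
  have \<delta>: "\<delta> > 0" using \<epsilon> ng by (simp add: \<delta>_def)
  obtain F0 where F0: "finite F0" "F0 \<subseteq> E"
    and b: "L2_norm M (\<lambda>x. f x - (\<Sum>e\<in>F0. L2_inner M f e * e x)) < \<delta>"
    using orthonormal_basis_expansion[OF E f \<delta>] by blast
  have "dist (\<Sum>e\<in>F. L2_inner M f e * L2_inner M e g) (L2_inner M f g) < \<epsilon>"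
    if F: "finite F" "F0 \<subseteq> F" "F \<subseteq> E" for F
  proof -
    let ?s = "\<lambda>x. \<Sum>e\<in>F. L2_inner M f e * e x"
    have s: "?s \<in> L2 M" using F EL by (intro L2_sum L2_scale) auto
    have "(L2_norm M (\<lambda>x. f x - ?s x))\<^sup>2 \<le> (L2_norm M (\<lambda>x. f x - (\<Sum>e\<in>F0. L2_inner M f e * e x)))\<^sup>2"
      unfolding L2_norm_diff_projection[OF On F(1,3) f] L2_norm_diff_projection[OF On F0 f]
      using F by (intro diff_left_mono sum_mono2) auto
    hence "L2_norm M (\<lambda>x. f x - ?s x) \<le> L2_norm M (\<lambda>x. f x - (\<Sum>e\<in>F0. L2_inner M f e * e x))"
      by (rule power2_le_imp_le) simp
    with b have b': "L2_norm M (\<lambda>x. f x - ?s x) \<le> \<delta>" by linarith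
    have "L2_inner M ?s g = (\<Sum>e\<in>F. L2_inner M (\<lambda>x. L2_inner M f e * e x) g)"
      using F EL g by (intro L2_inner_sum_left L2_scale) auto
    hence "(\<Sum>e\<in>F. L2_inner M f e * L2_inner M e g) = L2_inner M ?s g"
      by (simp add: L2_inner_scale_left)
    hence "dist (\<Sum>e\<in>F. L2_inner M f e * L2_inner M e g) (L2_inner M f g) = cmod (L2_inner M (\<lambda>x. f x - ?s x) g)"
      using f g s by (simp add: dist_norm norm_minus_commute L2_inner_diff_left)
    also have "\<dots> \<le> L2_norm M (\<lambda>x. f x - ?s x) * L2_norm M g"
      by (rule L2_inner_bound[OF L2_diff[OF f s] g])
    also have "\<dots> \<le> \<delta> * L2_norm M g" using b' by (intro mult_right_mono) auto
    also have "\<dots> < \<delta> * (L2_norm M g + 1)" using \<delta> by (intro mult_strict_left_mono) auto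
    also have "\<dots> = \<epsilon>" using ng by (simp add: \<delta>_def)
    finally show ?thesis .
  qed
  thus "\<forall>\<^sub>F F in finite_subsets_at_top E. dist (\<Sum>e\<in>F. L2_inner M f e * L2_inner M e g) (L2_inner M f g) < \<epsilon>"
    unfolding eventually_finite_subsets_at_top using F0 by blast
qed

text \<open>The second claim shares the hypotheses of the first because it needs an admissible bound
  to exist: the infimum of the empty set is arbitrary.\<close>

lemma op_norm_le:
  assumes "0 \<le> c" "\<And>f. f \<in> L2 M \<Longrightarrow> L2_norm M (T f) \<le> c * L2_norm M f"
  shows "op_norm M T \<le> c" "op_norm M T \<ge> 0"
  unfolding op_norm_def
  using assms by (auto intro!: cInf_lower cInf_greatest bdd_belowI[of _ 0])

text \<open>Each F n is one competitor in the infimum that defines the n-th singular number.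
  Nonnegativity is shown for all competitors, since the set must be bounded below before its infimum
  can be compared with a member.\<close>

lemma trace_classI:
  assumes T: "bounded_op M T"
    and F: "\<And>n. bounded_op M (F n)" "\<And>n. rank_at_most M n (F n)"
    and err: "\<And>n f. f \<in> L2 M \<Longrightarrow> L2_norm M (\<lambda>x. T f x - F n f x) \<le> \<epsilon> n * L2_norm M f"
    and \<epsilon>: "\<And>n. 0 \<le> \<epsilon> n" "summable \<epsilon>"
  shows "trace_class M T"
proof -
  have nonneg: "0 \<le> op_norm M (\<lambda>f x. T f x - G f x)" if G: "bounded_op M G" for G
  proof -
    obtain a where a: "\<And>f. f \<in> L2 M \<Longrightarrow> L2_norm M (T f) \<le> a * L2_norm M f"
      using T unfolding bounded_op_def by metis
    obtain b where b: "\<And>f. f \<in> L2 M \<Longrightarrow> L2_norm M (G f) \<le> b * L2_norm M f"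
      using G unfolding bounded_op_def by metis
    show ?thesis
    proof (rule op_norm_le(2))
      fix f assume f: "f \<in> L2 M"
      have "L2_norm M (\<lambda>x. T f x - G f x) \<le> L2_norm M (T f) + L2_norm M (G f)"
        using f T G by (intro L2_norm_diff_le) (auto simp: bounded_op_def)
      also have "\<dots> \<le> \<bar>a\<bar> * L2_norm M f + \<bar>b\<bar> * L2_norm M f"
        using a[OF f] b[OF f] mult_right_mono[OF abs_ge_self L2_norm_nonneg, of a M f]
          mult_right_mono[OF abs_ge_self L2_norm_nonneg, of b M f] by linarith
      finally show "L2_norm M (\<lambda>x. T f x - G f x) \<le> (\<bar>a\<bar> + \<bar>b\<bar>) * L2_norm M f" by (simp add: distrib_right)
    qed simp
  qed
  have "0 \<le> singular_number M T n" "singular_number M T n \<le> \<epsilon> n" for n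
  proof -
    let ?S = "{op_norm M (\<lambda>f x. T f x - F f x) |F. bounded_op M F \<and> rank_at_most M n F}"
    have F': "op_norm M (\<lambda>f x. T f x - F n f x) \<in> ?S" using F by blast
    show "0 \<le> singular_number M T n"
      unfolding singular_number_def using F' nonneg by (intro cInf_greatest) auto
    have "singular_number M T n \<le> op_norm M (\<lambda>f x. T f x - F n f x)"
      unfolding singular_number_def using F' nonneg by (intro cInf_lower bdd_belowI[of _ 0]) auto
    also have "\<dots> \<le> \<epsilon> n" using err \<epsilon> by (intro op_norm_le) auto
    finally show "singular_number M T n \<le> \<epsilon> n" .
  qed
  hence "summable (singular_number M T)"
    by (intro summable_comparison_test'[OF \<epsilon>(2), of 0]) auto
  thus ?thesis using T by (simp add: trace_class_def)
qed

section \<open>Determinants over finite index sets\<close>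

text \<open>The Leibniz formula over an arbitrary finite set without any order. It agrees literally
  with the finite sections in \<open>has_fredholm_det\<close>, whose indices are basis functions,
  and serves equally for minors indexed by integers.\<close>

definition fdet :: "'a set \<Rightarrow> ('a \<Rightarrow> 'a \<Rightarrow> complex) \<Rightarrow> complex" where
  "fdet F A = (\<Sum>p | p permutes F. of_int (sign p) * (\<Prod>i\<in>F. A i (p i)))"

lemma fdet_cong:
  assumes "\<And>i j. i \<in> F \<Longrightarrow> j \<in> F \<Longrightarrow> A i j = B i j"
  shows "fdet F A = fdet F B"
  unfolding fdet_def
  by (intro sum.cong refl arg_cong2[where f = "(*)"] prod.cong) (auto simp: assms permutes_in_image)

lemma fdet_empty [simp]: "fdet {} A = 1"
  by (simp add: fdet_def)

lemma fdet_scale_columns: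
  assumes "finite F"
  shows "fdet F (\<lambda>i j. c j * A i j) = (\<Prod>i\<in>F. c i) * fdet F A"
proof -
  have "(\<Prod>i\<in>F. c (p i) * A i (p i)) = (\<Prod>i\<in>F. c i) * (\<Prod>i\<in>F. A i (p i))" if "p permutes F" for p
    using prod.permute[OF that, of c] by (simp add: prod.distrib comp_def)
  thus ?thesis
    unfolding fdet_def sum_distrib_left
    by (intro sum.cong refl) (auto simp: mult_ac)
qed

lemma fdet_scale_rows:
  assumes "finite F"
  shows "fdet F (\<lambda>i j. c i * A i j) = (\<Prod>i\<in>F. c i) * fdet F A"
  unfolding fdet_def sum_distrib_left by (intro sum.cong refl) (auto simp: prod.distrib mult_ac)

lemma norm_fdet_le:
  assumes "finite F" "\<And>i j. i \<in> F \<Longrightarrow> j \<in> F \<Longrightarrow> cmod (A i j) \<le> M"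
  shows "cmod (fdet F A) \<le> fact (card F) * M ^ card F"
proof -
  have "cmod (fdet F A) \<le> (\<Sum>p | p permutes F. M ^ card F)"
    unfolding fdet_def
  proof (rule sum_norm_le)
    fix p assume "p \<in> {p. p permutes F}"
    hence p: "p permutes F" by simp
    have "cmod (\<Prod>i\<in>F. A i (p i)) \<le> (\<Prod>i\<in>F. M)"
      unfolding prod_norm [symmetric]
      by (rule prod_mono) (use assms p in \<open>auto simp: permutes_in_image\<close>)
    moreover have "cmod (of_int (sign p)) = 1"
      by (simp add: sign_def)
    ultimately show "cmod (of_int (sign p) * (\<Prod>i\<in>F. A i (p i))) \<le> M ^ card F"
      by (simp add: norm_mult)
  qed
  thus ?thesis using assms(1) by (simp add: card_permutations)
qed

lemma fdet_row_sum:
  assumes "finite F" "i \<in> F" "finite S"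
  shows "fdet F (A(i := (\<lambda>j. \<Sum>s\<in>S. c s * v s j))) = (\<Sum>s\<in>S. c s * fdet F (A(i := v s)))"
proof -
  have row: "(\<Prod>k\<in>F. (A(i := w)) k (p k)) = w (p i) * (\<Prod>k\<in>F - {i}. A k (p k))" for w and p :: "'a \<Rightarrow> 'a"
  proof -
    have "(\<Prod>k\<in>F. (A(i := w)) k (p k)) = (A(i := w)) i (p i) * (\<Prod>k\<in>F - {i}. (A(i := w)) k (p k))"
      using assms by (intro prod.remove)
    also have "(\<Prod>k\<in>F - {i}. (A(i := w)) k (p k)) = (\<Prod>k\<in>F - {i}. A k (p k))"
      by (intro prod.cong) auto
    finally show ?thesis by simp
  qed
  show ?thesis
    unfolding fdet_def row sum_distrib_left sum_distrib_right
    by (subst sum.swap) (simp add: mult_ac)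
qed

lemma fdet_identical_rows:
  assumes "finite F" "i \<in> F" "k \<in> F" "i \<noteq> k" "\<And>j. A i j = A k j"
  shows "fdet F A = 0"
proof -
  let ?t = "Transposition.transpose i k"
  have tp: "?t permutes F" using assms by (simp add: permutes_swap_id)
  have "fdet F A = (\<Sum>p | p permutes F. of_int (sign (p \<circ> ?t)) * (\<Prod>j\<in>F. A j ((p \<circ> ?t) j)))"
    unfolding fdet_def
    by (rule sum_permutations_compose_right[OF tp])
  also have "\<dots> = (\<Sum>p | p permutes F. - (of_int (sign p) * (\<Prod>j\<in>F. A j (p j))))"
  proof (intro sum.cong refl)
    fix p assume "p \<in> {p. p permutes F}"
    hence p: "p permutes F" by simp
    have "sign (p \<circ> ?t) = - sign p"
      using sign_compose[of p ?t] assms p permutation_permutes[of p] permutation_swap_id[of i k]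
      by (auto simp: sign_swap_id)
    moreover have "(\<Prod>j\<in>F. A j ((p \<circ> ?t) j)) = (\<Prod>j\<in>F. A (?t j) (p (?t j)))"
      by (intro prod.cong refl) (auto simp: Transposition.transpose_def assms(5))
    moreover have "\<dots> = (\<Prod>j\<in>F. A j (p j))"
      using prod.permute[OF tp, of "\<lambda>j. A j (p j)"] by (simp add: comp_def)
    ultimately show "of_int (sign (p \<circ> ?t)) * (\<Prod>j\<in>F. A j ((p \<circ> ?t) j)) =
        - (of_int (sign p) * (\<Prod>j\<in>F. A j (p j)))"
      by simp
  qed
  also have "\<dots> = - fdet F A" by (simp add: fdet_def sum_negf)
  finally show ?thesis by simp
qed

text \<open>Cramer's rule without division: \<open>v = adj(A) b\<close>.\<close>

lemma fdet_adjugate_vector: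
  fixes b c :: "'a \<Rightarrow> complex"
  assumes F: "finite F"
  obtains v where "\<And>i. i \<in> F \<Longrightarrow> (\<Sum>j\<in>F. A i j * v j) = fdet F A * b i"
    and "(\<Sum>i\<in>F. b i * fdet F (A(i := c))) = (\<Sum>j\<in>F. c j * v j)"
proof -
  define u where "u j = (\<lambda>k::'a. if k = j then 1 else 0 :: complex)" for j
  \<comment> \<open>\<open>fdet F (A(i := u j))\<close> is the cofactor of the entry (i, j), so v is
    the adjugate applied to b. Taking a row of A for w in \<open>expand\<close> puts two equal rows
    into all determinants but one.\<close>
  define v where "v j = (\<Sum>i\<in>F. b i * fdet F (A(i := u j)))" for j
  have expand: "(\<Sum>j\<in>F. w j * v j) = (\<Sum>i\<in>F. b i * fdet F (A(i := w)))" for w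
  proof -
    have "(\<Sum>j\<in>F. w j * v j) = (\<Sum>i\<in>F. b i * (\<Sum>j\<in>F. w j * fdet F (A(i := u j))))"
      unfolding v_def sum_distrib_left by (subst sum.swap) (simp add: mult_ac)
    also have "\<dots> = (\<Sum>i\<in>F. b i * fdet F (A(i := (\<lambda>k. \<Sum>j\<in>F. w j * u j k))))"
      by (intro sum.cong refl) (simp add: fdet_row_sum F)
    also have "\<dots> = (\<Sum>i\<in>F. b i * fdet F (A(i := w)))"
      by (intro sum.cong refl arg_cong2[where f = "(*)"] fdet_cong) (auto simp: u_def F if_distrib cong: if_cong)
    finally show ?thesis .
  qed
  have "(\<Sum>j\<in>F. A i j * v j) = fdet F A * b i" if i: "i \<in> F" for i
  proof -
    have "(\<Sum>j\<in>F. A i j * v j) = (\<Sum>k\<in>F. b k * fdet F (A(k := A i)))"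
      by (rule expand)
    also have "\<dots> = (\<Sum>k\<in>F. if k = i then b k * fdet F A else 0)"
    proof (intro sum.cong refl)
      fix k assume k: "k \<in> F"
      show "b k * fdet F (A(k := A i)) = (if k = i then b k * fdet F A else 0)"
        using fdet_identical_rows[of F i k "A(k := A i)"] i k F by auto
    qed
    finally show ?thesis using i F by simp
  qed
  from this expand[of c, symmetric] show ?thesis by (rule that)
qed

text \<open>In each product over J, a subset S of the factors contributes -M and the others the
  identity matrix. The latter force the permutation to fix every point outside S, so what remains is
  the principal minor of S.\<close>

lemma fdet_minors:
  assumes J: "finite J"
  shows "fdet J (\<lambda>i j. (if i = j then 1 else 0) - M i j) = (\<Sum>S\<in>Pow J. (- 1) ^ card S * fdet S M)"
proof -
  let ?\<delta> = "\<lambda>i j. if i = j then 1 else 0 :: complex"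
  have "fdet J (\<lambda>i j. ?\<delta> i j - M i j) =
      (\<Sum>p | p permutes J. \<Sum>S\<in>Pow J. of_int (sign p) * ((\<Prod>i\<in>S. - M i (p i)) * (\<Prod>i\<in>J - S. ?\<delta> i (p i))))"
    unfolding fdet_def
  proof (intro sum.cong refl)
    fix p
    have "(\<Prod>i\<in>J. ?\<delta> i (p i) - M i (p i)) = (\<Prod>i\<in>J. - M i (p i) + ?\<delta> i (p i))" by simp
    also have "\<dots> = (\<Sum>S\<in>Pow J. (\<Prod>i\<in>S. - M i (p i)) * (\<Prod>i\<in>J - S. ?\<delta> i (p i)))"
      by (rule prod_add[OF J])
    finally show "of_int (sign p) * (\<Prod>i\<in>J. ?\<delta> i (p i) - M i (p i)) =
      (\<Sum>S\<in>Pow J. of_int (sign p) * ((\<Prod>i\<in>S. - M i (p i)) * (\<Prod>i\<in>J - S. ?\<delta> i (p i))))"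
      by (simp add: sum_distrib_left)
  qed
  also have "\<dots> = (\<Sum>S\<in>Pow J. \<Sum>p | p permutes J. of_int (sign p) * ((\<Prod>i\<in>S. - M i (p i)) * (\<Prod>i\<in>J - S. ?\<delta> i (p i))))"
    by (rule sum.swap)
  also have "\<dots> = (\<Sum>S\<in>Pow J. (- 1) ^ card S * fdet S M)"
  proof (intro sum.cong refl)
    fix S assume "S \<in> Pow J"
    hence S: "S \<subseteq> J" "finite S" using J finite_subset by auto
    have "(\<Sum>p | p permutes J. of_int (sign p) * ((\<Prod>i\<in>S. - M i (p i)) * (\<Prod>i\<in>J - S. ?\<delta> i (p i)))) =
        (\<Sum>p | p permutes S. of_int (sign p) * (\<Prod>i\<in>S. - M i (p i)))"
    proof (rule sum.mono_neutral_cong_right)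
      show "finite {p. p permutes J}" using J by (rule finite_permutations)
      show "{p. p permutes S} \<subseteq> {p. p permutes J}" using S permutes_subset by blast
      show "\<forall>p\<in>{p. p permutes J} - {p. p permutes S}.
          of_int (sign p) * ((\<Prod>i\<in>S. - M i (p i)) * (\<Prod>i\<in>J - S. ?\<delta> i (p i))) = 0"
      proof
        fix p assume p: "p \<in> {p. p permutes J} - {p. p permutes S}"
        have "\<exists>i\<in>J - S. p i \<noteq> i"
        proof (rule ccontr)
          assume "\<not> ?thesis"
          hence "p permutes S" using p permutes_superset[of p J S] by auto
          thus False using p by simp
        qed
        then obtain i where i: "i \<in> J - S" "p i \<noteq> i" by blast
        have "(\<Prod>i\<in>J - S. ?\<delta> i (p i)) = 0" using J i by (intro prod_zero bexI[of _ i]) auto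
        thus "of_int (sign p) * ((\<Prod>i\<in>S. - M i (p i)) * (\<Prod>i\<in>J - S. ?\<delta> i (p i))) = 0" by simp
      qed
      show "of_int (sign p) * ((\<Prod>i\<in>S. - M i (p i)) * (\<Prod>i\<in>J - S. ?\<delta> i (p i))) =
          of_int (sign p) * (\<Prod>i\<in>S. - M i (p i))" if "p \<in> {p. p permutes S}" for p
      proof -
        have "(\<Prod>i\<in>J - S. ?\<delta> i (p i)) = 1"
          using that by (intro prod.neutral) (auto simp: permutes_not_in)
        thus ?thesis by simp
      qed
    qed
    also have "\<dots> = (- 1) ^ card S * fdet S M"
      unfolding fdet_def sum_distrib_left
      by (intro sum.cong refl) (simp add: prod_uminus mult_ac)
    finally show "(\<Sum>p | p permutes J. of_int (sign p) * ((\<Prod>i\<in>S. - M i (p i)) * (\<Prod>i\<in>J - S. ?\<delta> i (p i)))) =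
        (- 1) ^ card S * fdet S M" .
  qed
  finally show ?thesis .
qed

text \<open>The bridge to determinants of matrices with indices \<open>{0..<n}\<close>, for which
  block decompositions are at hand.\<close>

lemma fdet_bij_betw:
  assumes h: "bij_betw h F G" and F: "finite F"
  shows "fdet F (\<lambda>i j. A (h i) (h j)) = fdet G A"
proof -
  have inj: "inj_on h F" using h by (simp add: bij_betw_def)
  show ?thesis
    unfolding fdet_def
  proof (rule sum.reindex_bij_witness[where j = "map_permutation F h" and i = "map_permutation G (inv_into F h)"])
    fix p assume "p \<in> {p. p permutes F}"
    hence p: "p permutes F" by simp
    show "map_permutation F h p \<in> {p. p permutes G}"
      using map_permutation_permutes[OF h p] by simp
    show "map_permutation G (inv_into F h) (map_permutation F h p) = p"
      using h p by (rule map_permutation_compose_inv) (use inj in auto)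
    have s: "sign (map_permutation F h p) = sign p"
      using sign_map_permutation[OF inj p F] by simp
    have "(\<Prod>i\<in>G. A i (map_permutation F h p i)) = (\<Prod>i\<in>F. A (h i) (map_permutation F h p (h i)))"
      using prod.reindex_bij_betw[OF h, of "\<lambda>i. A i (map_permutation F h p i)"] by simp
    also have "\<dots> = (\<Prod>i\<in>F. A (h i) (h (p i)))"
      by (intro prod.cong refl) (simp add: map_permutation_apply[OF inj])
    finally show "of_int (sign (map_permutation F h p)) * (\<Prod>i\<in>G. A i (map_permutation F h p i)) =
       of_int (sign p) * (\<Prod>i\<in>F. A (h i) (h (p i)))"
      using s by simp
  next
    fix p assume "p \<in> {p. p permutes G}"
    hence p: "p permutes G" by simp
    have h': "bij_betw (inv_into F h) G F" using h by (rule bij_betw_inv_into)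
    show "map_permutation G (inv_into F h) p \<in> {p. p permutes F}"
      using map_permutation_permutes[OF h' p] by simp
    show "map_permutation F h (map_permutation G (inv_into F h) p) = p"
      using h' p by (rule map_permutation_compose_inv) (use h in \<open>auto simp: bij_betw_inv_into_right\<close>)
  qed
qed

text \<open>The block matrix with diagonal blocks 1, 1 and off-diagonal blocks X, Y becomes block
  triangular when multiplied by the same unipotent factor, with 1 - XY left on the diagonal for one
  order of the factors and 1 - YX for the other.\<close>

lemma det_one_minus_mult_swap:
  fixes X Y :: "complex mat"
  assumes X: "X \<in> carrier_mat m k" and Y: "Y \<in> carrier_mat k m"
  shows "det (1\<^sub>m m - X * Y) = det (1\<^sub>m k - Y * X)"
proof -
  let ?B = "four_block_mat (1\<^sub>m m) X Y (1\<^sub>m k)"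
  let ?L = "four_block_mat (1\<^sub>m m) (0\<^sub>m m k) (- Y) (1\<^sub>m k)"
  let ?B1 = "four_block_mat (1\<^sub>m m - X * Y) X (0\<^sub>m k m) (1\<^sub>m k)"
  let ?B2 = "four_block_mat (1\<^sub>m m) X (0\<^sub>m k m) (1\<^sub>m k - Y * X)"
  have B: "?B \<in> carrier_mat (m + k) (m + k)" and L: "?L \<in> carrier_mat (m + k) (m + k)"
    using X Y by auto
  have "1\<^sub>m m + X * - Y = 1\<^sub>m m - X * Y" "1\<^sub>m k - Y * X = - Y * X + 1\<^sub>m k" "Y + - Y = 0\<^sub>m k m" "- Y + Y = 0\<^sub>m k m"
    using X Y by (auto intro!: eq_matI)
  hence e1: "?B * ?L = ?B1" and e2: "?L * ?B = ?B2"
    using X Y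
    by (simp_all add: mult_four_block_mat[of _ m m _ k _ k _ _ m _ k])
  have dL: "det ?L = 1"
    by (subst det_four_block_mat_upper_right_zero[of _ m _ k]) (use X Y in auto)
  have "det (1\<^sub>m m - X * Y) = det ?B1"
    by (subst det_four_block_mat_lower_left_zero[of _ m _ k]) (use X Y in auto)
  also have "\<dots> = det ?B" using det_mult[OF B L] e1 dL by simp
  also have "\<dots> = det ?B2" using det_mult[OF L B] e2 dL by simp
  also have "\<dots> = det (1\<^sub>m k - Y * X)"
    by (subst det_four_block_mat_lower_left_zero[of _ m _ k]) (use X Y in auto)
  finally show ?thesis .
qed

lemma fdet_Sylvester:
  assumes F: "finite F" and J: "finite J"
  shows "fdet F (\<lambda>e f. (if e = f then 1 else 0) - (\<Sum>n\<in>J. x e n * y n f)) =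
         fdet J (\<lambda>i j. (if i = j then 1 else 0) - (\<Sum>e\<in>F. y i e * x e j))"
proof -
  obtain hF where hF: "bij_betw hF {0..<card F} F" using F ex_bij_betw_nat_finite by blast
  obtain hJ where hJ: "bij_betw hJ {0..<card J} J" using J ex_bij_betw_nat_finite by blast
  define X where "X = mat (card F) (card J) (\<lambda>(i, j). x (hF i) (hJ j))"
  define Y where "Y = mat (card J) (card F) (\<lambda>(i, j). y (hJ i) (hF j))"
  have X: "X \<in> carrier_mat (card F) (card J)" and Y: "Y \<in> carrier_mat (card J) (card F)"
    by (auto simp: X_def Y_def)
  have "fdet F (\<lambda>e f. (if e = f then 1 else 0) - (\<Sum>n\<in>J. x e n * y n f)) = det (1\<^sub>m (card F) - X * Y)"
    unfolding fdet_bij_betw[OF hF finite_atLeastLessThan, symmetric]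
    by (subst det_def'[of _ "card F"])
       (auto simp: X Y fdet_def X_def Y_def scalar_prod_def sum.reindex_bij_betw[OF hJ, symmetric]
          bij_betw_imp_inj_on[OF hF] inj_on_eq_iff[of hF "{0..<card F}"]
          intro!: sum.cong prod.cong arg_cong2[where f = "(*)"] dest: permutes_in_image)
  also have "\<dots> = det (1\<^sub>m (card J) - Y * X)"
    using X Y by (rule det_one_minus_mult_swap)
  also have "\<dots> = fdet J (\<lambda>i j. (if i = j then 1 else 0) - (\<Sum>e\<in>F. y i e * x e j))"
    unfolding fdet_bij_betw[OF hJ finite_atLeastLessThan, symmetric]
    by (subst det_def'[of _ "card J"])
       (auto simp: X Y fdet_def X_def Y_def scalar_prod_def sum.reindex_bij_betw[OF hF, symmetric]
          bij_betw_imp_inj_on[OF hJ] inj_on_eq_iff[of hJ "{0..<card J}"]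
          intro!: sum.cong prod.cong arg_cong2[where f = "(*)"] dest: permutes_in_image)
  finally show ?thesis .
qed

text \<open>Sylvester's identity exchanges the index set F of basis functions for the set J of
  exponentials. The index set then stays fixed while F grows, and F enters only through the sums
  over e, which are truncated inner products.\<close>

lemma fdet_one_minus_finite_rank:
  assumes F: "finite F" and J: "finite J"
  shows "fdet F (\<lambda>e f. (if e = f then 1 else 0) - (\<Sum>n\<in>J. c n * a n e * b n f)) =
     (\<Sum>S\<in>Pow J. (- 1) ^ card S * (\<Prod>n\<in>S. c n) * fdet S (\<lambda>i j. \<Sum>e\<in>F. b i e * a j e))"
proof -
  have "fdet F (\<lambda>e f. (if e = f then 1 else 0) - (\<Sum>n\<in>J. c n * a n e * b n f)) =
      fdet J (\<lambda>i j. (if i = j then 1 else 0) - (\<Sum>e\<in>F. b i e * (c j * a j e)))"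
    using fdet_Sylvester[OF F J, of "\<lambda>e n. c n * a n e" b] by simp
  also have "\<dots> = (\<Sum>S\<in>Pow J. (- 1) ^ card S * fdet S (\<lambda>i j. \<Sum>e\<in>F. b i e * (c j * a j e)))"
    by (rule fdet_minors[OF J])
  also have "\<dots> = (\<Sum>S\<in>Pow J. (- 1) ^ card S * (\<Prod>n\<in>S. c n) * fdet S (\<lambda>i j. \<Sum>e\<in>F. b i e * a j e))"
  proof (intro sum.cong refl)
    fix S assume "S \<in> Pow J"
    hence "finite S" using J finite_subset by auto
    hence "fdet S (\<lambda>i j. \<Sum>e\<in>F. b i e * (c j * a j e)) = (\<Prod>n\<in>S. c n) * fdet S (\<lambda>i j. \<Sum>e\<in>F. b i e * a j e)"
      using fdet_scale_columns[of S c "\<lambda>i j. \<Sum>e\<in>F. b i e * a j e"]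
      by (simp add: sum_distrib_left mult_ac)
    thus "(- 1) ^ card S * fdet S (\<lambda>i j. \<Sum>e\<in>F. b i e * (c j * a j e)) =
      (- 1) ^ card S * (\<Prod>n\<in>S. c n) * fdet S (\<lambda>i j. \<Sum>e\<in>F. b i e * a j e)" by simp
  qed
  finally show ?thesis .
qed

lemma fdet_has_vector_derivative:
  fixes A :: "real \<Rightarrow> 'a \<Rightarrow> 'a \<Rightarrow> complex"
  assumes F: "finite F"
    and der: "\<And>i j. i \<in> F \<Longrightarrow> j \<in> F \<Longrightarrow> ((\<lambda>u. A u i j) has_vector_derivative A' i j) (at x within X)"
  shows "((\<lambda>u. fdet F (A u)) has_vector_derivative (\<Sum>i\<in>F. fdet F ((A x)(i := A' i)))) (at x within X)"
proof -
  have "((\<lambda>u. \<Prod>i\<in>F. A u i (p i)) has_vector_derivative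
      (\<Sum>i\<in>F. \<Prod>k\<in>F. ((A x)(i := A' i)) k (p k))) (at x within X)" if p: "p permutes F" for p
  proof -
    have "((\<lambda>u. \<Prod>i\<in>G. A u i (p i)) has_vector_derivative
      (\<Sum>i\<in>G. \<Prod>k\<in>G. ((A x)(i := A' i)) k (p k))) (at x within X)" if "G \<subseteq> F" for G
      using finite_subset[OF that F] that
    proof (induction G rule: finite_induct)
      case (insert g G)
      have d: "((\<lambda>u. A u g (p g)) has_vector_derivative A' g (p g)) (at x within X)"
        using insert p by (intro der) (auto simp: permutes_in_image)
      have IH: "((\<lambda>u. \<Prod>i\<in>G. A u i (p i)) has_vector_derivative
      (\<Sum>i\<in>G. \<Prod>k\<in>G. ((A x)(i := A' i)) k (p k))) (at x within X)"
        using insert by auto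
      have "(\<Prod>k\<in>G. ((A x)(g := A' g)) k (p k)) = (\<Prod>k\<in>G. A x k (p k))"
        using insert by (intro prod.cong) auto
      moreover have "(\<Sum>i\<in>G. \<Prod>k\<in>insert g G. ((A x)(i := A' i)) k (p k)) =
          A x g (p g) * (\<Sum>i\<in>G. \<Prod>k\<in>G. ((A x)(i := A' i)) k (p k))"
        unfolding sum_distrib_left using insert by (intro sum.cong refl) auto
      ultimately have eq: "(\<Sum>i\<in>insert g G. \<Prod>k\<in>insert g G. ((A x)(i := A' i)) k (p k)) =
         A x g (p g) * (\<Sum>i\<in>G. \<Prod>k\<in>G. ((A x)(i := A' i)) k (p k)) + A' g (p g) * (\<Prod>k\<in>G. A x k (p k))"
        using insert by simp
      have f: "(\<lambda>u. \<Prod>i\<in>insert g G. A u i (p i)) = (\<lambda>u. A u g (p g) * (\<Prod>i\<in>G. A u i (p i)))"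
        using insert by simp
      show ?case
        unfolding f eq by (rule has_vector_derivative_mult[OF d IH])
    qed simp
    thus ?thesis by simp
  qed
  hence "((\<lambda>u. fdet F (A u)) has_vector_derivative
     (\<Sum>p | p permutes F. of_int (sign p) * (\<Sum>i\<in>F. \<Prod>k\<in>F. ((A x)(i := A' i)) k (p k)))) (at x within X)"
    unfolding fdet_def
    by (intro has_vector_derivative_sum has_vector_derivative_mult_right) auto
  also have "(\<Sum>p | p permutes F. of_int (sign p) * (\<Sum>i\<in>F. \<Prod>k\<in>F. ((A x)(i := A' i)) k (p k))) =
      (\<Sum>i\<in>F. fdet F ((A x)(i := A' i)))"
    unfolding fdet_def sum_distrib_left by (rule sum.swap)
  finally show ?thesis .
qed

text \<open>Distributes the factorial of \<open>norm_fdet_le\<close> over the indices, giving a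
  multiplicative bound. If g has the largest modulus in S, then S lies in [-|g|, |g|] and has at
  most 2|g| + 1 elements; g pays for this factor and is removed.\<close>

lemma fact_card_le_prod_abs:
  fixes S :: "int set"
  assumes "finite S"
  shows "fact (card S) \<le> (\<Prod>n\<in>S. 2 * (1 + real_of_int \<bar>n\<bar>))"
  using assms
proof (induction "card S" arbitrary: S)
  case (Suc m)
  hence "S \<noteq> {}" by auto
  hence "Max (abs ` S) \<in> abs ` S" using Suc by (intro Max_in) auto
  then obtain g where "g \<in> S" "Max (abs ` S) = \<bar>g\<bar>" by auto
  hence g: "g \<in> S" "\<And>n. n \<in> S \<Longrightarrow> \<bar>n\<bar> \<le> \<bar>g\<bar>"
    using Max_ge[of "abs ` S"] Suc by auto
  have "S \<subseteq> {- \<bar>g\<bar>..\<bar>g\<bar>}" using g by force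
  hence "card S \<le> card {- \<bar>g\<bar>..\<bar>g\<bar>}" by (intro card_mono) auto
  hence c: "real (card S) \<le> 2 * (1 + real_of_int \<bar>g\<bar>)" by simp
  have S': "card (S - {g}) = m" "finite (S - {g})" using Suc g by auto
  have "fact (card S) = real (card S) * fact m"
    unfolding Suc(2)[symmetric] by (simp only: fact_Suc)
  also have "\<dots> \<le> 2 * (1 + real_of_int \<bar>g\<bar>) * (\<Prod>n\<in>S - {g}. 2 * (1 + real_of_int \<bar>n\<bar>))"
    using c Suc(1)[of "S - {g}"] S' by (intro mult_mono) auto
  also have "\<dots> = (\<Prod>n\<in>S. 2 * (1 + real_of_int \<bar>n\<bar>))"
    using g Suc by (simp add: prod.remove[of S g])
  finally show ?case .
qed auto

text \<open>The left side is the sum over the subsets of A that are not contained in B. The product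
  of 1 + w n expands into a sum over subsets as well, so the same family of subsets appears on the
  right.\<close>

lemma sum_Pow_diff_le:
  fixes t :: "'a set \<Rightarrow> complex" and w :: "'a \<Rightarrow> real"
  assumes "finite A" "B \<subseteq> A"
    and t: "\<And>S. finite S \<Longrightarrow> cmod (t S) \<le> (\<Prod>n\<in>S. w n)"
  shows "cmod ((\<Sum>S\<in>Pow A. t S) - (\<Sum>S\<in>Pow B. t S)) \<le> (\<Prod>n\<in>A. 1 + w n) - (\<Prod>n\<in>B. 1 + w n)"
proof -
  have B: "finite B" "finite (Pow A)" "Pow B \<subseteq> Pow A" using assms finite_subset by auto
  have P: "(\<Prod>n\<in>C. 1 + w n) = (\<Sum>S\<in>Pow C. \<Prod>n\<in>S. w n)" if "finite C" for C
    using prod_add[OF that, of w "\<lambda>_. 1"] by (simp add: add.commute)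
  have "(\<Sum>S\<in>Pow A. t S) - (\<Sum>S\<in>Pow B. t S) = (\<Sum>S\<in>Pow A - Pow B. t S)"
    using B by (simp add: sum_diff)
  also have "cmod \<dots> \<le> (\<Sum>S\<in>Pow A - Pow B. \<Prod>n\<in>S. w n)"
    using assms(1) finite_subset by (intro sum_norm_le t) auto
  also have "\<dots> = (\<Prod>n\<in>A. 1 + w n) - (\<Prod>n\<in>B. 1 + w n)"
    unfolding P[OF B(1)] P[OF assms(1)] using B by (simp add: sum_diff)
  finally show ?thesis .
qed

section \<open>Fourier series of periodic analytic functions\<close>

text \<open>\<open>int_decode\<close> runs through 0, -1, 1, -2, 2, ...: 2m goes to m and 2m + 1 to
  -m - 1. This linear growth makes sums over the integers comparable with ordinary series.\<close>

lemma nat_le_abs_int_decode: "real n \<le> 2 * real_of_int \<bar>int_decode n\<bar>"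
proof (cases "even n")
  case True
  then obtain m where "n = 2 * m" by (elim evenE)
  thus ?thesis by (simp add: int_decode_def sum_decode_def)
next
  case False
  then obtain m where "n = 2 * m + 1" by (elim oddE)
  thus ?thesis by (simp add: int_decode_def sum_decode_def)
qed

lemma bij_int_decode': "bij_betw int_decode UNIV UNIV"
  using bij_int_decode by (simp add: bij_def bij_betw_def)

lemma has_sum_int_iff: "(f has_sum S) (UNIV :: int set) \<longleftrightarrow> ((\<lambda>n. f (int_decode n)) has_sum S) UNIV"
  by (rule has_sum_reindex_bij_betw[OF bij_int_decode', symmetric])

lemma summable_on_int_iff: "f summable_on (UNIV :: int set) \<longleftrightarrow> (\<lambda>n. f (int_decode n)) summable_on UNIV"
  by (rule summable_on_reindex_bij_betw[OF bij_int_decode', symmetric])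

lemma summable_on_int_nonneg_iff:
  fixes f :: "int \<Rightarrow> real"
  assumes "\<And>n. f n \<ge> 0"
  shows "f summable_on UNIV \<longleftrightarrow> summable (\<lambda>n. f (int_decode n))"
  unfolding summable_on_int_iff by (rule summable_on_UNIV_nonneg_real_iff) (rule assms)

lemma summable_on_int_powr:
  fixes s :: real
  assumes "s > 1"
  shows "(\<lambda>n::int. (1 + \<bar>real_of_int n\<bar>) powr - s) summable_on UNIV"
proof (subst summable_on_int_nonneg_iff)
  show "summable (\<lambda>n. (1 + \<bar>real_of_int (int_decode n)\<bar>) powr - s)"
  proof (rule summable_comparison_test'[of _ 0])
    show "summable (\<lambda>n. 2 powr s * real (Suc n) powr - s)"
      using assms summable_Suc_iff[of "\<lambda>n. real n powr - s"] summable_real_powr_iff[of "- s"]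
      by (intro summable_mult) auto
    fix n
    have "real (Suc n) / 2 \<le> 1 + \<bar>real_of_int (int_decode n)\<bar>"
      using nat_le_abs_int_decode[of n] by simp
    hence "(1 + \<bar>real_of_int (int_decode n)\<bar>) powr - s \<le> (real (Suc n) / 2) powr - s"
      using assms by (intro powr_mono2') auto
    also have "\<dots> = 2 powr s * real (Suc n) powr - s"
      by (simp add: powr_divide powr_minus field_simps)
    finally show "norm ((1 + \<bar>real_of_int (int_decode n)\<bar>) powr - s) \<le> 2 powr s * real (Suc n) powr - s"
      by simp
  qed
qed auto

text \<open>The intervals are half-open so that a sum of \<open>a (n + 1) - a n\<close> over them
  telescopes to \<open>a (int N) - a (- int N)\<close>.\<close>

lemma int_symmetric_interval_tendsto:
  fixes f :: "int \<Rightarrow> 'b :: {comm_monoid_add, topological_space}"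
  assumes "(f has_sum S) UNIV"
  shows "(\<lambda>N. \<Sum>n\<in>{- int N..<int N}. f n) \<longlonglongrightarrow> S"
proof -
  have "filterlim (\<lambda>N. {- int N..<int N}) (finite_subsets_at_top UNIV) sequentially"
    unfolding filterlim_iff eventually_finite_subsets_at_top
  proof safe
    fix P and X :: "int set"
    assume X: "finite X" and P: "\<forall>Y. finite Y \<and> X \<subseteq> Y \<and> Y \<subseteq> UNIV \<longrightarrow> P Y"
    obtain B where B: "\<And>x. x \<in> X \<Longrightarrow> \<bar>x\<bar> \<le> B"
      using X finite_nat_set_iff_bounded_le[of "(nat \<circ> abs) ` X"]
      by (metis (no_types, opaque_lifting) comp_apply finite_imageI image_eqI nat_le_iff)
    have "P {- int N..<int N}" if "N \<ge> nat (B + 1)" for N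
    proof -
      have "X \<subseteq> {- int N..<int N}"
      proof
        fix x assume "x \<in> X"
        from B[OF this] that show "x \<in> {- int N..<int N}" by auto
      qed
      thus ?thesis using P by auto
    qed
    thus "\<forall>\<^sub>F N in sequentially. P {- int N..<int N}"
      unfolding eventually_at_top_linorder by blast
  qed
  from filterlim_compose[OF assms[unfolded has_sum_def] this] show ?thesis by simp
qed

definition osc_integral :: "real \<Rightarrow> complex \<Rightarrow> (complex \<Rightarrow> complex) \<Rightarrow> complex" where
  "osc_integral P w q = (LBINT u:{0..P}. exp (w * of_real u) * q (of_real u))"

lemma osc_integral_has_integral:
  assumes P: "P > 0" and q: "q analytic_on (of_real ` {0..P})"
  shows "((\<lambda>u. exp (w * of_real u) * q (of_real u)) has_integral osc_integral P w q) {0..P}"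
proof -
  have "continuous_on {0..P} (\<lambda>u. q (complex_of_real u))"
  proof (rule continuous_on_compose2[of "of_real ` {0..P}" q])
    show "continuous_on (of_real ` {0..P}) q"
      using q analytic_imp_holomorphic holomorphic_on_imp_continuous_on by blast
  qed (auto intro!: continuous_intros)
  hence "set_integrable lborel {0..P} (\<lambda>u. exp (w * of_real u) * q (of_real u))"
    by (intro borel_integrable_atLeastAtMost' continuous_intros)
  from set_borel_integral_eq_integral[OF this] show ?thesis
    unfolding osc_integral_def by (simp add: has_integral_integrable_integral)
qed

context
  fixes P :: real and q :: "complex \<Rightarrow> complex"
  assumes P: "P > 0" and q: "q analytic_on (of_real ` {0..P})"
begin

lemma continuous_on_real_segment: "continuous_on {0..P} (\<lambda>u. q (complex_of_real u))"
proof (rule continuous_on_compose2[of "of_real ` {0..P}" q])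
  show "continuous_on (of_real ` {0..P}) q"
    using q analytic_imp_holomorphic holomorphic_on_imp_continuous_on by blast
qed (auto intro!: continuous_intros)

lemma osc_integral_integrable:
  "set_integrable lborel {0..P} (\<lambda>u. exp (w * of_real u) * q (of_real u))"
  by (rule borel_integrable_atLeastAtMost') (intro continuous_intros continuous_on_real_segment)

lemma osc_integral_eq_integral:
  "osc_integral P w q = integral {0..P} (\<lambda>u. exp (w * of_real u) * q (of_real u))"
  unfolding osc_integral_def using set_borel_integral_eq_integral(2)[OF osc_integral_integrable] .

lemma osc_integral_bounded:
  obtains B where "B \<ge> 0" "\<And>w. Re w = 0 \<Longrightarrow> cmod (osc_integral P w q) \<le> B"
proof -
  have "compact ((\<lambda>u. q (complex_of_real u)) ` {0..P})"
    by (intro compact_continuous_image continuous_on_real_segment compact_Icc)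
  then obtain b where b: "\<And>u. u \<in> {0..P} \<Longrightarrow> cmod (q (of_real u)) \<le> b"
    using compact_imp_bounded bounded_iff by (metis (no_types, lifting) imageI)
  have b0: "b \<ge> 0" using b[of 0] P norm_ge_zero[of "q 0"] by (simp del: norm_ge_zero)
  have "cmod (osc_integral P w q) \<le> b * P" if "Re w = 0" for w
  proof -
    have "norm (integral {0..P} (\<lambda>u. exp (w * of_real u) * q (of_real u))) \<le> b * (P - 0)"
      by (rule integral_bound) (use that b P in \<open>auto simp: norm_mult intro!: continuous_intros continuous_on_real_segment\<close>)
    thus ?thesis by (simp add: osc_integral_eq_integral)
  qed
  thus ?thesis using that[of "b * P"] b0 P by auto
qed

lemma osc_integral_by_parts:
  assumes w: "w \<noteq> 0"
  shows "osc_integral P w q = (exp (w * P) * q P - q 0) / w - osc_integral P w (deriv q) / w"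
proof -
  have dq: "deriv q analytic_on (of_real ` {0..P})" using q by (rule analytic_deriv)
  have der: "((\<lambda>u. exp (w * of_real u) * q (of_real u)) has_vector_derivative
      (w * (exp (w * of_real u) * q (of_real u)) + exp (w * of_real u) * deriv q (of_real u))) (at u within {0..P})"
    if u: "u \<in> {0..P}" for u
  proof -
    have "q analytic_on {of_real u}" by (rule analytic_on_subset[OF q]) (use u in auto)
    hence "(q has_field_derivative deriv q (of_real u)) (at (of_real u))"
      by (intro DERIV_deriv_iff_field_differentiable[THEN iffD2] analytic_on_imp_differentiable_at) auto
    hence "((\<lambda>z. exp (w * z) * q z) has_field_derivative
       (w * (exp (w * of_real u) * q (of_real u)) + exp (w * of_real u) * deriv q (of_real u))) (at (of_real u))"
      by (auto intro!: derivative_eq_intros)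
    thus ?thesis by (rule has_vector_derivative_real_field)
  qed
  have "((\<lambda>u. w * (exp (w * of_real u) * q (of_real u)) + exp (w * of_real u) * deriv q (of_real u)) has_integral
     (exp (w * of_real P) * q (of_real P) - exp (w * of_real 0) * q (of_real 0))) {0..P}"
    by (rule fundamental_theorem_of_calculus) (use P der in auto)
  moreover have "((\<lambda>u. w * (exp (w * of_real u) * q (of_real u)) + exp (w * of_real u) * deriv q (of_real u)) has_integral
     (w * osc_integral P w q + osc_integral P w (deriv q))) {0..P}"
    by (intro has_integral_add has_integral_mult_right osc_integral_has_integral P q dq)
  ultimately have "exp (w * of_real P) * q (of_real P) - exp (w * of_real 0) * q (of_real 0) =
      w * osc_integral P w q + osc_integral P w (deriv q)"
    by (rule has_integral_unique)
  thus ?thesis using w by (simp add: field_simps)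
qed

end

lemma periodic_int_shift:
  fixes g :: "complex \<Rightarrow> 'b"
  assumes per: "\<And>z. g (z + of_real P) = g z"
  shows "g (z + of_int k * of_real P) = g z"
proof -
  have pn: "g (z + of_nat n * of_real P) = g z" for n z
  proof (induction n)
    case (Suc n)
    have "g (z + of_nat (Suc n) * of_real P) = g ((z + of_nat n * of_real P) + of_real P)"
      by (simp add: algebra_simps)
    thus ?case using Suc per by simp
  qed simp
  show ?thesis
  proof (cases "k \<ge> 0")
    case True
    thus ?thesis using pn[of z "nat k"] by simp
  next
    case False
    thus ?thesis using pn[of "z + of_int k * of_real P" "nat (- k)"] by (simp add: algebra_simps)
  qed
qed

lemma periodic_deriv:
  fixes g :: "complex \<Rightarrow> complex"
  assumes per: "\<And>z. g (z + c) = g z"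
  shows "deriv g (z + c) = deriv g z"
proof -
  have "(\<lambda>x. g (x + c)) = g" using per by auto
  thus ?thesis unfolding deriv_def by (simp only: DERIV_shift)
qed

text \<open>Periodicity is demanded in the whole plane but analyticity only on one real period,
  because the intended function can have poles off the real axis. At a pole the division yields 0,
  and the periodicity persists.\<close>

locale periodic_analytic =
  fixes P :: real and g :: "complex \<Rightarrow> complex"
  assumes P: "P > 0"
    and per: "\<And>z. g (z + of_real P) = g z"
    and an: "g analytic_on (of_real ` {0..P})"
begin

definition freq :: complex where "freq = 2 * of_real pi * \<i> / of_real P"

lemma freq: "freq \<noteq> 0" "Re freq = 0" "exp (freq * of_real P) = 1" "cmod freq = 2 * pi / P"
  using P by (auto simp: freq_def norm_mult norm_divide)

lemma exp_freq_P: "exp (of_int n * freq * of_real P) = 1"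
proof -
  have "exp (of_int n * freq * of_real P) = exp (2 * of_real pi * \<i> * of_int n)"
    using P by (simp add: freq_def mult_ac)
  also have "\<dots> = 1" unfolding exp_eq_1 by (rule conjI) (auto intro: exI[of _ n])
  finally show ?thesis .
qed

text \<open>The sign in the exponent is opposite to the usual one, in accordance with
  \<open>lame_xi\<close>; the inversion formula therefore carries the negative exponents.\<close>

definition coef :: "int \<Rightarrow> complex" where
  "coef n = osc_integral P (of_int n * freq) g / of_real P"

lemma periodic_analytic_deriv: "periodic_analytic P (deriv g)"
  by unfold_locales (use P per an in \<open>auto intro: periodic_deriv analytic_deriv\<close>)

lemma osc_integral_deriv:
  assumes "n \<noteq> 0"
  shows "osc_integral P (of_int n * freq) g = - osc_integral P (of_int n * freq) (deriv g) / (of_int n * freq)"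
proof -
  have "g (of_real P) = g 0" using per[of 0] by simp
  thus ?thesis
    using osc_integral_by_parts[OF P an, of "of_int n * freq"] assms freq exp_freq_P by simp
qed

lemma osc_integral_higher_deriv:
  assumes "n \<noteq> 0"
  shows "cmod (osc_integral P (of_int n * freq) g) =
    cmod (osc_integral P (of_int n * freq) ((deriv ^^ j) g)) / (cmod (of_int n * freq)) ^ j"
proof -
  have pa: "periodic_analytic P ((deriv ^^ j) g)" for j
    by (induction j) (auto simp: periodic_analytic_axioms intro: periodic_analytic.periodic_analytic_deriv)
  show ?thesis
  proof (induction j)
    case (Suc j)
    have "cmod (osc_integral P (of_int n * freq) ((deriv ^^ j) g)) =
        cmod (osc_integral P (of_int n * freq) ((deriv ^^ Suc j) g)) / cmod (of_int n * freq)"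
      using periodic_analytic.osc_integral_deriv[OF pa[of j] assms] by (simp add: norm_divide)
    with Suc show ?case by simp
  qed simp
qed

text \<open>Four integrations by parts, without boundary terms by periodicity. Of the four powers
  gained, two are spent on the weight in \<open>exponential_system\<close> and two on
  summability.\<close>

lemma coef_decay:
  obtains C where "C \<ge> 0" "\<And>n. cmod (coef n) \<le> C * (1 + \<bar>real_of_int n\<bar>) powr - 4"
proof -
  have pa: "periodic_analytic P ((deriv ^^ j) g)" for j
    by (induction j) (auto simp: periodic_analytic_axioms intro: periodic_analytic.periodic_analytic_deriv)
  obtain B0 where B0: "B0 \<ge> 0" "\<And>w. Re w = 0 \<Longrightarrow> cmod (osc_integral P w g) \<le> B0"
    using osc_integral_bounded[OF P an] by blast
  obtain B4 where B4: "B4 \<ge> 0" "\<And>w. Re w = 0 \<Longrightarrow> cmod (osc_integral P w ((deriv ^^ 4) g)) \<le> B4"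
    using osc_integral_bounded[OF P periodic_analytic.an[OF pa[of 4]]] by blast
  \<comment> \<open>B0 takes care of n = 0. For n nonzero the divisor is (2 pi |n| / P)^4, and 2|n|
    >= 1 + |n| bounds it below by ((1 + |n|) pi / P)^4.\<close>
  define C where "C = (B0 + B4 * (P / pi) ^ 4) / P"
  show ?thesis
  proof (rule that[of C])
    show "C \<ge> 0" using B0(1) B4(1) P by (simp add: C_def)
    fix n :: int
    have powr: "(1 + \<bar>real_of_int n\<bar>) powr - 4 = 1 / (1 + \<bar>real_of_int n\<bar>) ^ 4"
      by (simp add: powr_minus powr_numeral inverse_eq_divide)
    show "cmod (coef n) \<le> C * (1 + \<bar>real_of_int n\<bar>) powr - 4"
    proof (cases "n = 0")
      case True
      have "cmod (osc_integral P (of_int n * freq) g) \<le> B0" using freq by (intro B0(2)) simp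
      also have "\<dots> \<le> B0 + B4 * (P / pi) ^ 4" using B4(1) P by simp
      finally show ?thesis using True P by (simp add: coef_def C_def norm_divide divide_right_mono)
    next
      case False
      define m where "m = \<bar>real_of_int n\<bar>"
      have m: "m \<ge> 1" using False by (simp add: m_def)
      have "cmod (osc_integral P (of_int n * freq) g) =
          cmod (osc_integral P (of_int n * freq) ((deriv ^^ 4) g)) / (m * (2 * pi / P)) ^ 4"
        using osc_integral_higher_deriv[OF False, of 4] freq by (simp add: norm_mult m_def)
      also have "\<dots> \<le> B4 / (m * (2 * pi / P)) ^ 4"
        using freq m P by (intro divide_right_mono B4(2)) auto
      also have "\<dots> \<le> B4 / ((1 + m) * (pi / P)) ^ 4"
      proof (intro divide_left_mono power_mono)
        have "(1 + m) * (pi / P) \<le> (2 * m) * (pi / P)" using m P by (intro mult_right_mono) auto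
        thus "(1 + m) * (pi / P) \<le> m * (2 * pi / P)" by (simp add: mult_ac)
        show "0 < (m * (2 * pi / P)) ^ 4 * ((1 + m) * (pi / P)) ^ 4"
          using m P by (intro mult_pos_pos zero_less_power divide_pos_pos) auto
      qed (use m P B4(1) in auto)
      also have "\<dots> = B4 * (P / pi) ^ 4 / (1 + m) ^ 4"
        by (simp add: power_mult_distrib power_divide)
      also have "\<dots> \<le> (B0 + B4 * (P / pi) ^ 4) / (1 + m) ^ 4"
        using m B0 by (intro divide_right_mono) auto
      finally have "cmod (osc_integral P (of_int n * freq) g) / P \<le> (B0 + B4 * (P / pi) ^ 4) / (1 + m) ^ 4 / P"
        using P by (intro divide_right_mono) auto
      thus ?thesis
        unfolding powr using P by (simp add: coef_def C_def norm_divide m_def[symmetric] mult.commute)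
    qed
  qed
qed

lemma coef_summable: "(\<lambda>n. cmod (coef n)) summable_on UNIV"
proof -
  obtain C where C: "C \<ge> 0" "\<And>n. cmod (coef n) \<le> C * (1 + \<bar>real_of_int n\<bar>) powr - 4"
    using coef_decay by blast
  show ?thesis
    by (rule summable_on_comparison_test[OF summable_on_cmult_right[OF summable_on_int_powr[of 4]]])
       (use C in auto)
qed

text \<open>Near \<open>x0\<close> the quotient \<open>(g z - g x0) / (exp (freq * (z - x0)) - 1)\<close> has a removable
  singularity. Its Fourier coefficients turn those of \<open>g\<close> into a telescoping sum.\<close>

lemma analytic_quotient:
  fixes x0 :: real
  obtains q where "q analytic_on (of_real ` {0..P})"
    and "\<And>z. g z - g (of_real x0) = q z * (exp (freq * (z - of_real x0)) - 1)"
proof -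
  define e where "e z = exp (freq * (z - of_real x0)) - 1" for z
  \<comment> \<open>\<open>e\<close> vanishes exactly at the points x0 + kP; the value chosen there
    is the limit g'(x0) / e'(x0), with e'(x0) = \<open>freq\<close>.\<close>
  define q where "q z = (if e z = 0 then deriv g (of_real x0) / freq else (g z - g (of_real x0)) / e z)" for z
  have e_per: "e (z + of_real P) = e z" for z
    using freq(3) by (simp add: e_def algebra_simps exp_add exp_diff)
  have q_per: "q (z + of_real P) = q z" for z by (simp add: q_def e_per per)
  have ez: "\<exists>k. z = of_real x0 + of_int k * of_real P" if "e z = 0" for z
  proof -
    have "exp (freq * (z - of_real x0)) = 1" using that by (simp add: e_def)
    then obtain k where k: "Re (freq * (z - of_real x0)) = 0" "Im (freq * (z - of_real x0)) = of_int (2 * k) * pi"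
      unfolding exp_eq_1 by auto
    hence "freq * (z - of_real x0) = freq * (of_int k * of_real P)"
      using P by (intro complex_eqI) (auto simp: freq_def)
    hence "z - of_real x0 = of_int k * of_real P" using freq(1) by (simp only: mult_left_cancel not_False_eq_True)
    thus ?thesis by (intro exI[of _ k]) (simp add: algebra_simps)
  qed
  \<comment> \<open>The point x0 is an arbitrary real number, so analyticity has to be carried from
    the segment to the whole real line by a shift.\<close>
  have g_an: "g analytic_on {of_real x}" for x :: real
  proof -
    define k where "k = \<lfloor>x / P\<rfloor>"
    define x' where "x' = x - of_int k * P"
    have "of_int k \<le> x / P" "x / P < of_int k + 1" unfolding k_def by linarith+
    hence "x' \<in> {0..P}" using P by (auto simp: x'_def field_simps)
    hence "g analytic_on {of_real x'}" by (intro analytic_on_subset[OF an]) auto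
    hence "(g \<circ> (\<lambda>z. z - of_int k * of_real P)) analytic_on {of_real x}"
      by (intro analytic_on_compose analytic_intros) (auto simp: x'_def)
    moreover have "g \<circ> (\<lambda>z. z - of_int k * of_real P) = g"
    proof
      fix z show "(g \<circ> (\<lambda>z. z - of_int k * of_real P)) z = g z"
        using periodic_int_shift[of g P "z - of_int k * of_real P" k] per by simp
    qed
    ultimately show ?thesis by simp
  qed
  have e_an: "e analytic_on A" for A unfolding e_def[abs_def] by (intro analytic_intros)
  have der_e: "deriv e (of_real x0) = freq"
    unfolding e_def[abs_def] by (rule DERIV_imp_deriv) (auto intro!: derivative_eq_intros)
  have q_x0: "q analytic_on {of_real x0}"
  proof -
    let ?x = "complex_of_real x0"
    \<comment> \<open>Dividing numerator and denominator by z - x0 leaves two analytic functions,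
      and the denominator now takes the nonzero value \<open>freq\<close> at x0.\<close>
    define q1 where "q1 z = (if z = ?x then deriv (\<lambda>z. g z - g ?x) ?x else (g z - g ?x) / (z - ?x))" for z
    define e1 where "e1 z = (if z = ?x then deriv e ?x else e z / (z - ?x))" for z
    have q1: "q1 analytic_on {?x}"
      by (rule pole_theorem_analytic_0[of "\<lambda>z. g z - g ?x" _ ?x])
         (auto simp: q1_def intro!: analytic_intros g_an exI[of _ 1])
    have e1: "e1 analytic_on {?x}"
      by (rule pole_theorem_analytic_0[of e _ ?x])
         (auto simp: e1_def intro!: e_an exI[of _ 1] simp: e_def)
    have e1x: "e1 ?x = freq" by (simp add: e1_def der_e)
    have "(\<lambda>z. q1 z / e1 z) analytic_on {?x}"
      using q1 e1 e1x freq by (intro analytic_on_divide) auto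
    moreover have "\<forall>\<^sub>F z in nhds ?x. q z = q1 z / e1 z"
    proof -
      have "isCont e1 ?x" using e1 analytic_at_imp_isCont by blast
      hence "(e1 \<longlongrightarrow> e1 ?x) (nhds ?x)"
        by (simp only: isCont_def tendsto_at_iff_tendsto_nhds)
      hence "(e1 \<longlongrightarrow> freq) (nhds ?x)" by (simp only: e1x)
      hence "\<forall>\<^sub>F z in nhds ?x. e1 z \<noteq> 0" using freq(1) by (rule tendsto_imp_eventually_ne)
      thus ?thesis
      proof eventually_elim
        case (elim z)
        show ?case
        proof (cases "z = ?x")
          case True
          have "deriv (\<lambda>z. g z - g ?x) ?x = deriv g ?x"
            using analytic_on_imp_differentiable_at[OF g_an[of x0]] by simp
          thus ?thesis using True by (simp add: q_def q1_def e1_def der_e) (simp add: e_def)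
        next
          case False
          with elim have "e z \<noteq> 0" by (auto simp: e1_def)
          thus ?thesis using False by (simp add: q_def q1_def e1_def)
        qed
      qed
    qed
    ultimately show ?thesis by (simp add: analytic_at_cong)
  qed
  have "q analytic_on {of_real x}" for x :: real
  proof (cases "e (of_real x) = 0")
    case True
    then obtain k where k: "complex_of_real x = of_real x0 + of_int k * of_real P" using ez by blast
    have "(q \<circ> (\<lambda>z. z - of_int k * of_real P)) analytic_on {of_real x}"
      by (intro analytic_on_compose analytic_intros) (use q_x0 in \<open>auto simp: k\<close>)
    moreover have "q \<circ> (\<lambda>z. z - of_int k * of_real P) = q"
    proof
      fix z show "(q \<circ> (\<lambda>z. z - of_int k * of_real P)) z = q z"
        using periodic_int_shift[of q P "z - of_int k * of_real P" k] q_per by simp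
    qed
    ultimately show ?thesis by simp
  next
    case False
    have "(\<lambda>z. (g z - g (of_real x0)) / e z) analytic_on {of_real x}"
      by (intro analytic_on_divide analytic_intros g_an e_an) (use False in auto)
    moreover have "\<forall>\<^sub>F z in nhds (complex_of_real x). q z = (g z - g (of_real x0)) / e z"
    proof -
      have "isCont e (of_real x)" using e_an analytic_at_imp_isCont by blast
      hence "(e \<longlongrightarrow> e (of_real x)) (nhds (of_real x))"
        by (simp add: isCont_def tendsto_at_iff_tendsto_nhds)
      hence "\<forall>\<^sub>F z in nhds (of_real x). e z \<noteq> 0" using False by (rule tendsto_imp_eventually_ne)
      thus ?thesis by eventually_elim (simp add: q_def)
    qed
    ultimately show ?thesis by (simp add: analytic_at_cong)
  qed
  hence "q analytic_on (of_real ` {0..P})"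
    using analytic_on_analytic_at by blast
  moreover have "g z - g (of_real x0) = q z * (exp (freq * (z - of_real x0)) - 1)" for z
  proof (cases "e z = 0")
    case True
    then obtain k where "z = of_real x0 + of_int k * of_real P" using ez by blast
    hence "g z = g (of_real x0)" using periodic_int_shift[of g P "of_real x0" k] per by simp
    thus ?thesis using True by (simp add: e_def)
  next
    case False
    thus ?thesis by (simp add: q_def) (simp add: e_def)
  qed
  ultimately show ?thesis using that by blast
qed

lemma osc_integral_exp: "osc_integral P (of_int n * freq) (\<lambda>_. 1) = (if n = 0 then of_real P else 0)"
proof (cases "n = 0")
  case True
  thus ?thesis using P osc_integral_eq_integral[OF P, of "\<lambda>_. 1" 0] by (simp add: scaleR_conv_of_real)
next
  case False
  have "osc_integral P (of_int n * freq) (\<lambda>_. 1) =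
    (exp (of_int n * freq * of_real P) * 1 - 1) / (of_int n * freq) - osc_integral P (of_int n * freq) (deriv (\<lambda>_. 1)) / (of_int n * freq)"
    by (rule osc_integral_by_parts[OF P]) (use False freq in auto)
  thus ?thesis using False exp_freq_P[of n] by (simp add: osc_integral_def)
qed

text \<open>Absolute convergence provides some sum S. The symmetric partial sums telescope to g(x)
  plus boundary terms a(N) and a(-N), which are O(1/N) after one integration by parts, and this
  identifies S.\<close>

theorem Fourier_inversion:
  fixes x :: real
  shows "((\<lambda>n. coef n * exp (- of_int n * freq * of_real x)) has_sum g (of_real x)) UNIV"
proof -
  obtain q where q: "q analytic_on (of_real ` {0..P})"
    and gq: "\<And>z. g z - g (of_real x) = q z * (exp (freq * (z - of_real x)) - 1)"
    using analytic_quotient by blast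
  define a where "a n = exp (- of_int n * freq * of_real x) * osc_integral P (of_int n * freq) q" for n
  have norm1: "cmod (exp (of_int n * freq * of_real x)) = 1" for n x
    using freq by (simp add: norm_exp_eq_Re)
  define f where "f n = coef n * exp (- of_int n * freq * of_real x)" for n
  \<comment> \<open>The factor exp(freq (u - x)) in g(u) - g(x) = q(u) (exp(freq (u - x)) - 1)
    raises the frequency from n to n + 1, which produces the difference of consecutive a.\<close>
  have step: "f n * of_real P = (if n = 0 then g (of_real x) * of_real P else 0) + (a (n + 1) - a n)" for n
  proof -
    have "osc_integral P (of_int n * freq) g =
      (LBINT u:{0..P}. (g (of_real x) * (exp (of_int n * freq * of_real u) * 1) +
        (exp (- freq * of_real x) * (exp (of_int (n + 1) * freq * of_real u) * q (of_real u)) -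
          exp (of_int n * freq * of_real u) * q (of_real u))))"
      unfolding osc_integral_def
    proof (intro set_lebesgue_integral_cong allI impI)
      fix u
      define X where "X = exp (freq * (of_real u - of_real x))"
      define W where "W = exp (of_int n * freq * of_real u)"
      have e1: "g (of_real u) = g (of_real x) + q (of_real u) * (X - 1)"
        using gq[of "of_real u"] by (simp add: X_def algebra_simps)
      have "exp (- freq * of_real x) * exp (of_int (n + 1) * freq * of_real u) = W * X"
        unfolding X_def W_def exp_add[symmetric] by (simp add: algebra_simps)
      hence e2: "exp (- freq * of_real x) * (exp (of_int (n + 1) * freq * of_real u) * q (of_real u)) = W * X * q (of_real u)"
        by (simp only: mult.assoc[symmetric])
      show "exp (of_int n * freq * of_real u) * g (of_real u) =
        g (of_real x) * (exp (of_int n * freq * of_real u) * 1) +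
        (exp (- freq * of_real x) * (exp (of_int (n + 1) * freq * of_real u) * q (of_real u)) -
          exp (of_int n * freq * of_real u) * q (of_real u))"
        unfolding W_def[symmetric] e2 e1 by (simp add: algebra_simps)
    qed simp
    also have "\<dots> = g (of_real x) * osc_integral P (of_int n * freq) (\<lambda>_. 1) +
        (exp (- freq * of_real x) * osc_integral P (of_int (n + 1) * freq) q - osc_integral P (of_int n * freq) q)"
      unfolding osc_integral_def
      using osc_integral_integrable[OF P q] osc_integral_integrable[OF P, of "\<lambda>_. 1"]
      by (subst set_integral_add set_integral_diff set_integral_mult_right; auto)+
    finally have "f n * of_real P = exp (- of_int n * freq * of_real x) *
       (g (of_real x) * (if n = 0 then of_real P else 0) +
        (exp (- freq * of_real x) * osc_integral P (of_int (n + 1) * freq) q - osc_integral P (of_int n * freq) q))"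
      using P by (simp add: f_def coef_def osc_integral_exp)
    also have "\<dots> = (if n = 0 then g (of_real x) * of_real P else 0) + (a (n + 1) - a n)"
      by (simp add: a_def algebra_simps exp_diff exp_minus exp_add field_simps)
    finally show ?thesis .
  qed
  have "(\<lambda>n. norm (f n)) summable_on UNIV"
    using coef_summable freq(2) by (simp add: f_def norm_mult)
  hence "f summable_on UNIV" by (rule abs_summable_summable)
  then obtain S where S: "(f has_sum S) UNIV" by (auto simp: summable_on_def)
  have "(\<lambda>N. \<Sum>n\<in>{- int N..<int N}. f n) \<longlonglongrightarrow> S" by (rule int_symmetric_interval_tendsto[OF S])
  moreover have "(\<lambda>N. \<Sum>n\<in>{- int N..<int N}. f n) \<longlonglongrightarrow> g (of_real x)"
  proof -
    have part: "(\<Sum>n\<in>{- int N..<int N}. f n) = g (of_real x) + (a (int N) - a (- int N)) / of_real P" if "N > 0" for N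
    proof -
      have tele: "(\<Sum>n\<in>{- int N..<int N}. a (n + 1) - a n) = a (int N) - a (- int N)" for N
      proof (induction N)
        case (Suc N)
        have "{- int (Suc N)..<int (Suc N)} = insert (- 1 - int N) (insert (int N) {- int N..<int N})" by auto
        thus ?case using Suc by (simp add: add.commute)
      qed simp
      have "(\<Sum>n\<in>{- int N..<int N}. f n) * of_real P =
          (\<Sum>n\<in>{- int N..<int N}. if n = 0 then g (of_real x) * of_real P else 0) + (a (int N) - a (- int N))"
        unfolding sum_distrib_right step sum.distrib tele ..
      also have "(\<Sum>n\<in>{- int N..<int N}. if n = 0 then g (of_real x) * of_real P else 0) = g (of_real x) * of_real P"
        using that by simp
      finally show ?thesis using P by (simp add: field_simps)
    qed
    \<comment> \<open>The integration by parts keeps q P - q 0, a constant independent of n that is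
      harmless for the order 1/|n|.\<close>
    obtain C where C: "\<And>n. n \<noteq> 0 \<Longrightarrow> cmod (a n) \<le> C / \<bar>real_of_int n\<bar>"
    proof -
      obtain B where B: "B \<ge> 0" "\<And>w. Re w = 0 \<Longrightarrow> cmod (osc_integral P w (deriv q)) \<le> B"
        using osc_integral_bounded[OF P analytic_deriv[OF q]] by blast
      show ?thesis
      proof (rule that)
        fix n :: int assume n: "n \<noteq> 0"
        have "cmod (a n) = cmod (osc_integral P (of_int n * freq) q)"
          using norm1[of "- n" x] by (simp add: a_def norm_mult)
        also have "osc_integral P (of_int n * freq) q =
            (q P - q 0 - osc_integral P (of_int n * freq) (deriv q)) / (of_int n * freq)"
          using osc_integral_by_parts[OF P q, of "of_int n * freq"] n freq exp_freq_P[of n] by (simp add: diff_divide_distrib)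
        also have "cmod \<dots> = cmod (q P - q 0 - osc_integral P (of_int n * freq) (deriv q)) / (\<bar>real_of_int n\<bar> * (2 * pi / P))"
          using freq by (simp add: norm_divide norm_mult)
        also have "\<dots> \<le> (cmod (q P - q 0) + B) / (\<bar>real_of_int n\<bar> * (2 * pi / P))"
          using P freq by (intro divide_right_mono order_trans[OF norm_triangle_ineq4] add_left_mono B(2)) auto
        also have "\<dots> = ((cmod (q P - q 0) + B) / (2 * pi / P)) / \<bar>real_of_int n\<bar>"
          by (simp add: field_simps)
        finally show "cmod (a n) \<le> ((cmod (q P - q 0) + B) / (2 * pi / P)) / \<bar>real_of_int n\<bar>" .
      qed
    qed
    have C0: "(\<lambda>N. C / real N) \<longlonglongrightarrow> 0" by (rule lim_const_over_n)
    have a1: "(\<lambda>N. a (int N)) \<longlonglongrightarrow> 0"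
      by (rule Lim_null_comparison[OF _ C0]) (use C[of "int N" for N] in \<open>auto simp: eventually_at_top_linorder intro!: exI[of _ 1]\<close>)
    have a2: "(\<lambda>N. a (- int N)) \<longlonglongrightarrow> 0"
      by (rule Lim_null_comparison[OF _ C0]) (use C[of "- int N" for N] in \<open>auto simp: eventually_at_top_linorder intro!: exI[of _ 1]\<close>)
    have "(\<lambda>N. g (of_real x) + (a (int N) - a (- int N)) / of_real P) \<longlonglongrightarrow> g (of_real x) + (0 - 0) / of_real P"
      using P by (intro tendsto_intros a1 a2) auto
    hence "(\<lambda>N. g (of_real x) + (a (int N) - a (- int N)) / of_real P) \<longlonglongrightarrow> g (of_real x)" by simp
    thus ?thesis
      by (rule Lim_transform_eventually) (use part in \<open>auto simp: eventually_at_top_linorder intro!: exI[of _ 1]\<close>)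
  qed
  ultimately have "S = g (of_real x)" by (rule LIMSEQ_unique)
  thus ?thesis using S by (simp add: f_def[abs_def])
qed

end

section \<open>Quasi-periodicity of the sigma function\<close>

text \<open>The integrand is at least 1, so K is at least pi/2.\<close>

lemma elliptic_K_pos:
  assumes "0 \<le> k" "k < 1"
  shows "elliptic_K k > 0"
proof -
  have k2: "k\<^sup>2 < 1" using assms by (simp add: power_less_one_iff abs_square_less_1)
  have pos: "1 - k\<^sup>2 * (sin u)\<^sup>2 > 0" for u
  proof -
    have "k\<^sup>2 * (sin u)\<^sup>2 \<le> k\<^sup>2 * 1" by (intro mult_left_mono) (auto simp: abs_square_le_1)
    thus ?thesis using k2 by simp
  qed
  have c: "continuous_on {0..pi/2} (\<lambda>u. 1 / sqrt (1 - k\<^sup>2 * (sin u)\<^sup>2))"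
    using pos by (intro continuous_intros) (auto simp: less_imp_neq[symmetric])
  have "(LBINT u:{0..pi/2}. 1 :: real) \<le> (LBINT u:{0..pi/2}. 1 / sqrt (1 - k\<^sup>2 * (sin u)\<^sup>2))"
  proof (rule set_integral_mono)
    show "set_integrable lborel {0..pi/2} (\<lambda>u. 1 :: real)"
      by (rule borel_integrable_atLeastAtMost') simp
    show "set_integrable lborel {0..pi/2} (\<lambda>u. 1 / sqrt (1 - k\<^sup>2 * (sin u)\<^sup>2))"
      by (rule borel_integrable_atLeastAtMost'[OF c])
    show "1 \<le> 1 / sqrt (1 - k\<^sup>2 * (sin u)\<^sup>2)" for u
    proof -
      have "sqrt (1 - k\<^sup>2 * (sin u)\<^sup>2) \<le> 1" by (simp add: real_sqrt_le_1_iff)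
      thus ?thesis using pos[of u] by simp
    qed
  qed
  moreover have "(LBINT u:{0..pi/2}. 1 :: real) = pi / 2"
    by (simp add: set_lebesgue_integral_def)
  ultimately show ?thesis unfolding elliptic_K_def using pi_gt_zero by linarith
qed

text \<open>\<open>wsigma\<close> is a limit along finite subsets of the lattice, whereas the theory
  of Weierstrass products speaks of products along a sequence. Absolute convergence makes the two
  agree.\<close>

lemma has_prod_imp_tendsto_finite_subsets:
  fixes a :: "nat \<Rightarrow> complex"
  assumes sm: "summable (\<lambda>n. norm (a n - 1))" and P: "a has_prod P"
  shows "((\<lambda>F. \<Prod>n\<in>F. a n) \<longlongrightarrow> P) (finite_subsets_at_top UNIV)"
proof (rule tendstoI)
  fix \<epsilon> :: real assume \<epsilon>: "\<epsilon> > 0"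
  define x where "x n = a n - 1" for n
  define S where "S = (\<Sum>n. norm (x n))"
  \<comment> \<open>Chosen so that exp S * (exp \<delta> - 1) = \<epsilon> / 2: exp S bounds the
    finite product up to N, and exp \<delta> - 1 the deviation from 1 of any product of later
    factors.\<close>
  define \<delta> where "\<delta> = ln (1 + \<epsilon> / (2 * exp S))"
  have \<delta>: "\<delta> > 0" "exp S * (exp \<delta> - 1) = \<epsilon> / 2"
    using \<epsilon> by (auto simp: \<delta>_def ln_gt_zero_iff add_pos_pos)
  have smx: "summable (\<lambda>n. norm (x n))" using sm by (simp add: x_def)
  have le_S: "(\<Sum>n\<in>F. norm (x n)) \<le> S" if "finite F" for F
    unfolding S_def by (rule sum_le_suminf[OF smx that]) auto
  have "(\<lambda>N. \<Sum>n<N. norm (x n)) \<longlonglongrightarrow> S" unfolding S_def by (rule summable_LIMSEQ[OF smx])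
  hence "\<forall>\<^sub>F N in sequentially. dist (\<Sum>n<N. norm (x n)) S < \<delta>" using \<delta>(1) by (rule tendstoD)
  moreover have "\<forall>\<^sub>F N in sequentially. dist (\<Prod>n<N. a n) P < \<epsilon> / 2"
    by (rule tendstoD[OF has_prod_imp_tendsto'[OF P]]) (use \<epsilon> in simp)
  ultimately have "\<forall>\<^sub>F N in sequentially. dist (\<Sum>n<N. norm (x n)) S < \<delta> \<and> dist (\<Prod>n<N. a n) P < \<epsilon> / 2"
    by eventually_elim simp
  then obtain N where N: "dist (\<Sum>n<N. norm (x n)) S < \<delta>" "dist (\<Prod>n<N. a n) P < \<epsilon> / 2"
    unfolding eventually_at_top_linorder by blast
  have "dist (\<Prod>n\<in>F. a n) P < \<epsilon>" if F: "finite F" "{..<N} \<subseteq> F" for F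
  proof -
    let ?G = "F - {..<N}"
    have "(\<Sum>n\<in>?G. norm (x n)) = (\<Sum>n\<in>F. norm (x n)) - (\<Sum>n<N. norm (x n))"
      using F by (simp add: sum_diff)
    hence tail: "(\<Sum>n\<in>?G. norm (x n)) < \<delta>"
      using N(1) le_S[OF F(1)] by (auto simp: dist_real_def)
    have "(\<Prod>n\<in>F. a n) = (\<Prod>n<N. a n) * (\<Prod>n\<in>?G. a n)"
      using prod.subset_diff[OF F(2,1), of a] by (simp add: mult.commute)
    hence "dist (\<Prod>n\<in>F. a n) (\<Prod>n<N. a n) = norm ((\<Prod>n<N. a n) * ((\<Prod>n\<in>?G. a n) - 1))"
      by (simp add: dist_norm algebra_simps)
    also have "\<dots> = norm (\<Prod>n<N. a n) * norm ((\<Prod>n\<in>?G. 1 + x n) - 1)"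
      by (simp add: norm_mult x_def)
    also have "\<dots> \<le> exp S * (exp \<delta> - 1)"
    proof (rule mult_mono)
      have "norm (\<Prod>n<N. a n) \<le> (\<Prod>n<N. 1 + norm (x n))"
        unfolding prod_norm[symmetric]
        by (rule prod_mono) (use norm_triangle_ineq[of 1 "x n" for n] in \<open>auto simp: x_def\<close>)
      also have "\<dots> \<le> exp (\<Sum>n<N. norm (x n))" by (rule prod_le_exp_sum) auto
      also have "\<dots> \<le> exp S" using le_S by simp
      finally show "norm (\<Prod>n<N. a n) \<le> exp S" .
      have "norm ((\<Prod>n\<in>?G. 1 + x n) - 1) \<le> (\<Prod>n\<in>?G. 1 + norm (x n)) - 1"
        by (rule norm_prod_minus1_le_prod_minus1)
      also have "\<dots> \<le> exp (\<Sum>n\<in>?G. norm (x n)) - 1"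
        using prod_le_exp_sum[of ?G "\<lambda>n. norm (x n)"] by simp
      also have "\<dots> \<le> exp \<delta> - 1" using tail by simp
      finally show "norm ((\<Prod>n\<in>?G. 1 + x n) - 1) \<le> exp \<delta> - 1" .
    qed auto
    finally have "dist (\<Prod>n\<in>F. a n) (\<Prod>n<N. a n) \<le> \<epsilon> / 2" using \<delta>(2) by simp
    thus ?thesis using N(2) dist_triangle[of "\<Prod>n\<in>F. a n" P "\<Prod>n<N. a n"] by linarith
  qed
  thus "\<forall>\<^sub>F F in finite_subsets_at_top UNIV. dist (\<Prod>n\<in>F. a n) P < \<epsilon>"
    unfolding eventually_finite_subsets_at_top by (intro exI[of _ "{..<N}"]) auto
qed

lemma tendsto_prod_reindex_bij_betw:
  fixes f :: "'a \<Rightarrow> complex"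
  assumes h: "bij_betw h A B" and lim: "((\<lambda>F. \<Prod>n\<in>F. f (h n)) \<longlongrightarrow> P) (finite_subsets_at_top A)"
  shows "((\<lambda>F. \<Prod>n\<in>F. f n) \<longlongrightarrow> P) (finite_subsets_at_top B)"
proof -
  have inj: "inj_on h A" and im: "h ` A = B" using h by (auto simp: bij_betw_def)
  have "((\<lambda>F. \<Prod>n\<in>h ` F. f n) \<longlongrightarrow> P) (finite_subsets_at_top A)"
  proof (rule Lim_transform_eventually[OF lim])
    show "\<forall>\<^sub>F F in finite_subsets_at_top A. (\<Prod>n\<in>F. f (h n)) = (\<Prod>n\<in>h ` F. f n)"
    proof (rule eventually_finite_subsets_at_top_weakI)
      fix X assume "finite X" "X \<subseteq> A"
      thus "(\<Prod>n\<in>X. f (h n)) = (\<Prod>n\<in>h ` X. f n)"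
        using inj_on_subset[OF inj] by (subst prod.reindex) auto
    qed
  qed
  hence "((\<lambda>F. \<Prod>n\<in>F. f n) \<longlongrightarrow> P) (filtermap ((`) h) (finite_subsets_at_top A))"
    by (simp add: filterlim_filtermap)
  thus ?thesis unfolding filtermap_image_finite_subsets_at_top[OF inj] im .
qed

lemma has_field_derivative_minus_inverse_square:
  fixes x c k :: complex
  assumes "x \<noteq> c"
  shows "((\<lambda>v. - 1 / (v - c)\<^sup>2 + k) has_field_derivative 2 / (x - c) ^ 3) (at x)"
proof -
  have "((\<lambda>v. - 1 / (v - c)\<^sup>2 + k) has_field_derivative 2 * (x - c) / ((x - c)\<^sup>2 * (x - c)\<^sup>2)) (at x)"
    using assms by (auto intro!: derivative_eq_intros) (simp add: diff_divide_distrib)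
  moreover have "2 * y / (y\<^sup>2 * y\<^sup>2) = 2 / y ^ 3" if "y \<noteq> 0" for y :: complex
    using that by (simp add: power2_eq_square power3_eq_cube)
  ultimately show ?thesis using assms by (simp only: right_minus_eq not_False_eq_True)
qed

locale rectangular_lattice =
  fixes a b :: real
  assumes ab: "a > 0" "b > 0"
begin

definition lattice :: "complex set" where
  "lattice = {of_real a * of_int m + \<i> * of_real b * of_int n |m n. True}"

definition sigma :: "complex \<Rightarrow> complex" where
  "sigma z = z * Lim (finite_subsets_at_top (lattice - {0})) (\<lambda>F. \<Prod>\<omega>\<in>F. weierstrass_factor 2 (z / \<omega>))"

definition zeta :: "complex \<Rightarrow> complex" where
  "zeta z = deriv sigma z / sigma z"

lemma lattice_0 [simp]: "0 \<in> lattice"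
  unfolding lattice_def by (auto intro: exI[of _ 0])

lemma lattice_add_period: "z + of_real a \<in> lattice \<longleftrightarrow> z \<in> lattice"
proof -
  have *: "z + of_real a \<in> lattice" if zl: "z \<in> lattice" for z
  proof -
    obtain m n where z: "z = of_real a * of_int m + \<i> * of_real b * of_int n"
      using zl by (auto simp: lattice_def)
    show ?thesis unfolding lattice_def z mem_Collect_eq
      by (rule exI[of _ "m + 1"], rule exI[of _ n]) (simp add: algebra_simps)
  qed
  have **: "z - of_real a \<in> lattice" if zl: "z \<in> lattice" for z
  proof -
    obtain m n where z: "z = of_real a * of_int m + \<i> * of_real b * of_int n"
      using zl by (auto simp: lattice_def)
    show ?thesis unfolding lattice_def z mem_Collect_eq
      by (rule exI[of _ "m - 1"], rule exI[of _ n]) (simp add: algebra_simps)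
  qed
  show ?thesis using *[of z] **[of "z + of_real a"] by auto
qed

lemma lattice_uminus: "- z \<in> lattice \<longleftrightarrow> z \<in> lattice"
proof -
  have *: "- z \<in> lattice" if zl: "z \<in> lattice" for z
  proof -
    obtain m n where z: "z = of_real a * of_int m + \<i> * of_real b * of_int n"
      using zl by (auto simp: lattice_def)
    show ?thesis unfolding lattice_def z mem_Collect_eq
      by (rule exI[of _ "- m"], rule exI[of _ "- n"]) (simp add: algebra_simps)
  qed
  show ?thesis using *[of z] *[of "- z"] by auto
qed

lemma half_period_notin_lattice: "- of_real (a / 2) \<notin> lattice"
proof
  assume "- of_real (a / 2) \<in> lattice"
  then obtain m n where "- of_real (a / 2) = of_real a * of_int m + \<i> * of_real b * of_int n"
    unfolding lattice_def by blast
  hence "Re (- of_real (a / 2)) = Re (of_real a * of_int m + \<i> * of_real b * of_int n)" by (rule arg_cong)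
  hence "a * (2 * of_int m + 1) = 0" by (simp add: algebra_simps)
  hence "2 * real_of_int m + 1 = 0" using ab by simp
  hence "2 * m + 1 = 0" by linarith
  thus False by presburger
qed

lemma lattice_eq_image: "lattice = (\<lambda>(m, n). of_real a * of_int m + \<i> * of_real b * of_int n) ` UNIV"
  by (auto simp: lattice_def)

lemma inj_lattice: "inj (\<lambda>(m, n). of_real a * of_int m + \<i> * of_real b * of_int n :: complex)"
  using ab by (auto simp: inj_def complex_eq_iff)

lemma countable_lattice: "countable lattice"
  unfolding lattice_eq_image by (intro countable_image) auto

lemma infinite_lattice: "infinite (lattice - {0})"
proof -
  have "infinite (UNIV :: (int \<times> int) set)" by (simp add: finite_prod)
  thus ?thesis unfolding lattice_eq_image using inj_lattice by (simp add: finite_image_iff)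
qed

text \<open>With M = max |m| |n|, a lattice point has modulus at least d M, where d = min a b. As 1
  + |m| and 1 + |n| are at most 2M for M >= 1, the cube splits into two powers 3/2, and the double
  sum is dominated by a product of convergent simple sums.\<close>

lemma lattice_cubes_summable: "(\<lambda>\<omega>. 1 / norm \<omega> ^ 3) summable_on (lattice - {0})"
proof -
  let ?h = "\<lambda>(m, n). of_real a * of_int m + \<i> * of_real b * of_int n :: complex"
  let ?w = "\<lambda>n::int. (1 + \<bar>real_of_int n\<bar>) powr - (3 / 2)"
  define d where "d = min a b"
  have d: "d > 0" "d \<le> a" "d \<le> b" using ab by (auto simp: d_def)
  have s1: "?w summable_on UNIV" by (rule summable_on_int_powr) simp
  have "(\<lambda>(m, n). ?w m * ?w n) summable_on (UNIV \<times> UNIV)"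
  proof (rule summable_on_SigmaI)
    show "((\<lambda>n. (\<lambda>(m, n). ?w m * ?w n) (m, n)) has_sum ?w m * infsum ?w UNIV) UNIV" for m
      using has_sum_cmult_right[OF has_sum_infsum[OF s1], of "?w m"] by simp
    show "(\<lambda>m. ?w m * infsum ?w UNIV) summable_on UNIV" by (intro summable_on_cmult_left s1)
  qed auto
  hence "(\<lambda>x. (2 / d) ^ 3 * (case x of (m, n) \<Rightarrow> ?w m * ?w n)) summable_on (- {(0, 0)})"
    by (intro summable_on_cmult_right) (auto elim: summable_on_subset_banach)
  hence "(\<lambda>x. 1 / norm (?h x) ^ 3) summable_on (- {(0, 0)})"
  proof (rule summable_on_comparison_test)
    fix x :: "int \<times> int" assume x: "x \<in> - {(0, 0)}"
    obtain m n where mn: "x = (m, n)" by (cases x)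
    define M where "M = max \<bar>real_of_int m\<bar> \<bar>real_of_int n\<bar>"
    have M1: "M \<ge> 1" using x mn by (auto simp: M_def)
    have "d * M \<le> norm (?h x)"
    proof (cases "\<bar>real_of_int m\<bar> \<ge> \<bar>real_of_int n\<bar>")
      case True
      have "d * M \<le> a * \<bar>real_of_int m\<bar>" using True d by (auto simp: M_def intro: mult_right_mono)
      also have "\<dots> = \<bar>Re (?h x)\<bar>" using ab by (simp add: mn abs_mult)
      finally show ?thesis using abs_Re_le_cmod order_trans by blast
    next
      case False
      have "d * M \<le> b * \<bar>real_of_int n\<bar>" using False d by (auto simp: M_def intro: mult_right_mono)
      also have "\<dots> = \<bar>Im (?h x)\<bar>" using ab by (simp add: mn abs_mult)
      finally show ?thesis using abs_Im_le_cmod order_trans by blast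
    qed
    hence 1: "d * M \<le> norm (?h x)" .
    have dM: "d * M > 0" using d M1 by simp
    have n0: "norm (?h x) > 0" using 1 dM by linarith
    have "1 / norm (?h x) ^ 3 \<le> 1 / (d * M) ^ 3"
      using 1 dM d M1 n0 by (intro divide_left_mono power_mono mult_pos_pos zero_less_power) auto
    also have "\<dots> = (2 / d) ^ 3 * (2 * M) powr - 3"
      using M1 d by (simp add: powr_minus powr_numeral power_mult_distrib power_divide field_simps)
    also have "(2 * M) powr - 3 = (2 * M) powr - (3 / 2) * (2 * M) powr - (3 / 2)"
      by (simp add: powr_add[symmetric])
    also have "\<dots> \<le> ?w m * ?w n"
      using M1 by (intro mult_mono powr_mono2') (auto simp: M_def)
    finally have "1 / norm (?h x) ^ 3 \<le> (2 / d) ^ 3 * (?w m * ?w n)" using d by simp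
    thus "1 / norm (?h x) ^ 3 \<le> (2 / d) ^ 3 * (case x of (m, n) \<Rightarrow> ?w m * ?w n)"
      by (simp add: mn)
  qed auto
  moreover have "bij_betw ?h (- {(0, 0)}) (lattice - {0})"
  proof -
    have "?h ` (- {(0, 0)}) = lattice - {0}"
      unfolding lattice_eq_image Compl_eq_Diff_UNIV
      using inj_on_image_set_diff[OF inj_lattice, of UNIV "{(0, 0)}"] by simp
    thus ?thesis using inj_on_subset[OF inj_lattice] by (auto simp: bij_betw_def)
  qed
  ultimately show ?thesis
    using summable_on_reindex_bij_betw[of ?h _ _ "\<lambda>\<omega>. 1 / norm \<omega> ^ 3"] by blast
qed

definition enum :: "nat \<Rightarrow> complex" where
  "enum = from_nat_into (lattice - {0})"

lemma bij_enum: "bij_betw enum UNIV (lattice - {0})"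
  unfolding enum_def using countable_lattice infinite_lattice by (intro bij_betw_from_nat_into) auto

lemma enum_cubes_summable: "summable (\<lambda>n. 1 / norm (enum n) ^ 3)"
proof -
  have "(\<lambda>n. 1 / norm (enum n) ^ 3) summable_on UNIV"
    using summable_on_reindex_bij_betw[OF bij_enum, of "\<lambda>\<omega>. 1 / norm \<omega> ^ 3"] lattice_cubes_summable by simp
  thus ?thesis by (subst (asm) summable_on_UNIV_nonneg_real_iff) auto
qed

lemma enum_nonzero: "enum n \<noteq> 0"
  using bij_enum by (auto simp: bij_betw_def)

lemma enum_at_infinity: "filterlim enum at_infinity sequentially"
proof -
  have "(\<lambda>n. 1 / norm (enum n) ^ 3) \<longlonglongrightarrow> 0" by (rule summable_LIMSEQ_zero[OF enum_cubes_summable])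
  hence "(\<lambda>n. root 3 (1 / norm (enum n) ^ 3)) \<longlonglongrightarrow> root 3 0" by (intro tendsto_intros)
  hence "(\<lambda>n. inverse (norm (enum n))) \<longlonglongrightarrow> 0"
    by (simp add: real_root_divide real_root_power_cancel inverse_eq_divide real_root_pos2)
  hence "filterlim (\<lambda>n. inverse (inverse (norm (enum n)))) at_top sequentially"
    by (rule filterlim_inverse_at_top) (use enum_nonzero in auto)
  thus ?thesis by (simp add: filterlim_at_infinity_conv_norm_at_top)
qed

sublocale W: weierstrass_product enum "\<lambda>_. 2"
proof
  show "summable (\<lambda>n. (r / norm (enum n)) ^ Suc 2)" if "r > 0" for r
    using summable_mult[OF enum_cubes_summable, of "r ^ 3"] by (simp add: power_divide eval_nat_numeral)
qed (rule enum_nonzero enum_at_infinity)+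

lemma sigma_product:
  "((\<lambda>F. \<Prod>\<omega>\<in>F. weierstrass_factor 2 (z / \<omega>)) \<longlongrightarrow> W.f z) (finite_subsets_at_top (lattice - {0}))"
proof (rule tendsto_prod_reindex_bij_betw[OF bij_enum])
  have "summable (\<lambda>n. norm (weierstrass_factor 2 (z / enum n) - 1))"
    using W.abs_convergent[of z] by (simp add: abs_convergent_prod_conv_summable)
  thus "((\<lambda>F. \<Prod>n\<in>F. weierstrass_factor 2 (z / enum n)) \<longlongrightarrow> W.f z) (finite_subsets_at_top UNIV)"
    by (rule has_prod_imp_tendsto_finite_subsets[OF _ W.has_prod])
qed

lemma sigma_eq: "sigma z = z * W.f z"
  unfolding sigma_def using tendsto_Lim[OF finite_subsets_at_top_neq_bot sigma_product] by simp

lemma sigma_holomorphic: "sigma holomorphic_on A"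
  unfolding sigma_eq[abs_def] by (intro holomorphic_intros)

lemma sigma_zero_iff: "sigma z = 0 \<longleftrightarrow> z \<in> lattice"
proof -
  have "range enum = lattice - {0}" using bij_enum by (simp add: bij_betw_def)
  thus ?thesis unfolding sigma_eq using W.zero[of z] by auto
qed

text \<open>The substitution of -\<omega> for \<omega> permutes the lattice, and the unconditional
  product does not notice it.\<close>

lemma sigma_uminus: "sigma (- z) = - sigma z"
proof -
  have "bij_betw uminus (lattice - {0}) (lattice - {0})"
    by (rule bij_betw_byWitness[where f' = uminus]) (auto simp: lattice_uminus)
  moreover have "((\<lambda>F. \<Prod>\<omega>\<in>F. weierstrass_factor 2 (z / - \<omega>)) \<longlongrightarrow> W.f (- z)) (finite_subsets_at_top (lattice - {0}))"
    using sigma_product[of "- z"] by simp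
  ultimately have "((\<lambda>F. \<Prod>\<omega>\<in>F. weierstrass_factor 2 (z / \<omega>)) \<longlongrightarrow> W.f (- z)) (finite_subsets_at_top (lattice - {0}))"
    by (rule tendsto_prod_reindex_bij_betw)
  hence "W.f (- z) = W.f z"
    using sigma_product[of z] tendsto_unique finite_subsets_at_top_neq_bot by blast
  thus ?thesis by (simp add: sigma_eq)
qed

lemma open_compl_lattice: "open (- lattice)"
proof -
  have "closed (range enum)" using W.not_islimpt_range_a by (auto simp: closed_limpt)
  hence "closed (insert 0 (range enum))" by (rule closed_insert)
  moreover have "insert 0 (range enum) = lattice" using bij_enum by (auto simp: bij_betw_def)
  ultimately show ?thesis by (simp add: open_Compl)
qed

lemma connected_compl_lattice: "connected (- lattice)"
  unfolding Compl_eq_Diff_UNIV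
  by (rule connected_open_diff_countable) (use countable_lattice in auto)

section \<open>The zeta function of the lattice and its quasi-period\<close>

lemma zeta_holomorphic: "zeta holomorphic_on - lattice"
  unfolding zeta_def[abs_def]
  by (intro holomorphic_intros sigma_holomorphic open_compl_lattice) (auto simp: sigma_zero_iff)

lemma zeta_uminus: "zeta (- z) = - zeta z"
proof -
  have d: "(sigma has_field_derivative deriv sigma z) (at z)" for z
    using sigma_holomorphic[of UNIV] holomorphic_derivI by blast
  have "((\<lambda>z. - sigma (- z)) has_field_derivative deriv sigma (- z)) (at z)"
    by (auto intro!: derivative_eq_intros DERIV_chain2[OF d])
  hence "(sigma has_field_derivative deriv sigma (- z)) (at z)" by (simp add: sigma_uminus)
  hence "deriv sigma (- z) = deriv sigma z" using d DERIV_unique by blast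
  thus ?thesis by (simp add: zeta_def sigma_uminus)
qed

text \<open>The logarithmic derivative of \<open>weierstrass_factor 2 (z / \<omega>)\<close>. It
  equals z^2 / (\<omega>^2 (z - \<omega>)) and so is of order |\<omega>|^-3 on bounded sets.\<close>

definition zeta_term :: "complex \<Rightarrow> complex \<Rightarrow> complex" where
  "zeta_term \<omega> z = 1 / (z - \<omega>) + 1 / \<omega> + z / \<omega>\<^sup>2"

lemma zeta_term_bound:
  assumes "norm z \<le> r" "2 * r \<le> norm \<omega>" "\<omega> \<noteq> 0" "r > 0"
  shows "norm (zeta_term \<omega> z) \<le> 2 * r\<^sup>2 * (1 / norm \<omega> ^ 3)"
proof -
  have zw: "norm \<omega> / 2 \<le> norm (z - \<omega>)"
    using norm_triangle_ineq3[of \<omega> z] assms by (simp add: norm_minus_commute)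
  hence nz: "z - \<omega> \<noteq> 0" using assms by auto
  have "zeta_term \<omega> z = z\<^sup>2 / (\<omega>\<^sup>2 * (z - \<omega>))"
    using nz assms(3) unfolding zeta_term_def by (simp add: divide_simps power2_eq_square) (simp add: algebra_simps)
  hence "norm (zeta_term \<omega> z) = norm z ^ 2 / (norm \<omega> ^ 2 * norm (z - \<omega>))"
    by (simp add: norm_divide norm_mult norm_power)
  also have "\<dots> \<le> r ^ 2 / (norm \<omega> ^ 2 * (norm \<omega> / 2))"
    using assms zw nz by (intro frac_le mult_left_mono power_mono mult_pos_pos) auto
  also have "\<dots> = 2 * r\<^sup>2 * (1 / norm \<omega> ^ 3)" by (simp add: power2_eq_square power3_eq_cube)
  finally show ?thesis .
qed

text \<open>Two differentiations remove the terms 1/\<omega> + z/\<omega>^2 that only secure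
  convergence. What remains depends on z - \<omega> alone, so this is the level at which periodicity
  becomes visible. Locally uniform convergence of the logarithmic derivative justifies the termwise
  differentiation.\<close>

lemma zeta_deriv2:
  assumes z: "z \<notin> lattice"
  shows "(\<lambda>n. 2 / (z - enum n) ^ 3) sums ((deriv ^^ 2) zeta z - 2 / z ^ 3)"
proof -
  obtain r where r: "r > 0" "ball z r \<subseteq> - lattice"
    using open_compl_lattice z open_contains_ball by (metis ComplI)
  let ?A = "ball z r"
  have nz: "w \<noteq> enum n" "w \<noteq> 0" if "w \<in> ?A" for w n
  proof -
    have "w \<notin> lattice" using that r(2) by blast
    moreover have "enum n \<in> lattice" using bij_enum by (auto simp: bij_betw_def)
    ultimately show "w \<noteq> enum n" "w \<noteq> 0" by auto
  qed
  define R where "R = norm z + r"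
  have R: "R > 0" "\<And>w. w \<in> ?A \<Longrightarrow> norm w \<le> R"
  proof -
    show "R > 0" using r(1) by (simp add: R_def add_nonneg_pos)
    fix w assume "w \<in> ?A"
    thus "norm w \<le> R" using norm_triangle_sub[of w z] by (simp add: R_def dist_norm norm_minus_commute)
  qed
  have ul: "uniform_limit ?A (\<lambda>N w. \<Sum>n<N. zeta_term (enum n) w) (\<lambda>w. \<Sum>n. zeta_term (enum n) w) sequentially"
  proof (rule Weierstrass_m_test_ev)
    have "\<forall>\<^sub>F n in sequentially. norm (enum n) \<ge> 2 * R"
      using enum_at_infinity by (metis filterlim_at_infinity_imp_norm_at_top filterlim_at_top)
    thus "\<forall>\<^sub>F n in sequentially. \<forall>w\<in>?A. norm (zeta_term (enum n) w) \<le> 2 * R\<^sup>2 * (1 / norm (enum n) ^ 3)"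
      by eventually_elim (intro ballI zeta_term_bound enum_nonzero R)
    show "summable (\<lambda>n. 2 * R\<^sup>2 * (1 / norm (enum n) ^ 3))" by (intro summable_mult enum_cubes_summable)
  qed
  have zeta_eq: "zeta w = 1 / w + (\<Sum>n. zeta_term (enum n) w)" if w: "w \<in> ?A" for w
  proof -
    have fw: "W.f w \<noteq> 0" using W.zero[of w] nz(1)[OF w] by auto
    have "(\<lambda>n. deriv (\<lambda>z. weierstrass_factor 2 (z / enum n)) w / weierstrass_factor 2 (w / enum n)) sums (deriv W.f w / W.f w)"
    proof (rule logderiv_prodinf_complex_uniform_limit)
      show "uniform_limit (ball 0 (R + 1)) (\<lambda>n x. \<Prod>k<n. weierstrass_factor 2 (x / enum k)) W.f sequentially"
        by (rule uniform_limit_on_subset[OF W.uniform_limit[of "R + 1"]]) (use R in auto)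
      show "w \<in> ball 0 (R + 1)" using R(2)[OF w] by simp
    qed (use fw enum_nonzero in \<open>auto intro!: holomorphic_intros\<close>)
    also have "(\<lambda>n. deriv (\<lambda>z. weierstrass_factor 2 (z / enum n)) w / weierstrass_factor 2 (w / enum n)) = (\<lambda>n. zeta_term (enum n) w)"
    proof
      fix n
      define \<omega> where "\<omega> = enum n"
      have \<omega>: "\<omega> \<noteq> 0" "w - \<omega> \<noteq> 0" using enum_nonzero[of n] nz(1)[OF w, of n] by (auto simp: \<omega>_def)
      define E where "E = exp (w / \<omega> + (w / \<omega>)\<^sup>2 / 2)"
      have wf: "weierstrass_factor 2 z = (1 - z) * exp (z + z\<^sup>2 / 2)" for z
        by (simp add: weierstrass_factor_def numeral_2_eq_2)
      have "((\<lambda>z. weierstrass_factor 2 (z / \<omega>)) has_field_derivative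
          (- 1 / \<omega> * E + (1 - w / \<omega>) * (E * (1 / \<omega> + w / \<omega>\<^sup>2)))) (at w)"
        unfolding wf E_def using \<omega>
        by (auto intro!: derivative_eq_intros simp: power2_eq_square divide_simps)
      hence D: "deriv (\<lambda>z. weierstrass_factor 2 (z / \<omega>)) w = - 1 / \<omega> * E + (1 - w / \<omega>) * (E * (1 / \<omega> + w / \<omega>\<^sup>2))"
        by (rule DERIV_imp_deriv)
      have F: "weierstrass_factor 2 (w / \<omega>) = (1 - w / \<omega>) * E" by (simp add: wf E_def)
      have E0: "E \<noteq> 0" by (simp add: E_def)
      define v where "v = 1 - w / \<omega>"
      have v: "v \<noteq> 0" "\<omega> * v = - (w - \<omega>)" using \<omega> by (auto simp: v_def field_simps)
      have "(- 1 / \<omega> * E + v * (E * (1 / \<omega> + w / \<omega>\<^sup>2))) / (v * E) = - (1 / (\<omega> * v)) + (1 / \<omega> + w / \<omega>\<^sup>2)"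
        using v(1) E0 by (simp add: diff_divide_distrib)
      also have "- (1 / (\<omega> * v)) = 1 / (w - \<omega>)"
      proof -
        have "w - \<omega> = - (\<omega> * v)" using v(2) by simp
        thus ?thesis by simp
      qed
      finally have "deriv (\<lambda>z. weierstrass_factor 2 (z / \<omega>)) w / weierstrass_factor 2 (w / \<omega>) = zeta_term \<omega> w"
        unfolding D F v_def[symmetric] zeta_term_def by (simp add: add.assoc)
      thus "deriv (\<lambda>z. weierstrass_factor 2 (z / enum n)) w / weierstrass_factor 2 (w / enum n) = zeta_term (enum n) w"
        by (simp add: \<omega>_def)
    qed
    finally have s: "(\<Sum>n. zeta_term (enum n) w) = deriv W.f w / W.f w" by (simp add: sums_iff)
    have "(W.f has_field_derivative deriv W.f w) (at w)"
      using W.holomorphic[of UNIV] holomorphic_derivI by blast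
    hence "(sigma has_field_derivative (W.f w + w * deriv W.f w)) (at w)"
      unfolding sigma_eq[abs_def] by (auto intro!: derivative_eq_intros)
    hence "deriv sigma w = W.f w + w * deriv W.f w" by (rule DERIV_imp_deriv)
    thus ?thesis unfolding zeta_def s sigma_eq using fw nz(2)[OF w] by (simp add: field_simps)
  qed
  have t2: "(deriv ^^ 2) (zeta_term \<omega>) w = 2 / (w - \<omega>) ^ 3" if w: "w \<in> ?A" and \<omega>: "\<omega> \<in> lattice - {0}" for w \<omega>
  proof -
    have nz': "v - \<omega> \<noteq> 0" if "v \<in> ?A" for v using that \<omega> r(2) by auto
    have d1: "deriv (zeta_term \<omega>) v = - 1 / (v - \<omega>)\<^sup>2 + 1 / \<omega>\<^sup>2" if "v \<in> ?A" for v
      unfolding zeta_term_def[abs_def] using nz'[OF that] \<omega>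
      by (intro DERIV_imp_deriv) (auto intro!: derivative_eq_intros simp: power2_eq_square)
    have "(deriv ^^ 2) (zeta_term \<omega>) w = deriv (deriv (zeta_term \<omega>)) w" by (simp add: numeral_2_eq_2)
    also have "\<dots> = deriv (\<lambda>v. - 1 / (v - \<omega>)\<^sup>2 + 1 / \<omega>\<^sup>2) w"
      by (rule deriv_cong_ev) (use w d1 in \<open>auto intro!: eventually_mono[OF eventually_nhds_in_open[of ?A]]\<close>)
    also have "\<dots> = 2 / (w - \<omega>) ^ 3"
      using nz'[OF w] by (intro DERIV_imp_deriv has_field_derivative_minus_inverse_square) auto
    finally show ?thesis .
  qed
  have th: "zeta_term \<omega> holomorphic_on ?A" if "\<omega> \<in> lattice - {0}" for \<omega>
    unfolding zeta_term_def[abs_def] using that r(2) by (intro holomorphic_intros) auto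
  have en: "enum n \<in> lattice - {0}" for n using bij_enum by (auto simp: bij_betw_def)
  have zA: "z \<in> ?A" using r by simp
  have "(\<lambda>N. (deriv ^^ 2) (\<lambda>w. 1 / w + (\<Sum>n<N. zeta_term (enum n) w)) z) \<longlonglongrightarrow> (deriv ^^ 2) zeta z"
  proof (rule higher_deriv_complex_uniform_limit)
    have "uniform_limit ?A (\<lambda>N w. 1 / w + (\<Sum>n<N. zeta_term (enum n) w)) (\<lambda>w. 1 / w + (\<Sum>n. zeta_term (enum n) w)) sequentially"
      by (intro uniform_limit_intros ul)
    also have "?this \<longleftrightarrow> uniform_limit ?A (\<lambda>N w. 1 / w + (\<Sum>n<N. zeta_term (enum n) w)) zeta sequentially"
      by (intro uniform_limit_cong) (auto simp: zeta_eq)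
    finally show "uniform_limit ?A (\<lambda>N w. 1 / w + (\<Sum>n<N. zeta_term (enum n) w)) zeta sequentially" .
    show "\<forall>\<^sub>F N in sequentially. (\<lambda>w. 1 / w + (\<Sum>n<N. zeta_term (enum n) w)) holomorphic_on ?A"
      by (intro always_eventually allI holomorphic_intros th en) (use nz in auto)
  qed (use zA in auto)
  moreover have "(deriv ^^ 2) (\<lambda>w. 1 / w + (\<Sum>n<N. zeta_term (enum n) w)) z = 2 / z ^ 3 + (\<Sum>n<N. 2 / (z - enum n) ^ 3)" for N
  proof (induction N)
    case 0
    have d1: "deriv (\<lambda>w. 1 / w) v = - 1 / v\<^sup>2" if "v \<in> ?A" for v
      using nz(2)[OF that] by (intro DERIV_imp_deriv) (auto intro!: derivative_eq_intros simp: power2_eq_square)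
    have "(deriv ^^ 2) (\<lambda>w. 1 / w) z = deriv (deriv (\<lambda>w. 1 / w)) z" by (simp add: numeral_2_eq_2)
    also have "\<dots> = deriv (\<lambda>v. - 1 / v\<^sup>2) z"
      by (rule deriv_cong_ev) (use zA d1 in \<open>auto intro!: eventually_mono[OF eventually_nhds_in_open[of ?A]]\<close>)
    also have "\<dots> = 2 / z ^ 3"
      using has_field_derivative_minus_inverse_square[of z 0 0] nz(2)[OF zA] by (intro DERIV_imp_deriv) simp
    finally show ?case by simp
  next
    case (Suc N)
    have "(deriv ^^ 2) (\<lambda>w. (1 / w + (\<Sum>n<N. zeta_term (enum n) w)) + zeta_term (enum N) w) z =
       (deriv ^^ 2) (\<lambda>w. 1 / w + (\<Sum>n<N. zeta_term (enum n) w)) z + (deriv ^^ 2) (zeta_term (enum N)) z"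
    proof (rule higher_deriv_add[of _ ?A])
      show "(\<lambda>w. 1 / w + (\<Sum>n<N. zeta_term (enum n) w)) holomorphic_on ?A"
        by (intro holomorphic_intros th en) (use nz(2) in blast)
    qed (use zA th[OF en] in auto)
    thus ?case using Suc t2[OF zA en] by (simp add: add.assoc)
  qed
  ultimately have "(\<lambda>N. 2 / z ^ 3 + (\<Sum>n<N. 2 / (z - enum n) ^ 3)) \<longlonglongrightarrow> (deriv ^^ 2) zeta z" by simp
  from tendsto_diff[OF this tendsto_const[of "2 / z ^ 3"]] show ?thesis
    by (simp add: sums_def)
qed

text \<open>The term of \<omega> = 0 completes the sum to the whole lattice, and unconditional
  convergence then allows a reindexing by translations.\<close>

lemma zeta_deriv2_has_sum:
  assumes z: "z \<notin> lattice"
  shows "((\<lambda>\<omega>. 2 / (z - \<omega>) ^ 3) has_sum (deriv ^^ 2) zeta z) lattice"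
proof -
  have "summable (\<lambda>n. norm (2 / (z - enum n) ^ 3))"
  proof (rule summable_comparison_test_ev)
    have "\<forall>\<^sub>F n in sequentially. norm (enum n) \<ge> 2 * norm z"
      using enum_at_infinity by (metis filterlim_at_infinity_imp_norm_at_top filterlim_at_top)
    thus "\<forall>\<^sub>F n in sequentially. norm (norm (2 / (z - enum n) ^ 3)) \<le> 16 * (1 / norm (enum n) ^ 3)"
    proof eventually_elim
      case (elim n)
      have "norm (enum n) / 2 \<le> norm (z - enum n)"
        using norm_triangle_ineq3[of "enum n" z] elim by (simp add: norm_minus_commute)
      hence "2 / norm (z - enum n) ^ 3 \<le> 2 / (norm (enum n) / 2) ^ 3"
        using enum_nonzero[of n] by (intro divide_left_mono power_mono mult_pos_pos zero_less_power) auto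
      thus ?case by (simp add: norm_divide norm_power power_divide)
    qed
    show "summable (\<lambda>n. 16 * (1 / norm (enum n) ^ 3))" by (intro summable_mult enum_cubes_summable)
  qed
  hence "((\<lambda>n. 2 / (z - enum n) ^ 3) has_sum ((deriv ^^ 2) zeta z - 2 / z ^ 3)) UNIV"
    using zeta_deriv2[OF z] by (rule norm_summable_imp_has_sum)
  hence "((\<lambda>\<omega>. 2 / (z - \<omega>) ^ 3) has_sum ((deriv ^^ 2) zeta z - 2 / z ^ 3)) (lattice - {0})"
    using has_sum_reindex_bij_betw[OF bij_enum, of "\<lambda>\<omega>. 2 / (z - \<omega>) ^ 3"] by simp
  from has_sum_insert[OF _ this, of 0] show ?thesis by (simp add: insert_absorb)
qed

lemma zeta_deriv2_periodic:
  assumes z: "z \<notin> lattice"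
  shows "(deriv ^^ 2) zeta (z + of_real a) = (deriv ^^ 2) zeta z"
proof -
  have "bij_betw (\<lambda>\<omega>. \<omega> + of_real a) lattice lattice"
    by (rule bij_betw_byWitness[where f' = "\<lambda>\<omega>. \<omega> - of_real a"])
       (use lattice_add_period lattice_add_period[of "\<omega> - of_real a" for \<omega>] in auto)
  from has_sum_reindex_bij_betw[OF this, of "\<lambda>\<omega>. 2 / (z + of_real a - \<omega>) ^ 3"]
  have "((\<lambda>\<omega>. 2 / (z - \<omega>) ^ 3) has_sum (deriv ^^ 2) zeta (z + of_real a)) lattice"
    using zeta_deriv2_has_sum[of "z + of_real a"] z lattice_add_period by simp
  thus ?thesis using zeta_deriv2_has_sum[OF z] by (rule has_sum_unique)
qed

text \<open>Periodicity of the second derivative is integrated twice on the connected complement of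
  the lattice. The first constant of integration vanishes because the derivative of zeta is even;
  the second one is c.\<close>

lemma zeta_quasi_periodic:
  obtains c where "\<And>z. z \<notin> lattice \<Longrightarrow> zeta (z + of_real a) - zeta z = c"
proof -
  let ?D = "- lattice" and ?a = "complex_of_real a"
  have inD: "z + ?a \<in> ?D \<longleftrightarrow> z \<in> ?D" for z by (simp add: lattice_add_period)
  have dz: "(zeta has_field_derivative deriv zeta z) (at z)" if "z \<in> ?D" for z
    using holomorphic_derivI[OF zeta_holomorphic open_compl_lattice that] .
  have d2z: "(deriv zeta has_field_derivative (deriv ^^ 2) zeta z) (at z)" if "z \<in> ?D" for z
    using holomorphic_derivI[OF holomorphic_deriv[OF zeta_holomorphic open_compl_lattice] open_compl_lattice that]
    by (simp add: numeral_2_eq_2)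
  have "(\<lambda>z. deriv zeta (z + ?a) - deriv zeta z) constant_on ?D"
  proof (rule has_field_derivative_0_imp_constant_on[OF _ connected_compl_lattice open_compl_lattice])
    fix z assume z: "z \<in> ?D"
    have "((\<lambda>z. deriv zeta (z + ?a) - deriv zeta z) has_field_derivative
        (deriv ^^ 2) zeta (z + ?a) - (deriv ^^ 2) zeta z) (at z)"
      using d2z[of "z + ?a"] d2z[OF z] inD[of z] z by (auto intro!: derivative_intros simp: DERIV_shift)
    thus "((\<lambda>z. deriv zeta (z + ?a) - deriv zeta z) has_field_derivative 0) (at z)"
      using zeta_deriv2_periodic[of z] z by simp
  qed
  then obtain c1 where c1: "\<And>z. z \<in> ?D \<Longrightarrow> deriv zeta (z + ?a) - deriv zeta z = c1"
    unfolding constant_on_def by blast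
  have even: "deriv zeta (- z) = deriv zeta z" if "z \<in> ?D" for z
  proof -
    have "- z \<in> ?D" using that by (simp add: lattice_uminus)
    hence "((\<lambda>z. - zeta (- z)) has_field_derivative deriv zeta (- z)) (at z)"
      by (auto intro!: derivative_eq_intros DERIV_chain2[OF dz])
    hence "(zeta has_field_derivative deriv zeta (- z)) (at z)" by (simp add: zeta_uminus)
    thus ?thesis using dz[OF that] DERIV_unique by blast
  qed
  \<comment> \<open>At z = -a/2 the translate z + a is -z, where the even function takes the same
    value.\<close>
  have "c1 = deriv zeta (- of_real (a / 2) + ?a) - deriv zeta (- of_real (a / 2))"
    using c1[of "- of_real (a / 2)"] half_period_notin_lattice by simp
  also have "- of_real (a / 2) + ?a = - (- of_real (a / 2))" by (simp add: field_simps)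
  also have "deriv zeta \<dots> = deriv zeta (- of_real (a / 2))" using half_period_notin_lattice by (intro even) simp
  finally have c1_0: "c1 = 0" by simp
  have "(\<lambda>z. zeta (z + ?a) - zeta z) constant_on ?D"
  proof (rule has_field_derivative_0_imp_constant_on[OF _ connected_compl_lattice open_compl_lattice])
    fix z assume z: "z \<in> ?D"
    have "((\<lambda>z. zeta (z + ?a) - zeta z) has_field_derivative deriv zeta (z + ?a) - deriv zeta z) (at z)"
      using dz[of "z + ?a"] dz[OF z] inD[of z] z by (auto intro!: derivative_intros simp: DERIV_shift)
    thus "((\<lambda>z. zeta (z + ?a) - zeta z) has_field_derivative 0) (at z)"
      using c1[OF z] c1_0 by simp
  qed
  then obtain c where "\<And>z. z \<in> ?D \<Longrightarrow> zeta (z + ?a) - zeta z = c"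
    unfolding constant_on_def by blast
  thus ?thesis using that by auto
qed

text \<open>The logarithmic derivative of \<sigma>(z + a) / \<sigma>(z) is the constant c, so the
  quotient times exp(-cz) is constant off the lattice. On the lattice both sides vanish. The
  constant is written through \<alpha> because it occurs in this form in
  \<open>lame_beta\<close>.\<close>

lemma sigma_quasi_periodic:
  assumes \<alpha>: "\<alpha> \<notin> lattice"
  obtains C where "C \<noteq> 0" "\<And>z. sigma (z + of_real a) = C * exp ((zeta (\<alpha> + of_real a) - zeta \<alpha>) * z) * sigma z"
proof -
  let ?D = "- lattice" and ?a = "complex_of_real a"
  obtain c where c: "\<And>z. z \<notin> lattice \<Longrightarrow> zeta (z + of_real a) - zeta z = c"
    using zeta_quasi_periodic by blast
  define u where "u z = sigma (z + ?a) / sigma z * exp (- c * z)" for z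
  have ds: "(sigma has_field_derivative deriv sigma z) (at z)" for z
    using sigma_holomorphic[of UNIV] holomorphic_derivI by blast
  have "u constant_on ?D"
  proof (rule has_field_derivative_0_imp_constant_on[OF _ connected_compl_lattice open_compl_lattice])
    fix z assume z: "z \<in> ?D"
    define s s1 where "s = sigma z" and "s1 = sigma (z + ?a)"
    have nz: "s \<noteq> 0" "s1 \<noteq> 0" using z by (auto simp: s_def s1_def sigma_zero_iff lattice_add_period)
    have ds1: "((\<lambda>z. sigma (z + ?a)) has_field_derivative deriv sigma (z + ?a)) (at z)"
      using ds[of "z + ?a"] by (simp add: DERIV_shift)
    have e1: "deriv sigma z = zeta z * s" using nz by (simp add: zeta_def s_def)
    have e2: "deriv sigma (z + ?a) = (zeta z + c) * s1"
    proof -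
      have "zeta (z + ?a) = zeta z + c" using c[of z] z by (simp add: diff_eq_eq add.commute)
      moreover have "deriv sigma (z + ?a) = zeta (z + ?a) * s1" using nz by (simp add: zeta_def s1_def)
      ultimately show ?thesis by simp
    qed
    have "(u has_field_derivative
        ((deriv sigma (z + ?a) * s - s1 * deriv sigma z) / (s * s) * exp (- c * z) + exp (- c * z) * (- c) * (s1 / s))) (at z)"
      unfolding u_def[abs_def] s_def s1_def
      by (rule derivative_eq_intros ds ds1 refl | use z in \<open>simp add: sigma_zero_iff\<close>)+
    also have "(deriv sigma (z + ?a) * s - s1 * deriv sigma z) / (s * s) * exp (- c * z) + exp (- c * z) * (- c) * (s1 / s) = 0"
      unfolding e1 e2 using nz by (simp add: field_simps)
    finally show "(u has_field_derivative 0) (at z)" .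
  qed
  then obtain C where C: "\<And>z. z \<in> ?D \<Longrightarrow> u z = C" unfolding constant_on_def by blast
  have eq: "sigma (z + ?a) = C * exp (c * z) * sigma z" for z
  proof (cases "z \<in> lattice")
    case True
    thus ?thesis using sigma_zero_iff[of z] sigma_zero_iff[of "z + ?a"] by (simp add: lattice_add_period)
  next
    case False
    hence "sigma z \<noteq> 0" by (simp add: sigma_zero_iff)
    thus ?thesis using C[of z] False by (simp add: u_def exp_minus field_simps)
  qed
  have "C \<noteq> 0"
  proof
    assume "C = 0"
    hence "sigma (\<alpha> + ?a) = 0" using eq[of \<alpha>] by simp
    thus False using \<alpha> by (simp add: sigma_zero_iff lattice_add_period)
  qed
  thus ?thesis using that eq c[OF \<alpha>] by blast
qed

end

text \<open>The factor C cancels between \<sigma>(z - \<alpha>) and \<sigma>(z); the exponents leave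
  -c\<alpha> + 2K\<zeta>(\<alpha>), which is -\<beta>. At the lattice points both sides are 0 by
  division by zero, so z is unrestricted.\<close>

theorem Psi_quasi_periodic:
  assumes k: "0 < k" "k < 1" and \<alpha>: "\<alpha> \<notin> period_lattice k"
  shows "Psi k \<alpha> (z + of_real (2 * elliptic_K k)) = exp (- lame_beta k \<alpha>) * Psi k \<alpha> z"
proof -
  have k': "0 \<le> sqrt (1 - k\<^sup>2)" "sqrt (1 - k\<^sup>2) < 1"
    using k by (auto simp: power_le_one)
  have "elliptic_K k > 0" "elliptic_K (sqrt (1 - k\<^sup>2)) > 0"
    by (rule elliptic_K_pos[OF less_imp_le[OF k(1)] k(2)], rule elliptic_K_pos[OF k'])
  then interpret rectangular_lattice "2 * elliptic_K k" "2 * elliptic_K (sqrt (1 - k\<^sup>2))"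
    by (intro rectangular_lattice.intro) simp_all
  have lat: "period_lattice k = lattice"
    unfolding period_lattice_def lattice_def by (simp add: mult_ac)
  have sig: "wsigma k = sigma" by (rule ext) (simp add: wsigma_def sigma_def lat)
  have zet: "wzeta k = zeta" by (rule ext) (simp add: wzeta_def zeta_def sig)
  let ?a = "complex_of_real (2 * elliptic_K k)"
  define c where "c = zeta (\<alpha> + ?a) - zeta \<alpha>"
  obtain C where C: "C \<noteq> 0" "\<And>z. sigma (z + ?a) = C * exp (c * z) * sigma z"
    using sigma_quasi_periodic \<alpha> unfolding lat c_def by metis
  have \<beta>: "lame_beta k \<alpha> = - ?a * zeta \<alpha> + \<alpha> * c"
    by (simp add: lame_beta_def zet c_def algebra_simps)
  have "Psi k \<alpha> (z + ?a) = - (sigma ((z - \<alpha>) + ?a) / (sigma \<alpha> * sigma (z + ?a))) * exp (zeta \<alpha> * (z + ?a))"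
    by (simp add: Psi_def sig zet algebra_simps)
  also have "\<dots> = - ((C * exp (c * (z - \<alpha>)) * sigma (z - \<alpha>)) / (sigma \<alpha> * (C * exp (c * z) * sigma z))) * exp (zeta \<alpha> * (z + ?a))"
    unfolding C(2) ..
  also have "\<dots> = - (sigma (z - \<alpha>) / (sigma \<alpha> * sigma z)) * (exp (c * (z - \<alpha>)) / exp (c * z) * exp (zeta \<alpha> * (z + ?a)))"
    using C(1) by (simp add: mult_ac)
  also have "exp (c * (z - \<alpha>)) / exp (c * z) * exp (zeta \<alpha> * (z + ?a)) = exp (- lame_beta k \<alpha>) * exp (zeta \<alpha> * z)"
    unfolding exp_diff[symmetric] exp_add[symmetric] \<beta> by (simp add: algebra_simps)
  finally show ?thesis by (simp add: Psi_def sig zet)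
qed

section \<open>Sequence spaces and Hankel operators\<close>

text \<open>Norms of sequences are by definition integrals over the counting measure, while the
  operators are written with \<open>infsum\<close>. For absolutely summable families the two notions
  can be exchanged.\<close>

lemma abs_summable_on_int_iff_integrable:
  fixes f :: "int \<Rightarrow> 'b :: {banach, second_countable_topology}"
  shows "integrable (count_space UNIV) f \<longleftrightarrow> (\<lambda>n. norm (f n)) summable_on UNIV"
  using abs_summable_equivalent[of f UNIV] by (simp add: Infinite_Set_Sum.abs_summable_on_def)

lemma integral_count_space_eq_infsum:
  fixes f :: "int \<Rightarrow> 'b :: {banach, second_countable_topology}"
  assumes "(\<lambda>n. norm (f n)) summable_on UNIV"
  shows "integral\<^sup>L (count_space UNIV) f = infsum f UNIV"
  using infsetsum_infsum[of f UNIV] assms abs_summable_on_int_iff_integrable[of f]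
  by (simp add: infsetsum_def Infinite_Set_Sum.abs_summable_on_def)

lemma ell2_iff: "a \<in> ell2 \<longleftrightarrow> (\<lambda>n. (cmod (a n))\<^sup>2) summable_on UNIV"
  using abs_summable_on_int_iff_integrable[of "\<lambda>n. (cmod (a n))\<^sup>2"] by (simp add: L2_def)

lemma ell2_norm_power2:
  assumes "a \<in> ell2"
  shows "(L2_norm (count_space UNIV) a)\<^sup>2 = (\<Sum>\<^sub>\<infinity>n. (cmod (a n))\<^sup>2)"
  using assms integral_count_space_eq_infsum[of "\<lambda>n. (cmod (a n))\<^sup>2"] by (simp add: ell2_iff L2_norm_power2)

lemma ell1_D: "a \<in> ell1 \<Longrightarrow> (\<lambda>n. cmod (a n)) summable_on UNIV"
  by (simp add: ell1_def)

lemma ell1_imp_summable: "a \<in> ell1 \<Longrightarrow> a summable_on UNIV"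
  using ell1_D abs_summable_summable by blast

lemma ell1_bound:
  assumes "g summable_on UNIV" "\<And>n. cmod (a n) \<le> g n"
  shows "a \<in> ell1" "(\<Sum>\<^sub>\<infinity>n. cmod (a n)) \<le> infsum g UNIV"
proof -
  show "a \<in> ell1"
    unfolding ell1_def mem_Collect_eq by (rule summable_on_comparison_test[OF assms(1)]) (use assms(2) in auto)
  thus "(\<Sum>\<^sub>\<infinity>n. cmod (a n)) \<le> infsum g UNIV"
    using assms by (intro infsum_mono ell1_D) auto
qed

lemma norm_infsum_le:
  fixes a :: "int \<Rightarrow> complex"
  assumes "g summable_on UNIV" "\<And>n. cmod (a n) \<le> g n"
  shows "cmod (\<Sum>\<^sub>\<infinity>n. a n) \<le> infsum g UNIV"
  using norm_infsum_bound[OF ell1_D[OF ell1_bound(1)[of g a, OF assms]]] ell1_bound(2)[of g a, OF assms] by linarith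

lemma ell1_add: "a \<in> ell1 \<Longrightarrow> b \<in> ell1 \<Longrightarrow> (\<lambda>n. a n + b n) \<in> ell1"
  by (rule ell1_bound(1)[of "\<lambda>n. cmod (a n) + cmod (b n)"]) (auto intro: summable_on_add ell1_D norm_triangle_ineq)

lemma ell1_scale: "a \<in> ell1 \<Longrightarrow> (\<lambda>n. c * a n) \<in> ell1"
  by (rule ell1_bound(1)[of "\<lambda>n. cmod c * cmod (a n)"]) (auto intro: summable_on_cmult_right ell1_D simp: norm_mult)

lemma ell1_diff: "a \<in> ell1 \<Longrightarrow> b \<in> ell1 \<Longrightarrow> (\<lambda>n. a n - b n) \<in> ell1"
  using ell1_add[of a "\<lambda>n. (- 1) * b n"] ell1_scale[of b "- 1"] by simp

lemma ell1_subset_ell2: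
  assumes a: "a \<in> ell1"
  shows "a \<in> ell2" "L2_norm (count_space UNIV) a \<le> (\<Sum>\<^sub>\<infinity>n. cmod (a n))"
proof -
  define A where "A = (\<Sum>\<^sub>\<infinity>n. cmod (a n))"
  have A: "A \<ge> 0" unfolding A_def by (intro infsum_nonneg) auto
  have le: "cmod (a n) \<le> A" for n
    unfolding A_def using finite_sum_le_infsum[OF ell1_D[OF a], of "{n}"] by simp
  have sq: "(cmod (a n))\<^sup>2 \<le> A * cmod (a n)" for n
    using le[of n] by (simp add: power2_eq_square mult_right_mono)
  have sm: "(\<lambda>n. A * cmod (a n)) summable_on UNIV" by (intro summable_on_cmult_right ell1_D a)
  show e2: "a \<in> ell2"
    unfolding ell2_iff by (rule summable_on_comparison_test[OF sm]) (use sq in auto)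
  have "(L2_norm (count_space UNIV) a)\<^sup>2 \<le> (\<Sum>\<^sub>\<infinity>n. A * cmod (a n))"
    unfolding ell2_norm_power2[OF e2] using e2 sq by (intro infsum_mono sm) (auto simp: ell2_iff)
  also have "\<dots> = A\<^sup>2" by (simp add: infsum_cmult_right' A_def power2_eq_square)
  finally show "L2_norm (count_space UNIV) a \<le> (\<Sum>\<^sub>\<infinity>n. cmod (a n))"
    unfolding A_def[symmetric] by (rule power2_le_imp_le) (rule A)
qed

lemma ell2_mult:
  assumes "a \<in> ell2" "b \<in> ell2"
  shows "(\<lambda>n. cmod (a n * b n)) summable_on UNIV"
    and "cmod (\<Sum>\<^sub>\<infinity>n. a n * b n) \<le> L2_norm (count_space UNIV) a * L2_norm (count_space UNIV) b"
proof -
  show s: "(\<lambda>n. cmod (a n * b n)) summable_on UNIV"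
    using L2_mult_integrable(1)[OF assms] by (simp only: abs_summable_on_int_iff_integrable)
  show "cmod (\<Sum>\<^sub>\<infinity>n. a n * b n) \<le> L2_norm (count_space UNIV) a * L2_norm (count_space UNIV) b"
    using L2_mult_bound[OF assms] unfolding integral_count_space_eq_infsum[OF s] .
qed

lemma ell2_norm_eq_0:
  assumes "a \<in> ell2" "L2_norm (count_space UNIV) a = 0"
  shows "a n = 0"
  using L2_norm_eq_0_imp_AE[OF assms] by (simp add: AE_count_space)

lemma bounded_op_ell2_linear:
  assumes "bounded_op (count_space (UNIV :: int set)) T" "f \<in> ell2" "g \<in> ell2"
  shows "T (\<lambda>x. a * f x + b * g x) n = a * T f n + b * T g n"
  using assms unfolding bounded_op_def by (auto simp: AE_count_space)

lemma bounded_op_ell2_diff: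
  assumes "bounded_op (count_space (UNIV :: int set)) T" "f \<in> ell2" "g \<in> ell2"
  shows "T (\<lambda>x. f x - g x) n = T f n - T g n"
  using bounded_op_ell2_linear[OF assms, of 1 "- 1" n] by simp

lemma bounded_op_one_plus:
  assumes T: "bounded_op M T"
  shows "bounded_op M (\<lambda>a n. a n + \<mu> * T a n)"
  unfolding bounded_op_def
proof (intro conjI ballI allI)
  show "(\<lambda>n. f n + \<mu> * T f n) \<in> L2 M" if "f \<in> L2 M" for f
    using that T by (intro L2_add L2_scale) (auto simp: bounded_op_def)
  show "AE x in M. a * f x + b * g x + \<mu> * T (\<lambda>x. a * f x + b * g x) x =
      a * (f x + \<mu> * T f x) + b * (g x + \<mu> * T g x)" if "f \<in> L2 M" "g \<in> L2 M" for f g a b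
  proof -
    have "AE x in M. T (\<lambda>x. a * f x + b * g x) x = a * T f x + b * T g x"
      using T that unfolding bounded_op_def by blast
    thus ?thesis by eventually_elim (simp add: algebra_simps)
  qed
  obtain c where c: "\<And>f. f \<in> L2 M \<Longrightarrow> L2_norm M (T f) \<le> c * L2_norm M f"
    using T unfolding bounded_op_def by metis
  have "L2_norm M (\<lambda>n. f n + \<mu> * T f n) \<le> (1 + cmod \<mu> * c) * L2_norm M f" if f: "f \<in> L2 M" for f
  proof -
    have "L2_norm M (\<lambda>n. f n + \<mu> * T f n) \<le> L2_norm M f + L2_norm M (\<lambda>n. \<mu> * T f n)"
      using f T by (intro L2_norm_add_le L2_scale) (auto simp: bounded_op_def)
    also have "\<dots> \<le> L2_norm M f + cmod \<mu> * (c * L2_norm M f)"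
      unfolding L2_norm_scale by (intro add_left_mono mult_left_mono c f) auto
    finally show ?thesis by (simp add: algebra_simps)
  qed
  thus "\<exists>c. \<forall>f\<in>L2 M. L2_norm M (\<lambda>n. f n + \<mu> * T f n) \<le> c * L2_norm M f" by blast
qed

text \<open>The Neumann series of \<open>(I + T)\<^sup>-\<^sup>1\<close>, as the limit of \<open>s \<mapsto> b - T s\<close>.\<close>

lemma invertible_op_one_plus_small:
  fixes T :: "(int \<Rightarrow> complex) \<Rightarrow> int \<Rightarrow> complex"
  assumes T: "bounded_op (count_space UNIV) T"
    and small: "\<And>a. a \<in> ell2 \<Longrightarrow> L2_norm (count_space UNIV) (T a) \<le> 1 / 2 * L2_norm (count_space UNIV) a"
  shows "invertible_op (count_space UNIV) (\<lambda>a n. a n + T a n)"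
proof -
  let ?N = "L2_norm (count_space (UNIV :: int set))"
  have TL: "T a \<in> ell2" if "a \<in> ell2" for a using T that by (auto simp: bounded_op_def)
  \<comment> \<open>One estimate with two uses: it makes I + T injective, and it bounds the inverse
    by 2.\<close>
  have half: "?N a \<le> 2 * ?N (\<lambda>n. a n + T a n)" if a: "a \<in> ell2" for a
  proof -
    have "?N a \<le> ?N (\<lambda>n. a n + T a n) + ?N (T a)"
      using L2_norm_diff_le[OF L2_add[OF a TL[OF a]] TL[OF a]] by simp
    thus ?thesis using small[OF a] by simp
  qed
  have uniq: "a = a'" if a: "a \<in> ell2" "a' \<in> ell2" and eq: "\<And>n. a n + T a n = a' n + T a' n" for a a'
  proof -
    let ?d = "\<lambda>n. a n - a' n"
    have d: "?d \<in> ell2" using a by auto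
    have "(\<lambda>n. ?d n + T ?d n) = (\<lambda>n. 0)"
      using eq by (auto simp: bounded_op_ell2_diff[OF T a] algebra_simps)
    hence "?N ?d = 0" using half[OF d] L2_norm_nonneg[of _ ?d] by (simp add: order_antisym)
    thus ?thesis using ell2_norm_eq_0[OF d] by auto
  qed
  have solve: "\<exists>a\<in>ell2. \<forall>n. a n + T a n = b n" if b: "b \<in> ell2" for b
  proof -
    define s where "s = rec_nat (\<lambda>n. 0) (\<lambda>_ a. (\<lambda>n. b n - T a n))"
    have s0: "s 0 = (\<lambda>n. 0)" and sS: "s (Suc k) = (\<lambda>n. b n - T (s k) n)" for k by (simp_all add: s_def)
    have s: "s k \<in> ell2" for k
      by (induction k) (use b TL in \<open>auto simp: s0 sS intro!: L2_diff\<close>)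
    have step: "?N (\<lambda>n. s (Suc k) n - s k n) \<le> (1 / 2) ^ k * ?N b" for k
    proof (induction k)
      case 0
      have "T (\<lambda>n. 0) n = 0" for n using bounded_op_ell2_linear[OF T L2_zero L2_zero, of 0 0 n] by simp
      thus ?case by (simp add: s0 sS)
    next
      case (Suc k)
      have "s (Suc (Suc k)) n - s (Suc k) n = - T (\<lambda>n. s (Suc k) n - s k n) n" for n
        unfolding bounded_op_ell2_diff[OF T s s] fun_cong[OF sS[of "Suc k"]] by (simp add: fun_cong[OF sS[of k]])
      hence "?N (\<lambda>n. s (Suc (Suc k)) n - s (Suc k) n) = ?N (\<lambda>n. - T (\<lambda>n. s (Suc k) n - s k n) n)"
        by (intro arg_cong[of _ _ ?N] ext)
      also have "\<dots> \<le> 1 / 2 * ?N (\<lambda>n. s (Suc k) n - s k n)"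
        unfolding L2_norm_minus by (intro small L2_diff s)
      finally show ?case using Suc by simp
    qed
    \<comment> \<open>The increments are bounded by 2^-k times the norm of b. Dropping the first K
      iterates brings that constant down to 1, as \<open>L2_complete\<close> requires.\<close>
    obtain K where K: "?N b * (1 / 2) ^ K \<le> 1"
    proof -
      have "(\<lambda>K. ?N b * (1 / 2) ^ K) \<longlonglongrightarrow> ?N b * 0" by (intro tendsto_intros LIMSEQ_power_zero) auto
      hence "\<forall>\<^sub>F K in sequentially. ?N b * (1 / 2) ^ K < 1" by (rule order_tendstoD) simp
      thus ?thesis using that by (auto simp: eventually_at_top_linorder intro: less_imp_le)
    qed
    have "(?N (\<lambda>n. s (Suc k + K) n - s (k + K) n))\<^sup>2 \<le> (1 / 4) ^ k" for k
    proof -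
      have "?N (\<lambda>n. s (Suc k + K) n - s (k + K) n) \<le> (1 / 2) ^ k * (?N b * (1 / 2) ^ K)"
        using step[of "k + K"] by (simp add: power_add mult_ac)
      also have "\<dots> \<le> (1 / 2) ^ k * 1" using K by (intro mult_left_mono) auto
      finally have "(?N (\<lambda>n. s (Suc k + K) n - s (k + K) n))\<^sup>2 \<le> ((1 / 2) ^ k)\<^sup>2"
        by (intro power_mono) auto
      also have "\<dots> = ((1 / 2)\<^sup>2) ^ k" by (simp only: power_mult[symmetric] mult.commute)
      finally show ?thesis by (simp add: power_divide)
    qed
    from L2_complete[of "\<lambda>k. s (k + K)", OF s this]
    obtain a where a: "a \<in> ell2" and lim: "(\<lambda>k. ?N (\<lambda>n. s (k + K) n - a n)) \<longlonglongrightarrow> 0" by auto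
    have "?N (\<lambda>n. a n - (b n - T a n)) \<le> 0"
    proof (rule LIMSEQ_le_const)
      show "(\<lambda>k. ?N (\<lambda>n. s (Suc k + K) n - a n) + 1 / 2 * ?N (\<lambda>n. s (k + K) n - a n)) \<longlonglongrightarrow> 0"
        using tendsto_add[OF LIMSEQ_Suc[OF lim] tendsto_mult_left[OF lim, of "1 / 2"]] by simp
      have "?N (\<lambda>n. a n - (b n - T a n)) \<le> ?N (\<lambda>n. s (Suc k + K) n - a n) + 1 / 2 * ?N (\<lambda>n. s (k + K) n - a n)" for k
      proof -
        have "?N (\<lambda>n. a n - (b n - T a n)) \<le> ?N (\<lambda>n. a n - s (Suc k + K) n) + ?N (\<lambda>n. s (Suc k + K) n - (b n - T a n))"
          by (intro L2_norm_triangle3 a s L2_diff b TL)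
        also have "?N (\<lambda>n. a n - s (Suc k + K) n) = ?N (\<lambda>n. s (Suc k + K) n - a n)" by (rule L2_norm_minus_commute)
        also have "?N (\<lambda>n. s (Suc k + K) n - (b n - T a n)) = ?N (\<lambda>n. - T (\<lambda>n. s (k + K) n - a n) n)"
          by (rule arg_cong[of _ _ ?N]) (simp add: sS bounded_op_ell2_diff[OF T s a])
        also have "\<dots> \<le> 1 / 2 * ?N (\<lambda>n. s (k + K) n - a n)"
          unfolding L2_norm_minus by (intro small L2_diff s a)
        finally show ?thesis by simp
      qed
      thus "\<exists>N. \<forall>k\<ge>N. ?N (\<lambda>n. a n - (b n - T a n)) \<le> ?N (\<lambda>n. s (Suc k + K) n - a n) + 1 / 2 * ?N (\<lambda>n. s (k + K) n - a n)"
        by blast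
    qed
    hence "?N (\<lambda>n. a n - (b n - T a n)) = 0"
      using L2_norm_nonneg[of "count_space UNIV" "\<lambda>n. a n - (b n - T a n)"] by linarith
    from ell2_norm_eq_0[OF L2_diff[OF a L2_diff[OF b TL[OF a]]] this] have "a n - (b n - T a n) = 0" for n .
    thus ?thesis using a by (intro bexI[of _ a]) (auto simp: algebra_simps)
  qed
  define S where "S b = (SOME a. a \<in> ell2 \<and> (\<forall>n. a n + T a n = b n))" for b
  have S: "S b \<in> ell2" "S b n + T (S b) n = b n" if "b \<in> ell2" for b n
    using someI_ex[of "\<lambda>a. a \<in> ell2 \<and> (\<forall>n. a n + T a n = b n)"] solve[OF that] unfolding S_def by auto
  have "bounded_op (count_space UNIV) S"
    unfolding bounded_op_def AE_count_space
  proof (intro conjI ballI allI)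
    show "S f \<in> ell2" if "f \<in> ell2" for f using S(1)[OF that] .
    show "S (\<lambda>x. p * f x + q * g x) n = p * S f n + q * S g n" if fg: "f \<in> ell2" "g \<in> ell2" for f g p q n
    proof -
      let ?h = "\<lambda>x. p * f x + q * g x" and ?k = "\<lambda>n. p * S f n + q * S g n"
      have h: "?h \<in> ell2" and k: "?k \<in> ell2" by (intro L2_add L2_scale fg S(1))+
      have "S ?h = ?k"
      proof (rule uniq[OF S(1)[OF h] k])
        fix n
        have "?k n + T ?k n = p * (S f n + T (S f) n) + q * (S g n + T (S g) n)"
          unfolding bounded_op_ell2_linear[OF T S(1)[OF fg(1)] S(1)[OF fg(2)]] by (simp add: algebra_simps)
        thus "S ?h n + T (S ?h) n = ?k n + T ?k n"
          using S(2)[OF h] S(2)[OF fg(1)] S(2)[OF fg(2)] by simp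
      qed
      thus ?thesis by simp
    qed
    have "?N (S f) \<le> 2 * ?N f" if "f \<in> ell2" for f
      using half[OF S(1)[OF that]] S(2)[OF that] by simp
    thus "\<exists>c. \<forall>f\<in>ell2. ?N (S f) \<le> c * ?N f" by blast
  qed
  moreover have "S (\<lambda>n. f n + T f n) n = f n" if f: "f \<in> ell2" for f n
  proof -
    have h: "(\<lambda>n. f n + T f n) \<in> ell2" by (intro L2_add f TL)
    show ?thesis using uniq[OF S(1)[OF h] f] S(2)[OF h] by simp
  qed
  moreover have "bounded_op (count_space UNIV) (\<lambda>a n. a n + T a n)"
    using bounded_op_one_plus[OF T, of 1] by simp
  ultimately show ?thesis
    unfolding invertible_op_def AE_count_space using S(2) by (intro conjI exI[of _ S]) auto
qed

lemma invertible_op_ell2: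
  assumes "invertible_op (count_space (UNIV :: int set)) Q"
  shows "\<And>b. b \<in> ell2 \<Longrightarrow> \<exists>a\<in>ell2. Q a = b"
    and "\<And>a a'. a \<in> ell2 \<Longrightarrow> a' \<in> ell2 \<Longrightarrow> Q a = Q a' \<Longrightarrow> a = a'"
    and "\<exists>S\<ge>0. \<forall>a\<in>ell2. L2_norm (count_space UNIV) a \<le> S * L2_norm (count_space UNIV) (Q a)"
proof -
  obtain S where Q: "bounded_op (count_space UNIV) Q" and S: "bounded_op (count_space UNIV) S"
    and inv: "\<And>f. f \<in> ell2 \<Longrightarrow> S (Q f) = f" "\<And>f. f \<in> ell2 \<Longrightarrow> Q (S f) = f"
    using assms unfolding invertible_op_def AE_count_space by (auto simp: fun_eq_iff)
  show "\<exists>a\<in>ell2. Q a = b" if "b \<in> ell2" for b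
    using that inv(2) S unfolding bounded_op_def by metis
  show "a = a'" if "a \<in> ell2" "a' \<in> ell2" "Q a = Q a'" for a a'
    using inv(1) that by metis
  obtain c where c: "\<And>f. f \<in> ell2 \<Longrightarrow> L2_norm (count_space UNIV) (S f) \<le> c * L2_norm (count_space UNIV) f"
    using S unfolding bounded_op_def by metis
  have "L2_norm (count_space UNIV) a \<le> \<bar>c\<bar> * L2_norm (count_space UNIV) (Q a)" if a: "a \<in> ell2" for a
  proof -
    have "Q a \<in> ell2" using Q a by (auto simp: bounded_op_def)
    from c[OF this] have "L2_norm (count_space UNIV) a \<le> c * L2_norm (count_space UNIV) (Q a)"
      using inv(1)[OF a] by simp
    also have "\<dots> \<le> \<bar>c\<bar> * L2_norm (count_space UNIV) (Q a)" by (intro mult_right_mono) auto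
    finally show ?thesis .
  qed
  thus "\<exists>S\<ge>0. \<forall>a\<in>ell2. L2_norm (count_space UNIV) a \<le> S * L2_norm (count_space UNIV) (Q a)"
    by (intro exI[of _ "\<bar>c\<bar>"]) auto
qed

section \<open>Exponential integrals and Hankel operators on half lines\<close>

lemma exp_decay_integral:
  fixes x c :: real
  assumes c: "c > 0"
  shows "set_integrable lborel {x..} (\<lambda>s. exp (- c * s))"
proof -
  have "(\<integral>\<^sup>+s. ennreal (exp (- c * s)) * indicator {x..} s \<partial>lborel) = ennreal (0 - (- exp (- c * x) / c))"
  proof (rule nn_integral_FTC_atLeast)
    show "((\<lambda>s. - exp (- c * s) / c) has_real_derivative exp (- c * s)) (at s)" for s
      using c by (auto intro!: derivative_eq_intros)
    have "filterlim (\<lambda>s. - c * s) at_bot at_top"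
      using c by (intro filterlim_tendsto_neg_mult_at_bot[OF tendsto_const]) (auto simp: filterlim_ident)
    hence "((\<lambda>s. exp (- c * s)) \<longlongrightarrow> 0) at_top" by (rule filterlim_compose[OF exp_at_bot])
    from tendsto_divide[OF tendsto_minus[OF this] tendsto_const[of c]] c
    show "((\<lambda>s. - exp (- c * s) / c) \<longlongrightarrow> 0) at_top" by simp
  qed auto
  moreover have "(\<integral>\<^sup>+s. ennreal (norm (indicator {x..} s *\<^sub>R exp (- c * s))) \<partial>lborel) =
    (\<integral>\<^sup>+s. ennreal (exp (- c * s)) * indicator {x..} s \<partial>lborel)"
    by (intro nn_integral_cong) (auto split: split_indicator)
  ultimately show ?thesis
    unfolding set_integrable_def by (intro integrableI_bounded) auto
qed

lemma complex_exp_integral: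
  fixes z :: complex
  assumes z: "Re z > 0"
  shows "set_integrable lborel {x..} (\<lambda>s. exp (- of_real s * z))"
    and "(LBINT s:{x..}. exp (- of_real s * z)) = exp (- of_real x * z) / z"
proof -
  have z0: "z \<noteq> 0" using z by auto
  show i: "set_integrable lborel {x..} (\<lambda>s. exp (- of_real s * z))"
    using exp_decay_integral[OF z, of x] unfolding set_integrable_def
    by (rule Bochner_Integration.integrable_bound)
       (auto simp: norm_mult mult.commute intro!: borel_measurable_continuous_onI borel_measurable_scaleR continuous_intros)
  have "((\<lambda>y. LBINT s:{x..y}. exp (- of_real s * z)) \<longlongrightarrow> (LBINT s:{x..}. exp (- of_real s * z))) at_top"
    by (rule tendsto_set_lebesgue_integral_at_top[OF _ i]) auto
  moreover have "((\<lambda>y. LBINT s:{x..y}. exp (- of_real s * z)) \<longlongrightarrow> exp (- of_real x * z) / z) at_top"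
  proof (rule Lim_transform_eventually)
    have "((\<lambda>s. exp (- (Re z * s))) \<longlongrightarrow> 0) at_top"
    proof -
      have "filterlim (\<lambda>s. - Re z * s) at_bot at_top"
        using z by (intro filterlim_tendsto_neg_mult_at_bot[OF tendsto_const]) (auto simp: filterlim_ident)
      from filterlim_compose[OF exp_at_bot this] show ?thesis by simp
    qed
    hence "((\<lambda>y. exp (- of_real y * z)) \<longlongrightarrow> 0) at_top"
      by (intro tendsto_norm_zero_cancel[of "\<lambda>y. exp (- of_real y * z)"]) (simp add: mult.commute)
    from tendsto_divide[OF tendsto_diff[OF tendsto_const[of "exp (- of_real x * z)"] this] tendsto_const[of z]] z0
    show "((\<lambda>y. (exp (- of_real x * z) - exp (- of_real y * z)) / z) \<longlongrightarrow> exp (- of_real x * z) / z) at_top" by simp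
    show "\<forall>\<^sub>F y in at_top. (exp (- of_real x * z) - exp (- of_real y * z)) / z = (LBINT s:{x..y}. exp (- of_real s * z))"
      using eventually_ge_at_top[of x]
    proof eventually_elim
      case (elim y)
      have "((\<lambda>s. exp (- of_real s * z)) has_integral (- exp (- of_real y * z) / z - - exp (- of_real x * z) / z)) {x..y}"
      proof (rule fundamental_theorem_of_calculus[OF elim])
        fix s assume "s \<in> {x..y}"
        have "((\<lambda>w. - exp (- w * z) / z) has_field_derivative exp (- of_real s * z)) (at (of_real s))"
          using z0 by (auto intro!: derivative_eq_intros)
        thus "((\<lambda>s. - exp (- of_real s * z) / z) has_vector_derivative exp (- of_real s * z)) (at s within {x..y})"
          by (rule has_vector_derivative_real_field)
      qed
      moreover have "set_integrable lborel {x..y} (\<lambda>s. exp (- of_real s * z))"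
        by (intro borel_integrable_atLeastAtMost' continuous_intros)
      ultimately show ?case
        using set_borel_integral_eq_integral(2)[of "{x..y}" "\<lambda>s. exp (- of_real s * z)"]
        by (simp add: integral_unique diff_divide_distrib)
    qed
  qed
  ultimately show "(LBINT s:{x..}. exp (- of_real s * z)) = exp (- of_real x * z) / z"
    using tendsto_unique trivial_limit_at_top_linorder by blast
qed

text \<open>Exchange of sum and integral under a majorant that separates the index from the
  variable: one integrable h serves all n, weighted by a summable w.\<close>

lemma integral_infsum_int:
  fixes f :: "int \<Rightarrow> 'a \<Rightarrow> complex"
  assumes f: "\<And>n. f n \<in> borel_measurable M"
    and h: "integrable M h" "\<And>x. x \<in> space M \<Longrightarrow> h x \<ge> 0"
    and w: "w summable_on UNIV" "\<And>n. w n \<ge> 0"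
    and b: "\<And>n x. x \<in> space M \<Longrightarrow> cmod (f n x) \<le> w n * h x"
  shows "integrable M (\<lambda>x. \<Sum>\<^sub>\<infinity>n. f n x)"
    and "(\<lambda>n. cmod (LINT x|M. f n x)) summable_on UNIV"
    and "((\<lambda>n. LINT x|M. f n x) has_sum (LINT x|M. (\<Sum>\<^sub>\<infinity>n. f n x))) UNIV"
proof -
  define g where "g n = f (int_decode n)" for n
  have fi: "integrable M (f n)" for n
  proof (rule Bochner_Integration.integrable_bound[OF integrable_mult_right[OF h(1)] f])
    show "AE x in M. norm (f n x) \<le> norm (w n * h x)"
      using b h(2) w(2) by (intro AE_I2) (simp add: abs_mult)
  qed
  have wn: "summable (\<lambda>n. w (int_decode n))"
    using w by (simp add: summable_on_int_nonneg_iff)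
  have gs: "summable (\<lambda>n. norm (g n x))" if "x \<in> space M" for x
    by (rule summable_comparison_test'[OF summable_mult2[OF wn], of 0]) (use b that in \<open>auto simp: g_def\<close>)
  have eq: "(\<Sum>\<^sub>\<infinity>n. f n x) = (\<Sum>n. g n x)" if "x \<in> space M" for x
  proof -
    have "((\<lambda>n. g n x) has_sum (\<Sum>n. g n x)) UNIV"
      by (rule norm_summable_imp_has_sum[OF gs[OF that] summable_sums[OF summable_norm_cancel[OF gs[OF that]]]])
    hence "((\<lambda>n. f n x) has_sum (\<Sum>n. g n x)) UNIV" by (simp add: has_sum_int_iff g_def)
    thus ?thesis by (rule infsumI)
  qed
  have bi: "(LINT x|M. norm (f n x)) \<le> w n * (LINT x|M. h x)" for n
  proof -
    have "(LINT x|M. norm (f n x)) \<le> (LINT x|M. w n * h x)"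
      using fi h b by (intro integral_mono integrable_norm integrable_mult_right) auto
    thus ?thesis by simp
  qed
  have gi: "summable (\<lambda>n. LINT x|M. norm (g n x))"
    by (rule summable_comparison_test'[OF summable_mult2[OF wn], of 0]) (use bi in \<open>auto simp: g_def\<close>)
  have "integrable M (\<lambda>x. \<Sum>n. g n x)"
    by (rule integrable_suminf) (use fi gs gi in \<open>auto simp: g_def\<close>)
  thus "integrable M (\<lambda>x. \<Sum>\<^sub>\<infinity>n. f n x)"
    by (subst Bochner_Integration.integrable_cong[OF refl eq]) auto
  have "(\<lambda>n. LINT x|M. g n x) sums (LINT x|M. (\<Sum>n. g n x))"
    by (rule sums_integral) (use fi gs gi in \<open>auto simp: g_def\<close>)
  also have "(LINT x|M. (\<Sum>n. g n x)) = (LINT x|M. (\<Sum>\<^sub>\<infinity>n. f n x))"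
    by (rule Bochner_Integration.integral_cong) (auto simp: eq)
  finally have s: "(\<lambda>n. LINT x|M. g n x) sums (LINT x|M. (\<Sum>\<^sub>\<infinity>n. f n x))" .
  have "summable (\<lambda>n. norm (LINT x|M. g n x))"
    by (rule summable_comparison_test'[OF gi, of 0]) (auto intro: integral_norm_bound)
  from norm_summable_imp_has_sum[OF this s]
  show "((\<lambda>n. LINT x|M. f n x) has_sum (LINT x|M. (\<Sum>\<^sub>\<infinity>n. f n x))) UNIV"
    by (simp add: has_sum_int_iff g_def)
  show "(\<lambda>n. cmod (LINT x|M. f n x)) summable_on UNIV"
  proof (rule summable_on_comparison_test)
    show "(\<lambda>n. w n * (LINT x|M. h x)) summable_on UNIV" using w by (intro summable_on_cmult_left)
    show "cmod (LINT x|M. f n x) \<le> w n * (LINT x|M. h x)" for n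
      using integral_norm_bound[of M "f n"] bi[of n] by linarith
  qed auto
qed

lemma half_line_integrable_iff:
  fixes f :: "real \<Rightarrow> 'b :: {banach, second_countable_topology}"
  shows "integrable half_line f \<longleftrightarrow> set_integrable lborel {0..} f"
proof -
  have "integrable half_line f \<longleftrightarrow> set_integrable lborel {0<..} f"
    by (simp add: integrable_restrict_space set_integrable_def)
  also have "\<dots> \<longleftrightarrow> set_integrable lborel {0..} f"
    by (rule set_integrable_discrete_difference[of "{0}"]) auto
  finally show ?thesis .
qed

lemma half_line_integral_eq:
  fixes f :: "real \<Rightarrow> 'b :: {banach, second_countable_topology}"
  shows "(LINT x|half_line. f x) = (LBINT x:{0..}. f x)"
proof -
  have "(LINT x|half_line. f x) = (LBINT x:{0<..}. f x)"
    by (simp add: integral_restrict_space set_lebesgue_integral_def)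
  also have "\<dots> = (LBINT x:{0..}. f x)"
    by (rule set_integral_discrete_difference[of "{0}"]) auto
  finally show ?thesis .
qed

lemma half_line_exp_integral:
  fixes z :: complex
  assumes "Re z > 0"
  shows "integrable half_line (\<lambda>u. exp (- of_real u * z))" "(LINT u|half_line. exp (- of_real u * z)) = 1 / z"
  using complex_exp_integral[OF assms, of 0] by (simp_all add: half_line_integrable_iff half_line_integral_eq)

lemma half_line_measurable: "f \<in> borel_measurable borel \<Longrightarrow> f \<in> borel_measurable half_line"
  by (rule measurable_restrict_space1) simp

lemma half_line_exp_L2:
  fixes z :: complex
  assumes z: "Re z > 0"
  shows "(\<lambda>u. exp (- of_real u * z)) \<in> L2 half_line"
    and "(L2_norm half_line (\<lambda>u. exp (- of_real u * z)))\<^sup>2 = 1 / (2 * Re z)"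
proof -
  have eq: "complex_of_real ((cmod (exp (- of_real u * z)))\<^sup>2) = exp (- of_real u * of_real (2 * Re z))" for u
    by (simp add: power2_eq_square exp_add[symmetric] flip: exp_of_real) (simp add: algebra_simps)
  have m: "(\<lambda>u. exp (- of_real u * z)) \<in> borel_measurable half_line"
    by (intro half_line_measurable borel_measurable_continuous_onI continuous_intros)
  have "integrable half_line (\<lambda>u. complex_of_real ((cmod (exp (- of_real u * z)))\<^sup>2))"
    unfolding eq using z by (intro half_line_exp_integral) simp
  hence "integrable half_line (\<lambda>u. (cmod (exp (- of_real u * z)))\<^sup>2)"
    by (simp only: complex_of_real_integrable_eq)
  with m show "(\<lambda>u. exp (- of_real u * z)) \<in> L2 half_line" by (simp add: L2_def)
  have "complex_of_real ((L2_norm half_line (\<lambda>u. exp (- of_real u * z)))\<^sup>2) =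
      (LINT u|half_line. complex_of_real ((cmod (exp (- of_real u * z)))\<^sup>2))"
    unfolding L2_norm_power2 by (rule integral_complex_of_real[symmetric])
  also have "\<dots> = 1 / of_real (2 * Re z)"
    unfolding eq using z by (subst half_line_exp_integral) auto
  also have "\<dots> = of_real (1 / (2 * Re z))" by simp
  finally show "(L2_norm half_line (\<lambda>u. exp (- of_real u * z)))\<^sup>2 = 1 / (2 * Re z)" by (simp only: of_real_eq_iff)
qed

context
  fixes \<psi> :: "real \<Rightarrow> complex" and \<epsilon> c :: real
  assumes \<psi>: "\<psi> \<in> borel_measurable borel" and c: "c > 0" and \<epsilon>: "\<epsilon> \<ge> 0"
    and bound: "\<And>s. s > 0 \<Longrightarrow> cmod (\<psi> s) \<le> \<epsilon> * exp (- c * s)"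
begin

lemma hankel_kernel_L2:
  assumes u: "u > 0"
  shows "(\<lambda>v. \<psi> (u + v)) \<in> L2 half_line"
    and "L2_norm half_line (\<lambda>v. \<psi> (u + v)) \<le> \<epsilon> * exp (- c * u) * sqrt (1 / (2 * c))"
proof -
  let ?e = "\<lambda>v. complex_of_real (\<epsilon> * exp (- c * u)) * exp (- of_real v * of_real c)"
  have e: "?e \<in> L2 half_line" using c by (intro L2_scale half_line_exp_L2) auto
  have m: "(\<lambda>v. \<psi> (u + v)) \<in> borel_measurable half_line"
    by (intro half_line_measurable measurable_compose[OF _ \<psi>]) auto
  have le: "(cmod (\<psi> (u + v)))\<^sup>2 \<le> (cmod (?e v))\<^sup>2" if "v > 0" for v
  proof (rule power_mono)
    have "cmod (\<psi> (u + v)) \<le> \<epsilon> * exp (- c * (u + v))" using u that by (intro bound) auto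
    also have "\<dots> = cmod (?e v)" using \<epsilon> by (simp add: norm_mult exp_add[symmetric] algebra_simps)
    finally show "cmod (\<psi> (u + v)) \<le> cmod (?e v)" .
  qed simp
  have AE: "AE v in half_line. (cmod (\<psi> (u + v)))\<^sup>2 \<le> (cmod (?e v))\<^sup>2"
    by (rule AE_I2) (use le in \<open>auto simp: space_restrict_space\<close>)
  show "(\<lambda>v. \<psi> (u + v)) \<in> L2 half_line" by (rule L2_bound(1)[OF L2_integrable[OF e] m AE])
  have "(L2_norm half_line (\<lambda>v. \<psi> (u + v)))\<^sup>2 \<le> (L2_norm half_line ?e)\<^sup>2"
    unfolding L2_norm_power2[of _ ?e] by (rule L2_bound(2)[OF L2_integrable[OF e] m AE])
  also have "\<dots> = (\<epsilon> * exp (- c * u) * sqrt (1 / (2 * c)))\<^sup>2"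
    using c \<epsilon> half_line_exp_L2(2)[of "of_real c"] by (simp add: L2_norm_scale norm_mult power_mult_distrib)
  finally show "L2_norm half_line (\<lambda>v. \<psi> (u + v)) \<le> \<epsilon> * exp (- c * u) * sqrt (1 / (2 * c))"
    by (rule power2_le_imp_le) (use \<epsilon> c in auto)
qed

lemma hankel_op_pointwise_bound:
  assumes f: "f \<in> L2 half_line" and u: "u > 0"
  shows "integrable half_line (\<lambda>v. \<psi> (u + v) * f v)"
    and "cmod (hankel_op \<psi> f u) \<le> \<epsilon> * sqrt (1 / (2 * c)) * L2_norm half_line f * exp (- c * u)"
proof -
  show "integrable half_line (\<lambda>v. \<psi> (u + v) * f v)"
    by (rule L2_mult_integrable(1)[OF hankel_kernel_L2(1)[OF u] f])
  have "cmod (hankel_op \<psi> f u) \<le> L2_norm half_line (\<lambda>v. \<psi> (u + v)) * L2_norm half_line f"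
    unfolding hankel_op_def by (rule L2_mult_bound[OF hankel_kernel_L2(1)[OF u] f])
  also have "\<dots> \<le> \<epsilon> * exp (- c * u) * sqrt (1 / (2 * c)) * L2_norm half_line f"
    using hankel_kernel_L2(2)[OF u] by (intro mult_right_mono) auto
  finally show "cmod (hankel_op \<psi> f u) \<le> \<epsilon> * sqrt (1 / (2 * c)) * L2_norm half_line f * exp (- c * u)"
    by (simp add: mult_ac)
qed

text \<open>The row of the kernel at u has norm of order exp(-cu), so the image of f is dominated
  pointwise by an exponential. The bound is linear in \<epsilon>; applied to the difference of a
  symbol and its truncation it becomes the approximation error.\<close>

lemma hankel_op_L2:
  assumes f: "f \<in> L2 half_line"
  shows "hankel_op \<psi> f \<in> L2 half_line"
    and "L2_norm half_line (hankel_op \<psi> f) \<le> \<epsilon> / (2 * c) * L2_norm half_line f"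
proof -
  define k where "k = \<epsilon> * sqrt (1 / (2 * c)) * L2_norm half_line f"
  have k: "k \<ge> 0" using \<epsilon> c by (simp add: k_def)
  let ?e = "\<lambda>v. complex_of_real k * exp (- of_real v * of_real c)"
  have e: "?e \<in> L2 half_line" using c by (intro L2_scale half_line_exp_L2) auto
  interpret sigma_finite_measure half_line
    by (rule sigma_finite_measure_restrict_space[OF lborel.sigma_finite_measure_axioms]) simp
  have m: "hankel_op \<psi> f \<in> borel_measurable half_line"
    unfolding hankel_op_def
  proof (rule borel_measurable_lebesgue_integral)
    have id: "(\<lambda>x. x) \<in> borel_measurable half_line" by (rule half_line_measurable) simp
    have fst: "fst \<in> borel_measurable (half_line \<Otimes>\<^sub>M half_line)"
      by (rule measurable_compose[OF measurable_fst id])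
    have snd: "snd \<in> borel_measurable (half_line \<Otimes>\<^sub>M half_line)"
      by (rule measurable_compose[OF measurable_snd id])
    have "(\<lambda>p. \<psi> (fst p + snd p)) \<in> borel_measurable (half_line \<Otimes>\<^sub>M half_line)"
      by (rule measurable_compose[OF borel_measurable_add[OF fst snd] \<psi>])
    moreover have "(\<lambda>p. f (snd p)) \<in> borel_measurable (half_line \<Otimes>\<^sub>M half_line)"
      by (rule measurable_compose[OF measurable_snd L2_measurable[OF f]])
    ultimately show "(\<lambda>(x, y). \<psi> (x + y) * f y) \<in> borel_measurable (half_line \<Otimes>\<^sub>M half_line)"
      unfolding case_prod_beta by (rule borel_measurable_times)
  qed
  have AE: "AE v in half_line. (cmod (hankel_op \<psi> f v))\<^sup>2 \<le> (cmod (?e v))\<^sup>2"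
  proof (rule AE_I2)
    fix u assume "u \<in> space half_line"
    hence "u > 0" by (simp add: space_restrict_space)
    have "cmod (?e u) = k * exp (- c * u)" using k by (simp add: norm_mult mult.commute)
    with hankel_op_pointwise_bound(2)[OF f \<open>u > 0\<close>]
    show "(cmod (hankel_op \<psi> f u))\<^sup>2 \<le> (cmod (?e u))\<^sup>2"
      by (intro power_mono) (auto simp: k_def)
  qed
  show "hankel_op \<psi> f \<in> L2 half_line" by (rule L2_bound(1)[OF L2_integrable[OF e] m AE])
  have "(L2_norm half_line (hankel_op \<psi> f))\<^sup>2 \<le> (L2_norm half_line ?e)\<^sup>2"
    unfolding L2_norm_power2[of _ ?e] by (rule L2_bound(2)[OF L2_integrable[OF e] m AE])
  also have "\<dots> = k\<^sup>2 * (1 / (2 * c))"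
    using k c half_line_exp_L2(2)[of "of_real c"] by (simp add: L2_norm_scale power_mult_distrib)
  also have "k\<^sup>2 = \<epsilon>\<^sup>2 * (1 / (2 * c)) * (L2_norm half_line f)\<^sup>2"
    using c by (simp add: k_def power_mult_distrib)
  also have "\<dots> * (1 / (2 * c)) = (\<epsilon> / (2 * c) * L2_norm half_line f)\<^sup>2"
    by (simp add: power2_eq_square)
  finally show "L2_norm half_line (hankel_op \<psi> f) \<le> \<epsilon> / (2 * c) * L2_norm half_line f"
    by (rule power2_le_imp_le) (use \<epsilon> c in auto)
qed

lemma hankel_op_bounded: "bounded_op half_line (hankel_op \<psi>)"
  unfolding bounded_op_def
proof (intro conjI ballI allI)
  show "hankel_op \<psi> f \<in> L2 half_line" if "f \<in> L2 half_line" for f by (rule hankel_op_L2(1)[OF that])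
  show "\<exists>k. \<forall>f\<in>L2 half_line. L2_norm half_line (hankel_op \<psi> f) \<le> k * L2_norm half_line f"
    using hankel_op_L2(2) by blast
  show "AE x in half_line. hankel_op \<psi> (\<lambda>x. a * f x + b * g x) x = a * hankel_op \<psi> f x + b * hankel_op \<psi> g x"
    if fg: "f \<in> L2 half_line" "g \<in> L2 half_line" for f g a b
  proof (rule AE_I2)
    fix u assume "u \<in> space half_line"
    hence u: "u > 0" by (simp add: space_restrict_space)
    have "hankel_op \<psi> (\<lambda>x. a * f x + b * g x) u = (LINT v|half_line. a * (\<psi> (u + v) * f v) + b * (\<psi> (u + v) * g v))"
      unfolding hankel_op_def by (simp add: algebra_simps)
    also have "\<dots> = a * hankel_op \<psi> f u + b * hankel_op \<psi> g u"
      unfolding hankel_op_def using hankel_op_pointwise_bound(1)[OF fg(1) u] hankel_op_pointwise_bound(1)[OF fg(2) u]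
      by (subst Bochner_Integration.integral_add) auto
    finally show "hankel_op \<psi> (\<lambda>x. a * f x + b * g x) u = a * hankel_op \<psi> f u + b * hankel_op \<psi> g u" .
  qed
qed

end

text \<open>Segments of the enumeration of the integers by \<open>int_decode\<close>, with exactly N
  elements: a truncation to \<open>initial N\<close> has rank at most N and can be compared with the
  N-th singular number without reindexing.\<close>

definition initial :: "nat \<Rightarrow> int set" where
  "initial N = int_decode ` {..<N}"

lemma finite_initial [simp]: "finite (initial N)"
  by (simp add: initial_def)

lemma initial_0 [simp]: "initial 0 = {}"
  by (simp add: initial_def)

lemma initial_mono: "M \<le> N \<Longrightarrow> initial M \<subseteq> initial N"
  by (auto simp: initial_def)

lemma sum_initial: "(\<Sum>n\<in>initial N. f n) = (\<Sum>i<N. f (int_decode i))"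
  unfolding initial_def using inj_int_decode[of "{..<N}"] by (subst sum.reindex) auto

lemma has_sum_initial:
  fixes f :: "int \<Rightarrow> 'b :: {comm_monoid_add, topological_space}"
  assumes "(f has_sum S) UNIV"
  shows "(\<lambda>N. \<Sum>n\<in>initial N. f n) \<longlonglongrightarrow> S"
  using has_sum_imp_sums[of "\<lambda>n. f (int_decode n)"] assms
  unfolding has_sum_int_iff sum_initial by (simp add: sums_def)

lemma not_initial_lower:
  assumes "n \<notin> initial N"
  shows "real N \<le> 2 * \<bar>real_of_int n\<bar>"
proof -
  obtain i where i: "n = int_decode i" using surj_int_decode by (metis surjD)
  with assms have "N \<le> i" by (auto simp: initial_def not_less[symmetric])
  thus ?thesis using nat_le_abs_int_decode[of i] i by simp
qed

lemma infsum_diff':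
  fixes f g :: "int \<Rightarrow> complex"
  assumes "f summable_on UNIV" "g summable_on UNIV"
  shows "(\<Sum>\<^sub>\<infinity>n. f n - g n) = (\<Sum>\<^sub>\<infinity>n. f n) - (\<Sum>\<^sub>\<infinity>n. g n)"
  using has_sum_add[OF has_sum_infsum[OF assms(1)] has_sum_uminusI[OF has_sum_infsum[OF assms(2)]]]
  by (intro infsumI) simp

lemma norm_exp_diff_le:
  fixes z :: complex
  assumes "Re z \<ge> 0" "u \<ge> 0" "v \<ge> 0"
  shows "cmod (exp (- of_real u * z) - exp (- of_real v * z)) \<le> \<bar>u - v\<bar> * cmod z"
proof -
  have "cmod (exp (- of_real u * z) - exp (- of_real v * z)) \<le> cmod z * cmod (complex_of_real u - complex_of_real v)"
  \<comment> \<open>The mean value estimate is taken along the nonnegative real ray, which is convex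
    and on which |exp(-wz)| <= 1.\<close>
  proof (rule field_differentiable_bound[where S = "{w. Re (w * z) \<ge> 0} \<inter> of_real ` {0..}"])
    show "convex ({w. Re (w * z) \<ge> 0} \<inter> complex_of_real ` {0..})"
    proof -
      have "{w. Re (w * z) \<ge> 0} \<inter> complex_of_real ` {0..} = complex_of_real ` {0..}" using assms by auto
      thus ?thesis by (auto intro!: convex_linear_image bounded_linear.linear bounded_linear_of_real)
    qed
    show "((\<lambda>w. exp (- w * z)) has_field_derivative - z * exp (- w * z)) (at w within {w. Re (w * z) \<ge> 0} \<inter> of_real ` {0..})" for w
      by (auto intro!: derivative_eq_intros)
    show "cmod (- z * exp (- w * z)) \<le> cmod z" if "w \<in> {w. Re (w * z) \<ge> 0} \<inter> of_real ` {0..}" for w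
    proof -
      have "cmod (exp (- w * z)) \<le> 1" using that by simp
      thus ?thesis using mult_left_mono[of "cmod (exp (- w * z))" 1 "cmod z"] by (simp add: norm_mult)
    qed
  qed (use assms in auto)
  also have "cmod (complex_of_real u - complex_of_real v) = \<bar>u - v\<bar>"
    by (simp flip: of_real_diff)
  finally show ?thesis by (simp add: mult.commute)
qed

text \<open>Interpolates between the Lipschitz bound and the trivial bound 2. The exponent 1/4 is
  small enough that |z|^(1/4) / |z| = |z|^(-3/4) is still square summable along the relevant
  z.\<close>

lemma norm_exp_diff_le_powr:
  fixes z :: complex
  assumes "Re z \<ge> 0" "u \<ge> 0" "v \<ge> 0" "z \<noteq> 0"
  shows "cmod (exp (- of_real u * z) - exp (- of_real v * z)) \<le> 2 * (\<bar>u - v\<bar> * cmod z) powr (1 / 4)"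
proof (cases "\<bar>u - v\<bar> * cmod z \<le> 1")
  case True
  have "cmod (exp (- of_real u * z) - exp (- of_real v * z)) \<le> \<bar>u - v\<bar> * cmod z"
    by (rule norm_exp_diff_le) (use assms in auto)
  also have "\<dots> \<le> (\<bar>u - v\<bar> * cmod z) powr (1 / 4)"
  proof (cases "u = v")
    case False
    thus ?thesis using powr_mono'[of "1 / 4" 1 "\<bar>u - v\<bar> * cmod z"] True assms by (simp add: powr_one)
  qed simp
  also have "\<dots> \<le> 2 * (\<bar>u - v\<bar> * cmod z) powr (1 / 4)" by simp
  finally show ?thesis .
next
  case False
  have *: "cmod (exp (- of_real w * z)) \<le> 1" if "w \<ge> 0" for w using assms that by simp
  have "cmod (exp (- of_real u * z) - exp (- of_real v * z)) \<le> 2"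
    using norm_triangle_ineq4[of "exp (- of_real u * z)" "exp (- of_real v * z)"] *[OF assms(2)] *[OF assms(3)]
    by linarith
  also have "\<dots> \<le> 2 * (\<bar>u - v\<bar> * cmod z) powr (1 / 4)"
    using ge_one_powr_ge_zero[of "\<bar>u - v\<bar> * cmod z" "1 / 4"] False by simp
  finally show ?thesis .
qed

section \<open>Symbols that are sums of exponentials\<close>

text \<open>Frees the argument from Lame's equation: what matters is that the exponents form an
  arithmetic progression on a vertical line to the right of 0. A symbol with shifted argument is
  again of this type, so results at x = 0 transfer to every x >= 0.\<close>

locale exponential_system =
  fixes b :: complex and \<theta> :: real and xi :: "int \<Rightarrow> complex"
  assumes b: "Re b > 0" and \<theta>: "\<theta> > 0"
    and xi_weighted: "(\<lambda>n. (1 + \<bar>real_of_int n\<bar>)\<^sup>2 * cmod (xi n)) summable_on UNIV"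
begin

abbreviation N2 :: "(int \<Rightarrow> complex) \<Rightarrow> real" where
  "N2 \<equiv> L2_norm (count_space UNIV)"

definition lam :: "int \<Rightarrow> complex" where
  "lam n = b + \<i> * of_real \<theta> * of_int n"

definition c :: real where "c = Re b"

lemma c: "c > 0" using b by (simp add: c_def)

lemma Re_lam [simp]: "Re (lam n) = c" by (simp add: lam_def c_def)

lemma Re_lam_add: "Re (lam j + lam m) = 2 * c" by simp

lemma lam_add_nonzero: "lam j + lam m \<noteq> 0"
  using Re_lam_add[of j m] c by (metis less_numeral_extra(3) mult_pos_pos zero_complex.sel(1) zero_less_numeral)

lemma norm_exp_lam: "cmod (exp (- of_real s * lam n)) = exp (- c * s)"
  by (simp add: mult.commute)

lemma norm_exp_lam_le: "s \<ge> 0 \<Longrightarrow> cmod (exp (- of_real s * lam n)) \<le> 1"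
  using c by (simp add: norm_exp_lam)

definition X :: real where "X = (\<Sum>\<^sub>\<infinity>n. cmod (xi n))"

lemma xi_ell1: "xi \<in> ell1"
proof (rule ell1_bound(1)[OF xi_weighted])
  show "cmod (xi n) \<le> (1 + \<bar>real_of_int n\<bar>)\<^sup>2 * cmod (xi n)" for n
    using mult_right_mono[OF one_le_power[of "1 + \<bar>real_of_int n\<bar>" 2] norm_ge_zero[of "xi n"]] by simp
qed

lemma X_nonneg: "X \<ge> 0"
  unfolding X_def by (intro infsum_nonneg) auto

definition tail :: "nat \<Rightarrow> real" where
  "tail N = (\<Sum>\<^sub>\<infinity>n. if n \<in> initial N then 0 else cmod (xi n))"

lemma tail_summable: "(\<lambda>n. if n \<in> initial N then 0 else cmod (xi n)) summable_on UNIV"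
  by (rule summable_on_comparison_test[OF ell1_D[OF xi_ell1]]) auto

lemma tail_nonneg: "tail N \<ge> 0"
  unfolding tail_def by (intro infsum_nonneg) auto

text \<open>Outside \<open>initial N\<close> one has N <= 2|n|, so the weight (1 + |n|)^2 is at
  least (N + 1)^2 / 4. The quadratic decay makes the tails summable, and the tails bound the
  singular numbers.\<close>

lemma tail_decay:
  obtains C where "\<And>N. tail N \<le> C * (1 / real (Suc N) ^ 2)"
proof
  fix N
  let ?w = "\<lambda>n. 4 * (1 / real (Suc N) ^ 2) * ((1 + \<bar>real_of_int n\<bar>)\<^sup>2 * cmod (xi n))"
  have "tail N \<le> infsum ?w UNIV"
    unfolding tail_def
  proof (rule infsum_mono[OF tail_summable summable_on_cmult_right[OF xi_weighted]])
    fix n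
    show "(if n \<in> initial N then 0 else cmod (xi n)) \<le> ?w n"
    proof (cases "n \<in> initial N")
      case False
      define y where "y = real (Suc N)"
      have "y \<le> 2 * (1 + \<bar>real_of_int n\<bar>)" "y > 0" using not_initial_lower[OF False] by (simp_all add: y_def)
      hence "y ^ 2 \<le> (2 * (1 + \<bar>real_of_int n\<bar>)) ^ 2" by (intro power_mono) auto
      hence "1 \<le> (2 * (1 + \<bar>real_of_int n\<bar>)) ^ 2 / y ^ 2" using \<open>y > 0\<close> by simp
      also have "\<dots> = 4 * (1 / real (Suc N) ^ 2) * (1 + \<bar>real_of_int n\<bar>)\<^sup>2"
        unfolding power_mult_distrib y_def by simp
      finally have "1 \<le> 4 * (1 / real (Suc N) ^ 2) * (1 + \<bar>real_of_int n\<bar>)\<^sup>2" .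
      from mult_right_mono[OF this norm_ge_zero[of "xi n"]] show ?thesis using False by (simp add: mult_ac)
    qed auto
  qed
  thus "tail N \<le> (4 * (\<Sum>\<^sub>\<infinity>n. (1 + \<bar>real_of_int n\<bar>)\<^sup>2 * cmod (xi n))) * (1 / real (Suc N) ^ 2)"
    unfolding infsum_cmult_right' by (simp only: mult_ac)
qed

lemma tail_summable_nat: "summable tail"
proof -
  obtain C where C: "\<And>N. tail N \<le> C * (1 / real (Suc N) ^ 2)" using tail_decay by blast
  have "summable (\<lambda>N. 1 / real (Suc N) ^ 2)"
    using inverse_power_summable[of 2, where 'a = real] by (subst summable_Suc_iff) (simp add: inverse_eq_divide)
  from summable_mult[OF this, of C] show ?thesis
    by (rule summable_comparison_test'[of _ 0]) (use C tail_nonneg in auto)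
qed

lemma tail_tendsto_0: "tail \<longlonglongrightarrow> 0"
  by (rule summable_LIMSEQ_zero[OF tail_summable_nat])

lemma infsum_minus_initial:
  assumes g: "\<And>n. cmod (g n) \<le> K * cmod (xi n)" and K: "K \<ge> 0"
  shows "g \<in> ell1" "cmod ((\<Sum>\<^sub>\<infinity>n. g n) - (\<Sum>n\<in>initial N. g n)) \<le> K * tail N"
proof -
  show g1: "g \<in> ell1" by (rule ell1_bound(1)[OF summable_on_cmult_right[OF ell1_D[OF xi_ell1]] g])
  have "(\<Sum>\<^sub>\<infinity>n. if n \<in> initial N then g n else 0) = (\<Sum>n\<in>initial N. g n)"
  proof -
    have "(\<Sum>\<^sub>\<infinity>n. if n \<in> initial N then g n else 0) = infsum g (initial N)"
      by (rule infsum_cong_neutral) auto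
    thus ?thesis by simp
  qed
  moreover have "(\<lambda>n. if n \<in> initial N then g n else 0) summable_on UNIV"
  proof -
    have "(\<lambda>n. if n \<in> initial N then g n else 0) summable_on UNIV \<longleftrightarrow> g summable_on initial N"
      by (rule summable_on_cong_neutral) auto
    thus ?thesis by simp
  qed
  hence "(\<Sum>\<^sub>\<infinity>n. g n - (if n \<in> initial N then g n else 0)) =
      (\<Sum>\<^sub>\<infinity>n. g n) - (\<Sum>\<^sub>\<infinity>n. if n \<in> initial N then g n else 0)"
    using infsum_diff'[OF ell1_imp_summable[OF g1]] by blast
  ultimately have "(\<Sum>\<^sub>\<infinity>n. g n) - (\<Sum>n\<in>initial N. g n) = (\<Sum>\<^sub>\<infinity>n. g n - (if n \<in> initial N then g n else 0))"
    by simp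
  also have "cmod \<dots> \<le> (\<Sum>\<^sub>\<infinity>n. K * (if n \<in> initial N then 0 else cmod (xi n)))"
    by (rule norm_infsum_le[OF summable_on_cmult_right[OF tail_summable]]) (use g in auto)
  finally show "cmod ((\<Sum>\<^sub>\<infinity>n. g n) - (\<Sum>n\<in>initial N. g n)) \<le> K * tail N"
    by (simp add: infsum_cmult_right' tail_def)
qed

definition phi :: "real \<Rightarrow> complex" where
  "phi s = (\<Sum>\<^sub>\<infinity>n. xi n * exp (- of_real s * lam n))"

definition phi_part :: "nat \<Rightarrow> real \<Rightarrow> complex" where
  "phi_part N s = (\<Sum>n\<in>initial N. xi n * exp (- of_real s * lam n))"

lemma phi_term_le: "cmod (xi n * exp (- of_real s * lam n)) \<le> exp (- c * s) * cmod (xi n)"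
  unfolding norm_mult norm_exp_lam by simp

lemma phi_ell1: "(\<lambda>n. xi n * exp (- of_real s * lam n)) \<in> ell1"
  using infsum_minus_initial(1)[OF phi_term_le, of s] by simp

lemma phi_diff_le: "cmod (phi s - phi_part N s) \<le> tail N * exp (- c * s)"
  using infsum_minus_initial(2)[OF phi_term_le, of s N] unfolding phi_def phi_part_def by (simp add: mult.commute)

lemma tail_0: "tail 0 = X" by (simp add: tail_def X_def)

lemma phi_le: "cmod (phi s) \<le> X * exp (- c * s)"
  using phi_diff_le[of s 0] by (simp add: phi_part_def tail_0)

lemma phi_part_measurable: "phi_part N \<in> borel_measurable borel"
  unfolding phi_part_def by (intro borel_measurable_continuous_onI continuous_intros)

lemma phi_part_tendsto: "(\<lambda>N. phi_part N s) \<longlonglongrightarrow> phi s"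
  unfolding phi_part_def phi_def
  by (rule has_sum_initial[OF has_sum_infsum[OF ell1_imp_summable[OF phi_ell1]]])

lemma phi_measurable: "phi \<in> borel_measurable borel"
  by (rule borel_measurable_LIMSEQ_metric[OF phi_part_measurable phi_part_tendsto])

lemma exp_lam_L2:
  "(\<lambda>u. exp (- of_real u * lam n)) \<in> L2 half_line"
  "(L2_norm half_line (\<lambda>u. exp (- of_real u * lam n)))\<^sup>2 = 1 / (2 * c)"
  using half_line_exp_L2[of "lam n"] c by auto

lemma hankel_op_diff:
  assumes f: "f \<in> L2 half_line" and u: "u > 0"
  shows "hankel_op phi f u - hankel_op (phi_part N) f u = hankel_op (\<lambda>s. phi s - phi_part N s) f u"
proof -
  have "cmod (phi_part N s) \<le> (X + tail N) * exp (- c * s)" for s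
    using phi_le[of s] phi_diff_le[of s N] norm_triangle_ineq4[of "phi s" "phi s - phi_part N s"]
    by (simp add: algebra_simps)
  hence "integrable half_line (\<lambda>v. phi_part N (u + v) * f v)"
    using X_nonneg tail_nonneg[of N]
    by (intro hankel_op_pointwise_bound(1)[OF phi_part_measurable c, of "X + tail N"] f u) auto
  moreover have "integrable half_line (\<lambda>v. phi (u + v) * f v)"
    by (rule hankel_op_pointwise_bound(1)[OF phi_measurable c X_nonneg phi_le f u])
  ultimately show ?thesis unfolding hankel_op_def by (simp add: left_diff_distrib)
qed

text \<open>The exponential of u + v factorises, so each n contributes an operator of rank
  one.\<close>

lemma hankel_op_phi_part:
  assumes f: "f \<in> L2 half_line"
  shows "hankel_op (phi_part N) f u =
    (\<Sum>n\<in>initial N. (xi n * (LINT v|half_line. exp (- of_real v * lam n) * f v)) * exp (- of_real u * lam n))"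
proof -
  have i: "integrable half_line (\<lambda>v. exp (- of_real v * lam n) * f v)" for n
    by (rule L2_mult_integrable(1)[OF exp_lam_L2(1) f])
  have "hankel_op (phi_part N) f u =
      (LINT v|half_line. (\<Sum>n\<in>initial N. xi n * exp (- of_real u * lam n) * (exp (- of_real v * lam n) * f v)))"
    unfolding hankel_op_def phi_part_def sum_distrib_right
    by (intro Bochner_Integration.integral_cong refl sum.cong) (simp add: exp_add[symmetric] algebra_simps)
  also have "\<dots> = (\<Sum>n\<in>initial N. xi n * exp (- of_real u * lam n) * (LINT v|half_line. exp (- of_real v * lam n) * f v))"
    using i by (subst Bochner_Integration.integral_sum) auto
  finally show ?thesis by (simp add: mult_ac)
qed

lemma hankel_error:
  assumes f: "f \<in> L2 half_line"
  shows "L2_norm half_line (\<lambda>u. hankel_op phi f u - hankel_op (phi_part N) f u) \<le> tail N / (2 * c) * L2_norm half_line f"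
proof -
  have meas: "(\<lambda>s. phi s - phi_part N s) \<in> borel_measurable borel"
    by (intro borel_measurable_diff phi_measurable phi_part_measurable)
  have "cmod (phi s - phi_part N s) \<le> tail N * exp (- c * s)" for s by (rule phi_diff_le)
  note H = hankel_op_L2[OF meas c tail_nonneg this f]
  have pb: "hankel_op phi f \<in> L2 half_line"
    by (rule hankel_op_L2(1)[OF phi_measurable c X_nonneg phi_le f])
  have pp: "hankel_op (phi_part N) f \<in> L2 half_line"
    unfolding hankel_op_phi_part[OF f, abs_def] by (intro L2_sum L2_scale exp_lam_L2)
  have "L2_norm half_line (\<lambda>u. hankel_op phi f u - hankel_op (phi_part N) f u) =
      L2_norm half_line (hankel_op (\<lambda>s. phi s - phi_part N s) f)"
    using L2_measurable[OF L2_diff[OF pb pp]] L2_measurable[OF H(1)] hankel_op_diff[OF f]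
    by (intro L2_norm_cong_AE) (auto intro!: AE_I2 simp: space_restrict_space)
  thus ?thesis using H(2) by simp
qed

theorem hankel_trace_class: "trace_class half_line (hankel_op phi)"
proof (rule trace_classI[where F = "\<lambda>N. hankel_op (phi_part N)" and \<epsilon> = "\<lambda>N. tail N / (2 * c)"])
  show "bounded_op half_line (hankel_op phi)"
    by (rule hankel_op_bounded[OF phi_measurable c X_nonneg phi_le])
  show "bounded_op half_line (hankel_op (phi_part N))" for N
  proof (rule hankel_op_bounded[OF phi_part_measurable c])
    show "X + tail N \<ge> 0" using X_nonneg tail_nonneg[of N] by simp
    show "cmod (phi_part N s) \<le> (X + tail N) * exp (- c * s)" for s
      using phi_le[of s] phi_diff_le[of s N] norm_triangle_ineq4[of "phi s" "phi s - phi_part N s"]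
      by (simp add: algebra_simps)
  qed
  show "rank_at_most half_line N (hankel_op (phi_part N))" for N
    unfolding rank_at_most_def
  proof (intro exI[of _ "\<lambda>i u. exp (- of_real u * lam (int_decode i))"] conjI allI impI ballI)
    fix f assume f: "f \<in> L2 half_line"
    show "\<exists>k. AE x in half_line. hankel_op (phi_part N) f x = (\<Sum>i<N. k i * exp (- of_real x * lam (int_decode i)))"
      unfolding hankel_op_phi_part[OF f] sum_initial
      by (intro exI[of _ "\<lambda>i. xi (int_decode i) * (LINT v|half_line. exp (- of_real v * lam (int_decode i)) * f v)"]) simp
  qed (rule exp_lam_L2)
  show "summable (\<lambda>N. tail N / (2 * c))" using tail_summable_nat by (rule summable_divide)
qed (use hankel_error tail_nonneg c in auto)

text \<open>The integral of exp(-s(\<lambda>_j + \<lambda>_m)) over s >= x, kept apart from the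
  factor \<xi>_j of the matrix of R_x.\<close>

definition R_kernel :: "real \<Rightarrow> int \<Rightarrow> int \<Rightarrow> complex" where
  "R_kernel x j m = exp (- of_real x * (lam j + lam m)) / (lam j + lam m)"

text \<open>The entries of \<^const>\<open>R_kernel\<close> are of size \<open>row\<^sup>-\<^sup>1\<close>, split as \<open>row\<^bsup>-1/4\<^esup> row\<^bsup>-3/4\<^esup>\<close>: the second factor is
  still square summable, and the first one is spent on the continuity in \<open>x\<close>.\<close>

definition row :: "int \<Rightarrow> real" where
  "row p = cmod (2 * b + \<i> * of_real \<theta> * of_int p)"

lemma norm_lam_add: "cmod (lam j + lam m) = row (j + m)"
  by (simp add: lam_def row_def algebra_simps)

lemma row_ge: "row p \<ge> 2 * c"
proof -
  have "2 * c = Re (2 * b + \<i> * of_real \<theta> * of_int p)" by (simp add: c_def)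
  thus ?thesis unfolding row_def by (simp only: complex_Re_le_cmod)
qed

lemma row_summable: "(\<lambda>p. row p powr - (3 / 2)) summable_on UNIV"
proof -
  \<comment> \<open>From \<theta>|p| <= row p + 2|b|: the constants 2|b| and \<theta> are replaced
    by multiples of row p, using row p >= 2c, so that \<theta>(1 + |p|) is bounded by row p times
    the denominator of \<kappa>.\<close>
  define \<kappa> where "\<kappa> = \<theta> / (1 + 2 * cmod b / (2 * c) + \<theta> / (2 * c))"
  have den: "1 + 2 * cmod b / (2 * c) + \<theta> / (2 * c) > 0" using c \<theta> by (intro add_pos_nonneg) auto
  have \<kappa>: "\<kappa> > 0" using den \<theta> by (simp add: \<kappa>_def)
  have le: "\<kappa> * (1 + \<bar>real_of_int p\<bar>) \<le> row p" for p
  proof -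
    have "\<theta> * \<bar>real_of_int p\<bar> = cmod ((2 * b + \<i> * of_real \<theta> * of_int p) - 2 * b)"
      using \<theta> by (simp add: norm_mult)
    also have "\<dots> \<le> row p + 2 * cmod b"
      unfolding row_def by (rule order_trans[OF norm_triangle_ineq4]) (simp add: norm_mult)
    also have "\<dots> \<le> row p + 2 * cmod b * (row p / (2 * c))"
      using row_ge[of p] c mult_left_mono[of 1 "row p / (2 * c)" "2 * cmod b"] by simp
    finally have 1: "\<theta> * \<bar>real_of_int p\<bar> \<le> row p + 2 * cmod b * (row p / (2 * c))" .
    have "\<theta> * 1 \<le> \<theta> * (row p / (2 * c))" using row_ge[of p] c \<theta> by (intro mult_left_mono) auto
    with 1 have "\<theta> * (1 + \<bar>real_of_int p\<bar>) \<le> row p * (1 + 2 * cmod b / (2 * c) + \<theta> / (2 * c))"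
      by (simp add: algebra_simps)
    thus ?thesis using den by (simp add: \<kappa>_def field_simps)
  qed
  show ?thesis
  proof (rule summable_on_comparison_test)
    show "(\<lambda>p. \<kappa> powr - (3 / 2) * (1 + \<bar>real_of_int p\<bar>) powr - (3 / 2)) summable_on UNIV"
      by (intro summable_on_cmult_right summable_on_int_powr) simp
    fix p :: int
    have "row p powr - (3 / 2) \<le> (\<kappa> * (1 + \<bar>real_of_int p\<bar>)) powr - (3 / 2)"
      using le[of p] \<kappa> by (intro powr_mono2') auto
    thus "row p powr - (3 / 2) \<le> \<kappa> powr - (3 / 2) * (1 + \<bar>real_of_int p\<bar>) powr - (3 / 2)"
      using \<kappa> by (simp add: powr_mult)
  qed auto
qed

definition row_norm :: real where "row_norm = sqrt (\<Sum>\<^sub>\<infinity>p. row p powr - (3 / 2))"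

lemma row_norm_nonneg: "row_norm \<ge> 0"
  unfolding row_norm_def by (intro real_sqrt_ge_zero infsum_nonneg) auto

text \<open>\<open>row\<close> is evaluated at j + m, so a shift of the summation index removes j:
  the bound is the same for all rows.\<close>

lemma row_ell2:
  assumes g: "\<And>m. cmod (g m) \<le> K * row (j + m) powr - (3 / 4)" and K: "K \<ge> 0"
  shows "g \<in> ell2" "N2 g \<le> K * row_norm"
proof -
  have bij: "bij_betw (\<lambda>m. j + m) UNIV (UNIV :: int set)"
    by (rule bij_betw_byWitness[where f' = "\<lambda>m. m - j"]) auto
  have s: "(\<lambda>m. K\<^sup>2 * row (j + m) powr - (3 / 2)) summable_on UNIV"
    using summable_on_reindex_bij_betw[OF bij, of "\<lambda>p. row p powr - (3 / 2)"] row_summable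
    by (intro summable_on_cmult_right) simp
  have le: "(cmod (g m))\<^sup>2 \<le> K\<^sup>2 * row (j + m) powr - (3 / 2)" for m
  proof -
    have "(cmod (g m))\<^sup>2 \<le> (K * row (j + m) powr - (3 / 4))\<^sup>2" using g by (intro power_mono) auto
    also have "\<dots> = K\<^sup>2 * row (j + m) powr - (3 / 2)"
      by (simp add: power_mult_distrib power2_eq_square powr_add[symmetric])
    finally show ?thesis .
  qed
  show e: "g \<in> ell2" unfolding ell2_iff by (rule summable_on_comparison_test[OF s]) (use le in auto)
  have "(N2 g)\<^sup>2 \<le> (\<Sum>\<^sub>\<infinity>m. K\<^sup>2 * row (j + m) powr - (3 / 2))"
    unfolding ell2_norm_power2[OF e] using e le by (intro infsum_mono s) (auto simp: ell2_iff)
  also have "\<dots> = K\<^sup>2 * (\<Sum>\<^sub>\<infinity>p. row p powr - (3 / 2))"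
    using infsum_reindex_bij_betw[OF bij, of "\<lambda>p. row p powr - (3 / 2)"] by (simp add: infsum_cmult_right')
  also have "\<dots> = (K * row_norm)\<^sup>2"
    unfolding row_norm_def power_mult_distrib by (simp add: infsum_nonneg)
  finally show "N2 g \<le> K * row_norm" by (rule power2_le_imp_le) (use K row_norm_nonneg in auto)
qed

text \<open>Bounds the norms of all rows of \<open>R_kernel\<close> at x = 0; the first factor comes
  from row^(-1/4) <= (2c)^(-1/4).\<close>

definition Q :: real where "Q = (2 * c) powr - (1 / 4) * row_norm"

lemma Q_nonneg: "Q \<ge> 0" using row_norm_nonneg by (simp add: Q_def)

lemma row_pos: "row p > 0" using row_ge[of p] c by linarith

lemma R_kernel_ell2:
  shows "R_kernel x j \<in> ell2" "N2 (R_kernel x j) \<le> exp (- 2 * c * x) * Q"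
proof -
  have "cmod (R_kernel x j m) \<le> (exp (- 2 * c * x) * (2 * c) powr - (1 / 4)) * row (j + m) powr - (3 / 4)" for m
  proof -
    have r: "row (j + m) > 0" by (rule row_pos)
    have "cmod (R_kernel x j m) = exp (- 2 * c * x) * row (j + m) powr - 1"
      using r by (simp add: R_kernel_def norm_divide norm_lam_add powr_minus_divide mult_ac)
    also have "row (j + m) powr - 1 = row (j + m) powr - (1 / 4) * row (j + m) powr - (3 / 4)"
      by (simp add: powr_add[symmetric])
    also have "\<dots> \<le> (2 * c) powr - (1 / 4) * row (j + m) powr - (3 / 4)"
      using row_ge[of "j + m"] c by (intro mult_right_mono powr_mono2') auto
    finally show ?thesis by simp
  qed
  from row_ell2[OF this] show "R_kernel x j \<in> ell2" "N2 (R_kernel x j) \<le> exp (- 2 * c * x) * Q"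
    by (simp_all add: Q_def)
qed

lemma R_kernel_diff_ell2:
  assumes "u \<ge> 0" "v \<ge> 0"
  shows "(\<lambda>m. R_kernel u j m - R_kernel v j m) \<in> ell2"
    "N2 (\<lambda>m. R_kernel u j m - R_kernel v j m) \<le> 2 * \<bar>u - v\<bar> powr (1 / 4) * row_norm"
proof -
  have "cmod (R_kernel u j m - R_kernel v j m) \<le> (2 * \<bar>u - v\<bar> powr (1 / 4)) * row (j + m) powr - (3 / 4)" for m
  proof -
    have r: "row (j + m) > 0" by (rule row_pos)
    have "cmod (R_kernel u j m - R_kernel v j m) =
        cmod (exp (- of_real u * (lam j + lam m)) - exp (- of_real v * (lam j + lam m))) / row (j + m)"
      by (simp add: R_kernel_def norm_divide norm_lam_add diff_divide_distrib[symmetric])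
    also have "\<dots> \<le> 2 * (\<bar>u - v\<bar> * row (j + m)) powr (1 / 4) / row (j + m)"
      using norm_exp_diff_le_powr[of "lam j + lam m" u v] assms c r lam_add_nonzero
      by (intro divide_right_mono) (auto simp: norm_lam_add)
    also have "\<dots> = 2 * \<bar>u - v\<bar> powr (1 / 4) * (row (j + m) powr (1 / 4) * row (j + m) powr - 1)"
      using r by (simp add: powr_mult powr_minus_divide)
    also have "row (j + m) powr (1 / 4) * row (j + m) powr - 1 = row (j + m) powr - (3 / 4)"
      by (subst powr_add[symmetric]) simp
    finally show ?thesis .
  qed
  from row_ell2[OF this] show "(\<lambda>m. R_kernel u j m - R_kernel v j m) \<in> ell2"
    "N2 (\<lambda>m. R_kernel u j m - R_kernel v j m) \<le> 2 * \<bar>u - v\<bar> powr (1 / 4) * row_norm" by auto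
qed

definition R :: "real \<Rightarrow> (int \<Rightarrow> complex) \<Rightarrow> int \<Rightarrow> complex" where
  "R x a j = xi j * (\<Sum>\<^sub>\<infinity>m. R_kernel x j m * a m)"

lemma R_op_eq: "R_op lam xi x = R x"
proof (intro ext)
  fix a j
  have out: "output_op (semigroup_op lam s (\<lambda>i. if i = m then 1 else 0)) = exp (- of_real s * lam m)" for s m
  proof -
    have "output_op (semigroup_op lam s (\<lambda>i. if i = m then 1 else 0)) = infsum (\<lambda>n. exp (- of_real s * lam n)) {m}"
      unfolding output_op_def semigroup_op_def by (rule infsum_cong_neutral) auto
    thus ?thesis by simp
  qed
  have "(LBINT s:{x..}. semigroup_op lam s (input_op xi (output_op
         (semigroup_op lam s (\<lambda>i. if i = m then 1 else 0)))) j) = xi j * R_kernel x j m" for m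
  proof -
    have "(LBINT s:{x..}. semigroup_op lam s (input_op xi (output_op
         (semigroup_op lam s (\<lambda>i. if i = m then 1 else 0)))) j) =
         (LBINT s:{x..}. xi j * exp (- of_real s * (lam j + lam m)))"
      unfolding out unfolding semigroup_op_def input_op_def
      by (intro set_lebesgue_integral_cong allI impI) (auto simp: exp_add[symmetric] algebra_simps)
    also have "\<dots> = xi j * R_kernel x j m"
      using complex_exp_integral(2)[of "lam j + lam m" x] c by (simp add: R_kernel_def)
    finally show ?thesis .
  qed
  hence "R_op lam xi x a j = (\<Sum>\<^sub>\<infinity>m. xi j * (R_kernel x j m * a m))"
    unfolding R_op_def by (simp add: mult.assoc)
  thus "R_op lam xi x a j = R x a j" by (simp add: R_def infsum_cmult_right')
qed

text \<open>The Cauchy-Schwarz inequality in each row, with the uniform row bound. The image of any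
  square summable sequence is thus dominated by a multiple of \<xi>, hence lies in
  \<open>ell1\<close>, the domain of C.\<close>

lemma R_le:
  assumes a: "a \<in> ell2"
  shows "cmod (R x a j) \<le> exp (- 2 * c * x) * Q * N2 a * cmod (xi j)"
proof -
  have "cmod (\<Sum>\<^sub>\<infinity>m. R_kernel x j m * a m) \<le> N2 (R_kernel x j) * N2 a"
    by (rule ell2_mult(2)[OF R_kernel_ell2(1) a])
  also have "\<dots> \<le> exp (- 2 * c * x) * Q * N2 a" using R_kernel_ell2(2) by (intro mult_right_mono) auto
  finally have le: "cmod (\<Sum>\<^sub>\<infinity>m. R_kernel x j m * a m) \<le> exp (- 2 * c * x) * Q * N2 a" .
  have "cmod (R x a j) = cmod (xi j) * cmod (\<Sum>\<^sub>\<infinity>m. R_kernel x j m * a m)" by (simp add: R_def norm_mult)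
  also have "\<dots> \<le> cmod (xi j) * (exp (- 2 * c * x) * Q * N2 a)" using le by (intro mult_left_mono) auto
  finally show ?thesis by (simp only: mult_ac)
qed

lemma R_diff_le:
  assumes a: "a \<in> ell2" and uv: "u \<ge> 0" "v \<ge> 0"
  shows "cmod (R u a j - R v a j) \<le> 2 * \<bar>u - v\<bar> powr (1 / 4) * row_norm * N2 a * cmod (xi j)"
proof -
  have "R u a j - R v a j = xi j * ((\<Sum>\<^sub>\<infinity>m. R_kernel u j m * a m) - (\<Sum>\<^sub>\<infinity>m. R_kernel v j m * a m))"
    by (simp add: R_def right_diff_distrib)
  also have "(\<Sum>\<^sub>\<infinity>m. R_kernel u j m * a m) - (\<Sum>\<^sub>\<infinity>m. R_kernel v j m * a m) = (\<Sum>\<^sub>\<infinity>m. (R_kernel u j m - R_kernel v j m) * a m)"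
    unfolding left_diff_distrib
    by (rule infsum_diff'[symmetric]) (rule abs_summable_summable, rule ell2_mult(1)[OF R_kernel_ell2(1) a])+
  finally have eq: "cmod (R u a j - R v a j) = cmod (xi j) * cmod (\<Sum>\<^sub>\<infinity>m. (R_kernel u j m - R_kernel v j m) * a m)"
    by (simp add: norm_mult)
  have "cmod (\<Sum>\<^sub>\<infinity>m. (R_kernel u j m - R_kernel v j m) * a m) \<le> N2 (\<lambda>m. R_kernel u j m - R_kernel v j m) * N2 a"
    by (rule ell2_mult(2)[OF R_kernel_diff_ell2(1)[OF uv] a])
  also have "\<dots> \<le> 2 * \<bar>u - v\<bar> powr (1 / 4) * row_norm * N2 a"
    using R_kernel_diff_ell2(2)[OF uv] by (intro mult_right_mono) auto
  finally have "cmod (xi j) * cmod (\<Sum>\<^sub>\<infinity>m. (R_kernel u j m - R_kernel v j m) * a m) \<le>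
      cmod (xi j) * (2 * \<bar>u - v\<bar> powr (1 / 4) * row_norm * N2 a)"
    by (intro mult_left_mono) auto
  thus ?thesis unfolding eq by (simp only: mult_ac)
qed

lemma ell1_xi_bound:
  assumes "\<And>j. cmod (g j) \<le> K * cmod (xi j)"
  shows "g \<in> ell1" "(\<Sum>\<^sub>\<infinity>n. cmod (g n)) \<le> K * X" "g \<in> ell2" "N2 g \<le> K * X"
proof -
  show g: "g \<in> ell1" by (rule ell1_bound(1)[OF summable_on_cmult_right[OF ell1_D[OF xi_ell1]] assms])
  show X: "(\<Sum>\<^sub>\<infinity>n. cmod (g n)) \<le> K * X"
    using ell1_bound(2)[OF summable_on_cmult_right[OF ell1_D[OF xi_ell1]] assms]
    by (simp add: infsum_cmult_right' X_def)
  show "g \<in> ell2" "N2 g \<le> K * X" using ell1_subset_ell2[OF g] X by auto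
qed

lemma R_ell1: "a \<in> ell2 \<Longrightarrow> R x a \<in> ell1" and R_ell2: "a \<in> ell2 \<Longrightarrow> R x a \<in> ell2"
  and N2_R_le: "a \<in> ell2 \<Longrightarrow> N2 (R x a) \<le> exp (- 2 * c * x) * Q * N2 a * X"
  using ell1_xi_bound[OF R_le] by auto

lemma R_linear:
  assumes "f \<in> ell2" "g \<in> ell2"
  shows "R x (\<lambda>n. p * f n + q * g n) j = p * R x f j + q * R x g j"
proof -
  have s: "(\<lambda>m. R_kernel x j m * f m) summable_on UNIV" "(\<lambda>m. R_kernel x j m * g m) summable_on UNIV"
    by (rule abs_summable_summable, rule ell2_mult(1)[OF R_kernel_ell2(1)], rule assms)+
  have "(\<Sum>\<^sub>\<infinity>m. R_kernel x j m * (p * f m + q * g m)) = (\<Sum>\<^sub>\<infinity>m. p * (R_kernel x j m * f m) + q * (R_kernel x j m * g m))"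
    by (simp add: algebra_simps)
  also have "\<dots> = (\<Sum>\<^sub>\<infinity>m. p * (R_kernel x j m * f m)) + (\<Sum>\<^sub>\<infinity>m. q * (R_kernel x j m * g m))"
    by (intro infsum_add summable_on_cmult_right s)
  also have "\<dots> = p * (\<Sum>\<^sub>\<infinity>m. R_kernel x j m * f m) + q * (\<Sum>\<^sub>\<infinity>m. R_kernel x j m * g m)"
    by (simp only: infsum_cmult_right')
  finally show ?thesis by (simp add: R_def algebra_simps)
qed

lemma R_bounded: "bounded_op (count_space UNIV) (R x)"
  unfolding bounded_op_def AE_count_space
proof (intro conjI ballI allI)
  show "\<exists>k. \<forall>f\<in>ell2. N2 (R x f) \<le> k * N2 f"
    using N2_R_le by (intro exI[of _ "exp (- 2 * c * x) * Q * X"]) (simp add: mult_ac)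
qed (auto simp: R_ell2 R_linear)

text \<open>Cutting off the output coordinates alone gives rank N at once. The discarded coordinates
  are dominated by the remaining \<xi>_j, so the error is a multiple of the tail.\<close>

theorem R_trace_class: "trace_class (count_space UNIV) (R x)"
proof (rule trace_classI[where F = "\<lambda>N a j. if j \<in> initial N then R x a j else 0"
    and \<epsilon> = "\<lambda>N. exp (- 2 * c * x) * Q * tail N"])
  show "bounded_op (count_space UNIV) (R x)" by (rule R_bounded)
  have le: "cmod (if j \<in> initial N then R x a j else 0) \<le> exp (- 2 * c * x) * Q * N2 a * cmod (xi j)" if "a \<in> ell2" for a N j
    using R_le[OF that, of x j] Q_nonneg by auto
  show "bounded_op (count_space UNIV) (\<lambda>a j. if j \<in> initial N then R x a j else 0)" for N
    unfolding bounded_op_def AE_count_space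
  proof (intro conjI ballI allI)
    show "(\<lambda>j. if j \<in> initial N then R x a j else 0) \<in> ell2" if "a \<in> ell2" for a
      by (rule ell1_xi_bound(3)[OF le[OF that]])
    have "N2 (\<lambda>j. if j \<in> initial N then R x a j else 0) \<le> (exp (- 2 * c * x) * Q * X) * N2 a" if "a \<in> ell2" for a
      using ell1_xi_bound(4)[OF le[OF that, of _ N]] by (simp add: mult_ac)
    thus "\<exists>k. \<forall>a\<in>ell2. N2 (\<lambda>j. if j \<in> initial N then R x a j else 0) \<le> k * N2 a" by blast
  qed (auto simp: R_linear)
  show "rank_at_most (count_space UNIV) N (\<lambda>a j. if j \<in> initial N then R x a j else 0)" for N
    unfolding rank_at_most_def AE_count_space
  proof (intro exI[of _ "\<lambda>i j. if j = int_decode i then 1 else 0"] conjI allI impI ballI)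
    fix i show "(\<lambda>j. if j = int_decode i then 1 else 0) \<in> ell2"
    proof -
      have "(\<lambda>n. (cmod (if n = int_decode i then 1 else 0))\<^sup>2) summable_on UNIV \<longleftrightarrow> (\<lambda>_. 1 :: real) summable_on {int_decode i}"
        by (rule summable_on_cong_neutral) auto
      thus ?thesis unfolding ell2_iff by simp
    qed
  next
    fix a
    have "(if j \<in> initial N then R x a j else 0) = (\<Sum>i<N. R x a (int_decode i) * (if j = int_decode i then 1 else 0))" for j
      unfolding sum_initial[symmetric, of "\<lambda>i. R x a i * (if j = i then 1 else 0)"] by (simp add: if_distrib cong: if_cong)
    thus "\<exists>k. \<forall>j\<in>UNIV. (if j \<in> initial N then R x a j else 0) = (\<Sum>i<N. k i * (if j = int_decode i then 1 else 0))"
      by (intro exI[of _ "\<lambda>i. R x a (int_decode i)"]) blast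
  qed
  show "N2 (\<lambda>j. R x a j - (if j \<in> initial N then R x a j else 0)) \<le> exp (- 2 * c * x) * Q * tail N * N2 a"
    if a: "a \<in> ell2" for a N
  proof -
    let ?g = "\<lambda>j. R x a j - (if j \<in> initial N then R x a j else 0)"
    have "cmod (?g j) \<le> exp (- 2 * c * x) * Q * N2 a * (if j \<in> initial N then 0 else cmod (xi j))" for j
      using R_le[OF a, of x j] by auto
    note b = ell1_bound[OF summable_on_cmult_right[OF tail_summable] this]
    show ?thesis
      using ell1_subset_ell2(2)[OF b(1)] b(2)[unfolded infsum_cmult_right'] unfolding tail_def by (simp only: mult_ac order_trans)
  qed
  show "summable (\<lambda>N. exp (- 2 * c * x) * Q * tail N)" by (intro summable_mult tail_summable_nat)
qed (use Q_nonneg tail_nonneg in auto)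

end

section \<open>The integral equation\<close>

lemma ell1_functional_finite:
  fixes l :: "(int \<Rightarrow> complex) \<Rightarrow> complex"
  assumes lin: "\<And>f g p q. f \<in> ell1 \<Longrightarrow> g \<in> ell1 \<Longrightarrow> l (\<lambda>n. p * f n + q * g n) = p * l f + q * l g"
    and J: "finite J"
  shows "(\<lambda>n. if n \<in> J then f n else 0) \<in> ell1"
    and "l (\<lambda>n. if n \<in> J then f n else 0) = (\<Sum>m\<in>J. f m * l (\<lambda>n. if n = m then 1 else 0))"
proof -
  have mem: "(\<lambda>n. if n \<in> J then f n else 0) \<in> ell1" if "finite J" for J and f :: "int \<Rightarrow> complex"
  proof -
    have "(\<lambda>n. cmod (if n \<in> J then f n else 0)) summable_on UNIV \<longleftrightarrow> (\<lambda>n. cmod (f n)) summable_on J"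
      by (rule summable_on_cong_neutral) auto
    thus ?thesis using that by (simp add: ell1_def)
  qed
  show "(\<lambda>n. if n \<in> J then f n else 0) \<in> ell1" by (rule mem[OF J])
  show "l (\<lambda>n. if n \<in> J then f n else 0) = (\<Sum>m\<in>J. f m * l (\<lambda>n. if n = m then 1 else 0))"
    using J
  proof (induction J rule: finite_induct)
    case empty
    show ?case using lin[OF mem[of "{}"] mem[of "{}"], of 0 f 0 f] by simp
  next
    case (insert m J)
    have "(\<lambda>n. if n \<in> insert m J then f n else 0) =
        (\<lambda>n. f m * (if n \<in> {m} then 1 else 0) + 1 * (if n \<in> J then f n else 0))"
      using insert by auto
    hence "l (\<lambda>n. if n \<in> insert m J then f n else 0) =
        l (\<lambda>n. f m * (if n \<in> {m} then 1 else 0) + 1 * (if n \<in> J then f n else 0))" by (rule arg_cong)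
    also have "\<dots> = f m * l (\<lambda>n. if n \<in> {m} then 1 else 0) + 1 * l (\<lambda>n. if n \<in> J then f n else 0)"
      by (rule lin) (use mem[of "{m}" "\<lambda>_. 1"] mem[OF insert(1)] in auto)
    finally show ?case using insert by simp
  qed
qed

text \<open>A bounded functional on \<open>ell1\<close> is determined by its values on the unit
  vectors, since the truncations of f converge to f in the norm of \<open>ell1\<close>. This turns
  an exchange of the functional with an integral into one of a sum with an integral.\<close>

lemma ell1_functional:
  fixes l :: "(int \<Rightarrow> complex) \<Rightarrow> complex"
  assumes lin: "\<And>f g p q. f \<in> ell1 \<Longrightarrow> g \<in> ell1 \<Longrightarrow> l (\<lambda>n. p * f n + q * g n) = p * l f + q * l g"
    and bound: "\<And>f. f \<in> ell1 \<Longrightarrow> cmod (l f) \<le> C * (\<Sum>\<^sub>\<infinity>n. cmod (f n))"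
  shows "cmod (l (\<lambda>n. if n = m then 1 else 0)) \<le> C"
    and "f \<in> ell1 \<Longrightarrow> ((\<lambda>m. f m * l (\<lambda>n. if n = m then 1 else 0)) has_sum l f) UNIV"
proof -
  define L where "L m = l (\<lambda>n. if n = m then 1 else 0)" for m
  have L: "cmod (L m) \<le> C" for m
  proof -
    have "(\<Sum>\<^sub>\<infinity>n. cmod (if n = m then 1 else 0)) = infsum (\<lambda>_. 1) {m}"
      by (rule infsum_cong_neutral) auto
    moreover have "(\<lambda>n. if n \<in> {m} then 1 else 0) \<in> ell1"
      by (rule ell1_functional_finite(1)[OF lin]) auto
    ultimately show ?thesis unfolding L_def using bound[of "\<lambda>n. if n = m then 1 else 0"] by simp
  qed
  thus "cmod (l (\<lambda>n. if n = m then 1 else 0)) \<le> C" by (simp add: L_def)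
  have C: "C \<ge> 0" using L[of 0] norm_ge_zero[of "L 0"] by linarith
  assume f: "f \<in> ell1"
  have "(\<lambda>m. f m * L m) \<in> ell1"
    by (rule ell1_bound(1)[OF summable_on_cmult_right[OF ell1_D[OF f], of C]])
       (use L in \<open>auto simp: norm_mult mult.commute[of C] intro: mult_left_mono\<close>)
  then obtain S where S: "((\<lambda>m. f m * L m) has_sum S) UNIV"
    using ell1_imp_summable unfolding summable_on_def by blast
  have "(\<lambda>N. \<Sum>m\<in>initial N. f m * L m) \<longlonglongrightarrow> l f"
  proof -
    have "(\<lambda>N. l f - (\<Sum>m\<in>initial N. f m * L m)) \<longlonglongrightarrow> 0"
    proof (rule Lim_null_comparison)
      define F where "F = (\<Sum>\<^sub>\<infinity>n. cmod (f n))"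
      have "(\<lambda>N. F - (\<Sum>n\<in>initial N. cmod (f n))) \<longlonglongrightarrow> F - F"
        unfolding F_def by (intro tendsto_intros has_sum_initial has_sum_infsum ell1_D f)
      from tendsto_mult_left[OF this, of C]
      show "(\<lambda>N. C * (F - (\<Sum>n\<in>initial N. cmod (f n)))) \<longlonglongrightarrow> 0" by simp
      have "norm (l f - (\<Sum>m\<in>initial N. f m * L m)) \<le> C * (F - (\<Sum>n\<in>initial N. cmod (f n)))" for N
      proof -
        let ?t = "\<lambda>n. if n \<in> initial N then f n else 0"
        have t: "?t \<in> ell1" by (rule ell1_functional_finite(1)[OF lin]) auto
        have et: "l ?t = (\<Sum>m\<in>initial N. f m * l (\<lambda>n. if n = m then 1 else 0))"
          by (rule ell1_functional_finite(2)[OF lin]) auto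
        have "l f - (\<Sum>m\<in>initial N. f m * L m) = l (\<lambda>n. 1 * f n + (- 1) * ?t n)"
          unfolding lin[OF f t] L_def et by simp
        also have "cmod \<dots> \<le> C * (\<Sum>\<^sub>\<infinity>n. cmod (1 * f n + (- 1) * ?t n))"
          using ell1_diff[OF f t] by (intro bound) simp
        also have "(\<Sum>\<^sub>\<infinity>n. cmod (1 * f n + (- 1) * ?t n)) = (\<Sum>\<^sub>\<infinity>n. cmod (f n) + - cmod (?t n))"
          by (intro infsum_cong) auto
        also have "\<dots> = F + (\<Sum>\<^sub>\<infinity>n. - cmod (?t n))"
          unfolding F_def using ell1_D[OF f] ell1_D[OF t] by (intro infsum_add) (auto simp: summable_on_uminus)
        also have "(\<Sum>\<^sub>\<infinity>n. - cmod (?t n)) = - (\<Sum>\<^sub>\<infinity>n. cmod (?t n))" by (rule infsum_uminus)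
        also have "(\<Sum>\<^sub>\<infinity>n. cmod (?t n)) = infsum (\<lambda>n. cmod (f n)) (initial N)"
          by (rule infsum_cong_neutral) auto
        finally show ?thesis by simp
      qed
      thus "\<forall>\<^sub>F N in sequentially. norm (l f - (\<Sum>m\<in>initial N. f m * L m)) \<le> C * (F - (\<Sum>n\<in>initial N. cmod (f n)))"
        by simp
    qed
    from tendsto_diff[OF tendsto_const[of "l f"] this] show ?thesis by simp
  qed
  with has_sum_initial[OF S] have "S = l f" by (rule LIMSEQ_unique)
  thus "((\<lambda>m. f m * l (\<lambda>n. if n = m then 1 else 0)) has_sum l f) UNIV" using S by (simp add: L_def)
qed

context exponential_system
begin

definition input_vec :: "real \<Rightarrow> int \<Rightarrow> complex" where
  "input_vec y n = exp (- of_real y * lam n) * xi n"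

lemma input_vec_eq: "semigroup_op lam y (input_op xi 1) = input_vec y"
  by (simp add: fun_eq_iff semigroup_op_def input_op_def input_vec_def)

lemma input_vec_le: "cmod (input_vec y n) \<le> exp (- c * y) * cmod (xi n)"
  unfolding input_vec_def norm_mult norm_exp_lam by simp

lemmas input_vec_ell = ell1_xi_bound[OF input_vec_le]

lemma output_input_vec: "output_op (semigroup_op lam s (input_vec y)) = phi (s + y)"
  unfolding output_op_def semigroup_op_def input_vec_def phi_def
  by (intro infsum_cong) (simp add: exp_add[symmetric] algebra_simps)

text \<open>On \<open>ell1\<close> the weak definition of R_x agrees with the integral of the
  operator function, coordinate by coordinate. The majorant of the exchange is |\<xi>_j| |a_m|
  exp(-2cs).\<close>

theorem R_integral:
  assumes a: "a \<in> ell1"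
  shows "set_integrable lborel {x..} (\<lambda>s. semigroup_op lam s (input_op xi (output_op (semigroup_op lam s a))) j)"
    and "R x a j = (LBINT s:{x..}. semigroup_op lam s (input_op xi (output_op (semigroup_op lam s a))) j)"
proof -
  define f where "f m s = indicator {x..} s *\<^sub>R (xi j * a m * exp (- of_real s * (lam j + lam m)))" for m and s :: real
  have sm: "(\<lambda>m. exp (- of_real s * lam m) * a m) summable_on UNIV" if "s \<ge> 0" for s
    by (rule ell1_imp_summable[OF ell1_bound(1)[OF ell1_D[OF a]]])
       (use that norm_exp_lam_le[OF that] in \<open>auto simp: norm_mult intro: mult_left_le_one_le\<close>)
  have inf: "(\<Sum>\<^sub>\<infinity>m. f m s) = indicator {x..} s *\<^sub>R semigroup_op lam s (input_op xi (output_op (semigroup_op lam s a))) j" for s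
  proof -
    have "(\<Sum>\<^sub>\<infinity>m. f m s) = (\<Sum>\<^sub>\<infinity>m. (indicator {x..} s *\<^sub>R (exp (- of_real s * lam j) * xi j)) * (exp (- of_real s * lam m) * a m))"
      unfolding f_def by (intro infsum_cong) (simp add: algebra_simps exp_diff exp_minus exp_add field_simps)
    also have "\<dots> = (indicator {x..} s *\<^sub>R (exp (- of_real s * lam j) * xi j)) * (\<Sum>\<^sub>\<infinity>m. exp (- of_real s * lam m) * a m)"
      by (rule infsum_cmult_right')
    finally show ?thesis by (simp add: semigroup_op_def input_op_def output_op_def mult_ac)
  qed
  have meas: "f m \<in> borel_measurable lborel" for m
    unfolding f_def
    by (intro borel_measurable_scaleR borel_measurable_indicator borel_measurable_continuous_onI continuous_intros) auto
  have h: "integrable lborel (\<lambda>s. indicator {x..} s *\<^sub>R exp (- (2 * c) * s))"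
    using exp_decay_integral[of "2 * c" x] c by (simp add: set_integrable_def)
  have w: "(\<lambda>m. cmod (xi j) * cmod (a m)) summable_on UNIV"
    by (intro summable_on_cmult_right ell1_D a)
  have b: "cmod (f m s) \<le> (cmod (xi j) * cmod (a m)) * (indicator {x..} s *\<^sub>R exp (- (2 * c) * s))" for m s
    by (simp add: f_def norm_mult mult_ac split: split_indicator)
  note I = integral_infsum_int[of f lborel "\<lambda>s. indicator {x..} s *\<^sub>R exp (- (2 * c) * s)", OF meas h _ w _ b]
  show "set_integrable lborel {x..} (\<lambda>s. semigroup_op lam s (input_op xi (output_op (semigroup_op lam s a))) j)"
    using I(1) unfolding inf set_integrable_def by simp
  have "(LINT s|lborel. f m s) = xi j * (R_kernel x j m * a m)" for m
  proof -
    have "(LINT s|lborel. f m s) = (LINT s|lborel. (xi j * a m) * (indicator {x..} s *\<^sub>R exp (- of_real s * (lam j + lam m))))"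
      by (simp add: f_def)
    also have "\<dots> = (xi j * a m) * (LBINT s:{x..}. exp (- of_real s * (lam j + lam m)))"
      unfolding set_lebesgue_integral_def by (rule integral_mult_right_zero)
    also have "\<dots> = xi j * (R_kernel x j m * a m)"
      using complex_exp_integral(2)[of "lam j + lam m" x] c by (simp add: R_kernel_def)
    finally show ?thesis .
  qed
  with I(3) have "((\<lambda>m. xi j * (R_kernel x j m * a m)) has_sum (LINT s|lborel. (\<Sum>\<^sub>\<infinity>m. f m s))) UNIV" by simp
  hence "(\<Sum>\<^sub>\<infinity>m. xi j * (R_kernel x j m * a m)) = (LINT s|lborel. (\<Sum>\<^sub>\<infinity>m. f m s))" by (rule infsumI)
  thus "R x a j = (LBINT s:{x..}. semigroup_op lam s (input_op xi (output_op (semigroup_op lam s a))) j)"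
    by (simp add: inf R_def infsum_cmult_right' set_lebesgue_integral_def)
qed

text \<open>\<open>Q * X\<close> bounds the norm of R_x for all x >= 0, so one condition on \<mu>
  serves every x. The summand 1 keeps the corresponding radius well defined if \<open>Q * X\<close>
  is 0.\<close>

lemma invertible_small:
  assumes "cmod \<mu> * (Q * X + 1) \<le> 1 / 2" "x \<ge> 0"
  shows "invertible_op (count_space UNIV) (\<lambda>a n. a n + \<mu> * R x a n)"
proof (rule invertible_op_one_plus_small)
  show "bounded_op (count_space UNIV) (\<lambda>a n. \<mu> * R x a n)"
    unfolding bounded_op_def AE_count_space
  proof (intro conjI ballI allI)
    show "\<exists>k. \<forall>f\<in>ell2. N2 (\<lambda>n. \<mu> * R x f n) \<le> k * N2 f"
      using mult_left_mono[OF N2_R_le norm_ge_zero[of \<mu>]]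
      by (intro exI[of _ "cmod \<mu> * (exp (- 2 * c * x) * Q * X)"]) (simp add: L2_norm_scale mult_ac)
  qed (auto simp: R_linear algebra_simps intro: L2_scale R_ell2)
  show "N2 (\<lambda>n. \<mu> * R x a n) \<le> 1 / 2 * N2 a" if a: "a \<in> ell2" for a
  proof -
    have "N2 (\<lambda>n. \<mu> * R x a n) = cmod \<mu> * N2 (R x a)" by (rule L2_norm_scale)
    also have "\<dots> \<le> cmod \<mu> * (exp (- 2 * c * x) * Q * N2 a * X)"
      by (intro mult_left_mono N2_R_le a) auto
    also have "\<dots> = exp (- 2 * c * x) * (cmod \<mu> * (Q * X)) * N2 a" by (simp only: mult_ac)
    also have "\<dots> \<le> 1 * (1 / 2) * N2 a"
    proof (intro mult_right_mono mult_mono)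
      show "cmod \<mu> * (Q * X) \<le> 1 / 2"
        using assms(1) norm_ge_zero[of \<mu>] unfolding distrib_left mult_1_right by linarith
    qed (use assms(2) c Q_nonneg X_nonneg in auto)
    finally show ?thesis by simp
  qed
qed

context
  fixes \<mu> :: complex and x :: real
  assumes x: "x \<ge> 0"
    and inv: "invertible_op (count_space UNIV) (\<lambda>a n. a n + \<mu> * R x a n)"
begin

definition res :: "(int \<Rightarrow> complex) \<Rightarrow> int \<Rightarrow> complex" where
  "res = resolvent_op lam xi \<mu> x"

lemma res:
  assumes "f \<in> ell2"
  shows "res f \<in> ell2" "res f n + \<mu> * R x (res f) n = f n"
proof -
  have ex: "f \<in> (\<lambda>a n. a n + \<mu> * R x a n) ` ell2"
    using invertible_op_ell2(1)[OF inv assms] by blast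
  have r: "res f = inv_into ell2 (\<lambda>a n. a n + \<mu> * R x a n) f"
    unfolding res_def resolvent_op_def R_op_eq ..
  show "res f \<in> ell2" unfolding r by (rule inv_into_into[OF ex])
  show "res f n + \<mu> * R x (res f) n = f n"
    using fun_cong[OF f_inv_into_f[OF ex], of n] unfolding r .
qed

lemma res_unique:
  assumes "a \<in> ell2" "\<And>n. a n + \<mu> * R x a n = f n" "f \<in> ell2"
  shows "res f = a"
  using invertible_op_ell2(2)[OF inv res(1)[OF assms(3)] assms(1)] res(2)[OF assms(3)] assms(2) by (simp add: fun_eq_iff)

lemma res_linear:
  assumes "f \<in> ell2" "g \<in> ell2"
  shows "res (\<lambda>n. p * f n + q * g n) = (\<lambda>n. p * res f n + q * res g n)"
proof (rule res_unique)
  fix n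
  have "p * f n + q * g n = p * (res f n + \<mu> * R x (res f) n) + q * (res g n + \<mu> * R x (res g) n)"
    by (simp only: res(2)[OF assms(1)] res(2)[OF assms(2)])
  thus "p * res f n + q * res g n + \<mu> * R x (\<lambda>n. p * res f n + q * res g n) n = p * f n + q * g n"
    by (simp only: R_linear[OF res(1)[OF assms(1)] res(1)[OF assms(2)]]) (simp add: algebra_simps)
qed (intro L2_add L2_scale res assms)+

lemma exp_R_le_1: "exp (- 2 * c * x) \<le> 1" using x c by simp

text \<open>In res f = f - \<mu> R_x (res f) the correction is dominated by \<xi>. The resolvent,
  known to be bounded on \<open>ell2\<close>, is therefore bounded on \<open>ell1\<close> as well,
  and C can be applied to its values there.\<close>

lemma res_ell1:
  obtains C where "C \<ge> 0"
    "\<And>f. f \<in> ell1 \<Longrightarrow> res f \<in> ell1" "\<And>f. f \<in> ell1 \<Longrightarrow> (\<Sum>\<^sub>\<infinity>n. cmod (res f n)) \<le> C * (\<Sum>\<^sub>\<infinity>n. cmod (f n))"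
proof -
  obtain S where S: "S \<ge> 0" "\<And>a. a \<in> ell2 \<Longrightarrow> N2 a \<le> S * N2 (\<lambda>n. a n + \<mu> * R x a n)"
    using invertible_op_ell2(3)[OF inv] by blast
  \<comment> \<open>S bounds the inverse on \<open>ell2\<close>, and \<open>Q * X\<close> bounds R_x
    as a map from \<open>ell2\<close> to \<open>ell1\<close>.\<close>
  define C where "C = 1 + cmod \<mu> * (Q * X * S)"
  have r: "res f \<in> ell1 \<and> (\<Sum>\<^sub>\<infinity>n. cmod (res f n)) \<le> C * (\<Sum>\<^sub>\<infinity>n. cmod (f n))" if f: "f \<in> ell1" for f
  proof -
    define F where "F = (\<Sum>\<^sub>\<infinity>n. cmod (f n))"
    have f2: "f \<in> ell2" "N2 f \<le> F" using ell1_subset_ell2[OF f] by (auto simp: F_def)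
    have "N2 (res f) \<le> S * N2 f" using S(2)[OF res(1)[OF f2(1)]] res(2)[OF f2(1)] by simp
    also have "\<dots> \<le> S * F" using f2(2) S(1) by (rule mult_left_mono)
    finally have n: "N2 (res f) \<le> S * F" .
    have b: "cmod (res f n) \<le> cmod (f n) + cmod \<mu> * (Q * (S * F)) * cmod (xi n)" for n
    proof -
      have "cmod (R x (res f) n) \<le> exp (- 2 * c * x) * Q * N2 (res f) * cmod (xi n)" by (rule R_le[OF res(1)[OF f2(1)]])
      also have "\<dots> \<le> 1 * Q * (S * F) * cmod (xi n)"
        using n exp_R_le_1 Q_nonneg by (intro mult_right_mono mult_mono) auto
      finally have "cmod \<mu> * cmod (R x (res f) n) \<le> cmod \<mu> * (Q * (S * F)) * cmod (xi n)"
        using mult_left_mono[OF _ norm_ge_zero[of \<mu>]] by (fastforce simp: mult.assoc)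
      moreover have "res f n = f n - \<mu> * R x (res f) n" using res(2)[OF f2(1), of n] by (simp add: algebra_simps)
      hence "cmod (res f n) \<le> cmod (f n) + cmod \<mu> * cmod (R x (res f) n)"
        using norm_triangle_ineq4[of "f n" "\<mu> * R x (res f) n"] by (simp add: norm_mult)
      ultimately show ?thesis by linarith
    qed
    have sm: "(\<lambda>n. cmod (f n) + cmod \<mu> * (Q * (S * F)) * cmod (xi n)) summable_on UNIV"
      by (intro summable_on_add summable_on_cmult_right ell1_D f xi_ell1)
    have "infsum (\<lambda>n. cmod (f n) + cmod \<mu> * (Q * (S * F)) * cmod (xi n)) UNIV = F + cmod \<mu> * (Q * (S * F)) * X"
      unfolding F_def X_def infsum_cmult_right'[symmetric]
      by (intro infsum_add summable_on_cmult_right ell1_D f xi_ell1)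
    also have "\<dots> = C * F" by (simp add: C_def algebra_simps)
    finally show ?thesis using ell1_bound[OF sm b] by (simp add: F_def)
  qed
  show ?thesis
    by (rule that[of C]) (use r S(1) Q_nonneg X_nonneg in \<open>auto simp: C_def\<close>)
qed

text \<open>\<open>T\<^sub>\<mu>(x, z) = - \<mu> l(e\<^sup>-\<^sup>z\<^sup>A B)\<close> for a bounded functional \<open>l\<close> on \<open>\<ell>\<^sup>1\<close>, so that \<open>l\<close> may be taken
  out of the integral.\<close>

theorem T_kernel_integral_equation:
  assumes y: "y \<ge> x"
  shows "set_integrable lborel {x..} (\<lambda>z. T_kernel lam xi \<mu> x z * phi (z + y))"
    and "T_kernel lam xi \<mu> x y + \<mu> * phi (x + y) + \<mu> * (LBINT z:{x..}. T_kernel lam xi \<mu> x z * phi (z + y)) = 0"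
proof -
  define l where "l f = output_op (semigroup_op lam x (res f))" for f
  obtain C where C: "C \<ge> 0" "\<And>f. f \<in> ell1 \<Longrightarrow> res f \<in> ell1"
    "\<And>f. f \<in> ell1 \<Longrightarrow> (\<Sum>\<^sub>\<infinity>n. cmod (res f n)) \<le> C * (\<Sum>\<^sub>\<infinity>n. cmod (f n))"
    using res_ell1 by blast
  have out: "(\<lambda>n. exp (- of_real x * lam n) * a n) \<in> ell1"
    "cmod (output_op (semigroup_op lam x a)) \<le> (\<Sum>\<^sub>\<infinity>n. cmod (a n))" if a: "a \<in> ell1" for a
  proof -
    have le: "cmod (exp (- of_real x * lam n) * a n) \<le> cmod (a n)" for n
      unfolding norm_mult by (rule mult_left_le_one_le) (use norm_exp_lam_le[OF x] in auto)
    show "(\<lambda>n. exp (- of_real x * lam n) * a n) \<in> ell1" by (rule ell1_bound(1)[OF ell1_D[OF a] le])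
    show "cmod (output_op (semigroup_op lam x a)) \<le> (\<Sum>\<^sub>\<infinity>n. cmod (a n))"
      unfolding output_op_def semigroup_op_def by (rule norm_infsum_le[OF ell1_D[OF a] le])
  qed
  have out_lin: "output_op (semigroup_op lam x (\<lambda>n. p * f n + q * g n)) =
      p * output_op (semigroup_op lam x f) + q * output_op (semigroup_op lam x g)"
    if "f \<in> ell1" "g \<in> ell1" for f g p q
  proof -
    have "output_op (semigroup_op lam x (\<lambda>n. p * f n + q * g n)) =
      (\<Sum>\<^sub>\<infinity>n. p * (exp (- of_real x * lam n) * f n) + q * (exp (- of_real x * lam n) * g n))"
      unfolding output_op_def semigroup_op_def by (simp add: algebra_simps)
    also have "\<dots> = (\<Sum>\<^sub>\<infinity>n. p * (exp (- of_real x * lam n) * f n)) + (\<Sum>\<^sub>\<infinity>n. q * (exp (- of_real x * lam n) * g n))"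
      by (intro infsum_add summable_on_cmult_right ell1_imp_summable out(1) that)
    finally show ?thesis unfolding output_op_def semigroup_op_def infsum_cmult_right' .
  qed
  have lin: "l (\<lambda>n. p * f n + q * g n) = p * l f + q * l g" if "f \<in> ell1" "g \<in> ell1" for f g p q
    unfolding l_def res_linear[OF ell1_subset_ell2(1)[OF that(1)] ell1_subset_ell2(1)[OF that(2)]]
    by (rule out_lin) (intro C(2) that)+
  have bd: "cmod (l f) \<le> C * (\<Sum>\<^sub>\<infinity>n. cmod (f n))" if "f \<in> ell1" for f
    unfolding l_def using out(2)[OF C(2)[OF that]] C(3)[OF that] by linarith
  define L where "L m = l (\<lambda>n. if n = m then 1 else 0)" for m
  have L: "cmod (L m) \<le> C" for m unfolding L_def by (rule ell1_functional(1)[OF lin bd])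
  have Ls: "((\<lambda>m. f m * L m) has_sum l f) UNIV" if "f \<in> ell1" for f
    unfolding L_def by (rule ell1_functional(2)[OF lin bd that])
  have T: "T_kernel lam xi \<mu> x z = - \<mu> * l (input_vec z)" for z
    unfolding T_kernel_def l_def res_def input_vec_eq ..
  define f where "f m z = indicator {x..} z *\<^sub>R (input_vec z m * L m * phi (z + y))" for m z
  have inf: "(\<Sum>\<^sub>\<infinity>m. f m z) = indicator {x..} z *\<^sub>R (l (input_vec z) * phi (z + y))" for z
  proof -
    have "(\<Sum>\<^sub>\<infinity>m. f m z) = (\<Sum>\<^sub>\<infinity>m. (indicator {x..} z *\<^sub>R phi (z + y)) * (input_vec z m * L m))"
      unfolding f_def by (intro infsum_cong) simp
    also have "\<dots> = (indicator {x..} z *\<^sub>R phi (z + y)) * l (input_vec z)"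
      unfolding infsum_cmult_right' using infsumI[OF Ls[OF input_vec_ell(1)]] by simp
    finally show ?thesis by (simp add: mult_ac)
  qed
  have meas: "f m \<in> borel_measurable lborel" for m
    unfolding f_def input_vec_def
    by (intro borel_measurable_scaleR borel_measurable_times borel_measurable_indicator measurable_compose[OF _ phi_measurable]
        borel_measurable_continuous_onI continuous_intros) auto
  have h: "integrable lborel (\<lambda>s. indicator {x..} s *\<^sub>R exp (- c * s))"
    using exp_decay_integral[OF c, of x] by (simp add: set_integrable_def)
  have w: "(\<lambda>m. C * X * cmod (xi m)) summable_on UNIV" by (intro summable_on_cmult_right ell1_D xi_ell1)
  have b: "cmod (f m z) \<le> (C * X * cmod (xi m)) * (indicator {x..} z *\<^sub>R exp (- c * z))" for m z
  proof (cases "z \<ge> x")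
    case True
    have "cmod (phi (z + y)) \<le> X * exp (- c * (z + y))" by (rule phi_le)
    also have "\<dots> \<le> X * 1" using True x y c X_nonneg by (intro mult_left_mono) auto
    finally have p: "cmod (phi (z + y)) \<le> X" by simp
    have "cmod (f m z) = cmod (input_vec z m) * cmod (L m) * cmod (phi (z + y))"
      using True by (simp add: f_def norm_mult)
    also have "\<dots> \<le> (exp (- c * z) * cmod (xi m)) * C * X"
      by (intro mult_mono input_vec_le L p) (use C(1) in auto)
    finally show ?thesis using True by (simp add: mult_ac)
  qed (simp add: f_def)
  note I = integral_infsum_int[of f lborel "\<lambda>s. indicator {x..} s *\<^sub>R exp (- c * s)", OF meas h _ w _ b]
  have I1: "set_integrable lborel {x..} (\<lambda>z. l (input_vec z) * phi (z + y))"
    using I(1) C(1) X_nonneg unfolding inf set_integrable_def by simp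
  show "set_integrable lborel {x..} (\<lambda>z. T_kernel lam xi \<mu> x z * phi (z + y))"
    unfolding T mult.assoc by (rule set_integrable_mult_right) (rule I1)
  \<comment> \<open>By \<open>R_integral\<close> and C exp(-zA) exp(-yA) B = \<phi>(z + y), this is
    the integral of \<phi>(z + y) exp(-zA) B over z >= x. Applying l to it yields the integral in
    the equation, up to the factor -\<mu>.\<close>
  define r where "r = R x (input_vec y)"
  have r1: "r \<in> ell1" unfolding r_def by (rule R_ell1[OF input_vec_ell(3)])
  have "(LINT z|lborel. f m z) = r m * L m" for m
  proof -
    have e: "r m = (LBINT s:{x..}. input_vec s m * phi (s + y))"
      unfolding r_def R_integral(2)[OF input_vec_ell(1)] output_input_vec
      by (simp add: semigroup_op_def input_op_def input_vec_def mult_ac)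
    have "(LINT z|lborel. f m z) = (LINT z|lborel. L m * (indicator {x..} z *\<^sub>R (input_vec z m * phi (z + y))))"
      by (simp add: f_def mult_ac)
    also have "\<dots> = L m * r m"
      unfolding e set_lebesgue_integral_def by (rule integral_mult_right_zero)
    finally show ?thesis by (simp add: mult.commute)
  qed
  with I(3) have "((\<lambda>m. r m * L m) has_sum (LINT z|lborel. (\<Sum>\<^sub>\<infinity>m. f m z))) UNIV"
    using C(1) X_nonneg by simp
  with Ls[OF r1] have "(LINT z|lborel. (\<Sum>\<^sub>\<infinity>m. f m z)) = l r" using has_sum_unique by blast
  hence I2: "(LBINT z:{x..}. l (input_vec z) * phi (z + y)) = l r"
    by (simp add: inf set_lebesgue_integral_def)
  define a where "a = res (input_vec y)"
  have a: "a \<in> ell1" "a \<in> ell2" "\<And>n. a n + \<mu> * R x a n = input_vec y n"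
    unfolding a_def using C(2)[OF input_vec_ell(1)] res[OF input_vec_ell(3)] by auto
  have "res r = R x a"
  \<comment> \<open>The resolvent commutes with R_x: R_x a is the solution for the right side R_x (I
    + \<mu> R_x) a = r.\<close>
  proof (rule res_unique[OF R_ell2[OF a(2)]])
    show "r \<in> ell2" unfolding r_def by (rule R_ell2[OF input_vec_ell(3)])
    fix n
    have "r n = R x (\<lambda>n. 1 * a n + \<mu> * R x a n) n" unfolding r_def using a(3) by simp
    also have "\<dots> = 1 * R x a n + \<mu> * R x (R x a) n" by (rule R_linear[OF a(2) R_ell2[OF a(2)]])
    finally show "R x a n + \<mu> * R x (R x a) n = r n" by simp
  qed
  hence lr: "l r = output_op (semigroup_op lam x (R x a))" by (simp add: l_def)
  \<comment> \<open>Expanding exp(-yA) B = (I + \<mu> R_x) a inside C exp(-xA) exp(-yA) B gives one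
    term for T(x, y) and one for the integral.\<close>
  have "phi (x + y) = output_op (semigroup_op lam x (\<lambda>n. 1 * a n + \<mu> * R x a n))"
    unfolding output_input_vec[symmetric] using a(3) by (simp add: fun_eq_iff[symmetric])
  also have "\<dots> = 1 * output_op (semigroup_op lam x a) + \<mu> * output_op (semigroup_op lam x (R x a))"
    by (rule out_lin[OF a(1) R_ell1[OF a(2)]])
  finally have ph: "phi (x + y) = l (input_vec y) + \<mu> * l r" unfolding lr by (simp add: l_def a_def)
  have "(LBINT z:{x..}. T_kernel lam xi \<mu> x z * phi (z + y)) = - \<mu> * l r"
    unfolding T mult.assoc I2[symmetric] by (rule set_integral_mult_right)
  thus "T_kernel lam xi \<mu> x y + \<mu> * phi (x + y) + \<mu> * (LBINT z:{x..}. T_kernel lam xi \<mu> x z * phi (z + y)) = 0"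
    unfolding T ph by (simp add: algebra_simps)
qed

end

end

section \<open>The Fredholm determinant\<close>

text \<open>Turns the sum of the \<lambda>_n brought down by a differentiation into a product over
  the same indices, so that differentiated terms still have a multiplicative majorant.\<close>

lemma sum_le_prod_one_plus:
  fixes x :: "'a \<Rightarrow> real"
  assumes "finite S" "\<And>n. n \<in> S \<Longrightarrow> x n \<ge> 0"
  shows "(\<Sum>n\<in>S. x n) \<le> (\<Prod>n\<in>S. 1 + x n)"
proof -
  have "(\<Sum>n\<in>S. x n) + 1 \<le> (\<Prod>n\<in>S. 1 + x n)"
    using assms
  proof (induction S rule: finite_induct)
    case (insert n S)
    have IH: "(\<Sum>n\<in>S. x n) + 1 \<le> (\<Prod>n\<in>S. 1 + x n)" using insert by auto
    have "x n \<ge> 0" "(\<Sum>n\<in>S. x n) \<ge> 0" using insert by (auto intro: sum_nonneg)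
    hence "x n * 1 \<le> x n * (\<Prod>n\<in>S. 1 + x n)" using IH by (intro mult_left_mono) linarith+
    with IH show ?case using insert by (simp add: distrib_right)
  qed simp
  thus ?thesis by simp
qed

lemma tendsto_fdet:
  assumes "finite F" "\<And>i j. i \<in> F \<Longrightarrow> j \<in> F \<Longrightarrow> ((\<lambda>k. A k i j) \<longlongrightarrow> B i j) G"
  shows "((\<lambda>k. fdet F (A k)) \<longlongrightarrow> fdet F B) G"
  unfolding fdet_def using assms
  by (intro tendsto_sum tendsto_mult tendsto_const tendsto_prod) (auto simp: permutes_in_image)

text \<open>Tail of the expansion of \<open>\<Prod>n. 1 + w n\<close> over the finite subsets of \<open>\<int>\<close>; it dominates the tails of
  all sums over finite subsets with terms bounded by \<open>\<Prod>n\<in>S. w n\<close>.\<close>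

definition prod_tail :: "(int \<Rightarrow> real) \<Rightarrow> nat \<Rightarrow> real" where
  "prod_tail w M = lim (\<lambda>N. \<Prod>n\<in>initial N. 1 + w n) - (\<Prod>n\<in>initial M. 1 + w n)"

context
  fixes w :: "int \<Rightarrow> real"
  assumes w: "w summable_on UNIV" "\<And>n. w n \<ge> 0"
begin

lemma initial_prod_tendsto:
  "(\<lambda>N. \<Prod>n\<in>initial N. 1 + w n) \<longlonglongrightarrow> lim (\<lambda>N. \<Prod>n\<in>initial N. 1 + w n)"
  "(\<Prod>n\<in>initial N. 1 + w n) \<le> lim (\<lambda>N. \<Prod>n\<in>initial N. 1 + w n)"
proof -
  let ?W = "\<lambda>N. \<Prod>n\<in>initial N. 1 + w n"
  have inc: "incseq ?W"
    unfolding incseq_def using w(2) initial_mono by (intro allI impI prod_mono2) (auto intro: prod_nonneg)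
  have bdd: "?W N \<le> exp (infsum w UNIV)" for N
  proof -
    have "?W N \<le> exp (\<Sum>n\<in>initial N. w n)" by (rule prod_le_exp_sum) (rule w(2))
    also have "\<dots> \<le> exp (infsum w UNIV)" using w by (simp add: finite_sum_le_infsum)
    finally show ?thesis .
  qed
  obtain V where V: "?W \<longlonglongrightarrow> V" "\<forall>i. ?W i \<le> V" using incseq_convergent[OF inc] bdd by blast
  show "?W \<longlonglongrightarrow> lim ?W" "?W N \<le> lim ?W" using V by (simp_all add: limI)
qed

lemma prod_tail_tendsto: "prod_tail w \<longlonglongrightarrow> 0"
  unfolding prod_tail_def[abs_def]
  using tendsto_diff[OF tendsto_const[of "lim (\<lambda>N. \<Prod>n\<in>initial N. 1 + w n)"] initial_prod_tendsto(1)] by simp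

context
  fixes t :: "int set \<Rightarrow> complex"
  assumes t: "\<And>S. finite S \<Longrightarrow> cmod (t S) \<le> (\<Prod>n\<in>S. w n)"
begin

lemma initial_Pow_diff_le:
  assumes "M \<le> N"
  shows "cmod ((\<Sum>S\<in>Pow (initial N). t S) - (\<Sum>S\<in>Pow (initial M). t S)) \<le> prod_tail w M"
proof -
  have "cmod ((\<Sum>S\<in>Pow (initial N). t S) - (\<Sum>S\<in>Pow (initial M). t S)) \<le>
      (\<Prod>n\<in>initial N. 1 + w n) - (\<Prod>n\<in>initial M. 1 + w n)"
    by (rule sum_Pow_diff_le[OF finite_initial initial_mono[OF assms] t])
  also have "\<dots> \<le> prod_tail w M" using initial_prod_tendsto(2)[of N] by (simp add: prod_tail_def)
  finally show ?thesis .
qed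

lemma initial_Pow_convergent: "convergent (\<lambda>N. \<Sum>S\<in>Pow (initial N). t S)"
proof (rule Cauchy_convergent, rule CauchyI')
  fix e :: real assume "e > 0"
  with LIMSEQ_D[OF prod_tail_tendsto] obtain K where K: "\<And>n. n \<ge> K \<Longrightarrow> norm (prod_tail w n - 0) < e" by blast
  show "\<exists>K. \<forall>m\<ge>K. \<forall>n>m. dist (\<Sum>S\<in>Pow (initial m). t S) (\<Sum>S\<in>Pow (initial n). t S) < e"
  proof (intro exI[of _ K] allI impI)
    fix m n assume mn: "m \<ge> K" "n > m"
    have "dist (\<Sum>S\<in>Pow (initial m). t S) (\<Sum>S\<in>Pow (initial n). t S) \<le> prod_tail w m"
      using initial_Pow_diff_le[of m n] mn by (simp add: dist_norm norm_minus_commute)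
    also have "\<dots> < e" using K[OF mn(1)] by simp
    finally show "dist (\<Sum>S\<in>Pow (initial m). t S) (\<Sum>S\<in>Pow (initial n). t S) < e" .
  qed
qed

lemma initial_Pow_limit_le:
  assumes L: "(\<lambda>N. \<Sum>S\<in>Pow (initial N). t S) \<longlonglongrightarrow> L"
  shows "cmod (L - (\<Sum>S\<in>Pow (initial M). t S)) \<le> prod_tail w M"
proof (rule LIMSEQ_le_const2)
  show "(\<lambda>N. cmod ((\<Sum>S\<in>Pow (initial N). t S) - (\<Sum>S\<in>Pow (initial M). t S))) \<longlonglongrightarrow> cmod (L - (\<Sum>S\<in>Pow (initial M). t S))"
    by (intro tendsto_intros L)
qed (use initial_Pow_diff_le in blast)

end

end

section \<open>Expansion of the truncated determinants, their limit and their derivative\<close>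

context exponential_system
begin

text \<open>A Cauchy-type determinant. Its entries are the integrals of exp(-u\<lambda>_i)
  exp(-u\<lambda>_j) over the half line, which makes it the limit of the Gram determinants of the
  finite sections.\<close>

definition kap :: "int set \<Rightarrow> complex" where
  "kap S = fdet S (\<lambda>i j. 1 / (lam i + lam j))"

text \<open>The share of one index in the bound for a term: 1/(2c) from a matrix entry, 2(1 + |n|)
  from the factorial and |\<xi>_n| from the coefficient.\<close>

definition w :: "int \<Rightarrow> real" where
  "w n = 1 / (2 * c) * (2 * (1 + \<bar>real_of_int n\<bar>)) * cmod (xi n)"

lemma minor_le:
  assumes S: "finite S" and A: "\<And>i j. i \<in> S \<Longrightarrow> j \<in> S \<Longrightarrow> cmod (A i j) \<le> 1 / (2 * c)"
  shows "cmod (fdet S A) \<le> (\<Prod>n\<in>S. 1 / (2 * c) * (2 * (1 + \<bar>real_of_int n\<bar>)))"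
proof -
  have "cmod (fdet S A) \<le> fact (card S) * (1 / (2 * c)) ^ card S" by (rule norm_fdet_le[OF S A])
  also have "\<dots> \<le> (\<Prod>n\<in>S. 2 * (1 + real_of_int \<bar>n\<bar>)) * (1 / (2 * c)) ^ card S"
    using fact_card_le_prod_abs[OF S] c by (intro mult_right_mono) auto
  also have "\<dots> = (\<Prod>n\<in>S. 1 / (2 * c) * (2 * (1 + \<bar>real_of_int n\<bar>)))"
    by (simp add: prod.distrib prod_dividef power_divide)
  finally show ?thesis .
qed

lemma norm_inverse_lam_add: "cmod (1 / (lam i + lam j)) \<le> 1 / (2 * c)"
  using row_ge[of "i + j"] c by (simp add: norm_divide norm_lam_add frac_le)

lemma minor_term_le:
  assumes S: "finite S" and A: "\<And>i j. i \<in> S \<Longrightarrow> j \<in> S \<Longrightarrow> cmod (A i j) \<le> 1 / (2 * c)"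
    and d: "\<And>n. cmod (d n) \<le> r * cmod (xi n)"
  shows "cmod ((- 1) ^ card S * (\<Prod>n\<in>S. d n) * fdet S A) \<le> (\<Prod>n\<in>S. r * w n)"
proof -
  have "cmod ((- 1) ^ card S * (\<Prod>n\<in>S. d n) * fdet S A) = (\<Prod>n\<in>S. cmod (d n)) * cmod (fdet S A)"
    by (simp add: norm_mult norm_power prod_norm)
  also have "\<dots> \<le> (\<Prod>n\<in>S. r * cmod (xi n)) * (\<Prod>n\<in>S. 1 / (2 * c) * (2 * (1 + \<bar>real_of_int n\<bar>)))"
    by (intro mult_mono prod_mono minor_le[OF S A] prod_nonneg conjI d)
       (auto intro: order_trans[OF norm_ge_zero d])
  also have "\<dots> = (\<Prod>n\<in>S. r * w n)"
    by (simp add: prod.distrib[symmetric] w_def mult_ac)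
  finally show ?thesis .
qed

lemma w_nonneg: "w n \<ge> 0" using c by (simp add: w_def)

lemma w_summable: "w summable_on UNIV"
proof (rule summable_on_comparison_test[OF summable_on_cmult_right[OF xi_weighted, of "1 / c"]])
  fix n :: int
  have "(1 + \<bar>real_of_int n\<bar>) ^ 1 \<le> (1 + \<bar>real_of_int n\<bar>)\<^sup>2" by (rule power_increasing) auto
  hence "(1 + \<bar>real_of_int n\<bar>) * cmod (xi n) \<le> (1 + \<bar>real_of_int n\<bar>)\<^sup>2 * cmod (xi n)"
    by (intro mult_right_mono) auto
  hence "1 / c * ((1 + \<bar>real_of_int n\<bar>) * cmod (xi n)) \<le> 1 / c * ((1 + \<bar>real_of_int n\<bar>)\<^sup>2 * cmod (xi n))"
    using c by (intro mult_left_mono) auto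
  moreover have "1 / (2 * c) * (2 * x) * y = 1 / c * (x * y)" for x y :: real by simp
  ultimately show "w n \<le> 1 / c * ((1 + \<bar>real_of_int n\<bar>)\<^sup>2 * cmod (xi n))"
    unfolding w_def by presburger
qed (rule w_nonneg)

text \<open>The weight for differentiated terms. It is of order (1 + |n|)^2 |\<xi>_n|, which
  exhausts the summability assumed in the locale.\<close>

definition w' :: "int \<Rightarrow> real" where
  "w' n = w n * (1 + 2 * cmod (lam n))"

lemma norm_lam_le: "cmod (lam n) \<le> (cmod b + \<theta>) * (1 + \<bar>real_of_int n\<bar>)"
proof -
  have "cmod (lam n) \<le> cmod b + \<theta> * \<bar>real_of_int n\<bar>"
    unfolding lam_def by (rule order_trans[OF norm_triangle_ineq]) (use \<theta> in \<open>simp add: norm_mult\<close>)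
  also have "\<dots> \<le> (cmod b + \<theta>) * (1 + \<bar>real_of_int n\<bar>)" using \<theta> by (simp add: algebra_simps)
  finally show ?thesis .
qed

lemma w'_nonneg: "w' n \<ge> 0" using w_nonneg by (simp add: w'_def)

lemma w'_summable: "w' summable_on UNIV"
proof (rule summable_on_comparison_test[OF summable_on_cmult_right[OF xi_weighted, of "1 / c * (1 + 2 * (cmod b + \<theta>))"]])
  fix n :: int
  define m where "m = 1 + \<bar>real_of_int n\<bar>"
  have m: "m \<ge> 1" by (simp add: m_def)
  have "1 + 2 * cmod (lam n) \<le> (1 + 2 * (cmod b + \<theta>)) * m"
    using norm_lam_le[of n] m by (simp add: m_def[symmetric] algebra_simps)
  hence "w' n \<le> w n * ((1 + 2 * (cmod b + \<theta>)) * m)"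
    unfolding w'_def by (intro mult_left_mono w_nonneg)
  also have "\<dots> = 1 / c * (1 + 2 * (cmod b + \<theta>)) * (m\<^sup>2 * cmod (xi n))"
    by (simp add: w_def m_def[symmetric] power2_eq_square)
  finally show "w' n \<le> 1 / c * (1 + 2 * (cmod b + \<theta>)) * ((1 + \<bar>real_of_int n\<bar>)\<^sup>2 * cmod (xi n))"
    by (simp add: m_def)
qed (rule w'_nonneg)

text \<open>The contribution of the principal minor with index set S to the determinant of I -
  R_u.\<close>

definition t :: "real \<Rightarrow> int set \<Rightarrow> complex" where
  "t u S = (- 1) ^ card S * (\<Prod>n\<in>S. xi n * exp (- of_real (2 * u) * lam n)) * kap S"

definition Dn :: "nat \<Rightarrow> real \<Rightarrow> complex" where
  "Dn N u = (\<Sum>S\<in>Pow (initial N). t u S)"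

lemma t_le:
  assumes S: "finite S"
  shows "cmod (t u S) \<le> (\<Prod>n\<in>S. exp (- c * (2 * u)) * w n)"
  unfolding t_def kap_def
  by (rule minor_term_le[OF S norm_inverse_lam_add phi_term_le])

lemma t_le_w:
  assumes "u \<ge> 0" "finite S"
  shows "cmod (t u S) \<le> (\<Prod>n\<in>S. w n)"
proof -
  have "(\<Prod>n\<in>S. exp (- c * (2 * u)) * w n) \<le> (\<Prod>n\<in>S. w n)"
    using assms c by (intro prod_mono) (auto intro!: mult_left_le_one_le mult_nonneg_nonneg w_nonneg)
  thus ?thesis using t_le[OF assms(2), of u] by linarith
qed

text \<open>Splitting exp(-u(\<lambda>_i + \<lambda>_j)) between row i and column j leaves
  exp(-2u\<lambda>_n) for each n in S, times \<open>kap S\<close>. The sums reached from the Hankel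
  sections are therefore also the truncated determinants of I - R_u.\<close>

lemma Dn_eq_fdet: "Dn N u = fdet (initial N) (\<lambda>i j. (if i = j then 1 else 0) - xi i * R_kernel u i j)"
  unfolding fdet_minors[OF finite_initial] Dn_def t_def
proof (intro sum.cong refl)
  fix S assume "S \<in> Pow (initial N)"
  hence S: "finite S" using finite_subset[OF _ finite_initial] by auto
  have "fdet S (\<lambda>i j. xi i * R_kernel u i j) =
      fdet S (\<lambda>i j. (xi i * exp (- of_real u * lam i)) * (exp (- of_real u * lam j) * (1 / (lam i + lam j))))"
    by (intro fdet_cong) (simp add: R_kernel_def exp_add[symmetric] algebra_simps)
  also have "\<dots> = (\<Prod>n\<in>S. xi n * exp (- of_real u * lam n)) * ((\<Prod>n\<in>S. exp (- of_real u * lam n)) * kap S)"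
    unfolding fdet_scale_rows[OF S] fdet_scale_columns[OF S] kap_def ..
  also have "\<dots> = (\<Prod>n\<in>S. xi n * exp (- of_real (2 * u) * lam n)) * kap S"
    unfolding mult.assoc[symmetric] prod.distrib[symmetric]
    by (simp add: mult.assoc exp_add[symmetric])
  finally show "(- 1) ^ card S * (\<Prod>n\<in>S. xi n * exp (- of_real (2 * u) * lam n)) * kap S =
      (- 1) ^ card S * fdet S (\<lambda>i j. xi i * R_kernel u i j)" by simp
qed

definition t' :: "real \<Rightarrow> int set \<Rightarrow> complex" where
  "t' u S = - 2 * (\<Sum>n\<in>S. lam n) * t u S"

lemma t'_le:
  assumes "u \<ge> 0" and S: "finite S"
  shows "cmod (t' u S) \<le> (\<Prod>n\<in>S. w' n)"
proof -
  have "cmod (t' u S) = 2 * cmod (\<Sum>n\<in>S. lam n) * cmod (t u S)" by (simp add: t'_def norm_mult)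
  also have "\<dots> \<le> (\<Prod>n\<in>S. 1 + 2 * cmod (lam n)) * (\<Prod>n\<in>S. w n)"
  proof (intro mult_mono t_le_w assms prod_nonneg)
    have "2 * cmod (\<Sum>n\<in>S. lam n) \<le> (\<Sum>n\<in>S. 2 * cmod (lam n))"
      unfolding sum_distrib_left[symmetric] by (intro mult_left_mono norm_sum) auto
    also have "\<dots> \<le> (\<Prod>n\<in>S. 1 + 2 * cmod (lam n))" by (rule sum_le_prod_one_plus[OF S]) auto
    finally show "2 * cmod (\<Sum>n\<in>S. lam n) \<le> (\<Prod>n\<in>S. 1 + 2 * cmod (lam n))" .
  qed auto
  also have "\<dots> = (\<Prod>n\<in>S. w' n)" by (simp add: prod.distrib[symmetric] w'_def mult.commute)
  finally show ?thesis .
qed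

definition dDn :: "nat \<Rightarrow> real \<Rightarrow> complex" where
  "dDn N u = (\<Sum>S\<in>Pow (initial N). t' u S)"

lemma t_has_vector_derivative: "((\<lambda>u. t u S) has_vector_derivative t' u S) (at u within A)"
proof -
  have e: "t u S = (- 1) ^ card S * (\<Prod>n\<in>S. xi n) * kap S * exp (- 2 * (\<Sum>n\<in>S. lam n) * of_real u)" for u
  proof (cases "finite S")
    case True
    thus ?thesis
      by (simp add: t_def prod.distrib exp_sum[symmetric] sum_distrib_left sum_distrib_right mult_ac flip: sum_negf)
  next
    case False
    thus ?thesis by (simp add: t_def)
  qed
  have "((\<lambda>z. (- 1) ^ card S * (\<Prod>n\<in>S. xi n) * kap S * exp (- 2 * (\<Sum>n\<in>S. lam n) * z)) has_field_derivative t' u S) (at (of_real u))"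
    unfolding t'_def e by (auto intro!: derivative_eq_intros)
  thus ?thesis unfolding e by (rule has_vector_derivative_real_field)
qed

lemma Dn_has_vector_derivative: "((\<lambda>u. Dn N u) has_vector_derivative dDn N u) (at u within A)"
  unfolding Dn_def dDn_def by (intro has_vector_derivative_sum t_has_vector_derivative)

text \<open>The derivative of the matrix of I - R_u in u is the rank-one matrix with entries
  \<open>input_vec u i\<close> times exp(-u\<lambda>_j). Hence the derivative of the determinant is
  the adjugate evaluated on these two vectors. The adjugate avoids dividing by
  \<open>Dn N u\<close>, which may vanish.\<close>

lemma dDn_adjugate:
  obtains v where "\<And>i. i \<in> initial N \<Longrightarrow> v i - xi i * (\<Sum>j\<in>initial N. R_kernel u i j * v j) = Dn N u * input_vec u i"
    and "dDn N u = (\<Sum>j\<in>initial N. exp (- of_real u * lam j) * v j)"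
proof -
  let ?J = "initial N"
  define A where "A u i j = (if i = j then 1 else 0) - xi i * R_kernel u i j" for u i j
  define e where "e j = exp (- of_real u * lam j)" for j
  have der: "((\<lambda>u. A u i j) has_vector_derivative input_vec u i * e j) (at u within UNIV)" for i j
  proof -
    have nz: "lam i + lam j \<noteq> 0" by (rule lam_add_nonzero)
    have d: "((\<lambda>z. exp (- z * s) / s) has_field_derivative - exp (- of_real u * s)) (at (of_real u))" if "s \<noteq> 0" for s :: complex
      using that by (auto intro!: derivative_eq_intros)
    have "((\<lambda>z. (if i = j then 1 else 0) - xi i * (exp (- z * (lam i + lam j)) / (lam i + lam j)))
        has_field_derivative 0 - xi i * - exp (- of_real u * (lam i + lam j))) (at (of_real u))"
      by (intro DERIV_diff DERIV_const DERIV_cmult d nz)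
    also have "0 - xi i * - exp (- of_real u * (lam i + lam j)) = input_vec u i * e j"
      by (simp add: input_vec_def e_def exp_add[symmetric] algebra_simps)
    finally have "((\<lambda>z. (if i = j then 1 else 0) - xi i * (exp (- z * (lam i + lam j)) / (lam i + lam j)))
        has_field_derivative input_vec u i * e j) (at (of_real u))" .
    thus ?thesis unfolding A_def R_kernel_def by (rule has_vector_derivative_real_field)
  qed
  have "((\<lambda>u. fdet ?J (A u)) has_vector_derivative (\<Sum>i\<in>?J. fdet ?J ((A u)(i := \<lambda>j. input_vec u i * e j)))) (at u within UNIV)"
    by (rule fdet_has_vector_derivative[OF finite_initial der])
  moreover have "(\<lambda>u. fdet ?J (A u)) = (\<lambda>u. Dn N u)" unfolding Dn_eq_fdet A_def[abs_def] ..
  ultimately have "((\<lambda>u. Dn N u) has_vector_derivative (\<Sum>i\<in>?J. fdet ?J ((A u)(i := \<lambda>j. input_vec u i * e j)))) (at u)"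
    by (simp only:)
  hence "dDn N u = (\<Sum>i\<in>?J. fdet ?J ((A u)(i := \<lambda>j. input_vec u i * e j)))"
    by (rule vector_derivative_unique_at[OF Dn_has_vector_derivative])
  also have "\<dots> = (\<Sum>i\<in>?J. input_vec u i * fdet ?J ((A u)(i := e)))"
  proof (intro sum.cong refl)
    fix i assume "i \<in> ?J"
    from fdet_row_sum[OF finite_initial this, of "{0::nat}" "A u" "\<lambda>_. input_vec u i" "\<lambda>_. e"]
    show "fdet ?J ((A u)(i := \<lambda>j. input_vec u i * e j)) = input_vec u i * fdet ?J ((A u)(i := e))" by simp
  qed
  finally have d: "dDn N u = (\<Sum>i\<in>?J. input_vec u i * fdet ?J ((A u)(i := e)))" .
  obtain v where v: "\<And>i. i \<in> ?J \<Longrightarrow> (\<Sum>j\<in>?J. A u i j * v j) = fdet ?J (A u) * input_vec u i"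
    "(\<Sum>i\<in>?J. input_vec u i * fdet ?J ((A u)(i := e))) = (\<Sum>j\<in>?J. e j * v j)"
    by (rule fdet_adjugate_vector[OF finite_initial, where A = "A u" and b = "input_vec u" and c = e], rule that)
  show ?thesis
  proof (rule that)
    show "dDn N u = (\<Sum>j\<in>?J. exp (- of_real u * lam j) * v j)" using d v(2) by (simp add: e_def)
    fix i assume i: "i \<in> ?J"
    have "(\<Sum>j\<in>?J. A u i j * v j) = (\<Sum>j\<in>?J. (if i = j then v j else 0) - xi i * (R_kernel u i j * v j))"
      by (intro sum.cong refl) (simp add: A_def algebra_simps)
    also have "\<dots> = v i - xi i * (\<Sum>j\<in>?J. R_kernel u i j * v j)"
      using i by (simp add: sum_subtractf sum_distrib_left)
    finally show "v i - xi i * (\<Sum>j\<in>?J. R_kernel u i j * v j) = Dn N u * input_vec u i"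
      using v(1)[OF i] unfolding Dn_eq_fdet A_def by simp
  qed
qed

definition D :: "real \<Rightarrow> complex" where
  "D u = lim (\<lambda>N. Dn N u)"

lemma Dn_tendsto:
  assumes "u \<ge> 0"
  shows "(\<lambda>N. Dn N u) \<longlonglongrightarrow> D u"
proof -
  have "convergent (\<lambda>N. Dn N u)"
    unfolding Dn_def by (rule initial_Pow_convergent[OF w_summable w_nonneg t_le_w[OF assms]])
  thus ?thesis unfolding D_def by (simp add: convergent_LIMSEQ_iff)
qed

lemma D_minus_1_le:
  assumes "u \<ge> 0"
  shows "cmod (D u - 1) \<le> exp (exp (- c * (2 * u)) * infsum w UNIV) - 1"
proof (rule LIMSEQ_le_const2)
  show "(\<lambda>N. cmod (Dn N u - 1)) \<longlonglongrightarrow> cmod (D u - 1)" by (intro tendsto_intros Dn_tendsto assms)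
  have "cmod (Dn N u - 1) \<le> exp (exp (- c * (2 * u)) * infsum w UNIV) - 1" for N
  proof -
    \<comment> \<open>Comparison with the empty truncation, whose only term is 1. The factor
      exp(-2cu) at each weight is what drives D to 1 at infinity.\<close>
    have "cmod ((\<Sum>S\<in>Pow (initial N). t u S) - (\<Sum>S\<in>Pow {}. t u S)) \<le>
        (\<Prod>n\<in>initial N. 1 + exp (- c * (2 * u)) * w n) - (\<Prod>n\<in>{}. 1 + exp (- c * (2 * u)) * w n)"
      by (rule sum_Pow_diff_le[OF finite_initial _ t_le]) simp
    also have "(\<Sum>S\<in>Pow {}. t u S) = 1" by (simp add: t_def kap_def)
    also have "(\<Prod>n\<in>initial N. 1 + exp (- c * (2 * u)) * w n) \<le> exp (\<Sum>n\<in>initial N. exp (- c * (2 * u)) * w n)"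
      by (rule prod_le_exp_sum) (simp add: w_nonneg)
    also have "(\<Sum>n\<in>initial N. exp (- c * (2 * u)) * w n) \<le> exp (- c * (2 * u)) * infsum w UNIV"
      unfolding sum_distrib_left[symmetric]
      by (intro mult_left_mono finite_sum_le_infsum w_summable w_nonneg) auto
    finally show ?thesis by (simp add: Dn_def)
  qed
  thus "\<exists>N. \<forall>n\<ge>N. cmod (Dn n u - 1) \<le> exp (exp (- c * (2 * u)) * infsum w UNIV) - 1" by blast
qed

lemma D_tendsto_1: "(D \<longlongrightarrow> 1) at_top"
proof -
  have "((\<lambda>u. exp (- (2 * c) * u)) \<longlongrightarrow> 0) at_top"
  proof -
    have "filterlim (\<lambda>u. - (2 * c) * u) at_bot at_top"
      using c by (intro filterlim_tendsto_neg_mult_at_bot[OF tendsto_const]) (auto simp: filterlim_ident)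
    from filterlim_compose[OF exp_at_bot this] show ?thesis .
  qed
  hence "((\<lambda>u. exp (exp (- (2 * c) * u) * infsum w UNIV) - 1) \<longlongrightarrow> exp (0 * infsum w UNIV) - 1) at_top"
    by (intro tendsto_intros)
  hence l: "((\<lambda>u. exp (exp (- (2 * c) * u) * infsum w UNIV) - 1) \<longlongrightarrow> 0) at_top" by simp
  have "((\<lambda>u. D u - 1) \<longlongrightarrow> 0) at_top"
    by (rule Lim_null_comparison[OF _ l])
       (use eventually_ge_at_top[of 0] in \<open>eventually_elim, use D_minus_1_le in \<open>simp add: mult_ac\<close>\<close>)
  thus ?thesis by (simp add: LIM_zero_iff)
qed

section \<open>The diagonal of T_{-1} and the differential equation for D\<close>

abbreviation inv1 :: "real \<Rightarrow> bool" where
  "inv1 u \<equiv> invertible_op (count_space UNIV) (\<lambda>a n. a n + (- 1) * R u a n)"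

definition sol :: "real \<Rightarrow> int \<Rightarrow> complex" where
  "sol u = resolvent_op lam xi (- 1) u (input_vec u)"

definition tau :: "real \<Rightarrow> complex" where
  "tau u = (\<Sum>\<^sub>\<infinity>n. exp (- of_real u * lam n) * sol u n)"

lemma T_kernel_diag: "T_kernel lam xi (- 1) u u = tau u"
  unfolding T_kernel_def input_vec_eq tau_def sol_def output_op_def unfolding semigroup_op_def by simp

lemma sol:
  assumes u: "u \<ge> 0" and inv: "inv1 u"
  shows "sol u \<in> ell2" "sol u n = input_vec u n + R u (sol u) n" "sol u \<in> ell1"
    "cmod (sol u n) \<le> (exp (- c * u) + exp (- 2 * c * u) * Q * N2 (sol u)) * cmod (xi n)"
proof -
  have s: "sol u = res (- 1) u (input_vec u)" unfolding sol_def res_def[OF u inv] ..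
  show 2: "sol u \<in> ell2" unfolding s by (rule res(1)[OF u inv input_vec_ell(3)])
  show eq: "sol u n = input_vec u n + R u (sol u) n" for n
    using res(2)[OF u inv input_vec_ell(3), of u n] unfolding s[symmetric] by (simp add: algebra_simps)
  show b: "cmod (sol u n) \<le> (exp (- c * u) + exp (- 2 * c * u) * Q * N2 (sol u)) * cmod (xi n)" for n
    unfolding eq[of n] using norm_triangle_ineq[of "input_vec u n" "R u (sol u) n"] input_vec_le[of u n] R_le[OF 2, of u n]
    by (simp add: distrib_right)
  show "sol u \<in> ell1" by (rule ell1_xi_bound(1)[OF b])
qed

lemma exp_le_1: "u \<ge> 0 \<Longrightarrow> exp (- c * u) \<le> 1" "u \<ge> 0 \<Longrightarrow> exp (- 2 * c * u) \<le> 1"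
  using c by auto

lemma R_le': "a \<in> ell2 \<Longrightarrow> u \<ge> 0 \<Longrightarrow> cmod (R u a j) \<le> Q * N2 a * cmod (xi j)"
  using R_le[of a u j] mult_right_mono[OF exp_le_1(2)[of u], of "Q * N2 a * cmod (xi j)"] Q_nonneg
  by (simp add: mult.assoc)

lemma input_vec_le': "u \<ge> 0 \<Longrightarrow> cmod (input_vec u n) \<le> cmod (xi n)"
  using input_vec_le[of u n] mult_right_mono[OF exp_le_1(1)[of u], of "cmod (xi n)"] by simp

text \<open>The adjugate vector of the truncated system is close to the determinant times the solution of the
  full system.\<close>

lemma dDn_minus_Dn_tau:
  assumes u: "u \<ge> 0" and inv: "inv1 u"
  shows "(\<lambda>N. dDn N u - Dn N u * tau u) \<longlonglongrightarrow> 0"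
proof -
  define a where "a = sol u"
  note a = sol[OF u inv, folded a_def]
  obtain S where S: "S \<ge> 0" "\<And>f. f \<in> ell2 \<Longrightarrow> N2 f \<le> S * N2 (\<lambda>n. f n + (- 1) * R u f n)"
    using invertible_op_ell2(3)[OF inv] by blast
  have "Bseq (\<lambda>N. Dn N u)" using Dn_tendsto[OF u] convergentI convergent_imp_Bseq by blast
  then obtain B where B: "B > 0" "\<And>N. cmod (Dn N u) \<le> B" unfolding Bseq_def by auto
  define A where "A = 1 + Q * N2 a"
  have A: "A \<ge> 1" using Q_nonneg by (simp add: A_def)
  have aA: "cmod (a n) \<le> A * cmod (xi n)" for n
    using norm_triangle_ineq[of "input_vec u n" "R u a n"] input_vec_le'[OF u, of n] R_le'[OF a(1) u, of n] a(2)[of n]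
    by (simp add: A_def distrib_right)
  have *: "cmod (dDn N u - Dn N u * tau u) \<le> (Q * (2 * S * B * A) * X + B * A) * tail N"
    if small: "S * Q * tail N \<le> 1 / 2" for N
  proof -
    let ?J = "initial N"
    obtain v where v: "\<And>i. i \<in> ?J \<Longrightarrow> v i - xi i * (\<Sum>j\<in>?J. R_kernel u i j * v j) = Dn N u * input_vec u i"
      and dv: "dDn N u = (\<Sum>j\<in>?J. exp (- of_real u * lam j) * v j)"
      using dDn_adjugate by metis
    \<comment> \<open>The adjugate vector is extended by zero, and d measures its distance from the
      determinant times the full solution.\<close>
    define vv where "vv n = (if n \<in> ?J then v n else 0)" for n
    define d where "d n = vv n - Dn N u * a n" for n
    have vv1: "vv \<in> ell1"
    proof -
      have "(\<lambda>n. cmod (vv n)) summable_on UNIV \<longleftrightarrow> (\<lambda>n. cmod (v n)) summable_on ?J"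
        unfolding vv_def by (rule summable_on_cong_neutral) auto
      thus ?thesis by (simp add: ell1_def)
    qed
    have vv2: "vv \<in> ell2" by (rule ell1_subset_ell2(1)[OF vv1])
    have d2: "d \<in> ell2" unfolding d_def by (intro L2_diff L2_scale vv2 a(1))
    have Rvv: "R u vv j = xi j * (\<Sum>m\<in>?J. R_kernel u j m * v m)" for j
    proof -
      have "(\<Sum>\<^sub>\<infinity>m. R_kernel u j m * vv m) = infsum (\<lambda>m. R_kernel u j m * v m) ?J"
        unfolding vv_def by (rule infsum_cong_neutral) auto
      thus ?thesis by (simp add: R_def)
    qed
    have Rd: "R u d j = R u vv j - Dn N u * R u a j" for j
      using R_linear[OF vv2 a(1), of u 1 "- Dn N u" j] by (simp add: d_def[abs_def])
    \<comment> \<open>The truncated system is satisfied on \<open>initial N\<close>, so the residual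
      of d lives outside it, where it is dominated by the remaining \<xi>_j.\<close>
    have dJ: "d j + (- 1) * R u d j = (if j \<in> ?J then 0 else - R u vv j - Dn N u * input_vec u j)" for j
    proof (cases "j \<in> ?J")
      case True
      have "vv j - R u vv j = Dn N u * input_vec u j" using v[OF True] True by (simp add: Rvv vv_def)
      thus ?thesis using True a(2)[of j] unfolding Rd d_def by (simp add: algebra_simps)
    next
      case False
      thus ?thesis using a(2)[of j] unfolding Rd d_def by (simp add: vv_def algebra_simps)
    qed
    have "cmod (d j + (- 1) * R u d j) \<le> (Q * N2 vv + B) * (if j \<in> ?J then 0 else cmod (xi j))" for j
    proof (cases "j \<in> ?J")
      case False
      have "cmod (- R u vv j - Dn N u * input_vec u j) \<le> cmod (R u vv j) + cmod (Dn N u) * cmod (input_vec u j)"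
        using norm_triangle_ineq4[of "- R u vv j" "Dn N u * input_vec u j"] by (simp add: norm_mult)
      also have "\<dots> \<le> Q * N2 vv * cmod (xi j) + B * cmod (xi j)"
        by (intro add_mono R_le' vv2 u mult_mono B(2) input_vec_le') (use B(1) in auto)
      finally show ?thesis using False unfolding dJ by (simp add: distrib_right)
    next
      case True
      thus ?thesis unfolding dJ by simp
    qed
    note eb = ell1_bound[OF summable_on_cmult_right[OF tail_summable[of N]] this, unfolded infsum_cmult_right', folded tail_def]
    have "N2 d \<le> S * N2 (\<lambda>n. d n + (- 1) * R u d n)" by (rule S(2)[OF d2])
    also have "\<dots> \<le> S * ((Q * N2 vv + B) * tail N)"
      using ell1_subset_ell2(2)[OF eb(1)] eb(2) S(1) by (intro mult_left_mono) auto
    also have "N2 vv \<le> N2 d + B * N2 a"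
    proof -
      have "N2 vv \<le> N2 d + N2 (\<lambda>n. Dn N u * a n)"
        unfolding d_def by (intro L2_norm_triangle vv2 L2_scale a(1))
      also have "\<dots> \<le> N2 d + B * N2 a" unfolding L2_norm_scale using B(2) by (intro add_left_mono mult_right_mono) auto
      finally show ?thesis .
    qed
    finally have "N2 d \<le> S * ((Q * (N2 d + B * N2 a) + B) * tail N)"
      using S(1) Q_nonneg tail_nonneg[of N] by (simp add: mult_left_mono mult_right_mono)
    also have "\<dots> = (S * Q * tail N) * N2 d + S * B * A * tail N" by (simp add: A_def algebra_simps)
    \<comment> \<open>The bound contains the norm of d itself; for large N its coefficient is at
      most 1/2 and is absorbed on the left.\<close>
    also have "\<dots> \<le> 1 / 2 * N2 d + S * B * A * tail N" using small by (intro add_right_mono mult_right_mono) auto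
    finally have Nd: "N2 d \<le> 2 * S * B * A * tail N" by simp
    \<comment> \<open>From square summability back to a bound by \<xi>: on \<open>initial N\<close>
      the residual is 0, so d = R_u d there, and outside d is just the determinant times a
      coordinate of the solution.\<close>
    have dle: "cmod (d j) \<le> Q * N2 d * cmod (xi j) + B * A * (if j \<in> ?J then 0 else cmod (xi j))" for j
    proof (cases "j \<in> ?J")
      case True
      have "d j + (- 1) * R u d j = (if j \<in> ?J then 0 else - R u vv j - Dn N u * input_vec u j)" by (rule dJ)
      hence "d j + (- 1) * R u d j = 0" by (simp only: True if_True)
      hence "d j = R u d j" by (simp only: mult_minus1 add_uminus_conv_diff right_minus_eq)
      thus ?thesis using R_le'[OF d2 u, of j] True by simp
    next
      case False
      hence "cmod (d j) = cmod (Dn N u) * cmod (a j)" by (simp add: d_def vv_def norm_mult)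
      also have "\<dots> \<le> B * (A * cmod (xi j))" by (intro mult_mono B(2) aA) (use B(1) in auto)
      also have "\<dots> \<le> Q * N2 d * cmod (xi j) + B * (A * cmod (xi j))" using Q_nonneg by simp
      finally show ?thesis using False by (simp add: mult.assoc)
    qed
    have dsm: "(\<lambda>j. Q * N2 d * cmod (xi j) + B * A * (if j \<in> ?J then 0 else cmod (xi j))) summable_on UNIV"
      by (intro summable_on_add summable_on_cmult_right ell1_D xi_ell1 tail_summable)
    have e1: "cmod (exp (- of_real u * lam j) * f) \<le> cmod f" for j f
      unfolding norm_mult using norm_exp_lam_le[OF u, of j] by (intro mult_left_le_one_le) auto
    have es: "(\<lambda>j. exp (- of_real u * lam j) * f j) summable_on UNIV" if "f \<in> ell1" for f
      by (rule ell1_imp_summable[OF ell1_bound(1)[OF ell1_D[OF that] e1]])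
    have "dDn N u = (\<Sum>\<^sub>\<infinity>j. exp (- of_real u * lam j) * vv j)"
    proof -
      have "(\<Sum>\<^sub>\<infinity>j. exp (- of_real u * lam j) * vv j) = infsum (\<lambda>j. exp (- of_real u * lam j) * v j) ?J"
        unfolding vv_def by (rule infsum_cong_neutral) auto
      thus ?thesis using dv by simp
    qed
    moreover have "Dn N u * tau u = (\<Sum>\<^sub>\<infinity>j. exp (- of_real u * lam j) * (Dn N u * a j))"
      unfolding tau_def a_def[symmetric] infsum_cmult_right'[symmetric] by (intro infsum_cong) simp
    ultimately have "dDn N u - Dn N u * tau u = (\<Sum>\<^sub>\<infinity>j. exp (- of_real u * lam j) * vv j - exp (- of_real u * lam j) * (Dn N u * a j))"
      using infsum_diff'[OF es[OF vv1] es[OF ell1_scale[OF a(3)]]] by simp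
    also have "\<dots> = (\<Sum>\<^sub>\<infinity>j. exp (- of_real u * lam j) * d j)" by (simp add: d_def right_diff_distrib)
    also have "cmod \<dots> \<le> infsum (\<lambda>j. Q * N2 d * cmod (xi j) + B * A * (if j \<in> ?J then 0 else cmod (xi j))) UNIV"
      by (rule norm_infsum_le[OF dsm]) (rule order_trans[OF e1 dle])
    also have "\<dots> = Q * N2 d * X + B * A * tail N"
      unfolding X_def tail_def infsum_cmult_right'[symmetric]
      by (intro infsum_add summable_on_cmult_right ell1_D xi_ell1 tail_summable)
    also have "\<dots> \<le> Q * (2 * S * B * A * tail N) * X + B * A * tail N"
      using Nd Q_nonneg X_nonneg by (intro add_right_mono mult_right_mono mult_left_mono) auto
    finally show ?thesis by (simp add: algebra_simps)
  qed
  have "(\<lambda>N. S * Q * tail N) \<longlonglongrightarrow> S * Q * 0" by (intro tendsto_intros tail_tendsto_0)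
  hence "\<forall>\<^sub>F N in sequentially. S * Q * tail N < 1 / 2" by (rule order_tendstoD) simp
  hence ev: "\<forall>\<^sub>F N in sequentially. norm (dDn N u - Dn N u * tau u) \<le> (Q * (2 * S * B * A) * X + B * A) * tail N"
    by eventually_elim (rule *, simp)
  have "(\<lambda>N. (Q * (2 * S * B * A) * X + B * A) * tail N) \<longlonglongrightarrow> (Q * (2 * S * B * A) * X + B * A) * 0"
    by (intro tendsto_intros tail_tendsto_0)
  thus ?thesis by (intro Lim_null_comparison[OF ev]) simp
qed

text \<open>Two ingredients of different kind: \<open>dDn_minus_Dn_tau\<close> identifies the
  pointwise limit of the derivatives, and the majorant \<open>prod_tail w'\<close>, independent of
  the point, makes the convergence uniform, as differentiating the limit requires.\<close>

lemma D_has_vector_derivative: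
  assumes inv: "\<And>u. u > 0 \<Longrightarrow> inv1 u" and u: "u > 0"
  shows "(D has_vector_derivative tau u * D u) (at u)"
proof -
  have lim: "(\<lambda>N. dDn N v) \<longlonglongrightarrow> tau v * D v" if v: "v > 0" for v
  proof -
    have "(\<lambda>N. (dDn N v - Dn N v * tau v) + Dn N v * tau v) \<longlonglongrightarrow> 0 + D v * tau v"
      using v by (intro tendsto_intros dDn_minus_Dn_tau inv Dn_tendsto) auto
    thus ?thesis by (simp add: mult.commute)
  qed
  have unif: "cmod (dDn M v - tau v * D v) \<le> prod_tail w' M" if v: "v > 0" for v M
  proof -
    have "cmod (tau v * D v - (\<Sum>S\<in>Pow (initial M). t' v S)) \<le> prod_tail w' M"
      by (rule initial_Pow_limit_le[OF w'_summable w'_nonneg t'_le lim[OF v, unfolded dDn_def]]) (use v in auto)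
    thus ?thesis by (simp add: dDn_def norm_minus_commute)
  qed
  have "\<exists>g. \<forall>v\<in>{0<..}. (\<lambda>N. Dn N v) \<longlonglongrightarrow> g v \<and> (g has_derivative (\<lambda>h. h *\<^sub>R (tau v * D v))) (at v within {0<..})"
  proof (rule has_derivative_sequence[where f' = "\<lambda>N v h. h *\<^sub>R dDn N v" and ?x0.0 = u and l = "D u"])
    show "(Dn N has_derivative (\<lambda>h. h *\<^sub>R dDn N v)) (at v within {0<..})" for N v
      using Dn_has_vector_derivative[of N v] unfolding has_vector_derivative_def by blast
    fix e :: real assume e: "e > 0"
    have "\<forall>\<^sub>F N in sequentially. prod_tail w' N < e"
      by (rule order_tendstoD(2)[OF prod_tail_tendsto[OF w'_summable w'_nonneg] e])
    thus "\<forall>\<^sub>F N in sequentially. \<forall>v\<in>{0<..}. \<forall>h. norm (h *\<^sub>R dDn N v - h *\<^sub>R (tau v * D v)) \<le> e * norm h"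
    proof eventually_elim
      case (elim N)
      show ?case
      proof (intro ballI allI)
        fix v h :: real assume "v \<in> {0<..}"
        hence "cmod (dDn N v - tau v * D v) \<le> e" using unif[of v N] elim by simp
        from mult_left_mono[OF this abs_ge_zero[of h]]
        show "norm (h *\<^sub>R dDn N v - h *\<^sub>R (tau v * D v)) \<le> e * norm h"
          by (simp add: scaleR_diff_right[symmetric] mult.commute)
      qed
    qed
  qed (use u Dn_tendsto in auto)
  then obtain g where g: "\<And>v. v > 0 \<Longrightarrow> (\<lambda>N. Dn N v) \<longlonglongrightarrow> g v"
    "\<And>v. v > 0 \<Longrightarrow> (g has_derivative (\<lambda>h. h *\<^sub>R (tau v * D v))) (at v within {0<..})" by auto
  have gD: "g v = D v" if "v > 0" for v
    using LIMSEQ_unique[OF g(1)[OF that] Dn_tendsto] that by simp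
  have "(g has_vector_derivative tau u * D u) (at u)"
    using g(2)[OF u] u unfolding has_vector_derivative_def by (simp add: at_within_open[of u "{0<..}"])
  thus ?thesis
    by (rule has_vector_derivative_transform_within_open[of _ _ _ "{0<..}"]) (use u gD in auto)
qed

definition Y :: real where "Y = (\<Sum>\<^sub>\<infinity>n. cmod (lam n) * cmod (xi n))"

lemma Y_summable: "(\<lambda>n. cmod (lam n) * cmod (xi n)) summable_on UNIV"
proof (rule summable_on_comparison_test[OF w'_summable[THEN summable_on_cmult_right, of c]])
  fix n
  have le: "c * w n * (2 * cmod (lam n)) \<le> c * w' n"
    unfolding w'_def using c w_nonneg[of n] by (simp add: algebra_simps)
  have eq: "c * w n = (1 + \<bar>real_of_int n\<bar>) * cmod (xi n)"
    using c by (simp add: w_def)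
  have "cmod (lam n) * cmod (xi n) \<le> (1 + \<bar>real_of_int n\<bar>) * cmod (xi n) * (2 * cmod (lam n))"
  proof -
    have "1 \<le> (1 + \<bar>real_of_int n\<bar>) * 2" by simp
    from mult_left_mono[OF this, of "cmod (lam n) * cmod (xi n)"] show ?thesis by (simp only: mult_ac mult_1_left) simp
  qed
  from order_trans[OF this le[unfolded eq]] show "cmod (lam n) * cmod (xi n) \<le> c * w' n" .
qed auto

lemma exp_lam_diff_le:
  assumes "u \<ge> 0" "v \<ge> 0"
  shows "cmod (exp (- of_real u * lam n) - exp (- of_real v * lam n)) \<le> \<bar>u - v\<bar> * cmod (lam n)"
  using assms c by (intro norm_exp_diff_le) auto

text \<open>The difference d of the solutions at u and v satisfies (I - R_v) d = (b_u - b_v) + (R_u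
  - R_v)(d + a), where b denotes the input vectors and a the solution at v. The operator difference
  is of order |u - v|^(1/4), so its action on d is absorbed for u near v. Continuity is needed to
  integrate \<open>tau\<close> and to differentiate the integral.\<close>

lemma tau_isCont:
  assumes inv: "\<And>u. u > 0 \<Longrightarrow> inv1 u" and v: "v > 0"
  shows "isCont tau v"
proof -
  define a where "a = sol v"
  note a = sol[OF less_imp_le[OF v] inv[OF v], folded a_def]
  obtain S where S: "S \<ge> 0" "\<And>f. f \<in> ell2 \<Longrightarrow> N2 f \<le> S * N2 (\<lambda>n. f n + (- 1) * R v f n)"
    using invertible_op_ell2(3)[OF inv[OF v]] by blast
  define \<eta> where "\<eta> u = 2 * \<bar>u - v\<bar> powr (1 / 4) * row_norm" for u
  have \<eta>0: "\<eta> u \<ge> 0" for u using row_norm_nonneg by (simp add: \<eta>_def)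
  define A where "A = 1 + Q * N2 a"
  have A: "A \<ge> 0" using Q_nonneg by (simp add: A_def)
  have aA: "cmod (a n) \<le> A * cmod (xi n)" for n
    using norm_triangle_ineq[of "input_vec v n" "R v a n"] input_vec_le'[of v n] R_le'[OF a(1), of v n] a(2)[of n] v
    by (simp add: A_def distrib_right)
  define \<delta> where "\<delta> u = 2 * S * (\<bar>u - v\<bar> * Y + \<eta> u * N2 a * X)" for u
  have main: "cmod (tau u - tau v) \<le> (1 + A) * (\<bar>u - v\<bar> * Y) + Q * \<delta> u * X + \<eta> u * N2 a * X"
    if u: "u > 0" and small: "S * (\<eta> u * X) \<le> 1 / 2" for u
  proof -
    define a' where "a' = sol u"
    note a' = sol[OF less_imp_le[OF u] inv[OF u], folded a'_def]
    define d where "d n = a' n - a n" for n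
    have d2: "d \<in> ell2" unfolding d_def by (intro L2_diff a' a)
    have Rdiff: "cmod (R u f j - R v f j) \<le> \<eta> u * N2 f * cmod (xi j)" if "f \<in> ell2" for f j
      using R_diff_le[OF that, of u v j] u v by (simp add: \<eta>_def)
    have bdiff: "cmod (input_vec u n - input_vec v n) \<le> \<bar>u - v\<bar> * (cmod (lam n) * cmod (xi n))" for n
      using mult_right_mono[OF exp_lam_diff_le[of u v n] norm_ge_zero[of "xi n"]] u v
      by (simp add: input_vec_def left_diff_distrib[symmetric] norm_mult mult.assoc)
    have Ra': "R v a' n = R v d n + R v a n" for n
      using R_linear[OF d2 a(1), of v 1 1 n] by (simp add: d_def)
    have Rua': "R u a' n = R u d n + R u a n" for n
      using R_linear[OF d2 a(1), of u 1 1 n] by (simp add: d_def)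
    have eq: "d n + (- 1) * R v d n = (input_vec u n - input_vec v n) + (R u d n - R v d n) + (R u a n - R v a n)" for n
      using a'(2)[of n] a(2)[of n] Rua'[of n] by (simp add: d_def algebra_simps)
    define g where "g n = \<bar>u - v\<bar> * (cmod (lam n) * cmod (xi n)) + (\<eta> u * N2 d + \<eta> u * N2 a) * cmod (xi n)" for n
    have gs: "g summable_on UNIV"
      unfolding g_def by (intro summable_on_add summable_on_cmult_right ell1_D xi_ell1 Y_summable)
    have gi: "infsum g UNIV = \<bar>u - v\<bar> * Y + (\<eta> u * N2 d + \<eta> u * N2 a) * X"
      unfolding g_def Y_def X_def infsum_cmult_right'[symmetric]
      by (intro infsum_add summable_on_cmult_right ell1_D xi_ell1 Y_summable)
    have "cmod (d n + (- 1) * R v d n) \<le> g n" for n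
      unfolding eq g_def
      by (intro order_trans[OF norm_triangle_ineq] order_trans[OF add_mono[OF norm_triangle_ineq order_refl]])
         (use bdiff[of n] Rdiff[OF d2, of n] Rdiff[OF a(1), of n] in \<open>simp add: distrib_right\<close>)
    note eb = ell1_bound[OF gs this]
    have "N2 d \<le> S * N2 (\<lambda>n. d n + (- 1) * R v d n)" by (rule S(2)[OF d2])
    also have "\<dots> \<le> S * (\<bar>u - v\<bar> * Y + (\<eta> u * N2 d + \<eta> u * N2 a) * X)"
      using ell1_subset_ell2(2)[OF eb(1)] eb(2) S(1) unfolding gi by (intro mult_left_mono) auto
    also have "\<dots> = S * (\<eta> u * X) * N2 d + S * (\<bar>u - v\<bar> * Y + \<eta> u * N2 a * X)" by (simp add: algebra_simps)
    also have "\<dots> \<le> 1 / 2 * N2 d + S * (\<bar>u - v\<bar> * Y + \<eta> u * N2 a * X)"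
      using small by (intro add_right_mono mult_right_mono) auto
    finally have Nd: "N2 d \<le> \<delta> u" by (simp add: \<delta>_def)
    define e where "e w n = exp (- of_real w * lam n)" for w :: real and n
    have es: "(\<lambda>n. e w n * f n) summable_on UNIV" if "f \<in> ell1" "w \<ge> 0" for f w
    proof (rule ell1_imp_summable[OF ell1_bound(1)[OF ell1_D[OF that(1)]]])
      show "cmod (e w n * f n) \<le> cmod (f n)" for n
        unfolding e_def norm_mult by (rule mult_left_le_one_le) (use norm_exp_lam_le[OF that(2)] in auto)
    qed
    have "tau u - tau v = (\<Sum>\<^sub>\<infinity>n. e u n * a' n - e v n * a n)"
      unfolding tau_def a'_def[symmetric] a_def[symmetric] e_def[symmetric]
      by (rule infsum_diff'[symmetric, OF es[OF a'(3) less_imp_le[OF u]] es[OF a(3) less_imp_le[OF v]]])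
    also have "cmod \<dots> \<le> infsum (\<lambda>n. (1 + A) * \<bar>u - v\<bar> * (cmod (lam n) * cmod (xi n)) + (Q * \<delta> u + \<eta> u * N2 a) * cmod (xi n)) UNIV"
    proof (rule norm_infsum_le)
      show "(\<lambda>n. (1 + A) * \<bar>u - v\<bar> * (cmod (lam n) * cmod (xi n)) + (Q * \<delta> u + \<eta> u * N2 a) * cmod (xi n)) summable_on UNIV"
        by (intro summable_on_add summable_on_cmult_right ell1_D xi_ell1 Y_summable)
      fix n
      have "d n = (input_vec u n - input_vec v n) + R u d n + (R u a n - R v a n)"
        using a'(2)[of n] a(2)[of n] Rua'[of n] by (simp add: d_def algebra_simps)
      hence "cmod (d n) \<le> cmod (input_vec u n - input_vec v n) + cmod (R u d n) + cmod (R u a n - R v a n)"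
        by (metis norm_triangle_ineq norm_triangle_mono order_refl)
      also have "\<dots> \<le> \<bar>u - v\<bar> * (cmod (lam n) * cmod (xi n)) + Q * \<delta> u * cmod (xi n) + \<eta> u * N2 a * cmod (xi n)"
      proof (intro add_mono bdiff Rdiff a(1))
        have "cmod (R u d n) \<le> Q * N2 d * cmod (xi n)" using u by (intro R_le' d2) auto
        also have "\<dots> \<le> Q * \<delta> u * cmod (xi n)" using Nd Q_nonneg by (intro mult_right_mono mult_left_mono) auto
        finally show "cmod (R u d n) \<le> Q * \<delta> u * cmod (xi n)" .
      qed
      finally have dn: "cmod (d n) \<le> \<bar>u - v\<bar> * (cmod (lam n) * cmod (xi n)) + Q * \<delta> u * cmod (xi n) + \<eta> u * N2 a * cmod (xi n)" .
      have "e u n * a' n - e v n * a n = e u n * d n + (e u n - e v n) * a n" by (simp add: d_def algebra_simps)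
      hence "cmod (e u n * a' n - e v n * a n) \<le> cmod (e u n) * cmod (d n) + cmod (e u n - e v n) * cmod (a n)"
        by (metis norm_mult norm_triangle_ineq)
      also have "cmod (e u n) * cmod (d n) \<le> cmod (d n)"
        unfolding e_def by (rule mult_left_le_one_le) (use u norm_exp_lam_le[of u] in auto)
      also have "cmod (e u n - e v n) * cmod (a n) \<le> (\<bar>u - v\<bar> * cmod (lam n)) * (A * cmod (xi n))"
        unfolding e_def by (intro mult_mono exp_lam_diff_le aA) (use u v in auto)
      finally show "cmod (e u n * a' n - e v n * a n) \<le>
          (1 + A) * \<bar>u - v\<bar> * (cmod (lam n) * cmod (xi n)) + (Q * \<delta> u + \<eta> u * N2 a) * cmod (xi n)"
        using dn by (simp add: algebra_simps)
    qed
    also have "\<dots> = (1 + A) * \<bar>u - v\<bar> * Y + (Q * \<delta> u + \<eta> u * N2 a) * X"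
      unfolding Y_def X_def infsum_cmult_right'[symmetric]
      by (intro infsum_add summable_on_cmult_right ell1_D xi_ell1 Y_summable)
    finally show ?thesis by (simp add: algebra_simps)
  qed
  have h: "((\<lambda>u. \<bar>u - v\<bar>) \<longlongrightarrow> 0) (at v)"
  proof -
    have "((\<lambda>u. \<bar>u - v\<bar>) \<longlongrightarrow> \<bar>v - v\<bar>) (at v)" by (intro tendsto_intros)
    thus ?thesis by simp
  qed
  have "((\<lambda>u. \<bar>u - v\<bar> powr (1 / 4)) \<longlongrightarrow> 0 powr (1 / 4)) (at v)"
    by (rule tendsto_powr'[OF h tendsto_const]) auto
  hence hp: "((\<lambda>u. \<bar>u - v\<bar> powr (1 / 4)) \<longlongrightarrow> 0) (at v)" by simp
  have \<eta>l: "(\<eta> \<longlongrightarrow> 0) (at v)"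
    unfolding \<eta>_def[abs_def] using tendsto_mult_left[OF tendsto_mult_right[OF hp, of row_norm], of 2] by (simp add: mult.assoc)
  have "((\<lambda>u. S * (\<eta> u * X)) \<longlongrightarrow> S * (0 * X)) (at v)" by (intro tendsto_intros \<eta>l)
  hence "\<forall>\<^sub>F u in at v. S * (\<eta> u * X) < 1 / 2" by (rule order_tendstoD) simp
  moreover have "\<forall>\<^sub>F u in at v. u > 0"
    using v by (intro order_tendstoD(1)[OF tendsto_ident_at])
  ultimately have ev: "\<forall>\<^sub>F u in at v. norm (tau u - tau v) \<le> (1 + A) * (\<bar>u - v\<bar> * Y) + Q * \<delta> u * X + \<eta> u * N2 a * X"
    by eventually_elim (rule main, auto)
  have "((\<lambda>u. (1 + A) * (\<bar>u - v\<bar> * Y) + Q * \<delta> u * X + \<eta> u * N2 a * X) \<longlongrightarrow>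
      (1 + A) * (0 * Y) + Q * (2 * S * (0 * Y + 0 * N2 a * X)) * X + 0 * N2 a * X) (at v)"
    unfolding \<delta>_def by (intro tendsto_intros h \<eta>l)
  hence "((\<lambda>u. tau u - tau v) \<longlongrightarrow> 0) (at v)"
    by (intro Lim_null_comparison[OF ev]) simp
  thus ?thesis unfolding isCont_def by (rule LIM_zero_cancel)
qed

text \<open>For large u the factor exp(-2cu) makes the norm of R_u at most 1/2. The solution is then
  at most twice the input vector, which decays like exp(-cu).\<close>

lemma tau_decay:
  assumes inv: "\<And>u. u > 0 \<Longrightarrow> inv1 u"
  obtains u0 where "u0 > 0" "\<And>u. u \<ge> u0 \<Longrightarrow> cmod (tau u) \<le> (1 + 2 * Q * X) * X * exp (- c * u)"
proof -
  have "((\<lambda>u. exp (- (2 * c) * u) * (Q * X)) \<longlongrightarrow> 0 * (Q * X)) at_top"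
  proof (intro tendsto_mult tendsto_const)
    have "filterlim (\<lambda>u. - (2 * c) * u) at_bot at_top"
      using c by (intro filterlim_tendsto_neg_mult_at_bot[OF tendsto_const]) (auto simp: filterlim_ident)
    from filterlim_compose[OF exp_at_bot this] show "((\<lambda>u. exp (- (2 * c) * u)) \<longlongrightarrow> 0) at_top" .
  qed
  hence "\<forall>\<^sub>F u in at_top. exp (- (2 * c) * u) * (Q * X) < 1 / 2" by (rule order_tendstoD) simp
  then obtain u1 where u1: "\<And>u. u \<ge> u1 \<Longrightarrow> exp (- (2 * c) * u) * (Q * X) < 1 / 2"
    unfolding eventually_at_top_linorder by blast
  show ?thesis
  proof (rule that[of "max 1 u1"])
    fix u assume "u \<ge> max 1 u1"
    hence u: "u > 0" and sm: "exp (- 2 * c * u) * (Q * X) \<le> 1 / 2" using u1[of u] by auto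
    note s = sol[OF less_imp_le[OF u] inv[OF u]]
    define E where "E = exp (- c * u)"
    have E: "0 < E" "E \<le> 1" using exp_le_1(1)[of u] u by (auto simp: E_def)
    have "sol u = (\<lambda>n. input_vec u n + R u (sol u) n)" using s(2) by auto
    hence "N2 (sol u) \<le> N2 (input_vec u) + N2 (R u (sol u))"
      using L2_norm_add_le[OF input_vec_ell(3)[of u] R_ell2[OF s(1), of u]] by simp
    also have "\<dots> \<le> E * X + (exp (- 2 * c * u) * (Q * X)) * N2 (sol u)"
      using input_vec_ell(4)[of u] N2_R_le[OF s(1), of u] by (simp add: E_def mult_ac)
    also have "\<dots> \<le> E * X + 1 / 2 * N2 (sol u)" using sm by (intro add_left_mono mult_right_mono) auto
    finally have n: "N2 (sol u) \<le> 2 * (E * X)" by simp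
    have e2: "exp (- 2 * c * u) \<le> 1" using exp_le_1(2)[of u] u by simp
    have le: "cmod (exp (- of_real u * lam n) * sol u n) \<le> (1 + 2 * Q * X) * E * cmod (xi n)" for n
    proof -
      have "cmod (exp (- of_real u * lam n) * sol u n) \<le> cmod (sol u n)"
        unfolding norm_mult by (rule mult_left_le_one_le) (use norm_exp_lam_le[of u n] u in auto)
      also have "\<dots> \<le> (E + exp (- 2 * c * u) * Q * N2 (sol u)) * cmod (xi n)" using s(4)[of n] by (simp add: E_def)
      also have "\<dots> \<le> (E + 1 * Q * (2 * (E * X))) * cmod (xi n)"
        using n e2 Q_nonneg by (intro mult_right_mono add_left_mono mult_mono) auto
      finally show ?thesis by (simp add: algebra_simps)
    qed
    have "cmod (tau u) \<le> infsum (\<lambda>n. (1 + 2 * Q * X) * E * cmod (xi n)) UNIV"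
      unfolding tau_def by (rule norm_infsum_le[OF summable_on_cmult_right[OF ell1_D[OF xi_ell1]] le])
    also have "\<dots> = (1 + 2 * Q * X) * E * X" unfolding X_def by (rule infsum_cmult_right')
    finally show "cmod (tau u) \<le> (1 + 2 * Q * X) * X * exp (- c * u)" by (simp add: E_def mult_ac)
  qed auto
qed

lemma tau_integrable:
  assumes inv: "\<And>u. u > 0 \<Longrightarrow> inv1 u" and x: "x > 0"
  shows "set_integrable lborel {x..} tau"
proof -
  have cont: "continuous_on {0<..} tau"
    using tau_isCont[OF inv] by (intro continuous_at_imp_continuous_on) auto
  obtain u0 where u0: "u0 > 0" "\<And>u. u \<ge> u0 \<Longrightarrow> cmod (tau u) \<le> (1 + 2 * Q * X) * X * exp (- c * u)"
    using tau_decay[OF inv] by blast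
  have "compact (tau ` {x..max x u0})"
    by (rule compact_continuous_image[OF continuous_on_subset[OF cont]]) (use x in auto)
  then obtain B where B: "\<And>u. u \<in> {x..max x u0} \<Longrightarrow> cmod (tau u) \<le> B"
    using compact_imp_bounded bounded_iff by (metis (no_types, lifting) imageI)
  have B0: "B \<ge> 0" using B[of x] norm_ge_zero[of "tau x"] x by (simp del: norm_ge_zero)
  \<comment> \<open>The first summand is the bound beyond u0. On the compact stretch before, the
    constant B is lifted by exp(c * max x u0) so as to lie below the decaying exponential.\<close>
  define C where "C = (1 + 2 * Q * X) * X + B * exp (c * max x u0)"
  have C: "cmod (tau u) \<le> C * exp (- c * u)" if "u \<ge> x" for u
  proof (cases "u \<ge> u0")
    case True
    have "(1 + 2 * Q * X) * X * exp (- c * u) \<le> C * exp (- c * u)"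
      using B0 by (intro mult_right_mono) (auto simp: C_def)
    thus ?thesis using u0(2)[OF True] by linarith
  next
    case False
    hence "cmod (tau u) \<le> B" using that by (intro B) auto
    also have "\<dots> \<le> B * exp (c * (max x u0 - u))"
      using B0 c False mult_left_mono[of 1 "exp (c * (max x u0 - u))" B] by simp
    also have "\<dots> = B * exp (c * max x u0) * exp (- c * u)" by (simp add: exp_add[symmetric] algebra_simps)
    also have "\<dots> \<le> C * exp (- c * u)"
      using Q_nonneg X_nonneg by (intro mult_right_mono) (auto simp: C_def)
    finally show ?thesis .
  qed
  have "set_integrable lborel {x..} (\<lambda>u. C * exp (- c * u))"
    by (rule set_integrable_mult_right) (rule exp_decay_integral[OF c])
  thus ?thesis
  proof (rule set_integrable_bound)
    show "set_borel_measurable lborel {x..} tau"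
    proof -
      have "{x..} \<subseteq> {0<..}" using x by auto
      from borel_measurable_continuous_on_indicator[OF _ continuous_on_subset[OF cont this]]
      show ?thesis by (simp add: set_borel_measurable_def)
    qed
    show "AE u in lborel. u \<in> {x..} \<longrightarrow> norm (tau u) \<le> norm (C * exp (- c * u))"
      using C by (intro AE_I2) (auto intro: order_trans[OF _ abs_ge_self])
  qed
qed

text \<open>The differential equation makes D(y) times the exponential of minus the integral of
  \<open>tau\<close> from x to y independent of y, and y tends to infinity. No logarithm of D is
  taken; that D has no zeros on x > 0 is a consequence.\<close>

theorem D_eq_exp:
  assumes inv: "\<And>u. u > 0 \<Longrightarrow> inv1 u" and x: "x > 0"
  shows "D x = exp (- (LBINT u:{x..}. tau u))"
proof -
  have cont: "continuous_on {x..y} tau" for y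
    using tau_isCont[OF inv] x by (intro continuous_at_imp_continuous_on) auto
  define I where "I y = integral {x..y} tau" for y
  have step: "D y * exp (- I y) = D x" if y: "y \<ge> x" for y
  proof -
    have "((\<lambda>u. D u * exp (- I u)) has_vector_derivative 0) (at u within {x..y})" if u: "u \<in> {x..y}" for u
    proof -
      have "(I has_vector_derivative tau u) (at u within {x..y})"
        unfolding I_def by (rule integral_has_vector_derivative[OF cont u])
      hence mI: "((\<lambda>u. - I u) has_vector_derivative - tau u) (at u within {x..y})" by (rule has_vector_derivative_minus)
      have "((\<lambda>u. exp (- I u)) has_vector_derivative - tau u * exp (- I u)) (at u within {x..y})"
        using field_vector_diff_chain_within[OF mI has_field_derivative_at_within[OF DERIV_exp]]
        by (simp only: comp_def)
      hence "((\<lambda>u. D u * exp (- I u)) has_vector_derivative D u * (- tau u * exp (- I u)) + tau u * D u * exp (- I u)) (at u within {x..y})"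
      proof (rule has_vector_derivative_mult[rotated])
        show "(D has_vector_derivative tau u * D u) (at u within {x..y})"
        using D_has_vector_derivative[OF inv, of u] u x by (auto intro: has_vector_derivative_at_within)
      qed
      thus ?thesis by (simp add: algebra_simps)
    qed
    then obtain k where k: "\<And>u. u \<in> {x..y} \<Longrightarrow> D u * exp (- I u) = k"
      using has_vector_derivative_zero_constant[of "{x..y}" "\<lambda>u. D u * exp (- I u)"] by auto
    have "D y * exp (- I y) = D x * exp (- I x)" using k[of x] k[of y] y by simp
    thus ?thesis by (simp add: I_def)
  qed
  have "I y = (LBINT u:{x..y}. tau u)" for y
    unfolding I_def using borel_integrable_atLeastAtMost'[OF cont] set_borel_integral_eq_integral(2) by metis
  hence "I = (\<lambda>y. LBINT u:{x..y}. tau u)" by (rule ext)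
  hence "(I \<longlongrightarrow> (LBINT u:{x..}. tau u)) at_top"
    using tendsto_set_lebesgue_integral_at_top[OF _ tau_integrable[OF inv x]] by simp
  hence "((\<lambda>y. D y * exp (- I y)) \<longlongrightarrow> 1 * exp (- (LBINT u:{x..}. tau u))) at_top"
    by (intro tendsto_intros D_tendsto_1)
  moreover have "((\<lambda>y. D y * exp (- I y)) \<longlongrightarrow> D x) at_top"
    by (rule tendsto_eventually) (use step in \<open>auto simp: eventually_at_top_linorder\<close>)
  ultimately show ?thesis
    using tendsto_unique[OF trivial_limit_at_top_linorder] by fastforce
qed

text \<open>For a fixed finite F the rank-N sections converge entrywise as N grows, and their
  expansions in minors are dominated independently of F. Truncation at a fixed M thus changes every
  section by at most \<open>prod_tail w M\<close>, and only finitely many Gram determinants have to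
  be followed as F grows.\<close>

lemma hankel_section_limit:
  assumes E: "orthonormal_basis half_line E"
  shows "((\<lambda>F. fdet F (\<lambda>e f. L2_inner half_line (\<lambda>u. e u - hankel_op phi e u) f)) \<longlongrightarrow> D 0) (finite_subsets_at_top E)"
proof -
  have On: "orthonormal_set half_line E" using E by (simp add: orthonormal_basis_def)
  note EL = orthonormal_set_L2[OF On]
  have ON: "L2_inner half_line e f = (if e = f then 1 else 0)" if "e \<in> E" "f \<in> E" for e f
    using On that by (simp add: orthonormal_set_def)
  define ex where "ex n u = exp (- of_real u * lam n)" for n and u :: real
  have ex: "ex n \<in> L2 half_line" "(L2_norm half_line (ex n))\<^sup>2 = 1 / (2 * c)" for n
    unfolding ex_def using exp_lam_L2[of n] by auto
  have cex: "(\<lambda>u. cnj (ex n u)) \<in> L2 half_line" for n by (intro L2_cnj ex)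
  \<comment> \<open>The Hankel kernel is symmetric, not Hermitian, so e is paired with the
    exponential without conjugation; as an inner product this involves the conjugated exponential.
    Parseval's identity then produces the integral of exp(-u(\<lambda>_i + \<lambda>_j)).\<close>
  define \<alpha> where "\<alpha> n e = (LINT v|half_line. ex n v * e v)" for n e
  define \<beta> where "\<beta> n f = L2_inner half_line (ex n) f" for n f
  have \<alpha>: "\<alpha> n e = L2_inner half_line e (\<lambda>u. cnj (ex n u))" for n e
    by (simp add: \<alpha>_def L2_inner_def mult.commute)
  define A where "A e f = L2_inner half_line (\<lambda>u. e u - hankel_op phi e u) f" for e f
  define AN where "AN N e f = (if e = f then 1 else 0) - (\<Sum>n\<in>initial N. xi n * \<alpha> n e * \<beta> n f)" for N e f
  define tF where "tF F S = (- 1) ^ card S * (\<Prod>n\<in>S. xi n) * fdet S (\<lambda>i j. \<Sum>e\<in>F. \<beta> i e * \<alpha> j e)" for F S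
  have pL: "hankel_op phi e \<in> L2 half_line" if "e \<in> L2 half_line" for e
    by (rule hankel_op_L2(1)[OF phi_measurable c X_nonneg phi_le that])
  have ppL: "hankel_op (phi_part N) e \<in> L2 half_line" if "e \<in> L2 half_line" for N e
    unfolding hankel_op_phi_part[OF that, abs_def] by (intro L2_sum L2_scale exp_lam_L2)
  have AN_eq: "AN N e f = L2_inner half_line (\<lambda>u. e u - hankel_op (phi_part N) e u) f" if "e \<in> E" "f \<in> E" for N e f
  proof -
    have "L2_inner half_line (hankel_op (phi_part N) e) f = (\<Sum>n\<in>initial N. xi n * \<alpha> n e * \<beta> n f)"
    proof -
      have "L2_inner half_line (\<lambda>u. \<Sum>n\<in>initial N. (xi n * \<alpha> n e) * ex n u) f =
          (\<Sum>n\<in>initial N. L2_inner half_line (\<lambda>u. (xi n * \<alpha> n e) * ex n u) f)"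
        by (intro L2_inner_sum_left L2_scale ex EL[OF that(2)])
      moreover have "hankel_op (phi_part N) e = (\<lambda>u. \<Sum>n\<in>initial N. (xi n * \<alpha> n e) * ex n u)"
        using hankel_op_phi_part[OF EL[OF that(1)]] unfolding \<alpha>_def ex_def by blast
      ultimately show ?thesis by (simp add: L2_inner_scale_left \<beta>_def)
    qed
    thus ?thesis
      using L2_inner_diff_left[OF EL[OF that(1)] ppL[OF EL[OF that(1)]] EL[OF that(2)]] ON[OF that] by (simp add: AN_def)
  qed
  have AN_lim: "(\<lambda>N. AN N e f) \<longlonglongrightarrow> A e f" if ef: "e \<in> E" "f \<in> E" for e f
  proof -
    have "(\<lambda>N. AN N e f - A e f) \<longlonglongrightarrow> 0"
    proof (rule Lim_null_comparison)
      show "(\<lambda>N. tail N / (2 * c) * L2_norm half_line e * L2_norm half_line f) \<longlonglongrightarrow> 0"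
        using tendsto_mult_right[OF tendsto_mult_right[OF tendsto_divide[OF tail_tendsto_0 tendsto_const[of "2 * c"]], of "L2_norm half_line e"], of "L2_norm half_line f"] c
        by simp
      have "norm (AN N e f - A e f) \<le> tail N / (2 * c) * L2_norm half_line e * L2_norm half_line f" for N
      proof -
        have e: "e \<in> L2 half_line" and f: "f \<in> L2 half_line" using ef EL by auto
        have "AN N e f - A e f = L2_inner half_line (\<lambda>u. (e u - hankel_op (phi_part N) e u) - (e u - hankel_op phi e u)) f"
          unfolding AN_eq[OF ef] A_def by (rule L2_inner_diff_left[symmetric]) (intro L2_diff e f pL ppL)+
        also have "\<dots> = L2_inner half_line (\<lambda>u. hankel_op phi e u - hankel_op (phi_part N) e u) f" by simp
        also have "cmod \<dots> \<le> L2_norm half_line (\<lambda>u. hankel_op phi e u - hankel_op (phi_part N) e u) * L2_norm half_line f"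
          by (intro L2_inner_bound L2_diff pL ppL e f)
        also have "\<dots> \<le> (tail N / (2 * c) * L2_norm half_line e) * L2_norm half_line f"
          by (intro mult_right_mono hankel_error e) auto
        finally show ?thesis .
      qed
      thus "\<forall>\<^sub>F N in sequentially. norm (AN N e f - A e f) \<le> tail N / (2 * c) * L2_norm half_line e * L2_norm half_line f" by simp
    qed
    thus ?thesis by (rule LIM_zero_cancel)
  qed
  \<comment> \<open>The inequality xy <= (x^2 + y^2)/2 and Bessel's inequality, once for an
    exponential and once for a conjugated one; each has squared norm 1/(2c), whatever F is.\<close>
  have gram_le: "cmod (\<Sum>e\<in>F. \<beta> i e * \<alpha> j e) \<le> 1 / (2 * c)" if F: "finite F" "F \<subseteq> E" for F i j
  proof -
    have "cmod (\<Sum>e\<in>F. \<beta> i e * \<alpha> j e) \<le> (\<Sum>e\<in>F. 1 / 2 * ((cmod (\<beta> i e))\<^sup>2 + (cmod (L2_inner half_line (\<lambda>u. cnj (ex j u)) e))\<^sup>2))"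
    proof (rule sum_norm_le)
      fix e assume "e \<in> F"
      have "cmod (\<alpha> j e) = cmod (L2_inner half_line (\<lambda>u. cnj (ex j u)) e)"
        unfolding \<alpha> by (subst L2_inner_commute) simp
      moreover have "x * y \<le> 1 / 2 * (x\<^sup>2 + y\<^sup>2)" for x y :: real
        using zero_le_power2[of "x - y"] by (simp add: power2_diff)
      ultimately show "cmod (\<beta> i e * \<alpha> j e) \<le> 1 / 2 * ((cmod (\<beta> i e))\<^sup>2 + (cmod (L2_inner half_line (\<lambda>u. cnj (ex j u)) e))\<^sup>2)"
        by (simp add: norm_mult)
    qed
    also have "\<dots> = 1 / 2 * ((\<Sum>e\<in>F. (cmod (\<beta> i e))\<^sup>2) + (\<Sum>e\<in>F. (cmod (L2_inner half_line (\<lambda>u. cnj (ex j u)) e))\<^sup>2))"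
      by (simp only: sum_distrib_left[symmetric] sum.distrib)
    also have "\<dots> \<le> 1 / 2 * (1 / (2 * c) + 1 / (2 * c))"
      using L2_Bessel[OF On F ex(1)[of i]] L2_Bessel[OF On F cex[of j]] ex(2)
      unfolding \<beta>_def by (intro mult_left_mono add_mono) (auto simp: L2_norm_cnj)
    finally show ?thesis by simp
  qed
  have tF_le: "cmod (tF F S) \<le> (\<Prod>n\<in>S. w n)" if F: "finite F" "F \<subseteq> E" and S: "finite S" for F S
    using minor_term_le[OF S gram_le[OF F], of xi 1] unfolding tF_def by simp
  have sec: "cmod (fdet F A - (\<Sum>S\<in>Pow (initial M). tF F S)) \<le> prod_tail w M" if F: "finite F" "F \<subseteq> E" for F M
  proof (rule initial_Pow_limit_le[OF w_summable w_nonneg tF_le[OF F]])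
    have "(\<lambda>N. fdet F (AN N)) \<longlonglongrightarrow> fdet F A"
      by (rule tendsto_fdet[OF F(1)]) (use F AN_lim in auto)
    moreover have "fdet F (AN N) = (\<Sum>S\<in>Pow (initial N). tF F S)" for N
      unfolding AN_def tF_def by (rule fdet_one_minus_finite_rank[OF F(1) finite_initial])
    ultimately show "(\<lambda>N. \<Sum>S\<in>Pow (initial N). tF F S) \<longlonglongrightarrow> fdet F A" by simp
  qed
  have tF_lim: "((\<lambda>F. tF F S) \<longlongrightarrow> t 0 S) (finite_subsets_at_top E)" if S: "finite S" for S
  proof -
    have "((\<lambda>F. fdet S (\<lambda>i j. \<Sum>e\<in>F. \<beta> i e * \<alpha> j e)) \<longlongrightarrow> kap S) (finite_subsets_at_top E)"
      unfolding kap_def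
    proof (rule tendsto_fdet[OF S])
      fix i j
      have "L2_inner half_line (ex i) (\<lambda>u. cnj (ex j u)) = (LINT u|half_line. exp (- of_real u * (lam i + lam j)))"
        unfolding L2_inner_def ex_def
        by (intro Bochner_Integration.integral_cong refl) (simp add: exp_add[symmetric] algebra_simps)
      also have "\<dots> = 1 / (lam i + lam j)" using c by (subst half_line_exp_integral) auto
      finally show "((\<lambda>F. \<Sum>e\<in>F. \<beta> i e * \<alpha> j e) \<longlongrightarrow> 1 / (lam i + lam j)) (finite_subsets_at_top E)"
        using orthonormal_basis_Parseval[OF E ex(1)[of i] cex[of j]] unfolding \<beta>_def \<alpha> by simp
    qed
    hence "((\<lambda>F. tF F S) \<longlongrightarrow> (- 1) ^ card S * (\<Prod>n\<in>S. xi n) * kap S) (finite_subsets_at_top E)"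
      unfolding tF_def by (intro tendsto_intros)
    thus ?thesis by (simp add: t_def)
  qed
  have Dlim: "cmod (D 0 - Dn M 0) \<le> prod_tail w M" for M
    using initial_Pow_limit_le[OF w_summable w_nonneg t_le_w[of 0] Dn_tendsto[of 0, unfolded Dn_def], of M]
    unfolding Dn_def by simp
  have "((\<lambda>F. fdet F A) \<longlongrightarrow> D 0) (finite_subsets_at_top E)"
  \<comment> \<open>Three errors of size \<epsilon>/3: the truncation of the section at M, the
    convergence of the M-truncated sums along E, and the truncation of D at M.\<close>
  proof (rule tendstoI)
    fix \<epsilon> :: real assume \<epsilon>: "\<epsilon> > 0"
    have "\<forall>\<^sub>F M in sequentially. prod_tail w M < \<epsilon> / 3"
      by (rule order_tendstoD(2)[OF prod_tail_tendsto[OF w_summable w_nonneg]]) (use \<epsilon> in simp)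
    then obtain M where M: "prod_tail w M < \<epsilon> / 3" by (auto simp: eventually_at_top_linorder)
    have "((\<lambda>F. \<Sum>S\<in>Pow (initial M). tF F S) \<longlongrightarrow> Dn M 0) (finite_subsets_at_top E)"
      unfolding Dn_def by (intro tendsto_sum tF_lim) (auto intro: finite_subset[OF _ finite_initial])
    hence "\<forall>\<^sub>F F in finite_subsets_at_top E. dist (\<Sum>S\<in>Pow (initial M). tF F S) (Dn M 0) < \<epsilon> / 3"
      by (rule tendstoD) (use \<epsilon> in simp)
    moreover have "\<forall>\<^sub>F F in finite_subsets_at_top E. cmod (fdet F A - (\<Sum>S\<in>Pow (initial M). tF F S)) \<le> prod_tail w M"
      by (rule eventually_finite_subsets_at_top_weakI) (rule sec)
    ultimately show "\<forall>\<^sub>F F in finite_subsets_at_top E. dist (fdet F A) (D 0) < \<epsilon>"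
    proof eventually_elim
      case (elim F)
      have "dist (fdet F A) (D 0) \<le> cmod (fdet F A - (\<Sum>S\<in>Pow (initial M). tF F S)) +
          dist (\<Sum>S\<in>Pow (initial M). tF F S) (Dn M 0) + cmod (D 0 - Dn M 0)"
        unfolding dist_norm
        using norm_triangle_ineq[of "fdet F A - (\<Sum>S\<in>Pow (initial M). tF F S)" "(\<Sum>S\<in>Pow (initial M). tF F S) - Dn M 0"]
          norm_triangle_ineq4[of "fdet F A - Dn M 0" "D 0 - Dn M 0"] by simp
      thus ?case using elim M Dlim[of M] by linarith
    qed
  qed
  thus ?thesis by (simp only: A_def[abs_def])
qed

text \<open>A shift of the argument by 2x multiplies \<xi>_n by exp(-2x\<lambda>_n). The factor s is
  taken to be -1 as well, since \<open>has_fredholm_det\<close> asks for the trace class property of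
  (I - \<Gamma>) - I.\<close>

lemma shifted_system:
  assumes "x \<ge> 0" "cmod s = 1"
  shows "exponential_system b \<theta> (\<lambda>n. s * xi n * exp (- of_real (2 * x) * lam n))"
proof
  show "(\<lambda>n. (1 + \<bar>real_of_int n\<bar>)\<^sup>2 * cmod (s * xi n * exp (- of_real (2 * x) * lam n))) summable_on UNIV"
  proof (rule summable_on_comparison_test[OF xi_weighted])
    fix n
    have "cmod (s * xi n * exp (- of_real (2 * x) * lam n)) \<le> cmod (xi n)"
      unfolding norm_mult assms(2) using norm_exp_lam_le[of "2 * x" n] assms(1) by (simp add: mult_right_le_one_le)
    thus "(1 + \<bar>real_of_int n\<bar>)\<^sup>2 * cmod (s * xi n * exp (- of_real (2 * x) * lam n)) \<le> (1 + \<bar>real_of_int n\<bar>)\<^sup>2 * cmod (xi n)"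
      by (intro mult_left_mono) auto
  qed auto
qed (rule b \<theta>)+

theorem hankel_fredholm_det:
  assumes x: "x \<ge> 0"
  shows "has_fredholm_det half_line (\<lambda>h u. h u - hankel_op (\<lambda>v. phi (v + 2 * x)) h u) (D x)"
proof -
  let ?\<psi> = "\<lambda>v. phi (v + 2 * x)"
  have tr: "trace_class half_line (hankel_op (\<lambda>v. - ?\<psi> v))"
  proof -
    interpret S: exponential_system b \<theta> "\<lambda>n. - 1 * xi n * exp (- of_real (2 * x) * lam n)"
      by (rule shifted_system[OF x]) simp
    have "S.phi = (\<lambda>v. - ?\<psi> v)"
    proof
      fix v
      have "S.phi v = (\<Sum>\<^sub>\<infinity>n. - (xi n * exp (- of_real (v + 2 * x) * lam n)))"
        unfolding S.phi_def by (intro infsum_cong) (simp add: exp_add[symmetric] algebra_simps)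
      thus "S.phi v = - ?\<psi> v" by (simp add: infsum_uminus phi_def)
    qed
    thus ?thesis using S.hankel_trace_class by simp
  qed
  have eq: "(\<lambda>f u. f u - hankel_op ?\<psi> f u - f u) = hankel_op (\<lambda>v. - ?\<psi> v)"
    by (intro ext) (simp add: hankel_op_def)
  interpret S: exponential_system b \<theta> "\<lambda>n. 1 * xi n * exp (- of_real (2 * x) * lam n)"
    by (rule shifted_system[OF x]) simp
  have ph: "S.phi = ?\<psi>"
    unfolding S.phi_def phi_def by (intro ext infsum_cong) (simp add: exp_add[symmetric] algebra_simps)
  \<comment> \<open>In the shifted system the factors exp(-2x\<lambda>_n) sit in the coefficients
    instead of in the exponentials; the minors \<open>kap\<close> depend on the exponents alone and
    agree.\<close>
  have "S.t 0 = t x"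
    unfolding S.t_def t_def by (simp add: S.kap_def kap_def)
  hence "S.D 0 = D x" unfolding S.D_def D_def S.Dn_def Dn_def by simp
  hence lim: "((\<lambda>F. fdet F (\<lambda>e f. L2_inner half_line (\<lambda>u. e u - hankel_op ?\<psi> e u) f)) \<longlongrightarrow> D x) (finite_subsets_at_top E)"
    if "orthonormal_basis half_line E" for E
    using S.hankel_section_limit[OF that] unfolding ph by simp
  show ?thesis
    unfolding has_fredholm_det_def eq using tr lim by (simp add: fdet_def)
qed

end

section \<open>The symbol from Lame's equation\<close>

theorem theorem8p3:
  fixes k :: real and \<alpha> t :: complex
  defines "\<phi> \<equiv> lame_symbol k \<alpha> t"
    and "lam \<equiv> lame_lambda k \<alpha>"
    and "xi \<equiv> lame_xi k \<alpha> t"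
  defines "R \<equiv> R_op lam xi"
    and "T \<equiv> T_kernel lam xi"
  assumes k: "0 < k" "k < 1"
    and \<alpha>: "\<alpha> \<notin> period_lattice k"
    and \<beta>: "Re (lame_beta k \<alpha>) > 0"
    and analytic: "(\<lambda>z. Psi k \<alpha> (z + 2 * t)) analytic_on (of_real ` {0..2 * elliptic_K k})"
  shows
    "xi \<in> ell1 \<and>
     (\<forall>x>0. \<phi> x = output_op (semigroup_op lam x (input_op xi 1)) \<and>
            ((\<lambda>n. xi n * exp (- lam n * of_real x)) has_sum \<phi> x) UNIV) \<and>
     \<comment> \<open>(i)\<close>
     trace_class half_line (hankel_op \<phi>) \<and>
     \<comment> \<open>(ii)\<close>
     (\<forall>x>0. trace_class (count_space UNIV) (R x) \<and>
        (\<forall>a\<in>ell1. \<forall>j.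
           set_integrable lborel {x..}
             (\<lambda>s. semigroup_op lam s (input_op xi (output_op (semigroup_op lam s a))) j) \<and>
           R x a j =
             (LBINT s:{x..}. semigroup_op lam s (input_op xi (output_op (semigroup_op lam s a))) j))) \<and>
     (\<exists>U. open U \<and> 0 \<in> U \<and>
        (\<forall>\<mu>\<in>U. \<forall>x>0.
           invertible_op (count_space UNIV) (\<lambda>a n. a n + \<mu> * R x a n) \<and>
           (\<forall>y\<ge>x.
              resolvent_op lam xi \<mu> x (semigroup_op lam y (input_op xi 1)) \<in> ell1 \<and>
              set_integrable lborel {x..} (\<lambda>z. T \<mu> x z * \<phi> (z + y)) \<and>
              T \<mu> x y + \<mu> * \<phi> (x + y) + \<mu> * (LBINT z:{x..}. T \<mu> x z * \<phi> (z + y)) = 0))) \<and>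
     \<comment> \<open>(iii)\<close>
     ((\<forall>x>0. invertible_op (count_space UNIV) (\<lambda>a n. a n - R x a n)) \<longrightarrow>
      (\<forall>x>0.
         (\<forall>u\<ge>x. resolvent_op lam xi (-1) u (semigroup_op lam u (input_op xi 1)) \<in> ell1) \<and>
         set_integrable lborel {x..} (\<lambda>u. T (-1) u u) \<and>
         has_fredholm_det half_line (\<lambda>h u. h u - hankel_op (\<lambda>v. \<phi> (v + 2 * x)) h u)
           (exp (- (LBINT u:{x..}. T (-1) u u)))))"
proof -
  define P where "P = 2 * elliptic_K k"
  define \<beta>' where "\<beta>' = lame_beta k \<alpha>"
  have P: "P > 0" using elliptic_K_pos[of k] k by (simp add: P_def)
  have P2: "2 * complex_of_real (elliptic_K k) = of_real P" by (simp add: P_def)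
  define g where "g z = exp (\<beta>' * z / of_real P) * Psi k \<alpha> (z + 2 * t)" for z
  interpret G: periodic_analytic P g
  proof
    show "P > 0" by (rule P)
    show "g (z + of_real P) = g z" for z
    proof -
      have "Psi k \<alpha> (z + of_real P + 2 * t) = exp (- \<beta>') * Psi k \<alpha> (z + 2 * t)"
        using Psi_quasi_periodic[OF k \<alpha>, of "z + 2 * t"] by (simp add: P_def \<beta>'_def algebra_simps)
      moreover have "exp (\<beta>' * (z + of_real P) / of_real P) = exp (\<beta>' * z / of_real P) * exp \<beta>'"
        using P by (simp add: exp_add[symmetric] distrib_left add_divide_distrib)
      ultimately show ?thesis by (simp add: g_def exp_minus)
    qed
    show "g analytic_on (of_real ` {0..P})"
      unfolding g_def[abs_def] by (intro analytic_intros analytic[folded P_def]) (use P in auto)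
  qed
  have lam_eq: "lam n = \<beta>' / of_real P + of_int n * G.freq" for n
    by (simp add: lam_def lame_lambda_def P2 \<beta>'_def G.freq_def add_divide_distrib)
  have phi_g: "\<phi> u = exp (- (\<beta>' / of_real P) * of_real u) * g (of_real u)" for u
    by (simp add: \<phi>_def lame_symbol_def g_def exp_minus mult_ac)
  have xi_eq: "xi = G.coef"
  proof
    fix n
    have "(LBINT u:{0..P}. exp (lam n * of_real u) * \<phi> u) = osc_integral P (of_int n * G.freq) g"
      unfolding osc_integral_def
    proof (intro set_lebesgue_integral_cong allI impI)
      fix u
      have "exp (lam n * of_real u) * exp (- (\<beta>' / of_real P) * of_real u) = exp (of_int n * G.freq * of_real u)"
        unfolding lam_eq exp_add[symmetric] by (simp add: algebra_simps)
      thus "exp (lam n * of_real u) * \<phi> u = exp (of_int n * G.freq * of_real u) * g (of_real u)"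
        unfolding phi_g by (simp only: mult.assoc[symmetric])
    qed simp
    thus "xi n = G.coef n"
      unfolding xi_def lame_xi_def G.coef_def P2 P_def[symmetric] lam_def[symmetric] \<phi>_def[symmetric] by simp
  qed
  have sum_g: "((\<lambda>n. xi n * exp (- of_real u * lam n)) has_sum \<phi> u) UNIV" for u
  proof -
    have "((\<lambda>n. exp (- (\<beta>' / of_real P) * of_real u) * (G.coef n * exp (- of_int n * G.freq * of_real u))) has_sum \<phi> u) UNIV"
      unfolding phi_g by (rule has_sum_cmult_right[OF G.Fourier_inversion])
    also have "(\<lambda>n. exp (- (\<beta>' / of_real P) * of_real u) * (G.coef n * exp (- of_int n * G.freq * of_real u))) =
        (\<lambda>n. xi n * exp (- of_real u * lam n))"
    proof
      fix n
      have "exp (- (\<beta>' / of_real P) * of_real u) * exp (- of_int n * G.freq * of_real u) = exp (- of_real u * lam n)"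
        unfolding lam_eq exp_add[symmetric] by (simp add: algebra_simps)
      thus "exp (- (\<beta>' / of_real P) * of_real u) * (G.coef n * exp (- of_int n * G.freq * of_real u)) = xi n * exp (- of_real u * lam n)"
        unfolding xi_eq by (simp only: mult.left_commute)
    qed
    finally show ?thesis .
  qed
  interpret S: exponential_system "\<beta>' / of_real P" "2 * pi / P" xi
  proof
    show "0 < Re (\<beta>' / of_real P)" using \<beta> P by (simp add: \<beta>'_def)
    show "0 < 2 * pi / P" using P by simp
    obtain C where C: "C \<ge> 0" "\<And>n. cmod (G.coef n) \<le> C * (1 + \<bar>real_of_int n\<bar>) powr - 4"
      using G.coef_decay by blast
    show "(\<lambda>n. (1 + \<bar>real_of_int n\<bar>)\<^sup>2 * cmod (xi n)) summable_on UNIV"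
    \<comment> \<open>Decay of order 4 against a weight of order 2 leaves order 2, which is summable
      over the integers.\<close>
    proof (rule summable_on_comparison_test[OF summable_on_cmult_right[OF summable_on_int_powr[of 2]]])
      fix n :: int
      define m where "m = 1 + \<bar>real_of_int n\<bar>"
      have m: "m \<ge> 1" by (simp add: m_def)
      have "m\<^sup>2 * cmod (xi n) \<le> m powr 2 * (C * m powr - 4)"
        unfolding xi_eq using C(2)[of n] m by (intro mult_mono) (auto simp: m_def powr_numeral)
      also have "\<dots> = C * m powr - 2" by (simp add: powr_add[symmetric])
      finally show "(1 + \<bar>real_of_int n\<bar>)\<^sup>2 * cmod (xi n) \<le> C * (1 + \<bar>real_of_int n\<bar>) powr - 2"
        by (simp add: m_def)
    qed auto
  qed
  have lam: "S.lam = lam"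
    by (rule ext) (simp add: S.lam_def lam_eq G.freq_def)
  have phi: "S.phi = \<phi>"
    by (rule ext) (use infsumI[OF sum_g] in \<open>simp add: S.phi_def lam\<close>)
  have R: "R = S.R"
    unfolding R_def by (rule ext) (use S.R_op_eq in \<open>simp add: lam\<close>)
  have iv: "semigroup_op lam y (input_op xi 1) = S.input_vec y" for y
    using S.input_vec_eq[of y] by (simp add: lam)
  have part0: "\<phi> x = output_op (semigroup_op lam x (input_op xi 1))"
    "((\<lambda>n. xi n * exp (- lam n * of_real x)) has_sum \<phi> x) UNIV" for x
    using sum_g[of x] infsumI[OF sum_g[of x]] by (simp_all add: output_op_def semigroup_op_def input_op_def mult.commute)
  have part1: "trace_class half_line (hankel_op \<phi>)"
    using S.hankel_trace_class by (simp add: phi)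
  have part2: "trace_class (count_space UNIV) (R x)" for x
    unfolding R by (rule S.R_trace_class)
  have part2': "set_integrable lborel {x..} (\<lambda>s. semigroup_op lam s (input_op xi (output_op (semigroup_op lam s a))) j)"
    "R x a j = (LBINT s:{x..}. semigroup_op lam s (input_op xi (output_op (semigroup_op lam s a))) j)" if "a \<in> ell1" for x a j
    using S.R_integral[OF that] by (simp_all add: lam R)
  have res: "resolvent_op lam xi \<mu> x f \<in> ell1"
    if "x \<ge> 0" "invertible_op (count_space UNIV) (\<lambda>a n. a n + \<mu> * R x a n)" "f \<in> ell1" for \<mu> x f
  proof -
    note I = that(1) that(2)[unfolded R]
    have "S.res \<mu> x f \<in> ell1" using S.res_ell1[OF I] that(3) by metis
    thus ?thesis using S.res_def[OF I] by (simp add: lam)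
  qed
  \<comment> \<open>The radius is the bound for \<mu> in \<open>invertible_small\<close>, which does
    not involve x; a single neighbourhood therefore serves all x > 0.\<close>
  define U where "U = ball (0 :: complex) (1 / (2 * (S.Q * S.X + 1)))"
  have U: "open U" "0 \<in> U"
    using S.Q_nonneg S.X_nonneg by (auto simp: U_def intro: add_nonneg_pos)
  have inv: "invertible_op (count_space UNIV) (\<lambda>a n. a n + \<mu> * R x a n)" if "\<mu> \<in> U" "x > 0" for \<mu> x
    unfolding R
  proof (rule S.invertible_small)
    have "S.Q * S.X + 1 > 0" using S.Q_nonneg S.X_nonneg by (intro add_nonneg_pos) auto
    thus "cmod \<mu> * (S.Q * S.X + 1) \<le> 1 / 2" using that(1) by (simp add: U_def field_simps)
  qed (use that in auto)
  have part3: "set_integrable lborel {x..} (\<lambda>z. T \<mu> x z * \<phi> (z + y))"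
    "T \<mu> x y + \<mu> * \<phi> (x + y) + \<mu> * (LBINT z:{x..}. T \<mu> x z * \<phi> (z + y)) = 0"
    if "\<mu> \<in> U" "x > 0" "y \<ge> x" for \<mu> x y
    using S.T_kernel_integral_equation[OF less_imp_le[OF that(2)] inv[OF that(1,2), unfolded R] that(3)]
    by (simp_all add: T_def lam phi)
  have part4: "(\<forall>u\<ge>x. resolvent_op lam xi (-1) u (semigroup_op lam u (input_op xi 1)) \<in> ell1) \<and>
         set_integrable lborel {x..} (\<lambda>u. T (-1) u u) \<and>
         has_fredholm_det half_line (\<lambda>h u. h u - hankel_op (\<lambda>v. \<phi> (v + 2 * x)) h u)
           (exp (- (LBINT u:{x..}. T (-1) u u)))"
    if invertible: "\<forall>x>0. invertible_op (count_space UNIV) (\<lambda>a n. a n - R x a n)" and x: "x > 0" for x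
  proof -
    have inv1: "S.inv1 u" if "u > 0" for u
      using invertible that by (simp add: R)
    have T: "T (-1) u u = S.tau u" for u
      using S.T_kernel_diag[of u] by (simp add: T_def lam)
    have "resolvent_op lam xi (-1) u (semigroup_op lam u (input_op xi 1)) \<in> ell1" if "u \<ge> x" for u
      unfolding iv by (rule res) (use that x inv1[of u] S.input_vec_ell(1) in \<open>auto simp: R\<close>)
    moreover have "set_integrable lborel {x..} (\<lambda>u. T (-1) u u)"
      unfolding T by (rule S.tau_integrable[OF inv1 x])
    moreover have "has_fredholm_det half_line (\<lambda>h u. h u - hankel_op (\<lambda>v. \<phi> (v + 2 * x)) h u)
           (exp (- (LBINT u:{x..}. T (-1) u u)))"
    proof -
      have "S.D x = exp (- (LBINT u:{x..}. T (-1) u u))" unfolding T by (rule S.D_eq_exp[OF inv1 x])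
      thus ?thesis using S.hankel_fredholm_det[OF less_imp_le[OF x]] by (simp add: phi)
    qed
    ultimately show ?thesis by blast
  qed
  have "\<forall>\<mu>\<in>U. \<forall>x>0. invertible_op (count_space UNIV) (\<lambda>a n. a n + \<mu> * R x a n) \<and>
           (\<forall>y\<ge>x. resolvent_op lam xi \<mu> x (semigroup_op lam y (input_op xi 1)) \<in> ell1 \<and>
              set_integrable lborel {x..} (\<lambda>z. T \<mu> x z * \<phi> (z + y)) \<and>
              T \<mu> x y + \<mu> * \<phi> (x + y) + \<mu> * (LBINT z:{x..}. T \<mu> x z * \<phi> (z + y)) = 0)"
  proof (intro ballI allI impI conjI)
    fix \<mu> and x y :: real assume "\<mu> \<in> U" "x > 0" "y \<ge> x"
    thus "resolvent_op lam xi \<mu> x (semigroup_op lam y (input_op xi 1)) \<in> ell1"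
      unfolding iv by (intro res inv S.input_vec_ell) auto
  qed (use inv part3 in auto)
  hence "\<exists>U. open U \<and> 0 \<in> U \<and>
        (\<forall>\<mu>\<in>U. \<forall>x>0.
           invertible_op (count_space UNIV) (\<lambda>a n. a n + \<mu> * R x a n) \<and>
           (\<forall>y\<ge>x.
              resolvent_op lam xi \<mu> x (semigroup_op lam y (input_op xi 1)) \<in> ell1 \<and>
              set_integrable lborel {x..} (\<lambda>z. T \<mu> x z * \<phi> (z + y)) \<and>
              T \<mu> x y + \<mu> * \<phi> (x + y) + \<mu> * (LBINT z:{x..}. T \<mu> x z * \<phi> (z + y)) = 0))"
    using U by (intro exI[of _ U] conjI)
  with S.xi_ell1 part0 part1 part2 part2' part4 show ?thesis
    by (intro conjI allI impI ballI) blast+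
qed

end
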